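(* Let $T$ be $\mathrm{NTP}_2$ and $A$ a set. Consider: (1) There exists a ternary relation $R$ on small subsets of $\mathfrak{C}$ (write $R(X;C;Y)$) satisfying: invariance (if $R(X;C;Y)$ and $X'Y'C'\equiv XYC$ then $R(X';C';Y')$); monotonicity (if $R(X;C;Y)$, $X'\subseteq X$, $Y'\subseteq Y$ then $R(X';C;Y')$); base monotonicity (if $R(X;C;YD)$ then $R(X;CY;D)$); right extension (if $R(X;C;Y)$ and $D\supseteq Y$ there is $D'\equiv_{YC}D$ with $R(X;C;D')$); transitivity on the left ($R(X_1;C;Y)$ and $R(X_2;CX_1;YX_1)$ imply $R(X_1X_2;C;Y)$); stronger than invariance (if $R(X;C;Y)$ then $tp(X/YC)$ has a global extension fixed by every automorphism in $AutfL(\mathfrak{C}/C)$); preservation of indiscernibles (if $I$ is $C$-indiscernible and $R(X;C;I)$ then $I$ is $XC$-indiscernible); left extension over $A$ (if $R(X;A;Y)$ and $D\supseteq X$ there is $D'\equiv_{XA}D$ with $R(D';A;Y)$); and $A$ is an extension base for $R$, i.e. $R(a;A;A)$ for all $a$. (2) Forking equals dividing over $A$. Then (1) implies (2). If $T$ is dependent then (1) and (2) are equivalent.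
   Context: $T$ is $\mathrm{NTP}_2$ if there is no formula $\phi(x,y)$, $k<\omega$ and array $\langle a^j_i\rangle_{i,j<\omega}$ with every row $k$-inconsistent and every vertical path $\{\phi(x,a^j_{f(j)})\}_j$ consistent. $AutfL(\mathfrak{C}/C)$ is the group generated by automorphisms fixing pointwise some small model containing $C$. *)

theory Defs
  imports Main "HOL-Algebra.Bij" "HOL-Algebra.Generated_Groups"
begin

unbundle cardinal_syntax

section \<open>First-order structures and formulas\<close>

text \<open>
  A first-order structure together with its signature: \<open>Funs\<close> and \<open>Rels\<close> are the function
  and relation symbols with their arities (constants have arity 0), \<open>FunI\<close> and \<open>RelI\<close> the
  interpretation.  The universe is the whole type \<open>'m\<close>; the values of \<open>FunI\<close>, \<open>RelI\<close> on
  lists of the wrong length, or at symbols outside the signature, are never used.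
\<close>

record ('f, 'p, 'm) struct =
  Funs :: "('f \<times> nat) set"
  Rels :: "('p \<times> nat) set"
  FunI :: "'f \<Rightarrow> 'm list \<Rightarrow> 'm"
  RelI :: "'p \<Rightarrow> 'm list \<Rightarrow> bool"

datatype 'f tm = Var nat | App 'f "'f tm list"

text \<open>Variables are de Bruijn indices: \<open>Ex\<close> binds index 0 and shifts the others.\<close>

datatype ('f, 'p) fm =
    Eq "'f tm" "'f tm"
  | Rel 'p "'f tm list"
  | Neg "('f, 'p) fm"
  | Conj "('f, 'p) fm" "('f, 'p) fm"
  | Ex "('f, 'p) fm"

text \<open>
  \<open>fmla M n \<phi>\<close>: \<open>\<phi>\<close> is a formula in the language of \<open>M\<close> whose free variables are among
  \<open>v\<^sub>0, \<dots>, v\<^bsub>n-1\<^esub>\<close>.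
\<close>

fun trm :: "('f, 'p, 'm) struct \<Rightarrow> nat \<Rightarrow> 'f tm \<Rightarrow> bool" where
  "trm M n (Var i) \<longleftrightarrow> i < n"
| "trm M n (App f ts) \<longleftrightarrow> (f, length ts) \<in> Funs M \<and> (\<forall>t\<in>set ts. trm M n t)"

fun fmla :: "('f, 'p, 'm) struct \<Rightarrow> nat \<Rightarrow> ('f, 'p) fm \<Rightarrow> bool" where
  "fmla M n (Eq s t) \<longleftrightarrow> trm M n s \<and> trm M n t"
| "fmla M n (Rel p ts) \<longleftrightarrow> (p, length ts) \<in> Rels M \<and> (\<forall>t\<in>set ts. trm M n t)"
| "fmla M n (Neg \<phi>) \<longleftrightarrow> fmla M n \<phi>"
| "fmla M n (Conj \<phi> \<psi>) \<longleftrightarrow> fmla M n \<phi> \<and> fmla M n \<psi>"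
| "fmla M n (Ex \<phi>) \<longleftrightarrow> fmla M (Suc n) \<phi>"

fun val :: "('f, 'p, 'm) struct \<Rightarrow> 'm list \<Rightarrow> 'f tm \<Rightarrow> 'm" where
  "val M e (Var i) = e ! i"
| "val M e (App f ts) = FunI M f (map (val M e) ts)"

text \<open>Satisfaction in the substructure of \<open>M\<close> with universe \<open>D\<close>.\<close>

fun sat :: "('f, 'p, 'm) struct \<Rightarrow> 'm set \<Rightarrow> 'm list \<Rightarrow> ('f, 'p) fm \<Rightarrow> bool" where
  "sat M D e (Eq s t) \<longleftrightarrow> val M e s = val M e t"
| "sat M D e (Rel p ts) \<longleftrightarrow> RelI M p (map (val M e) ts)"
| "sat M D e (Neg \<phi>) \<longleftrightarrow> \<not> sat M D e \<phi>"
| "sat M D e (Conj \<phi> \<psi>) \<longleftrightarrow> sat M D e \<phi> \<and> sat M D e \<psi>"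
| "sat M D e (Ex \<phi>) \<longleftrightarrow> (\<exists>d\<in>D. sat M D (d # e) \<phi>)"

abbreviation holds :: "('f, 'p, 'm) struct \<Rightarrow> ('f, 'p) fm \<Rightarrow> 'm list \<Rightarrow> bool" where
  "holds M \<phi> e \<equiv> sat M UNIV e \<phi>"

definition elem_submodel :: "('f, 'p, 'm) struct \<Rightarrow> 'm set \<Rightarrow> bool" where
  "elem_submodel M N \<longleftrightarrow> N \<noteq> {} \<and>
     (\<forall>f xs. (f, length xs) \<in> Funs M \<and> set xs \<subseteq> N \<longrightarrow> FunI M f xs \<in> N) \<and>
     (\<forall>\<phi> xs. fmla M (length xs) \<phi> \<and> set xs \<subseteq> N \<longrightarrow> (sat M N xs \<phi> \<longleftrightarrow> sat M UNIV xs \<phi>))"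

definition elem_map :: "('f, 'p, 'm) struct \<Rightarrow> 'm set \<Rightarrow> ('m \<Rightarrow> 'm) \<Rightarrow> bool" where
  "elem_map M B f \<longleftrightarrow> (\<forall>\<phi> xs. fmla M (length xs) \<phi> \<and> set xs \<subseteq> B \<longrightarrow>
     (holds M \<phi> (map f xs) \<longleftrightarrow> holds M \<phi> xs))"

definition Aut :: "('f, 'p, 'm) struct \<Rightarrow> ('m \<Rightarrow> 'm) set" where
  "Aut M = {\<sigma>. bij \<sigma> \<and>
     (\<forall>f xs. (f, length xs) \<in> Funs M \<longrightarrow> \<sigma> (FunI M f xs) = FunI M f (map \<sigma> xs)) \<and>
     (\<forall>p xs. (p, length xs) \<in> Rels M \<longrightarrow> (RelI M p (map \<sigma> xs) \<longleftrightarrow> RelI M p xs))}"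


section \<open>The monster model\<close>

definition small :: "'k rel \<Rightarrow> 'a set \<Rightarrow> bool" where
  "small \<kappa> X \<longleftrightarrow> |X| <o \<kappa>"

text \<open>A pair \<open>(\<phi>, c)\<close> stands for the formula \<open>\<phi>(v, c)\<close> in one variable \<open>v\<close> with parameters \<open>c\<close>.\<close>

definition saturated :: "'k rel \<Rightarrow> ('f, 'p, 'm) struct \<Rightarrow> bool" where
  "saturated \<kappa> M \<longleftrightarrow>
     (\<forall>B p. small \<kappa> B \<and>
        p \<subseteq> {(\<phi>, c). set c \<subseteq> B \<and> fmla M (Suc (length c)) \<phi>} \<and>
        (\<forall>q\<subseteq>p. finite q \<longrightarrow> (\<exists>a. \<forall>(\<phi>, c)\<in>q. holds M \<phi> (a # c))) \<longrightarrow>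
        (\<exists>a. \<forall>(\<phi>, c)\<in>p. holds M \<phi> (a # c)))"

definition strongly_homogeneous :: "'k rel \<Rightarrow> ('f, 'p, 'm) struct \<Rightarrow> bool" where
  "strongly_homogeneous \<kappa> M \<longleftrightarrow>
     (\<forall>B f. small \<kappa> B \<and> elem_map M B f \<longrightarrow> (\<exists>\<sigma>\<in>Aut M. \<forall>b\<in>B. \<sigma> b = f b))"

text \<open>
  The complete theory \<open>T\<close> is determined by its monster model \<open>M\<close> as the set of sentences true
  in \<open>M\<close>, so it is not carried as a separate parameter.  \<open>\<kappa>\<close> is a cardinal greater than
  \<open>|T|\<close>, i.e. than \<open>\<aleph>\<^sub>0\<close> and the number of symbols; sets of cardinality less than \<open>\<kappa>\<close>
  are the small ones.
\<close>

definition monster_model :: "'k rel \<Rightarrow> ('f, 'p, 'm) struct \<Rightarrow> bool" where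
  "monster_model \<kappa> M \<longleftrightarrow>
     Card_order \<kappa> \<and> natLeq <o \<kappa> \<and> |Funs M <+> Rels M| <o \<kappa> \<and>
     saturated \<kappa> M \<and> strongly_homogeneous \<kappa> M"


section \<open>NTP2, dependence, forking and dividing\<close>

text \<open>
  Below \<open>\<phi>\<close> is a partitioned formula \<open>\<phi>(x, y)\<close> with \<open>|x| = n\<close>; its variables are those of
  \<open>x\<close> followed by those of \<open>y\<close>.  For a family \<open>b\<close> of parameter tuples,
  \<open>satisfiable M n \<phi> b S\<close> means that \<open>{\<phi>(x, b i) | i \<in> S}\<close> is realised in \<open>M\<close>.
\<close>

definition satisfiable ::
  "('f, 'p, 'm) struct \<Rightarrow> nat \<Rightarrow> ('f, 'p) fm \<Rightarrow> (nat \<Rightarrow> 'm list) \<Rightarrow> nat set \<Rightarrow> bool" where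
  "satisfiable M n \<phi> b S \<longleftrightarrow> (\<exists>a. length a = n \<and> (\<forall>i\<in>S. holds M \<phi> (a @ b i)))"

definition consistent ::
  "('f, 'p, 'm) struct \<Rightarrow> nat \<Rightarrow> ('f, 'p) fm \<Rightarrow> (nat \<Rightarrow> 'm list) \<Rightarrow> bool" where
  "consistent M n \<phi> b \<longleftrightarrow> (\<forall>S. finite S \<longrightarrow> satisfiable M n \<phi> b S)"

definition k_inconsistent ::
  "('f, 'p, 'm) struct \<Rightarrow> nat \<Rightarrow> nat \<Rightarrow> ('f, 'p) fm \<Rightarrow> (nat \<Rightarrow> 'm list) \<Rightarrow> bool" where
  "k_inconsistent M k n \<phi> b \<longleftrightarrow> (\<forall>S. finite S \<and> card S = k \<longrightarrow> \<not> satisfiable M n \<phi> b S)"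

definition NTP2 :: "('f, 'p, 'm) struct \<Rightarrow> bool" where
  "NTP2 M \<longleftrightarrow> \<not> (\<exists>n m \<phi> k a. fmla M (n + m) \<phi> \<and> (\<forall>j i. length (a j i) = m) \<and>
     (\<forall>j. k_inconsistent M k n \<phi> (a j)) \<and>
     (\<forall>f. consistent M n \<phi> (\<lambda>j. a j (f j))))"

text \<open>Dependent (NIP): no formula has the independence property.\<close>

definition dependent :: "('f, 'p, 'm) struct \<Rightarrow> bool" where
  "dependent M \<longleftrightarrow> \<not> (\<exists>n m \<phi> a b. fmla M (n + m) \<phi> \<and>
     (\<forall>i :: nat. length (a i) = n) \<and> (\<forall>s :: nat set. length (b s) = m) \<and>
     (\<forall>i s. holds M \<phi> (a i @ b s) \<longleftrightarrow> i \<in> s))"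

text \<open>Equality of \<open>tp(b/C)\<close> and \<open>tp(b'/C)\<close> for finite tuples.\<close>

definition same_tp :: "('f, 'p, 'm) struct \<Rightarrow> 'm set \<Rightarrow> 'm list \<Rightarrow> 'm list \<Rightarrow> bool" where
  "same_tp M C b b' \<longleftrightarrow> length b = length b' \<and>
     (\<forall>\<phi> c. set c \<subseteq> C \<and> fmla M (length b + length c) \<phi> \<longrightarrow>
        (holds M \<phi> (b @ c) \<longleftrightarrow> holds M \<phi> (b' @ c)))"

definition divides ::
  "('f, 'p, 'm) struct \<Rightarrow> 'm set \<Rightarrow> nat \<Rightarrow> ('f, 'p) fm \<Rightarrow> 'm list \<Rightarrow> bool" where
  "divides M A n \<phi> b \<longleftrightarrow> (\<exists>k b'. (\<forall>i. same_tp M A (b' i) b) \<and> k_inconsistent M k n \<phi> b')"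

definition forks ::
  "('f, 'p, 'm) struct \<Rightarrow> 'm set \<Rightarrow> nat \<Rightarrow> ('f, 'p) fm \<Rightarrow> 'm list \<Rightarrow> bool" where
  "forks M A n \<phi> b \<longleftrightarrow> (\<exists>\<Psi>. finite \<Psi> \<and>
     (\<forall>(\<psi>, c)\<in>\<Psi>. fmla M (n + length c) \<psi> \<and> divides M A n \<psi> c) \<and>
     (\<forall>a. length a = n \<and> holds M \<phi> (a @ b) \<longrightarrow> (\<exists>(\<psi>, c)\<in>\<Psi>. holds M \<psi> (a @ c))))"

definition forking_eq_dividing :: "('f, 'p, 'm) struct \<Rightarrow> 'm set \<Rightarrow> bool" where
  "forking_eq_dividing M A \<longleftrightarrow>
     (\<forall>n \<phi> b. fmla M (n + length b) \<phi> \<longrightarrow> (forks M A n \<phi> b \<longleftrightarrow> divides M A n \<phi> b))"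


section \<open>Global types and Lascar-invariance\<close>

text \<open>
  The variables of a type of a set \<open>X\<close> are indexed by the elements of \<open>X\<close>.  A triple
  \<open>(\<phi>, xs, c)\<close> stands for the formula \<open>\<phi>(v\<^bsub>xs\<^esub>, c)\<close>, where \<open>v\<^bsub>xs\<^esub>\<close> are the variables
  named by the list \<open>xs\<close> and \<open>c\<close> are parameters.
\<close>

type_synonym ('f, 'p, 'm) inst = "('f, 'p) fm \<times> 'm list \<times> 'm list"

definition insts :: "('f, 'p, 'm) struct \<Rightarrow> 'm set \<Rightarrow> 'm set \<Rightarrow> ('f, 'p, 'm) inst set" where
  "insts M X B = {(\<phi>, xs, c). set xs \<subseteq> X \<and> set c \<subseteq> B \<and> fmla M (length xs + length c) \<phi>}"

definition tp :: "('f, 'p, 'm) struct \<Rightarrow> 'm set \<Rightarrow> 'm set \<Rightarrow> ('f, 'p, 'm) inst set" where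
  "tp M X B = {(\<phi>, xs, c) \<in> insts M X B. holds M \<phi> (xs @ c)}"

definition global_type :: "('f, 'p, 'm) struct \<Rightarrow> 'm set \<Rightarrow> ('f, 'p, 'm) inst set \<Rightarrow> bool" where
  "global_type M X p \<longleftrightarrow> p \<subseteq> insts M X UNIV \<and>
     (\<forall>q\<subseteq>p. finite q \<longrightarrow> (\<exists>h. \<forall>(\<phi>, xs, c)\<in>q. holds M \<phi> (map h xs @ c))) \<and>
     (\<forall>(\<phi>, xs, c)\<in>insts M X UNIV. (\<phi>, xs, c) \<in> p \<or> (Neg \<phi>, xs, c) \<in> p)"

definition type_image :: "('m \<Rightarrow> 'm) \<Rightarrow> ('f, 'p, 'm) inst set \<Rightarrow> ('f, 'p, 'm) inst set" where
  "type_image \<sigma> p = (\<lambda>(\<phi>, xs, c). (\<phi>, xs, map \<sigma> c)) ` p"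

definition AutfL :: "'k rel \<Rightarrow> ('f, 'p, 'm) struct \<Rightarrow> 'm set \<Rightarrow> ('m \<Rightarrow> 'm) set" where
  "AutfL \<kappa> M C = generate (BijGroup UNIV)
     {\<sigma> \<in> Aut M. \<exists>N. small \<kappa> N \<and> elem_submodel M N \<and> C \<subseteq> N \<and> (\<forall>x\<in>N. \<sigma> x = x)}"


section \<open>Indiscernible sequences\<close>

text \<open>
  Sequences \<open>(s i)\<close>, with \<open>i\<close> ranging over an infinite small linear order \<open>r\<close>, of tuples
  \<open>s i = (s i v)\<close>, \<open>v \<in> V\<close>, where \<open>V\<close> is a small set of coordinates.  As \<open>\<kappa>\<close> is a cardinal
  on the type \<open>'k\<close>, every small linear order and every small set have copies on \<open>'k\<close>.
  In \<open>indiscernible\<close>, \<open>vs\<close> selects finitely many coordinates: \<open>(l, v)\<close> selects coordinate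
  \<open>v\<close> of the \<open>l\<close>-th tuple among \<open>s (is ! 0), s (is ! 1), \<dots>\<close>.
\<close>

definition increasing :: "'k rel \<Rightarrow> 'k list \<Rightarrow> bool" where
  "increasing r is \<longleftrightarrow> set is \<subseteq> Field r \<and> sorted_wrt (\<lambda>i j. (i, j) \<in> r \<and> i \<noteq> j) is"

definition seq_index :: "'k rel \<Rightarrow> 'k rel \<Rightarrow> 'k set \<Rightarrow> bool" where
  "seq_index \<kappa> r V \<longleftrightarrow> Linear_order r \<and> infinite (Field r) \<and> small \<kappa> (Field r) \<and> small \<kappa> V"

definition seq_set :: "'k rel \<Rightarrow> 'k set \<Rightarrow> ('k \<Rightarrow> 'k \<Rightarrow> 'm) \<Rightarrow> 'm set" where
  "seq_set r V s = (\<Union>i\<in>Field r. s i ` V)"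

definition indiscernible ::
  "('f, 'p, 'm) struct \<Rightarrow> 'm set \<Rightarrow> 'k rel \<Rightarrow> 'k set \<Rightarrow> ('k \<Rightarrow> 'k \<Rightarrow> 'm) \<Rightarrow> bool" where
  "indiscernible M C r V s \<longleftrightarrow>
     (\<forall>is js vs \<phi> c. increasing r is \<and> increasing r js \<and> length is = length js \<and>
        set vs \<subseteq> {..<length is} \<times> V \<and> set c \<subseteq> C \<and> fmla M (length vs + length c) \<phi> \<longrightarrow>
        (holds M \<phi> (map (\<lambda>(l, v). s (is ! l) v) vs @ c) \<longleftrightarrow>
         holds M \<phi> (map (\<lambda>(l, v). s (js ! l) v) vs @ c)))"


section \<open>Properties of a ternary relation on small sets\<close>

text \<open>\<open>X'Y'C' \<equiv> XYC\<close> and \<open>D' \<equiv>\<^sub>B D\<close>, the enumerations being given by the elementary map.\<close>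

definition conj_triple :: "('f, 'p, 'm) struct \<Rightarrow>
    'm set \<times> 'm set \<times> 'm set \<Rightarrow> 'm set \<times> 'm set \<times> 'm set \<Rightarrow> bool" where
  "conj_triple M = (\<lambda>(X', Y', C') (X, Y, C).
     \<exists>f. elem_map M (X \<union> Y \<union> C) f \<and> f ` X = X' \<and> f ` Y = Y' \<and> f ` C = C')"

definition conj_over :: "('f, 'p, 'm) struct \<Rightarrow> 'm set \<Rightarrow> 'm set \<Rightarrow> 'm set \<Rightarrow> bool" where
  "conj_over M B D' D \<longleftrightarrow> (\<exists>f. elem_map M (B \<union> D) f \<and> (\<forall>b\<in>B. f b = b) \<and> f ` D = D')"

type_synonym 'm ternary = "'m set \<Rightarrow> 'm set \<Rightarrow> 'm set \<Rightarrow> bool"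

definition invariance :: "'k rel \<Rightarrow> ('f, 'p, 'm) struct \<Rightarrow> 'm ternary \<Rightarrow> bool" where
  "invariance \<kappa> M R \<longleftrightarrow>
     (\<forall>X C Y X' C' Y'. small \<kappa> X \<and> small \<kappa> C \<and> small \<kappa> Y \<and>
        R X C Y \<and> conj_triple M (X', Y', C') (X, Y, C) \<longrightarrow> R X' C' Y')"

definition monotonicity :: "'k rel \<Rightarrow> 'm ternary \<Rightarrow> bool" where
  "monotonicity \<kappa> R \<longleftrightarrow>
     (\<forall>X C Y X' Y'. small \<kappa> X \<and> small \<kappa> C \<and> small \<kappa> Y \<and>
        R X C Y \<and> X' \<subseteq> X \<and> Y' \<subseteq> Y \<longrightarrow> R X' C Y')"

definition base_monotonicity :: "'k rel \<Rightarrow> 'm ternary \<Rightarrow> bool" where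
  "base_monotonicity \<kappa> R \<longleftrightarrow>
     (\<forall>X C Y D. small \<kappa> X \<and> small \<kappa> C \<and> small \<kappa> Y \<and> small \<kappa> D \<and>
        R X C (Y \<union> D) \<longrightarrow> R X (C \<union> Y) D)"

definition right_extension :: "'k rel \<Rightarrow> ('f, 'p, 'm) struct \<Rightarrow> 'm ternary \<Rightarrow> bool" where
  "right_extension \<kappa> M R \<longleftrightarrow>
     (\<forall>X C Y D. small \<kappa> X \<and> small \<kappa> C \<and> small \<kappa> Y \<and> small \<kappa> D \<and>
        R X C Y \<and> Y \<subseteq> D \<longrightarrow> (\<exists>D'. conj_over M (Y \<union> C) D' D \<and> R X C D'))"

definition left_transitivity :: "'k rel \<Rightarrow> 'm ternary \<Rightarrow> bool" where
  "left_transitivity \<kappa> R \<longleftrightarrow>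
     (\<forall>X1 X2 C Y. small \<kappa> X1 \<and> small \<kappa> X2 \<and> small \<kappa> C \<and> small \<kappa> Y \<and>
        R X1 C Y \<and> R X2 (C \<union> X1) (Y \<union> X1) \<longrightarrow> R (X1 \<union> X2) C Y)"

definition stronger_than_invariance :: "'k rel \<Rightarrow> ('f, 'p, 'm) struct \<Rightarrow> 'm ternary \<Rightarrow> bool" where
  "stronger_than_invariance \<kappa> M R \<longleftrightarrow>
     (\<forall>X C Y. small \<kappa> X \<and> small \<kappa> C \<and> small \<kappa> Y \<and> R X C Y \<longrightarrow>
        (\<exists>p. global_type M X p \<and> tp M X (Y \<union> C) \<subseteq> p \<and>
             (\<forall>\<sigma>\<in>AutfL \<kappa> M C. type_image \<sigma> p = p)))"

definition preserves_indiscernibles :: "'k rel \<Rightarrow> ('f, 'p, 'm) struct \<Rightarrow> 'm ternary \<Rightarrow> bool" where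
  "preserves_indiscernibles \<kappa> M R \<longleftrightarrow>
     (\<forall>X C r V s. small \<kappa> X \<and> small \<kappa> C \<and> seq_index \<kappa> r V \<and>
        indiscernible M C r V s \<and> R X C (seq_set r V s) \<longrightarrow> indiscernible M (X \<union> C) r V s)"

definition left_extension_over ::
  "'k rel \<Rightarrow> ('f, 'p, 'm) struct \<Rightarrow> 'm set \<Rightarrow> 'm ternary \<Rightarrow> bool" where
  "left_extension_over \<kappa> M A R \<longleftrightarrow>
     (\<forall>X Y D. small \<kappa> X \<and> small \<kappa> Y \<and> small \<kappa> D \<and> R X A Y \<and> X \<subseteq> D \<longrightarrow>
        (\<exists>D'. conj_over M (X \<union> A) D' D \<and> R D' A Y))"

definition extension_base_for :: "'k rel \<Rightarrow> 'm set \<Rightarrow> 'm ternary \<Rightarrow> bool" where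
  "extension_base_for \<kappa> A R \<longleftrightarrow> (\<forall>X. small \<kappa> X \<longrightarrow> R X A A)"

definition suitable_relation ::
  "'k rel \<Rightarrow> ('f, 'p, 'm) struct \<Rightarrow> 'm set \<Rightarrow> 'm ternary \<Rightarrow> bool" where
  "suitable_relation \<kappa> M A R \<longleftrightarrow>
     invariance \<kappa> M R \<and> monotonicity \<kappa> R \<and> base_monotonicity \<kappa> R \<and>
     right_extension \<kappa> M R \<and> left_transitivity \<kappa> R \<and>
     stronger_than_invariance \<kappa> M R \<and> preserves_indiscernibles \<kappa> M R \<and>
     left_extension_over \<kappa> M A R \<and> extension_base_for \<kappa> A R"

end

(*
  From (1) to (2).  NTP2 turns a witness of dividing into a finite inconsistent sequence of
  R-independent, Lascar equivalent tuples.  With such sequences the broom lemma shows that a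
  formula which forks over A quasi-divides: finitely many of its conjugates over A are
  inconsistent.  Hence every tuple d has, over any small set B, a realisation d' of its type over
  A which is Lascar-invariant and such that the type of B over Ad' contains no formula dividing
  over A.  By Kim's lemma, iterating this gives a sequence of conjugates of d which witnesses all
  dividing at d simultaneously, and by the pigeonhole principle a disjunction of dividing formulas
  divides.

  From (2) to (1) for dependent T.  R is the existence of a Lascar-invariant global extension.
  Left transitivity holds since tuples with the same type over a model are connected by
  indiscernible sequences, and these stay indiscernible over anything R-independent from them.  In
  a dependent theory a global type without dividing formulas is Lascar-invariant, so by (2) R holds
  as soon as the type of X over AY contains no dividing formula; this gives the extension base and,
  using (2) again, left extension over A.
*)
theory Submission
  imports Defs "HOL-Library.Ramsey"
begin

section \<open>Definable predicates of assignments\<close>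

text \<open>\<open>divides\<close> is witnessed by arbitrary sequences of conjugates, so on the way
  from (1) to (2) no indiscernible sequence is extracted; sequences are only compared through
  automorphisms. The obstacle is that each disjunct of a forking formula has its own dividing
  sequence, and these do not fit together. The broom lemma controls only finitely many conjugates. A
  common infinite witness needs two properties of each new realisation at once: Lascar-invariance
  over the previous elements, which makes every choice of one element per row conjugate to the
  sequence of realisations, and the absence of dividing formulas in the other direction, which
  allows a whole dividing sequence to be copied as a row conjugate over the previous elements.
  Equality of types over \<open>A\<close> is too weak for the first property, since invariance is
  only granted under automorphisms generated by those that fix a model; therefore dividing sequences
  are first made Lascar equivalent. In the dependent case the link between two tuples conjugate over
  a model is a common continuation: one sequence that prolongs either tuple to an indiscernible
  sequence.\<close>

fun ren_tm :: "(nat \<Rightarrow> nat) \<Rightarrow> 'f tm \<Rightarrow> 'f tm" where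
  "ren_tm \<rho> (Var i) = Var (\<rho> i)"
| "ren_tm \<rho> (App f ts) = App f (map (ren_tm \<rho>) ts)"

fun ren :: "(nat \<Rightarrow> nat) \<Rightarrow> ('f, 'p) fm \<Rightarrow> ('f, 'p) fm" where
  "ren \<rho> (Eq s t) = Eq (ren_tm \<rho> s) (ren_tm \<rho> t)"
| "ren \<rho> (Rel p ts) = Rel p (map (ren_tm \<rho>) ts)"
| "ren \<rho> (Neg \<phi>) = Neg (ren \<rho> \<phi>)"
| "ren \<rho> (Conj \<phi> \<psi>) = Conj (ren \<rho> \<phi>) (ren \<rho> \<psi>)"
| "ren \<rho> (Ex \<phi>) = Ex (ren (case_nat 0 (\<lambda>i. Suc (\<rho> i))) \<phi>)"

lemma trm_ren: "trm M n t \<Longrightarrow> (\<And>i. i < n \<Longrightarrow> \<rho> i < m) \<Longrightarrow> trm M m (ren_tm \<rho> t)"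
  by (induction t) auto

lemma val_ren: "trm M n t \<Longrightarrow> (\<And>i. i < n \<Longrightarrow> e' ! \<rho> i = e ! i) \<Longrightarrow> val M e' (ren_tm \<rho> t) = val M e t"
  by (induction t) (auto intro!: arg_cong[where f = "FunI M _"])

lemma fmla_ren: "fmla M n \<phi> \<Longrightarrow> (\<And>i. i < n \<Longrightarrow> \<rho> i < m) \<Longrightarrow> fmla M m (ren \<rho> \<phi>)"
proof (induction \<phi> arbitrary: n m \<rho>)
  case (Ex \<phi>)
  have "fmla M (Suc m) (ren (case_nat 0 (\<lambda>i. Suc (\<rho> i))) \<phi>)"
    using Ex.prems by (intro Ex.IH[of "Suc n"]) (auto split: nat.splits)
  then show ?case by simp
qed (auto simp: trm_ren)

text \<open>The renaming need not be injective: only the values at indices below \<open>n\<close>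
  are compared, so variables may also be identified.\<close>

lemma sat_ren: "fmla M n \<phi> \<Longrightarrow> (\<And>i. i < n \<Longrightarrow> e' ! \<rho> i = e ! i) \<Longrightarrow> sat M D e' (ren \<rho> \<phi>) \<longleftrightarrow> sat M D e \<phi>"
proof (induction \<phi> arbitrary: n e e' \<rho>)
  case (Eq s t)
  then show ?case using val_ren[of M n s e' \<rho> e] val_ren[of M n t e' \<rho> e] by simp
next
  case (Rel p ts)
  have "map (val M e') (map (ren_tm \<rho>) ts) = map (val M e) ts"
    using Rel by (auto intro!: val_ren)
  then show ?case by (simp only: ren.simps sat.simps)
next
  case (Neg \<phi>)
  then show ?case using Neg.IH[of n e' \<rho> e] by simp
next
  case (Conj \<phi> \<psi>)
  then show ?case using Conj.IH(1)[of n e' \<rho> e] Conj.IH(2)[of n e' \<rho> e] by simp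
next
  case (Ex \<phi>)
  have "sat M D (d # e') (ren (case_nat 0 (\<lambda>i. Suc (\<rho> i))) \<phi>) \<longleftrightarrow> sat M D (d # e) \<phi>" for d
    using Ex.prems by (intro Ex.IH[of "Suc n"]) (auto split: nat.splits)
  then show ?case by simp
qed

text \<open>
  \<open>definable M V P\<close>: the predicate \<open>P\<close> of assignments is given by a formula whose free variables are
  assigned the values at points of \<open>V\<close>.  Naming variables by the points of an arbitrary type avoids
  de Bruijn arithmetic, and parameters become variables named by themselves.
\<close>

definition definable :: "('f, 'p, 'm) struct \<Rightarrow> 'v set \<Rightarrow> (('v \<Rightarrow> 'm) \<Rightarrow> bool) \<Rightarrow> bool" where
  "definable M V P \<longleftrightarrow> (\<exists>\<phi> vs. set vs \<subseteq> V \<and> fmla M (length vs) \<phi> \<and> (\<forall>h. P h \<longleftrightarrow> holds M \<phi> (map h vs)))"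

lemma dfnI: "fmla M (length vs) \<phi> \<Longrightarrow> set vs \<subseteq> V \<Longrightarrow> definable M V (\<lambda>h. holds M \<phi> (map h vs))"
  unfolding definable_def by blast

lemma definable_mono: "definable M V P \<Longrightarrow> V \<subseteq> W \<Longrightarrow> definable M W P"
  unfolding definable_def by blast

lemma definable_rename: "definable M V P \<Longrightarrow> g ` V \<subseteq> W \<Longrightarrow> definable M W (\<lambda>h. P (\<lambda>v. h (g v)))"
  unfolding definable_def
  apply clarify
  subgoal for \<phi> vs
    apply (rule exI[of _ \<phi>], rule exI[of _ "map g vs"])
    by (auto simp: o_def)
  done

lemma definable_cong: "definable M V P \<Longrightarrow> (\<And>v. v \<in> V \<Longrightarrow> h v = h' v) \<Longrightarrow> P h \<longleftrightarrow> P h'"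
  unfolding definable_def by (metis (no_types, lifting) map_cong subsetD)

lemma definable_finite_support:
  assumes "definable M V P"
  obtains F where "finite F" "F \<subseteq> V" "definable M F P"
  using assms unfolding definable_def by (metis List.finite_set subset_refl)

text \<open>Each variable of the given formula is renamed to a position in \<open>ws\<close> with
  the same name. Two predicates can thus be written over one list, as the Boolean operations
  require.\<close>

lemma definable_list:
  assumes "definable M (set ws) P"
  obtains \<phi> where "fmla M (length ws) \<phi>" "\<And>h. P h \<longleftrightarrow> holds M \<phi> (map h ws)"
proof -
  obtain \<phi> vs where vs: "set vs \<subseteq> set ws" and f: "fmla M (length vs) \<phi>"
    and P: "\<And>h. P h \<longleftrightarrow> holds M \<phi> (map h vs)"
    using assms unfolding definable_def by blast
  have "\<forall>i. \<exists>j. i < length vs \<longrightarrow> j < length ws \<and> ws ! j = vs ! i"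
    using vs by (metis in_set_conv_nth nth_mem subset_iff)
  then obtain \<rho> where \<rho>: "\<And>i. i < length vs \<Longrightarrow> \<rho> i < length ws \<and> ws ! \<rho> i = vs ! i"
    by metis
  show thesis
  proof
    show "fmla M (length ws) (ren \<rho> \<phi>)" using f \<rho> by (intro fmla_ren) auto
    show "P h \<longleftrightarrow> holds M (ren \<rho> \<phi>) (map h ws)" for h
      unfolding P using \<rho> by (intro sat_ren[OF f, symmetric]) auto
  qed
qed

lemma definable_neg: "definable M V P \<Longrightarrow> definable M V (\<lambda>h. \<not> P h)"
  unfolding definable_def
  apply clarify
  subgoal for \<phi> vs
    by (rule exI[of _ "Neg \<phi>"], rule exI[of _ vs]) auto
  done

lemma definable_conj:
  assumes "definable M V P" "definable M V Q"
  shows "definable M V (\<lambda>h. P h \<and> Q h)"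
proof -
  obtain F G where F: "finite F" "F \<subseteq> V" "definable M F P" and G: "finite G" "G \<subseteq> V" "definable M G Q"
    using assms definable_finite_support by metis
  obtain ws where ws: "set ws = F \<union> G" using F(1) G(1) finite_list by (metis finite_Un)
  obtain \<phi> where \<phi>: "fmla M (length ws) \<phi>" "\<And>h. P h \<longleftrightarrow> holds M \<phi> (map h ws)"
    using definable_list[of M ws P] definable_mono[OF F(3)] ws by blast
  obtain \<psi> where \<psi>: "fmla M (length ws) \<psi>" "\<And>h. Q h \<longleftrightarrow> holds M \<psi> (map h ws)"
    using definable_list[of M ws Q] definable_mono[OF G(3)] ws by blast
  show ?thesis unfolding definable_def using \<phi> \<psi> ws F(2) G(2)
    by (intro exI[of _ "Conj \<phi> \<psi>"] exI[of _ ws]) auto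
qed

lemma definable_imp: "definable M V P \<Longrightarrow> definable M V Q \<Longrightarrow> definable M V (\<lambda>h. P h \<longrightarrow> Q h)"
  using definable_neg[OF definable_conj[OF _ definable_neg], of M V P Q] by simp

lemma definable_iff: "definable M V P \<Longrightarrow> definable M V Q \<Longrightarrow> definable M V (\<lambda>h. P h \<longleftrightarrow> Q h)"
  using definable_conj[OF definable_imp definable_imp, of M V P Q Q P] by (simp add: iff_conv_conj_imp)

lemma definable_True: "definable M V (\<lambda>h. True)"
  \<comment> \<open>Over the empty list of variables truth has to be a sentence without constants,
    hence a quantified equation.\<close>
  using dfnI[of M "[]" "Ex (Eq (Var 0) (Var 0))" V] by simp

lemma definable_const: "definable M V (\<lambda>h. b)"
  using definable_True definable_neg[OF definable_True] by (cases b) auto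

lemma definable_eq: "v \<in> V \<Longrightarrow> w \<in> V \<Longrightarrow> definable M V (\<lambda>h. h v = h w)"
  using dfnI[of M "[v, w]" "Eq (Var 0) (Var 1)" V] by simp

lemma definable_ball: "finite I \<Longrightarrow> (\<And>i. i \<in> I \<Longrightarrow> definable M V (P i)) \<Longrightarrow> definable M V (\<lambda>h. \<forall>i\<in>I. P i h)"
  by (induction I rule: finite_induct) (auto simp: definable_True intro: definable_conj)

lemma definable_bex: "finite I \<Longrightarrow> (\<And>i. i \<in> I \<Longrightarrow> definable M V (P i)) \<Longrightarrow> definable M V (\<lambda>h. \<exists>i\<in>I. P i h)"
  using definable_neg[OF definable_ball[of I M V "\<lambda>i h. \<not> P i h"]] definable_neg by fastforce

text \<open>The quantified name is put at the head of the list, where \<open>Ex\<close> binds it as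
  index 0.\<close>

lemma definable_ex:
  assumes "definable M (insert x V) P"
  shows "definable M V (\<lambda>h. \<exists>a. P (h(x := a)))"
proof -
  obtain F where F: "finite F" "F \<subseteq> insert x V" "definable M F P" using assms definable_finite_support by metis
  obtain ws where ws: "set ws = F - {x}" using F(1) finite_list by (metis finite_Diff)
  have "definable M (set (x # ws)) P" using definable_mono[OF F(3)] ws by auto
  then obtain \<phi> where \<phi>: "fmla M (length (x # ws)) \<phi>" "\<And>h. P h \<longleftrightarrow> holds M \<phi> (map h (x # ws))"
    using definable_list by blast
  have *: "map (h(x := a)) ws = map h ws" for h a using ws by auto
  show ?thesis unfolding definable_def using \<phi> ws F(2) *
    by (intro exI[of _ "Ex \<phi>"] exI[of _ ws]) auto
qed

lemma definable_finite_ex: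
  assumes "finite F" "definable M (F \<union> V) P"
  shows "definable M V (\<lambda>h. \<exists>g. P (\<lambda>v. if v \<in> F then g v else h v))"
  using assms
proof (induction F arbitrary: V)
  case empty
  then show ?case by simp
next
  case (insert x F)
  have "definable M (insert x V) (\<lambda>h. \<exists>g. P (\<lambda>v. if v \<in> F then g v else h v))"
    using insert by simp
  from definable_ex[OF this]
  have "definable M V (\<lambda>h. \<exists>a g. P (\<lambda>v. if v \<in> F then g v else (h(x := a)) v))" .
  moreover have "(\<exists>a g. P (\<lambda>v. if v \<in> F then g v else (h(x := a)) v)) \<longleftrightarrow>
      (\<exists>g. P (\<lambda>v. if v \<in> insert x F then g v else h v))" for h
  proof
    assume "\<exists>a g. P (\<lambda>v. if v \<in> F then g v else (h(x := a)) v)"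
    then obtain a g where "P (\<lambda>v. if v \<in> F then g v else (h(x := a)) v)" by blast
    moreover have "(\<lambda>v. if v \<in> F then g v else (h(x := a)) v) =
        (\<lambda>v. if v \<in> insert x F then (g(x := a)) v else h v)" using insert(2) by auto
    ultimately show "\<exists>g. P (\<lambda>v. if v \<in> insert x F then g v else h v)" by metis
  next
    assume "\<exists>g. P (\<lambda>v. if v \<in> insert x F then g v else h v)"
    then obtain g where "P (\<lambda>v. if v \<in> insert x F then g v else h v)" by blast
    moreover have "(\<lambda>v. if v \<in> F then g v else (h(x := g x)) v) =
        (\<lambda>v. if v \<in> insert x F then g v else h v)" using insert(2) by auto
    ultimately show "\<exists>a g. P (\<lambda>v. if v \<in> F then g v else (h(x := a)) v)" by metis
  qed
  ultimately show ?case by simp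
qed

text \<open>The components of the quantified tuple are named in the left summand, so they cannot
  clash with names in \<open>V\<close>.\<close>

lemma definable_ex_list:
  fixes V :: "'v set" and Q :: "'m list \<Rightarrow> ('v \<Rightarrow> 'm) \<Rightarrow> bool"
  assumes "definable M (Inl ` {..<n} \<union> Inr ` V) (\<lambda>h. Q (map (\<lambda>i. h (Inl i)) [0..<n]) (\<lambda>v. h (Inr v)))"
  shows "definable M V (\<lambda>h. \<exists>a. length a = n \<and> Q a h)"
proof -
  have "definable M (Inr ` V) (\<lambda>h :: nat + 'v \<Rightarrow> 'm. \<exists>g :: nat + 'v \<Rightarrow> 'm. Q (map (\<lambda>i. g (Inl i)) [0..<n]) (\<lambda>v. h (Inr v)))"
  proof -
    have "map (\<lambda>i. if i < n then g (Inl i) else h (Inl i)) [0..<n] = map (\<lambda>i. g (Inl i)) [0..<n]"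
      for g h :: "nat + 'v \<Rightarrow> 'm" by auto
    with definable_finite_ex[OF _ assms] show ?thesis by (simp add: image_iff del: map_eq_conv)
  qed
  from definable_rename[OF this, of projr V]
  have "definable M V (\<lambda>h. \<exists>g :: nat + 'v \<Rightarrow> 'm. Q (map (\<lambda>i. g (Inl i)) [0..<n]) h)" by (auto simp: image_image)
  moreover have "(\<exists>g :: nat + 'v \<Rightarrow> 'm. Q (map (\<lambda>i. g (Inl i)) [0..<n]) h) \<longleftrightarrow> (\<exists>a. length a = n \<and> Q a h)" for h
  proof
    assume "\<exists>a. length a = n \<and> Q a h"
    then obtain a where a: "length a = n" "Q a h" by blast
    have "map (\<lambda>i. a ! projl (Inl i :: nat + 'v)) [0..<n] = a" using a(1) map_nth by fastforce
    with a(2) show "\<exists>g :: nat + 'v \<Rightarrow> 'm. Q (map (\<lambda>i. g (Inl i)) [0..<n]) h"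
      by (intro exI[of _ "\<lambda>v. a ! projl v"]) (simp only:)
  next
    assume "\<exists>g :: nat + 'v \<Rightarrow> 'm. Q (map (\<lambda>i. g (Inl i)) [0..<n]) h"
    then obtain g :: "nat + 'v \<Rightarrow> 'm" where "Q (map (\<lambda>i. g (Inl i)) [0..<n]) h" ..
    then show "\<exists>a. length a = n \<and> Q a h"
      by (intro exI[of _ "map (\<lambda>i. g (Inl i)) [0..<n]"]) simp
  qed
  ultimately show ?thesis by simp
qed

lemma definable_satisfiable:
  assumes "fmla M (n + m) \<phi>" "finite S" "\<And>i. i \<in> S \<Longrightarrow> length (vs i) = m \<and> set (vs i) \<subseteq> V"
  shows "definable M V (\<lambda>h. satisfiable M n \<phi> (\<lambda>i. map h (vs i)) S)"
  unfolding satisfiable_def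
proof (rule definable_ex_list)
  have "definable M (Inl ` {..<n} \<union> Inr ` V)
     (\<lambda>h. holds M \<phi> (map h (map Inl [0..<n] @ map Inr (vs i))))" if "i \<in> S" for i
    using assms(1) assms(3)[OF that] by (intro dfnI) auto
  then show "definable M (Inl ` {..<n} \<union> Inr ` V)
     (\<lambda>h. \<forall>i\<in>S. holds M \<phi> (map (\<lambda>i. h (Inl i)) [0..<n] @ map (\<lambda>v. h (Inr v)) (vs i)))"
    using assms(2) by (intro definable_ball) (auto simp: o_def)
qed

section \<open>Automorphisms and compactness\<close>

text \<open>Brings a predicate into the shape of a formula in one variable followed by parameters,
  to which \<open>saturated\<close> applies.\<close>

lemma definable_insert_list:
  assumes "definable M (insert v D) P"
  obtains \<phi> ws where "set ws \<subseteq> D" "fmla M (Suc (length ws)) \<phi>"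
    "\<And>h. P h \<longleftrightarrow> holds M \<phi> (h v # map h ws)"
proof -
  obtain F where F: "finite F" "F \<subseteq> insert v D" "definable M F P" using assms definable_finite_support by metis
  obtain ws where ws: "set ws = F - {v}" using F(1) finite_list by (metis finite_Diff)
  have "definable M (set (v # ws)) P" using definable_mono[OF F(3)] ws by auto
  then obtain \<phi> where "fmla M (length (v # ws)) \<phi>" "\<And>h. P h \<longleftrightarrow> holds M \<phi> (map h (v # ws))"
    using definable_list by blast
  then show thesis using that[of ws \<phi>] ws F(2) by auto
qed

lemma Aut_Rel: "\<sigma> \<in> Aut M \<Longrightarrow> (p, length xs) \<in> Rels M \<Longrightarrow> RelI M p (map \<sigma> xs) \<longleftrightarrow> RelI M p xs"
  by (simp add: Aut_def)

lemma Aut_val: "\<sigma> \<in> Aut M \<Longrightarrow> trm M (length e) t \<Longrightarrow> val M (map \<sigma> e) t = \<sigma> (val M e t)"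
proof (induction t)
  case (App f ts)
  have "map (val M (map \<sigma> e)) ts = map \<sigma> (map (val M e) ts)"
    using App by auto
  moreover have "\<sigma> (FunI M f (map (val M e) ts)) = FunI M f (map \<sigma> (map (val M e) ts))"
    using App.prems by (simp add: Aut_def)
  ultimately show ?case by (simp only: val.simps)
qed auto

text \<open>The universe \<open>D\<close> is arbitrary because images of elementary submodels under
  automorphisms are needed later.\<close>

lemma Aut_sat:
  "\<sigma> \<in> Aut M \<Longrightarrow> fmla M (length e) \<phi> \<Longrightarrow> sat M (\<sigma> ` D) (map \<sigma> e) \<phi> \<longleftrightarrow> sat M D e \<phi>"
proof (induction \<phi> arbitrary: e)
  case (Eq s t)
  then have "inj \<sigma>" by (simp add: Aut_def bij_def)
  with Eq show ?case by (simp add: Aut_val inj_eq)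
next
  case (Rel p ts)
  have "map (val M (map \<sigma> e)) ts = map \<sigma> (map (val M e) ts)"
    using Rel by (auto simp: Aut_val)
  moreover have "RelI M p (map \<sigma> (map (val M e) ts)) \<longleftrightarrow> RelI M p (map (val M e) ts)"
    using Rel Aut_Rel[of \<sigma> M p "map (val M e) ts"] by simp
  ultimately show ?case by (simp only: sat.simps)
next
  case (Ex \<phi>)
  have "sat M (\<sigma> ` D) (\<sigma> d # map \<sigma> e) \<phi> \<longleftrightarrow> sat M D (d # e) \<phi>" for d
    using Ex.IH[of "d # e"] Ex.prems by simp
  then show ?case by simp
qed auto

lemma Aut_bij: "\<sigma> \<in> Aut M \<Longrightarrow> bij \<sigma>"
  by (simp add: Aut_def)

lemma Aut_holds:
  "\<sigma> \<in> Aut M \<Longrightarrow> fmla M (length e) \<phi> \<Longrightarrow> holds M \<phi> (map \<sigma> e) \<longleftrightarrow> holds M \<phi> e"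
  using Aut_sat[of \<sigma> M e \<phi> UNIV] Aut_bij[of \<sigma> M] by (simp add: bij_is_surj)

lemma Aut_id: "id \<in> Aut M"
  by (simp add: Aut_def)

lemma Aut_comp: "\<sigma> \<in> Aut M \<Longrightarrow> \<tau> \<in> Aut M \<Longrightarrow> \<sigma> \<circ> \<tau> \<in> Aut M"
proof -
  assume s: "\<sigma> \<in> Aut M" and t: "\<tau> \<in> Aut M"
  have "(\<sigma> \<circ> \<tau>) (FunI M f xs) = FunI M f (map (\<sigma> \<circ> \<tau>) xs)" if "(f, length xs) \<in> Funs M" for f xs
  proof -
    have "\<tau> (FunI M f xs) = FunI M f (map \<tau> xs)" using t that by (simp add: Aut_def)
    moreover have "\<sigma> (FunI M f (map \<tau> xs)) = FunI M f (map \<sigma> (map \<tau> xs))"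
      using s that by (simp add: Aut_def)
    ultimately show ?thesis by simp
  qed
  moreover have "RelI M p (map (\<sigma> \<circ> \<tau>) xs) \<longleftrightarrow> RelI M p xs" if "(p, length xs) \<in> Rels M" for p xs
  proof -
    have "RelI M p (map \<tau> xs) \<longleftrightarrow> RelI M p xs" using t that by (simp add: Aut_def)
    moreover have "RelI M p (map \<sigma> (map \<tau> xs)) \<longleftrightarrow> RelI M p (map \<tau> xs)"
      using Aut_Rel[OF s, of p "map \<tau> xs"] that by simp
    ultimately show ?thesis by simp
  qed
  ultimately show ?thesis using s t by (simp add: Aut_def bij_comp)
qed

lemma Aut_inv:
  assumes "\<sigma> \<in> Aut M"
  shows "inv_into UNIV \<sigma> \<in> Aut M"
proof -
  have b: "bij \<sigma>" using assms by (rule Aut_bij)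
  have m: "map \<sigma> (map (inv_into UNIV \<sigma>) xs) = xs" for xs
    using b by (simp add: o_def bij_is_surj surj_f_inv_f)
  have "inv_into UNIV \<sigma> (FunI M f xs) = FunI M f (map (inv_into UNIV \<sigma>) xs)" if "(f, length xs) \<in> Funs M" for f xs
  proof -
    have "\<sigma> (FunI M f (map (inv_into UNIV \<sigma>) xs)) = FunI M f xs"
      using assms that m[of xs] by (simp add: Aut_def del: map_map)
    then show ?thesis using bij_inv_eq_iff[OF b, of "FunI M f (map (inv_into UNIV \<sigma>) xs)" "FunI M f xs"] by simp
  qed
  moreover have "RelI M p (map (inv_into UNIV \<sigma>) xs) \<longleftrightarrow> RelI M p xs" if "(p, length xs) \<in> Rels M" for p xs
  proof -
    have "RelI M p (map \<sigma> (map (inv_into UNIV \<sigma>) xs)) \<longleftrightarrow> RelI M p (map (inv_into UNIV \<sigma>) xs)"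
      using Aut_Rel[OF assms, of p "map (inv_into UNIV \<sigma>) xs"] that by simp
    then show ?thesis unfolding m by simp
  qed
  ultimately show ?thesis using b by (simp add: Aut_def bij_imp_bij_inv)
qed

lemma Aut_definable:
  assumes "\<sigma> \<in> Aut M" "definable M V P"
  shows "P (\<lambda>v. \<sigma> (h v)) \<longleftrightarrow> P h"
proof -
  obtain \<phi> vs where "fmla M (length vs) \<phi>" "\<And>h. P h \<longleftrightarrow> holds M \<phi> (map h vs)"
    using assms(2) unfolding definable_def by blast
  then show ?thesis using Aut_holds[OF assms(1), of "map h vs" \<phi>] by (simp add: o_def)
qed

section \<open>The monster model: small sets and compactness\<close>

locale monster =
  fixes \<kappa> :: "'k rel" and M :: "('f, 'p, 'm) struct"
  assumes monster: "monster_model \<kappa> M"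
begin

lemma Card_order_kappa: "Card_order \<kappa>" and natLeq_kappa: "natLeq <o \<kappa>"
  and language_kappa: "|Funs M <+> Rels M| <o \<kappa>"
  and saturated: "saturated \<kappa> M" and homogeneous: "strongly_homogeneous \<kappa> M"
  using monster by (auto simp: monster_model_def)

lemma infinite_Field_kappa: "infinite (Field \<kappa>)"
proof -
  have "|Field natLeq| \<le>o |Field \<kappa>|"
    using natLeq_kappa by (intro card_of_mono2 ordLess_imp_ordLeq)
  then show ?thesis using card_of_ordLeq_infinite Field_natLeq infinite_UNIV_nat by metis
qed

lemma small_subset: "small \<kappa> X \<Longrightarrow> Y \<subseteq> X \<Longrightarrow> small \<kappa> Y"
  unfolding small_def using card_of_mono1 ordLeq_ordLess_trans by blast

lemma small_image: "small \<kappa> X \<Longrightarrow> small \<kappa> (f ` X)"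
  unfolding small_def using card_of_image ordLeq_ordLess_trans by blast

lemma small_Un: "small \<kappa> X \<Longrightarrow> small \<kappa> Y \<Longrightarrow> small \<kappa> (X \<union> Y)"
  unfolding small_def using card_of_Un_ordLess_infinite_Field infinite_Field_kappa Card_order_kappa
  by blast

lemma small_nat: "small \<kappa> (X :: nat set)"
proof -
  have "|UNIV :: nat set| =o natLeq" by (rule card_of_nat)
  then have "small \<kappa> (UNIV :: nat set)"
    unfolding small_def using natLeq_kappa ordIso_ordLess_trans by blast
  then show ?thesis using small_subset by blast
qed

lemma small_countable: "countable (X :: 'a set) \<Longrightarrow> small \<kappa> X"
proof -
  assume "countable X"
  then obtain f :: "'a \<Rightarrow> nat" where "inj_on f X" unfolding countable_def by blast
  then have "|X| \<le>o |UNIV :: nat set|" using card_of_ordLeq by blast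
  then show ?thesis using small_nat[of UNIV] ordLeq_ordLess_trans unfolding small_def by blast
qed

lemma small_finite: "finite X \<Longrightarrow> small \<kappa> X"
  using small_countable countable_finite by blast

text \<open>Saturation realises only types in one variable. Zorn's lemma gives a maximal partial
  assignment, extending \<open>h0\<close> on \<open>B\<close>, that is compatible with every finite
  part of \<open>\<Sigma>\<close>. If a variable were left out, the conditions on it with parameters
  already assigned would form a finitely satisfiable type over a small set, and a realisation would
  extend the assignment.\<close>

theorem compactness:
  fixes V :: "'v set" and \<Sigma> :: "(('v \<Rightarrow> 'm) \<Rightarrow> bool) set"
  assumes V: "small \<kappa> V" and \<Sigma>: "\<And>P. P \<in> \<Sigma> \<Longrightarrow> definable M V P" and B: "B \<subseteq> V"
    and fin: "\<And>q. q \<subseteq> \<Sigma> \<Longrightarrow> finite q \<Longrightarrow> \<exists>h. (\<forall>v\<in>B. h v = h0 v) \<and> (\<forall>P\<in>q. P h)"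
  obtains h where "\<And>v. v \<in> B \<Longrightarrow> h v = h0 v" "\<And>P. P \<in> \<Sigma> \<Longrightarrow> P h"
proof -
  define ext where "ext h G \<longleftrightarrow> (\<forall>v a. (v, a) \<in> G \<longrightarrow> h v = a)" for h :: "'v \<Rightarrow> 'm" and G
  \<comment> \<open>Partial assignments are kept as graphs, so that the union of a chain is again a
    candidate.\<close>
  define \<G> where "\<G> = {G. (\<lambda>v. (v, h0 v)) ` B \<subseteq> G \<and> Domain G \<subseteq> V \<and>
      (\<forall>q\<subseteq>\<Sigma>. finite q \<longrightarrow> (\<exists>h. ext h G \<and> (\<forall>P\<in>q. P h)))}"
  have \<G>D: "(\<lambda>v. (v, h0 v)) ` B \<subseteq> G" "Domain G \<subseteq> V" if "G \<in> \<G>" for G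
    using that by (simp_all add: \<G>_def)
  have \<G>h: "\<exists>h. ext h G \<and> (\<forall>P\<in>q. P h)" if "G \<in> \<G>" "q \<subseteq> \<Sigma>" "finite q" for G q
    using that by (simp add: \<G>_def)
  have \<G>I: "G \<in> \<G>" if "(\<lambda>v. (v, h0 v)) ` B \<subseteq> G" "Domain G \<subseteq> V"
      "\<And>q. q \<subseteq> \<Sigma> \<Longrightarrow> finite q \<Longrightarrow> \<exists>h. ext h G \<and> (\<forall>P\<in>q. P h)" for G
    using that by (simp add: \<G>_def)
  have sv: "a = b" if "G \<in> \<G>" "(v, a) \<in> G" "(v, b) \<in> G" for G v a b
  proof -
    obtain h where "ext h G" using \<G>h[OF \<open>G \<in> \<G>\<close>, of "{}"] by auto
    then show ?thesis using that(2,3) unfolding ext_def by metis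
  qed
  have dfnq: "definable M V (\<lambda>h. \<forall>P\<in>q. P h)" if "finite q" "q \<subseteq> \<Sigma>" for q
    using that \<Sigma> by (intro definable_ball) auto
  have "(\<lambda>v. (v, h0 v)) ` B \<in> \<G>"
  proof -
    have "ext h ((\<lambda>v. (v, h0 v)) ` B) \<longleftrightarrow> (\<forall>v\<in>B. h v = h0 v)" for h unfolding ext_def by auto
    moreover have "Domain ((\<lambda>v. (v, h0 v)) ` B) \<subseteq> V" using B by auto
    ultimately show ?thesis using fin unfolding \<G>_def by simp
  qed
  then have ne: "\<G> \<noteq> {}" by blast
  have ch: "\<Union>\<C> \<in> \<G>" if "\<C> \<noteq> {}" and C: "subset.chain \<G> \<C>" for \<C>
  proof -
    have CG: "\<C> \<subseteq> \<G>" using C by (simp add: subset.chain_def)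
    have svU: "a = b" if ab: "(v, a) \<in> \<Union>\<C>" "(v, b) \<in> \<Union>\<C>" for v a b
    proof -
      have "finite {(v, a), (v, b)}" "{(v, a), (v, b)} \<subseteq> \<Union>\<C>" using ab by auto
      then obtain G where "G \<in> \<C>" "{(v, a), (v, b)} \<subseteq> G"
        using finite_subset_Union_chain[OF _ _ \<open>\<C> \<noteq> {}\<close> C, of "{(v, a), (v, b)}"] by metis
      then show ?thesis using sv[of G v a b] CG by auto
    qed
    define g where "g v = (THE a. (v, a) \<in> \<Union>\<C>)" for v
    have g: "g v = a" if "(v, a) \<in> \<Union>\<C>" for v a
      unfolding g_def by (rule the_equality, rule that, rule svU[OF _ that], assumption)
    have "\<exists>h. ext h (\<Union>\<C>) \<and> (\<forall>P\<in>q. P h)" if q: "q \<subseteq> \<Sigma>" "finite q" for q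
    proof -
      obtain F where F: "finite F" "F \<subseteq> V" "definable M F (\<lambda>h. \<forall>P\<in>q. P h)"
        by (rule definable_finite_support[OF dfnq[OF q(2,1)]])
      define T where "T = {x \<in> \<Union>\<C>. fst x \<in> F}"
      have "T \<subseteq> (\<lambda>v. (v, g v)) ` F"
      proof
        fix x assume x: "x \<in> T"
        obtain v a where va: "x = (v, a)" by (cases x)
        have "(v, a) \<in> \<Union>\<C>" "v \<in> F" using x unfolding T_def va by simp_all
        then show "x \<in> (\<lambda>v. (v, g v)) ` F" using g[of v a] va by (intro image_eqI[of _ _ v]) simp_all
      qed
      then have "finite T" using F(1) finite_surj by blast
      moreover have "T \<subseteq> \<Union>\<C>" by (auto simp: T_def)
      ultimately obtain G where G: "G \<in> \<C>" "T \<subseteq> G"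
        using finite_subset_Union_chain[OF _ _ \<open>\<C> \<noteq> {}\<close> C] by metis
      obtain h1 where h1: "ext h1 G" "\<forall>P\<in>q. P h1" using \<G>h[of G q] G(1) CG q by auto
      \<comment> \<open>A finite part of \<open>\<Sigma>\<close> depends on finitely many variables
        \<open>F\<close>, and one member of the chain settles all of them that occur in the union.
        Off \<open>F\<close> the realisation may be changed to agree with the union.\<close>
      define h where "h v = (if v \<in> Domain (\<Union>\<C>) then g v else h1 v)" for v
      have "h v = h1 v" if "v \<in> F" for v
      proof (cases "v \<in> Domain (\<Union>\<C>)")
        case True
        then obtain a where a: "(v, a) \<in> \<Union>\<C>" by blast
        then have "(v, a) \<in> T" using that by (simp add: T_def)
        then have "(v, a) \<in> G" using G(2) by blast
        then show ?thesis using h1(1) True g[OF a] unfolding ext_def h_def by auto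
      qed (simp add: h_def)
      then have "\<forall>P\<in>q. P h" using definable_cong[OF F(3), of h h1] h1(2) by simp
      moreover have "ext h (\<Union>\<C>)" unfolding ext_def h_def using g by (auto simp: Domain_iff)
      ultimately show ?thesis by blast
    qed
    moreover have "(\<lambda>v. (v, h0 v)) ` B \<subseteq> \<Union>\<C>" using \<G>D(1) CG \<open>\<C> \<noteq> {}\<close> by fast
    moreover have "Domain (\<Union>\<C>) \<subseteq> V" using \<G>D(2) CG by fast
    ultimately show ?thesis by (intro \<G>I) auto
  qed
  obtain G where G: "G \<in> \<G>" and max: "\<And>H. H \<in> \<G> \<Longrightarrow> G \<subseteq> H \<Longrightarrow> H = G"
    using subset_Zorn_nonempty[OF ne ch] by blast
  define g where "g v = (THE a. (v, a) \<in> G)" for v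
  have g: "g v = a" if "(v, a) \<in> G" for v a
    unfolding g_def by (rule the_equality, rule that, rule sv[OF G _ that], assumption)
  have extg: "ext h G \<longleftrightarrow> (\<forall>v\<in>Domain G. h v = g v)" for h
    unfolding ext_def using g by (metis Domain.simps)
  note GV = \<G>D(2)[OF G] and Gfin = \<G>h[OF G]
  have "Domain G = V"
  proof (rule ccontr)
    assume "Domain G \<noteq> V"
    then obtain v where v: "v \<in> V" "v \<notin> Domain G" using GV by blast
    let ?D = "Domain G"
    define fq where "fq = {q. q \<subseteq> \<Sigma> \<and> finite q}"
    have "\<exists>F. finite F \<and> F \<inter> insert v ?D = {} \<and> definable M (F \<union> insert v ?D) (\<lambda>h. \<forall>P\<in>q. P h)"
      if "q \<in> fq" for q
    proof -
      have q: "finite q" "q \<subseteq> \<Sigma>" using that by (auto simp: fq_def)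
      obtain F where F: "finite F" "F \<subseteq> V" "definable M F (\<lambda>h. \<forall>P\<in>q. P h)"
        by (rule definable_finite_support[OF dfnq[OF q]])
      have "definable M ((F - insert v ?D) \<union> insert v ?D) (\<lambda>h. \<forall>P\<in>q. P h)"
        by (rule definable_mono[OF F(3)]) auto
      then show ?thesis using F(1) by (intro exI[of _ "F - insert v ?D"]) auto
    qed
    then have "\<forall>q. \<exists>F. q \<in> fq \<longrightarrow>
        finite F \<and> F \<inter> insert v ?D = {} \<and> definable M (F \<union> insert v ?D) (\<lambda>h. \<forall>P\<in>q. P h)" by auto
    from choice[OF this] obtain F where F: "\<And>q. q \<in> fq \<Longrightarrow> finite (F q)"
      "\<And>q. q \<in> fq \<Longrightarrow> F q \<inter> insert v ?D = {}"
      "\<And>q. q \<in> fq \<Longrightarrow> definable M (F q \<union> insert v ?D) (\<lambda>h. \<forall>P\<in>q. P h)" by auto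
    \<comment> \<open>The unassigned variables of \<open>q\<close> other than \<open>v\<close> are
      quantified away; what remains is a condition on \<open>v\<close> with parameters from the
      domain of \<open>G\<close>.\<close>
    define Q where "Q q h \<longleftrightarrow> (\<exists>g. \<forall>P\<in>q. P (\<lambda>w. if w \<in> F q then g w else h w))" for q h
    have "definable M (insert v ?D) (Q q)" if "q \<in> fq" for q
      using definable_finite_ex[OF F(1)[OF that] F(3)[OF that]] unfolding Q_def .
    then have "\<forall>q\<in>fq. \<exists>\<phi> ws. set ws \<subseteq> ?D \<and> fmla M (Suc (length ws)) \<phi> \<and>
        (\<forall>h. Q q h \<longleftrightarrow> holds M \<phi> (h v # map h ws))"
      using definable_insert_list by metis
    then obtain \<phi> ws where
      \<phi>: "\<And>q. q \<in> fq \<Longrightarrow> set (ws q) \<subseteq> ?D" "\<And>q. q \<in> fq \<Longrightarrow> fmla M (Suc (length (ws q))) (\<phi> q)"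
        "\<And>q h. q \<in> fq \<Longrightarrow> Q q h \<longleftrightarrow> holds M (\<phi> q) (h v # map h (ws q))"
      by metis
    define p where "p = (\<lambda>q. (\<phi> q, map g (ws q))) ` fq"
    have "small \<kappa> (g ` ?D)" using small_image small_subset[OF V GV] by blast
    moreover have "p \<subseteq> {(\<phi>, c). set c \<subseteq> g ` ?D \<and> fmla M (Suc (length c)) \<phi>}"
    proof
      fix x assume "x \<in> p"
      then obtain q where "q \<in> fq" "x = (\<phi> q, map g (ws q))" unfolding p_def by blast
      then show "x \<in> {(\<phi>, c). set c \<subseteq> g ` ?D \<and> fmla M (Suc (length c)) \<phi>}"
        using \<phi>(1,2)[of q] by (simp add: image_mono)
    qed
    moreover have "\<exists>a. \<forall>(\<phi>, c)\<in>p'. holds M \<phi> (a # c)" if p': "p' \<subseteq> p" "finite p'" for p'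
    proof -
      obtain qs where qs: "qs \<subseteq> fq" "finite qs" "p' = (\<lambda>q. (\<phi> q, map g (ws q))) ` qs"
        using finite_subset_image[OF p'(2) p'(1)[unfolded p_def]] by blast
      \<comment> \<open>Finitely many of these conditions stem from finitely many finite parts of
        \<open>\<Sigma>\<close>, and one realisation of their union satisfies them all.\<close>
      have "\<Union>qs \<subseteq> \<Sigma>" "finite (\<Union>qs)" using qs unfolding fq_def by auto
      then obtain h where h: "ext h G" "\<forall>P\<in>\<Union>qs. P h" using Gfin[of "\<Union>qs"] by auto
      have "holds M (\<phi> q) (h v # map g (ws q))" if q: "q \<in> qs" for q
      proof -
        have "Q q h" unfolding Q_def using h(2) q by (intro exI[of _ h]) auto
        moreover have "map h (ws q) = map g (ws q)" using h(1) extg \<phi>(1) q qs(1) by fastforce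
        moreover have "q \<in> fq" using q qs(1) by blast
        ultimately show ?thesis using \<phi>(3)[of q h] by (simp del: map_eq_conv)
      qed
      then show ?thesis unfolding qs(3) by auto
    qed
    ultimately have "\<exists>a. \<forall>(\<phi>, c)\<in>p. holds M \<phi> (a # c)"
      by (intro saturated[unfolded saturated_def, rule_format, of "g ` ?D" p]) auto
    then obtain a where a: "\<And>\<phi> c. (\<phi>, c) \<in> p \<Longrightarrow> holds M \<phi> (a # c)" by blast
    have "insert (v, a) G \<in> \<G>"
    proof -
      have *: "\<exists>h. ext h (insert (v, a) G) \<and> (\<forall>P\<in>q. P h)" if q: "q \<subseteq> \<Sigma>" "finite q" for q
      proof -
        have qf: "q \<in> fq" using q by (simp add: fq_def)
        have "holds M (\<phi> q) (a # map g (ws q))" using a[of "\<phi> q"] qf unfolding p_def by blast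
        moreover have "map (g(v := a)) (ws q) = map g (ws q)" using \<phi>(1)[OF qf] v(2) by auto
        ultimately have "Q q (g(v := a))" using \<phi>(3)[OF qf, of "g(v := a)"] by (simp del: map_eq_conv)
        then obtain g' where g': "\<forall>P\<in>q. P (\<lambda>w. if w \<in> F q then g' w else (g(v := a)) w)"
          unfolding Q_def by blast
        have "ext (\<lambda>w. if w \<in> F q then g' w else (g(v := a)) w) (insert (v, a) G)"
          using F(2)[OF qf] v(2) g unfolding ext_def by auto
        then show ?thesis using g' by blast
      qed
      show ?thesis using \<G>D[OF G] v(1) by (intro \<G>I *) auto
    qed
    then show False using max v(2) by blast
  qed
  show thesis
  proof
    show "g v = h0 v" if "v \<in> B" for v
      using that \<G>D(1)[OF G] by (intro g) auto
    show "P g" if P: "P \<in> \<Sigma>" for P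
    proof -
      obtain h where "ext h G" "P h" using Gfin[of "{P}"] P by auto
      then show ?thesis using definable_cong[OF \<Sigma>[OF P], of h g] extg \<open>Domain G = V\<close> by blast
    qed
  qed
qed

end

section \<open>Homogeneity and small elementary submodels\<close>

lemma set_subset_image_list: "set xs \<subseteq> f ` V \<Longrightarrow> \<exists>vs. set vs \<subseteq> V \<and> xs = map f vs"
proof (induction xs)
  case (Cons x xs)
  then obtain vs v where "set vs \<subseteq> V" "xs = map f vs" "v \<in> V" "x = f v" by auto
  then show ?case by (intro exI[of _ "v # vs"]) auto
qed auto

text \<open>All \<open>n\<close> tuple variables come first, whether or not they occur. Distinct
  parameters can later be turned back into variables with arbitrary values, which
  \<open>dividing_row\<close> needs.\<close>

lemma definable_tuple:
  assumes "definable M (Inl ` {..<n} \<union> Inr ` C) P"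
  obtains \<phi> c where "set c \<subseteq> C" "distinct c" "fmla M (n + length c) \<phi>"
    "\<And>h. P h \<longleftrightarrow> holds M \<phi> (map (\<lambda>i. h (Inl i)) [0..<n] @ map (\<lambda>v. h (Inr v)) c)"
proof -
  obtain F where F: "finite F" "F \<subseteq> Inl ` {..<n} \<union> Inr ` C" "definable M F P"
    by (rule definable_finite_support[OF assms])
  have "finite (Inr -` F)" using F(1) by (intro finite_vimageI) auto
  then obtain c where c: "set c = Inr -` F" "distinct c" using finite_distinct_list[of "Inr -` F"] by auto
  have "F \<subseteq> set (map Inl [0..<n] @ map Inr c)" using F(2) c by auto
  from definable_mono[OF F(3) this] obtain \<phi> where
    "fmla M (length (map Inl [0..<n] @ map Inr c)) \<phi>"
    "\<And>h. P h \<longleftrightarrow> holds M \<phi> (map h (map Inl [0..<n] @ map Inr c))"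
    by (rule definable_list) (rule that)
  moreover have "set c \<subseteq> C" using c F(2) by auto
  ultimately show thesis using that[of c \<phi>] c(2) by (simp add: o_def)
qed

context monster
begin

definition Fix :: "'m set \<Rightarrow> ('m \<Rightarrow> 'm) set" where
  "Fix C = {\<sigma> \<in> Aut M. \<forall>c\<in>C. \<sigma> c = c}"

lemma FixD: "\<sigma> \<in> Fix C \<Longrightarrow> \<sigma> \<in> Aut M" "\<sigma> \<in> Fix C \<Longrightarrow> c \<in> C \<Longrightarrow> \<sigma> c = c"
  by (auto simp: Fix_def)

lemma Fix_mono: "\<sigma> \<in> Fix D \<Longrightarrow> C \<subseteq> D \<Longrightarrow> \<sigma> \<in> Fix C"
  by (auto simp: Fix_def)

lemma Fix_id: "id \<in> Fix C"
  by (simp add: Fix_def Aut_id)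

lemma Fix_comp: "\<sigma> \<in> Fix C \<Longrightarrow> \<tau> \<in> Fix C \<Longrightarrow> \<sigma> \<circ> \<tau> \<in> Fix C"
  by (simp add: Fix_def Aut_comp)

lemma Aut_inv_left: "\<sigma> \<in> Aut M \<Longrightarrow> inv_into UNIV \<sigma> (\<sigma> x) = x"
  using Aut_bij by (metis bij_inv_eq_iff)

lemma Aut_inv_right: "\<sigma> \<in> Aut M \<Longrightarrow> \<sigma> (inv_into UNIV \<sigma> x) = x"
  using Aut_bij by (metis bij_inv_eq_iff)

lemma Fix_inv: "\<sigma> \<in> Fix C \<Longrightarrow> inv_into UNIV \<sigma> \<in> Fix C"
proof -
  assume s: "\<sigma> \<in> Fix C"
  have "inv_into UNIV \<sigma> c = c" if "c \<in> C" for c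
    using Aut_inv_left[OF FixD(1)[OF s], of c] FixD(2)[OF s that] by simp
  then show ?thesis using Aut_inv[OF FixD(1)[OF s]] by (simp add: Fix_def)
qed

lemma Fix_map: "\<sigma> \<in> Fix C \<Longrightarrow> set xs \<subseteq> C \<Longrightarrow> map \<sigma> xs = xs"
  by (auto simp: Fix_def intro!: map_idI)

lemma Fix_image: "\<sigma> \<in> Fix C \<Longrightarrow> X \<subseteq> C \<Longrightarrow> \<sigma> ` X = X"
  by (force simp: Fix_def)

text \<open>One implication is enough, since it can be applied to negations.\<close>

lemma aut_of_definable:
  fixes h h' :: "'v \<Rightarrow> 'm"
  assumes V: "small \<kappa> V" and P: "\<And>P. definable M V P \<Longrightarrow> P h \<Longrightarrow> P h'"
  obtains \<sigma> where "\<sigma> \<in> Aut M" "\<And>v. v \<in> V \<Longrightarrow> h' v = \<sigma> (h v)"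
proof -
  \<comment> \<open>Equality of two variables is definable, so \<open>h v = h w\<close> forces
    \<open>h' v = h' w\<close>, and the choice of \<open>v\<close> does not matter.\<close>
  define f where "f a = h' (SOME v. v \<in> V \<and> h v = a)" for a
  have f: "f (h v) = h' v" if "v \<in> V" for v
  proof -
    let ?w = "SOME w. w \<in> V \<and> h w = h v"
    have w: "?w \<in> V \<and> h ?w = h v" by (rule someI[of _ v]) (use that in simp)
    then have "h' ?w = h' v" using P[OF definable_eq[of ?w V v]] that by simp
    then show ?thesis unfolding f_def .
  qed
  have P': "P h \<longleftrightarrow> P h'" if "definable M V P" for P
    using P[OF that] P[OF definable_neg[OF that]] by blast
  have "elem_map M (h ` V) f"
    unfolding elem_map_def
  proof clarify
    fix \<phi> xs assume \<phi>: "fmla M (length xs) \<phi>" and "set xs \<subseteq> h ` V"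
    then obtain vs where vs: "set vs \<subseteq> V" "xs = map h vs" using set_subset_image_list[of xs h V] by blast
    have "map f xs = map h' vs" using vs f by auto
    then show "holds M \<phi> (map f xs) \<longleftrightarrow> holds M \<phi> xs"
      using P'[OF dfnI[of M vs \<phi> V]] \<phi> vs by (simp del: map_eq_conv map_map)
  qed
  then obtain \<sigma> where "\<sigma> \<in> Aut M" "\<forall>b\<in>h ` V. \<sigma> b = f b"
    using homogeneous small_image[OF V] unfolding strongly_homogeneous_def by blast
  then show thesis using that[of \<sigma>] f by auto
qed

lemma small_Plus:
  assumes "small \<kappa> V" "small \<kappa> C"
  shows "small \<kappa> (Inl ` V \<union> Inr ` C)"
  by (intro small_Un small_image assms)

text \<open>The elements of \<open>C\<close> enter as variables that denote themselves under both
  assignments, which makes the automorphism fix \<open>C\<close>.\<close>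

lemma aut_over_of_definable:
  fixes h h' :: "'v \<Rightarrow> 'm"
  assumes V: "small \<kappa> V" and C: "small \<kappa> C"
    and P: "\<And>P. definable M (Inl ` V \<union> Inr ` C) P \<Longrightarrow> P (case_sum h id) \<Longrightarrow> P (case_sum h' id)"
  obtains \<sigma> where "\<sigma> \<in> Fix C" "\<And>v. v \<in> V \<Longrightarrow> h' v = \<sigma> (h v)"
proof -
  obtain \<sigma> where s: "\<sigma> \<in> Aut M"
      "\<And>v. v \<in> Inl ` V \<union> Inr ` C \<Longrightarrow> case_sum h' id v = \<sigma> (case_sum h id v)"
    by (rule aut_of_definable[OF small_Plus[OF V C] P]) auto
  have "\<sigma> c = c" if "c \<in> C" for c using s(2)[of "Inr c"] that by simp
  moreover have "h' v = \<sigma> (h v)" if "v \<in> V" for v using s(2)[of "Inl v"] that by simp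
  ultimately show thesis using that[of \<sigma>] s(1) unfolding Fix_def by blast
qed

text \<open>Strong homogeneity replaces equality of types by conjugacy, the form in which types are
  handled from here on.\<close>

lemma same_tp_iff:
  assumes C: "small \<kappa> C"
  shows "same_tp M C b b' \<longleftrightarrow> (\<exists>\<sigma>\<in>Fix C. b' = map \<sigma> b)"
proof
  assume tp: "same_tp M C b b'"
  obtain \<sigma> where s: "\<sigma> \<in> Fix C" "\<And>i. i \<in> {..<length b} \<Longrightarrow> b' ! i = \<sigma> (b ! i)"
  proof (rule aut_over_of_definable[OF small_nat C, of "{..<length b}" "(!) b" "(!) b'"])
    fix P assume P: "definable M (Inl ` {..<length b} \<union> Inr ` C) P" "P (case_sum ((!) b) id)"
    obtain \<phi> c where c: "set c \<subseteq> C" "distinct c" "fmla M (length b + length c) \<phi>"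
      "\<And>h. P h \<longleftrightarrow> holds M \<phi> (map (\<lambda>i. h (Inl i)) [0..<length b] @ map (\<lambda>v. h (Inr v)) c)"
      by (rule definable_tuple[OF P(1)]) (rule that)
    have "holds M \<phi> (b @ c)" using P(2) by (simp add: c(4) map_nth)
    then have "holds M \<phi> (b' @ c)" using tp c unfolding same_tp_def by blast
    moreover have "map ((!) b') [0..<length b] = b'"
      using tp unfolding same_tp_def by (metis map_nth)
    ultimately show "P (case_sum ((!) b') id)" by (simp add: c(4))
  qed auto
  then have "b' = map \<sigma> b" using tp by (auto simp: same_tp_def intro!: nth_equalityI)
  then show "\<exists>\<sigma>\<in>Fix C. b' = map \<sigma> b" using s by blast
next
  assume "\<exists>\<sigma>\<in>Fix C. b' = map \<sigma> b"
  then obtain \<sigma> where s: "\<sigma> \<in> Fix C" "b' = map \<sigma> b" by blast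
  show "same_tp M C b b'"
    unfolding same_tp_def
  proof (intro conjI allI impI)
    fix \<phi> c assume c: "set c \<subseteq> C \<and> fmla M (length b + length c) \<phi>"
    have "b' @ c = map \<sigma> (b @ c)" using s c Fix_map[of \<sigma> C c] by simp
    then show "holds M \<phi> (b @ c) \<longleftrightarrow> holds M \<phi> (b' @ c)"
      using Aut_holds[OF FixD(1)[OF s(1)], of "b @ c" \<phi>] c by simp
  qed (simp add: s)
qed

end

section \<open>Counting terms and formulas; small elementary submodels\<close>

lemma card_of_lists_length:
  assumes "infinite W" "|X| \<le>o |W|"
  shows "|{xs \<in> lists X. length xs = n}| \<le>o |W|"
proof (induction n)
  case 0
  have "{xs \<in> lists X. length xs = 0} = {[]}" by auto
  then show ?case using assms(1) by (metis card_of_singl_ordLeq infinite_imp_nonempty)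
next
  case (Suc n)
  have "{xs \<in> lists X. length xs = Suc n} \<subseteq> (\<lambda>(x, xs). x # xs) ` (X \<times> {xs \<in> lists X. length xs = n})"
  proof
    fix xs assume "xs \<in> {xs \<in> lists X. length xs = Suc n}"
    then show "xs \<in> (\<lambda>(x, xs). x # xs) ` (X \<times> {xs \<in> lists X. length xs = n})"
      by (cases xs) auto
  qed
  then have "|{xs \<in> lists X. length xs = Suc n}| \<le>o |X \<times> {xs \<in> lists X. length xs = n}|"
    by (meson card_of_image card_of_mono1 ordLeq_transitive)
  also have "|X \<times> {xs \<in> lists X. length xs = n}| \<le>o |W|"
    using assms Suc by (intro card_of_Times_ordLeq_infinite_Field) (auto simp: Field_card_of card_of_card_order_on)
  finally show ?case .
qed

lemma card_of_lists_ordLeq: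
  assumes "infinite W" "|X| \<le>o |W|"
  shows "|lists X| \<le>o |W|"
proof -
  have "lists X = (\<Union>n. {xs \<in> lists X. length xs = n})" by auto
  moreover have "|\<Union>n :: nat. {xs \<in> lists X. length xs = n}| \<le>o |W|"
    using assms card_of_lists_length[OF assms] infinite_iff_card_of_nat
    by (intro card_of_UNION_ordLeq_infinite) auto
  ultimately show ?thesis by simp
qed

lemma card_of_Un_ordLeq_infinite:
  assumes "infinite W" "|X| \<le>o |W|" "|Y| \<le>o |W|"
  shows "|X \<union> Y| \<le>o |W|"
  using assms by (intro card_of_Un_ordLeq_infinite_Field) (auto simp: Field_card_of card_of_card_order_on)

lemma card_of_image_ordLeq: "|X| \<le>o r \<Longrightarrow> |f ` X| \<le>o r"
  using card_of_image ordLeq_transitive by blast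

lemma card_of_Times_ordLeq:
  assumes "infinite W" "|X| \<le>o |W|" "|Y| \<le>o |W|"
  shows "|X \<times> Y| \<le>o |W|"
  using assms by (intro card_of_Times_ordLeq_infinite_Field) (auto simp: Field_card_of card_of_card_order_on)

lemma card_of_UN_nat_ordLeq:
  assumes "infinite W" "\<And>n :: nat. |X n| \<le>o |W|"
  shows "|\<Union>n. X n| \<le>o |W|"
  using assms infinite_iff_card_of_nat by (intro card_of_UNION_ordLeq_infinite) auto

text \<open>Only terms in the language of \<open>M\<close> are counted, because the type of symbols
  may be much larger. They arise in countably many stages, each adding applications of function
  symbols to lists of earlier terms.\<close>

lemma card_of_terms:
  assumes W: "infinite W" and F: "|Funs M| \<le>o |W|"
  shows "|{t. \<exists>n. trm M n t}| \<le>o |W|"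
proof -
  define T where "T = rec_nat (range Var)
    (\<lambda>_ X. X \<union> (\<lambda>(g, ts). App (fst g) ts) ` (Funs M \<times> lists X))"
  have T0: "T 0 = range Var" and TS: "T (Suc k) = T k \<union> (\<lambda>(g, ts). App (fst g) ts) ` (Funs M \<times> lists (T k))" for k
    by (simp_all add: T_def)
  have mono: "T k \<subseteq> T l" if "k \<le> l" for k l
    using that by (induction rule: dec_induct) (auto simp: TS)
  have card: "|T k| \<le>o |W|" for k
  proof (induction k)
    case 0
    have "|UNIV :: nat set| \<le>o |W|" using W infinite_iff_card_of_nat by blast
    then show ?case unfolding T0 by (rule card_of_image_ordLeq)
  next
    case (Suc k)
    then show ?case unfolding TS
      using W F by (intro card_of_Un_ordLeq_infinite card_of_image_ordLeq card_of_Times_ordLeq card_of_lists_ordLeq)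
  qed
  have "\<exists>k. t \<in> T k" if "trm M n t" for n t
    using that
  proof (induction t)
    case (Var x)
    then show ?case using T0 by blast
  next
    case (App f ts)
    then have "\<forall>t\<in>set ts. \<exists>k. t \<in> T k" by auto
    then obtain k where k: "\<And>t. t \<in> set ts \<Longrightarrow> t \<in> T (k t)" by metis
    have "ts \<in> lists (T (Max (k ` set ts)))"
      unfolding in_lists_conv_set
    proof
      fix t assume t: "t \<in> set ts"
      then have "k t \<le> Max (k ` set ts)" by simp
      then show "t \<in> T (Max (k ` set ts))" using k[OF t] mono by blast
    qed
    then have "App f ts \<in> T (Suc (Max (k ` set ts)))"
    proof -
      assume "ts \<in> lists (T (Max (k ` set ts)))"
      then have "((f, length ts), ts) \<in> Funs M \<times> lists (T (Max (k ` set ts)))" using App.prems by simp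
      then have "(\<lambda>(g, ts). App (fst g) ts) ((f, length ts), ts) \<in> T (Suc (Max (k ` set ts)))"
        unfolding TS by (intro UnI2 imageI)
      then show ?thesis by simp
    qed
    then show ?case by blast
  qed
  then have "{t. \<exists>n. trm M n t} \<subseteq> (\<Union>k. T k)" by blast
  from ordLeq_transitive[OF card_of_mono1[OF this] card_of_UN_nat_ordLeq[OF W card]] show ?thesis .
qed

lemma card_of_formulas:
  assumes W: "infinite W" and F: "|Funs M| \<le>o |W|" and R: "|Rels M| \<le>o |W|"
  shows "|{\<phi>. \<exists>n. fmla M n \<phi>}| \<le>o |W|"
proof -
  let ?T = "{t. \<exists>n. trm M n t}"
  note T = card_of_terms[OF W F]
  define G where "G = rec_nat ((\<lambda>(s, t). Eq s t) ` (?T \<times> ?T) \<union> (\<lambda>(g, ts). Rel (fst g) ts) ` (Rels M \<times> lists ?T))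
    (\<lambda>_ X. X \<union> Neg ` X \<union> (\<lambda>(\<phi>, \<psi>). Conj \<phi> \<psi>) ` (X \<times> X) \<union> Ex ` X)"
  have G0: "G 0 = (\<lambda>(s, t). Eq s t) ` (?T \<times> ?T) \<union> (\<lambda>(g, ts). Rel (fst g) ts) ` (Rels M \<times> lists ?T)"
    and GS: "G (Suc k) = G k \<union> Neg ` G k \<union> (\<lambda>(\<phi>, \<psi>). Conj \<phi> \<psi>) ` (G k \<times> G k) \<union> Ex ` G k" for k
    by (simp_all add: G_def)
  have mono: "G k \<subseteq> G l" if "k \<le> l" for k l
    using that by (induction rule: dec_induct) (auto simp: GS)
  have card: "|G k| \<le>o |W|" for k
  proof (induction k)
    case 0
    show ?case unfolding G0 using W T R
      by (intro card_of_Un_ordLeq_infinite card_of_image_ordLeq card_of_Times_ordLeq card_of_lists_ordLeq)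
  next
    case (Suc k)
    then show ?case unfolding GS
      using W by (intro card_of_Un_ordLeq_infinite card_of_image_ordLeq card_of_Times_ordLeq)
  qed
  have "\<exists>k. \<phi> \<in> G k" if "fmla M n \<phi>" for n \<phi>
    using that
  proof (induction \<phi> arbitrary: n)
    case (Eq s t)
    then have "(s, t) \<in> ?T \<times> ?T" by auto
    then have "(\<lambda>(s, t). Eq s t) (s, t) \<in> G 0" unfolding G0 by (intro UnI1 imageI)
    then have "Eq s t \<in> G 0" by simp
    then show ?case by blast
  next
    case (Rel p ts)
    then have "((p, length ts), ts) \<in> Rels M \<times> lists ?T" by auto
    then have "(\<lambda>(g, ts). Rel (fst g) ts) ((p, length ts), ts) \<in> G 0" unfolding G0
      by (intro UnI2 imageI)
    then have "Rel p ts \<in> G 0" by simp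
    then show ?case by blast
  next
    case (Neg \<phi>)
    then obtain k where "\<phi> \<in> G k" by auto
    then have "Neg \<phi> \<in> G (Suc k)" unfolding GS by blast
    then show ?case by blast
  next
    case (Conj \<phi> \<psi>)
    then have "\<exists>k. \<phi> \<in> G k" "\<exists>k. \<psi> \<in> G k" by auto
    then obtain k l where "\<phi> \<in> G k" "\<psi> \<in> G l" by blast
    then have "\<phi> \<in> G (max k l)" "\<psi> \<in> G (max k l)" using mono[of k "max k l"] mono[of l "max k l"] by auto
    then have "(\<phi>, \<psi>) \<in> G (max k l) \<times> G (max k l)" by simp
    then have "(\<lambda>(\<phi>, \<psi>). Conj \<phi> \<psi>) (\<phi>, \<psi>) \<in> G (Suc (max k l))" unfolding GS
      by (intro UnI1 UnI2 imageI)
    then have "Conj \<phi> \<psi> \<in> G (Suc (max k l))" by simp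
    then show ?case by blast
  next
    case (Ex \<phi>)
    then have "\<exists>k. \<phi> \<in> G k" by (metis fmla.simps(5))
    then obtain k where "\<phi> \<in> G k" by blast
    then have "Ex \<phi> \<in> G (Suc k)" unfolding GS by blast
    then show ?case by blast
  qed
  then have "{\<phi>. \<exists>n. fmla M n \<phi>} \<subseteq> (\<Union>k. G k)" by blast
  from ordLeq_transitive[OF card_of_mono1[OF this] card_of_UN_nat_ordLeq[OF W card]] show ?thesis .
qed

lemma tarski_vaught:
  assumes ne: "N \<noteq> {}"
    and wit: "\<And>\<phi> xs. fmla M (Suc (length xs)) \<phi> \<Longrightarrow> set xs \<subseteq> N \<Longrightarrow> \<exists>d. holds M \<phi> (d # xs) \<Longrightarrow>
      \<exists>d\<in>N. holds M \<phi> (d # xs)"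
  shows "elem_submodel M N"
  unfolding elem_submodel_def
proof (intro conjI allI impI)
  fix f xs assume f: "(f, length xs) \<in> Funs M \<and> set xs \<subseteq> N"
  \<comment> \<open>The value of \<open>f\<close> is the only witness of this formula, so the
    criterion itself closes \<open>N\<close> under \<open>f\<close>. The arguments start at index 1
    because index 0 is the witness.\<close>
  let ?\<phi> = "Eq (Var 0) (App f (map Var [1..<Suc (length xs)]))"
  have "map (val M (d # xs) \<circ> Var) [1..<Suc (length xs)] = xs" for d
    by (intro nth_equalityI) (auto simp del: upt_Suc)
  then have h: "holds M ?\<phi> (d # xs) \<longleftrightarrow> d = FunI M f xs" for d by simp
  have "fmla M (Suc (length xs)) ?\<phi>" using f by (auto simp del: upt_Suc)
  moreover have "\<exists>d. holds M ?\<phi> (d # xs)" unfolding h by blast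
  ultimately have "\<exists>d\<in>N. holds M ?\<phi> (d # xs)" using wit f by blast
  then show "FunI M f xs \<in> N" unfolding h by blast
next
  fix \<phi> xs assume "fmla M (length xs) \<phi> \<and> set xs \<subseteq> N"
  then show "sat M N xs \<phi> \<longleftrightarrow> holds M \<phi> xs"
  proof (induction \<phi> arbitrary: xs)
    case (Ex \<phi>)
    have "sat M N (d # xs) \<phi> \<longleftrightarrow> holds M \<phi> (d # xs)" if "d \<in> N" for d
      using Ex.IH[of "d # xs"] Ex.prems that by simp
    then show ?case using wit[of xs \<phi>] Ex.prems by auto
  qed auto
qed (rule ne)

context monster
begin

text \<open>A Skolem hull: chosen witnesses for all formulas over the current set are added
  countably often. \<open>W\<close> gathers the natural numbers, the language and \<open>A\<close>;
  it bounds every stage and is still smaller than \<open>\<kappa>\<close>.\<close>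

theorem small_elem_submodel:
  assumes A: "small \<kappa> A"
  obtains N where "small \<kappa> N" "elem_submodel M N" "A \<subseteq> N"
proof -
  define W where "W = (UNIV :: nat set) <+> ((Funs M <+> Rels M) <+> A)"
  have infW: "infinite W" by (auto simp: W_def dest: finite_PlusD)
  have smallW: "|W| <o \<kappa>"
    unfolding W_def using language_kappa A small_nat[of UNIV] unfolding small_def
    by (simp add: card_of_Plus_ordLess_infinite_Field[OF infinite_Field_kappa Card_order_kappa])
  have "|Funs M| \<le>o |W|" "|Rels M| \<le>o |W|" and AW: "|A| \<le>o |W|"
    unfolding W_def by (rule ordLeq_transitive[OF card_of_Plus1 ordLeq_transitive[OF card_of_Plus1 card_of_Plus2]],
      rule ordLeq_transitive[OF card_of_Plus2 ordLeq_transitive[OF card_of_Plus1 card_of_Plus2]],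
      rule ordLeq_transitive[OF card_of_Plus2 card_of_Plus2])
  then have FM: "|{\<phi>. \<exists>n. fmla M n \<phi>}| \<le>o |W|" (is "|?FM| \<le>o _") using card_of_formulas[OF infW] by blast
  define w where "w = (\<lambda>(\<phi>, xs). SOME d. holds M \<phi> (d # xs))"
  define H where "H = rec_nat A (\<lambda>_ X. X \<union> w ` (?FM \<times> lists X))"
  have H0: "H 0 = A" and HS: "H (Suc k) = H k \<union> w ` (?FM \<times> lists (H k))" for k by (simp_all add: H_def)
  have mono: "H k \<subseteq> H l" if "k \<le> l" for k l
    using that by (induction rule: dec_induct) (auto simp: HS)
  have card: "|H k| \<le>o |W|" for k
  proof (induction k)
    case (Suc k)
    then show ?case unfolding HS
      using infW FM by (intro card_of_Un_ordLeq_infinite card_of_image_ordLeq card_of_Times_ordLeq card_of_lists_ordLeq)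
  qed (simp add: H0 AW)
  define N where "N = (\<Union>k. H k)"
  \<comment> \<open>A formula without parameters contributes an element even when \<open>A\<close>
    is empty, so the hull is nonempty.\<close>
  have "(Ex (Eq (Var 0) (Var 0)), []) \<in> ?FM \<times> lists (H 0)" by simp
  then have "w (Ex (Eq (Var 0) (Var 0)), []) \<in> H (Suc 0)" unfolding HS by blast
  then have ne: "N \<noteq> {}" unfolding N_def by blast
  have "elem_submodel M N"
  proof (rule tarski_vaught[OF ne])
    fix \<phi> xs assume \<phi>: "fmla M (Suc (length xs)) \<phi>" and xs: "set xs \<subseteq> N" and ex: "\<exists>d. holds M \<phi> (d # xs)"
    have "\<forall>x\<in>set xs. \<exists>k. x \<in> H k" using xs unfolding N_def by blast
    then obtain k where k: "\<And>x. x \<in> set xs \<Longrightarrow> x \<in> H (k x)" by metis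
    have "xs \<in> lists (H (Max (k ` set xs)))"
      unfolding in_lists_conv_set
    proof
      fix x assume x: "x \<in> set xs"
      then have "k x \<le> Max (k ` set xs)" by simp
      then show "x \<in> H (Max (k ` set xs))" using k[OF x] mono by blast
    qed
    then have "w (\<phi>, xs) \<in> H (Suc (Max (k ` set xs)))" unfolding HS using \<phi> by blast
    then have "w (\<phi>, xs) \<in> N" unfolding N_def by blast
    moreover have "holds M \<phi> (w (\<phi>, xs) # xs)" unfolding w_def using someI_ex[OF ex] by simp
    ultimately show "\<exists>d\<in>N. holds M \<phi> (d # xs)" by blast
  qed
  moreover have "small \<kappa> N" unfolding small_def N_def
    by (rule ordLeq_ordLess_trans[OF card_of_UN_nat_ordLeq[OF infW card] smallW])
  moreover have "A \<subseteq> N" unfolding N_def using H0 by blast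
  ultimately show thesis using that by blast
qed

lemma elem_submodel_image:
  assumes "elem_submodel M N" and s: "\<sigma> \<in> Aut M"
  shows "elem_submodel M (\<sigma> ` N)"
  unfolding elem_submodel_def
proof (intro conjI allI impI)
  show "\<sigma> ` N \<noteq> {}" using assms(1) by (simp add: elem_submodel_def)
next
  fix f xs assume f: "(f, length xs) \<in> Funs M \<and> set xs \<subseteq> \<sigma> ` N"
  then obtain ys where ys: "set ys \<subseteq> N" "xs = map \<sigma> ys" using set_subset_image_list by metis
  then have "FunI M f ys \<in> N" using assms(1) f by (simp add: elem_submodel_def)
  moreover have "\<sigma> (FunI M f ys) = FunI M f xs" using s f ys by (simp add: Aut_def)
  ultimately show "FunI M f xs \<in> \<sigma> ` N" by (metis imageI)
next
  fix \<phi> xs assume f: "fmla M (length xs) \<phi> \<and> set xs \<subseteq> \<sigma> ` N"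
  then obtain ys where ys: "set ys \<subseteq> N" "xs = map \<sigma> ys" using set_subset_image_list by metis
  then show "sat M (\<sigma> ` N) xs \<phi> \<longleftrightarrow> holds M \<phi> xs"
    using assms(1) f Aut_sat[OF s, of ys \<phi>] Aut_holds[OF s, of ys \<phi>] by (simp add: elem_submodel_def)
qed

end

section \<open>Lascar equivalence\<close>

context monster
begin

text \<open>The generating set of \<open>AutfL\<close>.\<close>

definition strong :: "'m set \<Rightarrow> ('m \<Rightarrow> 'm) set" where
  "strong C = {\<sigma> \<in> Aut M. \<exists>N. small \<kappa> N \<and> elem_submodel M N \<and> C \<subseteq> N \<and> (\<forall>x\<in>N. \<sigma> x = x)}"

lemma AutfL_eq: "AutfL \<kappa> M C = generate (BijGroup UNIV) (strong C)"
  by (simp add: AutfL_def strong_def)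

lemma strongI: "small \<kappa> N \<Longrightarrow> elem_submodel M N \<Longrightarrow> C \<subseteq> N \<Longrightarrow> \<sigma> \<in> Fix N \<Longrightarrow> \<sigma> \<in> strong C"
  by (auto simp: strong_def Fix_def)

lemma strongE:
  assumes "\<sigma> \<in> strong C"
  obtains N where "small \<kappa> N" "elem_submodel M N" "C \<subseteq> N" "\<sigma> \<in> Fix N"
  using assms by (auto simp: strong_def Fix_def)

lemma strong_Aut: "\<sigma> \<in> strong C \<Longrightarrow> \<sigma> \<in> Aut M"
  by (simp add: strong_def)

lemma strong_inv: "\<sigma> \<in> strong C \<Longrightarrow> inv_into UNIV \<sigma> \<in> strong C"
  by (erule strongE) (blast intro: strongI Fix_inv)

lemma Aut_Bij: "\<sigma> \<in> Aut M \<Longrightarrow> \<sigma> \<in> Bij UNIV"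
  by (simp add: Bij_def Aut_def)

text \<open>On \<open>UNIV\<close> the restrictions built into \<open>BijGroup\<close> disappear, so
  its operations are plain composition and \<open>inv_into\<close>.\<close>

lemma mult_BijGroup:
  "\<sigma> \<in> Aut M \<Longrightarrow> \<tau> \<in> Aut M \<Longrightarrow> \<sigma> \<otimes>\<^bsub>BijGroup UNIV\<^esub> \<tau> = \<sigma> \<circ> \<tau>"
  by (simp add: BijGroup_def Aut_Bij compose_def restrict_def fun_eq_iff)

lemma inv_BijGroup_Aut: "\<sigma> \<in> Aut M \<Longrightarrow> inv\<^bsub>BijGroup UNIV\<^esub> \<sigma> = inv_into UNIV \<sigma>"
  by (subst inv_BijGroup) (simp_all add: Aut_Bij restrict_def)

lemma one_BijGroup: "\<one>\<^bsub>BijGroup (UNIV :: 'm set)\<^esub> = id"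
  by (simp add: BijGroup_def fun_eq_iff)

lemma AutfL_Aut: "\<sigma> \<in> AutfL \<kappa> M C \<Longrightarrow> \<sigma> \<in> Aut M"
  unfolding AutfL_eq
proof (induction rule: generate.induct)
  case one
  show ?case unfolding one_BijGroup by (rule Aut_id)
next
  case (eng h1 h2)
  then show ?case by (simp only: mult_BijGroup Aut_comp)
qed (simp_all add: strong_Aut inv_BijGroup_Aut Aut_inv)

lemma AutfL_id: "id \<in> AutfL \<kappa> M C"
  unfolding AutfL_eq using generate.one[of "BijGroup UNIV" "strong C"] by (simp add: one_BijGroup)

lemma AutfL_strong: "\<sigma> \<in> strong C \<Longrightarrow> \<sigma> \<in> AutfL \<kappa> M C"
  unfolding AutfL_eq by (rule generate.incl)

lemma AutfL_comp: "\<sigma> \<in> AutfL \<kappa> M C \<Longrightarrow> \<tau> \<in> AutfL \<kappa> M C \<Longrightarrow> \<sigma> \<circ> \<tau> \<in> AutfL \<kappa> M C"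
  using generate.eng[of \<sigma> "BijGroup UNIV" "strong C" \<tau>] mult_BijGroup[of \<sigma> \<tau>] AutfL_Aut
  by (metis AutfL_eq)

text \<open>The generators are closed under inverses, which removes the case of inverses from the
  induction.\<close>

lemma AutfL_induct [consumes 1, case_names id strong comp]:
  assumes "\<sigma> \<in> AutfL \<kappa> M C" "P id" "\<And>\<sigma>. \<sigma> \<in> strong C \<Longrightarrow> P \<sigma>"
    "\<And>\<sigma> \<tau>. \<sigma> \<in> AutfL \<kappa> M C \<Longrightarrow> \<tau> \<in> AutfL \<kappa> M C \<Longrightarrow> P \<sigma> \<Longrightarrow> P \<tau> \<Longrightarrow> P (\<sigma> \<circ> \<tau>)"
  shows "P \<sigma>"
  using assms(1) unfolding AutfL_eq
proof (induction rule: generate.induct)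
  case one
  show ?case unfolding one_BijGroup by (rule assms(2))
next
  case (incl h)
  then show ?case by (rule assms(3))
next
  case (inv h)
  then show ?case by (simp add: inv_BijGroup_Aut strong_Aut strong_inv assms(3))
next
  case (eng h1 h2)
  then show ?case using assms(4)[of h1 h2] mult_BijGroup[of h1 h2] AutfL_Aut
    by (metis AutfL_eq)
qed

lemma inv_comp: "\<sigma> \<in> Aut M \<Longrightarrow> \<tau> \<in> Aut M \<Longrightarrow>
    inv_into UNIV (\<sigma> \<circ> \<tau>) = inv_into UNIV \<tau> \<circ> inv_into UNIV \<sigma>"
  using Aut_bij o_inv_distrib by blast

lemma AutfL_inv: "\<sigma> \<in> AutfL \<kappa> M C \<Longrightarrow> inv_into UNIV \<sigma> \<in> AutfL \<kappa> M C"
proof (induction rule: AutfL_induct)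
  case (comp \<sigma> \<tau>)
  then show ?case by (simp only: inv_comp AutfL_Aut AutfL_comp)
next
  case id
  show ?case unfolding inv_id by (rule AutfL_id)
qed (rule AutfL_strong strong_inv | assumption)+

lemma AutfL_Fix: "\<sigma> \<in> AutfL \<kappa> M C \<Longrightarrow> \<sigma> \<in> Fix C"
proof (induction rule: AutfL_induct)
  case (strong \<sigma>)
  then obtain N where "C \<subseteq> N" "\<sigma> \<in> Fix N" by (rule strongE)
  then show ?case using Fix_mono by blast
qed (rule Fix_id Fix_comp | assumption)+

lemma AutfL_mono:
  assumes "\<sigma> \<in> AutfL \<kappa> M D" and CD: "C \<subseteq> D"
  shows "\<sigma> \<in> AutfL \<kappa> M C"
  using assms(1)
proof (induction rule: AutfL_induct)
  case (strong \<sigma>)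
  then obtain N where "small \<kappa> N" "elem_submodel M N" "D \<subseteq> N" "\<sigma> \<in> Fix N" by (rule strongE)
  then show ?case using strongI[of N C \<sigma>] AutfL_strong CD by blast
qed (rule AutfL_id AutfL_comp | assumption)+

lemma Fix_conj:
  assumes "\<sigma> \<in> Fix C" "\<tau> \<in> Aut M"
  shows "\<tau> \<circ> \<sigma> \<circ> inv_into UNIV \<tau> \<in> Fix (\<tau> ` C)"
  unfolding Fix_def
  using assms by (auto simp: Aut_comp Aut_inv FixD Aut_inv_left)

text \<open>If \<open>\<sigma>\<close> fixes a model, its conjugate by \<open>\<tau>\<close> fixes
  the image of that model, which is again a model.\<close>

lemma AutfL_conj:
  assumes "\<sigma> \<in> AutfL \<kappa> M C" and t: "\<tau> \<in> Aut M"
  shows "\<tau> \<circ> \<sigma> \<circ> inv_into UNIV \<tau> \<in> AutfL \<kappa> M (\<tau> ` C)"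
  using assms(1)
proof (induction rule: AutfL_induct)
  case id
  have "\<tau> \<circ> id \<circ> inv_into UNIV \<tau> = id" using Aut_inv_right[OF t] by (simp add: fun_eq_iff)
  from this show ?case by (simp only: AutfL_id)
next
  case (strong \<sigma>)
  then obtain N where "small \<kappa> N" "elem_submodel M N" "C \<subseteq> N" "\<sigma> \<in> Fix N" by (rule strongE)
  then show ?case
    by (intro AutfL_strong strongI[of "\<tau> ` N"] small_image elem_submodel_image[OF _ t] image_mono Fix_conj[OF _ t])
next
  case (comp \<sigma> \<rho>)
  have "\<tau> \<circ> (\<sigma> \<circ> \<rho>) \<circ> inv_into UNIV \<tau> = (\<tau> \<circ> \<sigma> \<circ> inv_into UNIV \<tau>) \<circ> (\<tau> \<circ> \<rho> \<circ> inv_into UNIV \<tau>)"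
    using Aut_inv_left[OF t] by (simp add: fun_eq_iff)
  then show ?case using comp AutfL_comp by metis
qed

text \<open>Equality of Lascar strong types over \<open>C\<close>.\<close>

definition Ls :: "'m set \<Rightarrow> 'm list \<Rightarrow> 'm list \<Rightarrow> bool" where
  "Ls C xs ys \<longleftrightarrow> (\<exists>\<sigma>\<in>AutfL \<kappa> M C. ys = map \<sigma> xs)"

lemma Ls_sym: "Ls C xs ys \<Longrightarrow> Ls C ys xs"
proof -
  assume "Ls C xs ys"
  then obtain \<sigma> where s: "\<sigma> \<in> AutfL \<kappa> M C" "ys = map \<sigma> xs" unfolding Ls_def by blast
  have "xs = map (inv_into UNIV \<sigma>) ys"
    using s Aut_inv_left[OF AutfL_Aut[OF s(1)]] by (simp add: map_idI)
  then show ?thesis unfolding Ls_def using AutfL_inv[OF s(1)] by blast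
qed

lemma Ls_trans: "Ls C xs ys \<Longrightarrow> Ls C ys zs \<Longrightarrow> Ls C xs zs"
  unfolding Ls_def using AutfL_comp by (metis map_map)

lemma Ls_strong: "small \<kappa> N \<Longrightarrow> elem_submodel M N \<Longrightarrow> C \<subseteq> N \<Longrightarrow> \<sigma> \<in> Fix N \<Longrightarrow> Ls C xs (map \<sigma> xs)"
  unfolding Ls_def using AutfL_strong strongI by blast

lemma Ls_Aut:
  assumes "Ls C xs ys" and t: "\<tau> \<in> Aut M"
  shows "Ls (\<tau> ` C) (map \<tau> xs) (map \<tau> ys)"
proof -
  obtain \<sigma> where s: "\<sigma> \<in> AutfL \<kappa> M C" "ys = map \<sigma> xs" using assms(1) unfolding Ls_def by blast
  have "map \<tau> ys = map (\<tau> \<circ> \<sigma> \<circ> inv_into UNIV \<tau>) (map \<tau> xs)"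
    using s Aut_inv_left[OF t] by simp
  then show ?thesis unfolding Ls_def using AutfL_conj[OF s(1) t] by blast
qed

lemma Ls_Fix: "Ls C xs ys \<Longrightarrow> \<tau> \<in> Fix C \<Longrightarrow> Ls C (map \<tau> xs) (map \<tau> ys)"
  using Ls_Aut[of C xs ys \<tau>] FixD(1) Fix_image[of \<tau> C C] by auto

lemma Ls_length: "Ls C xs ys \<Longrightarrow> length ys = length xs"
  unfolding Ls_def by auto

section \<open>Lascar equivalent witnesses of dividing\<close>

lemma satisfiable_Aut:
  assumes "\<tau> \<in> Aut M" "fmla M (n + m) \<phi>" "\<And>i. i \<in> S \<Longrightarrow> length (b i) = m"
  shows "satisfiable M n \<phi> (\<lambda>i. map \<tau> (b i)) S \<longleftrightarrow> satisfiable M n \<phi> b S"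
proof -
  have *: "satisfiable M n \<phi> (\<lambda>i. map \<tau> (b i)) S"
    if t: "\<tau> \<in> Aut M" and sat: "satisfiable M n \<phi> b S" and l: "\<And>i. i \<in> S \<Longrightarrow> length (b i) = m" for \<tau> b
  proof -
    obtain a where a: "length a = n" "\<And>i. i \<in> S \<Longrightarrow> holds M \<phi> (a @ b i)"
      using sat unfolding satisfiable_def by blast
    have "holds M \<phi> (map \<tau> a @ map \<tau> (b i))" if i: "i \<in> S" for i
      using Aut_holds[OF t, of "a @ b i" \<phi>] a i l[OF i] assms(2) by simp
    then show ?thesis using a(1) unfolding satisfiable_def by (intro exI[of _ "map \<tau> a"]) simp
  qed
  show ?thesis
  proof
    assume "satisfiable M n \<phi> (\<lambda>i. map \<tau> (b i)) S"
    from *[OF Aut_inv[OF assms(1)] this]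
    have "satisfiable M n \<phi> (\<lambda>i. map (inv_into UNIV \<tau>) (map \<tau> (b i))) S" using assms(3) by simp
    then show "satisfiable M n \<phi> b S" using Aut_inv_left[OF assms(1)] by (simp add: o_def)
  qed (use * assms in blast)
qed

lemma k_inconsistent_Aut:
  assumes "\<tau> \<in> Aut M" "fmla M (n + m) \<phi>" "\<And>i. length (b i) = m"
  shows "k_inconsistent M k n \<phi> (\<lambda>i. map \<tau> (b i)) \<longleftrightarrow> k_inconsistent M k n \<phi> b"
  unfolding k_inconsistent_def using satisfiable_Aut[OF assms(1,2)] assms(3) by metis

text \<open>
  Given a witness of dividing and a model \<open>N\<close>, infinitely many of its elements agree on any finite
  set of formulas over \<open>N\<close>; so by compactness they may be assumed to have the same type over \<open>N\<close>.
\<close>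

theorem divides_Lascar:
  assumes A: "small \<kappa> A" and \<phi>: "fmla M (n + length b) \<phi>" and dv: "divides M A n \<phi> b"
  obtains k b' where "k_inconsistent M k n \<phi> b'" "\<And>i. Ls A b (b' i)"
proof -
  define m where "m = length b"
  obtain k b0 where b0: "\<And>i. same_tp M A (b0 i) b" "k_inconsistent M k n \<phi> b0"
    using dv unfolding divides_def by blast
  have lb0: "length (b0 i) = m" for i using b0(1)[of i] by (simp add: same_tp_def m_def)
  obtain N where N: "small \<kappa> N" "elem_submodel M N" "A \<subseteq> N" by (rule small_elem_submodel[OF A])
  \<comment> \<open>\<open>pick i\<close> restricts an assignment of the whole array of variables to
    its \<open>i\<close>-th tuple and keeps the parameters.\<close>
  define pick :: "nat \<Rightarrow> (nat \<times> nat + 'm \<Rightarrow> 'm) \<Rightarrow> nat + 'm \<Rightarrow> 'm" where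
    "pick i h = (\<lambda>x. h (case x of Inl v \<Rightarrow> Inl (i, v) | Inr c \<Rightarrow> Inr c))" for i h
  define row where "row i = map (\<lambda>v. Inl (i, v) :: nat \<times> nat + 'm) [0..<m]" for i :: nat
  define V where "V = Inl ` ((UNIV :: nat set) \<times> {..<m}) \<union> Inr ` N"
  have V: "small \<kappa> V" unfolding V_def by (intro small_Plus N small_countable countableI_type)
  have dpick: "definable M V (\<lambda>h. P (pick i h))" if "definable M (Inl ` {..<m} \<union> Inr ` N) P" for P i
    unfolding pick_def using that by (rule definable_rename) (auto simp: V_def)
  \<comment> \<open>\<open>f1\<close> expresses k-inconsistency, \<open>f2\<close> that the
    \<open>i\<close>-th tuple has the same type over \<open>N\<close> as the first one, and
    \<open>\<Sigma>3\<close> that every tuple has the type of \<open>b\<close> over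
    \<open>A\<close>.\<close>
  define f1 where "f1 S = (\<lambda>h. \<not> satisfiable M n \<phi> (\<lambda>i. map h (row i)) S)" for S
  define f2 where "f2 = (\<lambda>(P :: (nat + 'm \<Rightarrow> 'm) \<Rightarrow> bool, i). (\<lambda>h. P (pick i h) \<longleftrightarrow> P (pick 0 h)))"
  define \<Sigma>1 where "\<Sigma>1 = f1 ` {S. finite S \<and> card S = k}"
  define \<Sigma>2 where "\<Sigma>2 = f2 ` ({P. definable M (Inl ` {..<m} \<union> Inr ` N) P} \<times> UNIV)"
  define \<Sigma>3 where "\<Sigma>3 = {\<lambda>h. P (pick i h) | P i. definable M (Inl ` {..<m} \<union> Inr ` A) P \<and> P (case_sum ((!) b) id)}"
  have A_N: "definable M (Inl ` {..<m} \<union> Inr ` N) P" if "definable M (Inl ` {..<m} \<union> Inr ` A) P" for P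
    using that N(3) by (elim definable_mono) auto
  obtain h where h: "\<And>v. v \<in> Inr ` N \<Longrightarrow> h v = case_sum undefined id v"
      "\<And>P. P \<in> \<Sigma>1 \<union> \<Sigma>2 \<union> \<Sigma>3 \<Longrightarrow> P h"
  proof (rule compactness[OF V])
    show "Inr ` N \<subseteq> V" by (simp add: V_def)
    show "definable M V P" if "P \<in> \<Sigma>1 \<union> \<Sigma>2 \<union> \<Sigma>3" for P
    proof -
      have "definable M V (f1 S)" if "finite S" for S
        unfolding f1_def using \<phi> that
        by (intro definable_neg definable_satisfiable[where m = m]) (auto simp: row_def V_def m_def)
      moreover have "definable M V (f2 (P, i))" if "definable M (Inl ` {..<m} \<union> Inr ` N) P" for P i
        unfolding f2_def split using that by (intro definable_iff dpick)
      ultimately show ?thesis using that dpick[OF A_N] unfolding \<Sigma>1_def \<Sigma>2_def \<Sigma>3_def by auto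
    qed
    fix q assume q: "q \<subseteq> \<Sigma>1 \<union> \<Sigma>2 \<union> \<Sigma>3" "finite q"
    have "finite (q \<inter> \<Sigma>2)" "q \<inter> \<Sigma>2 \<subseteq> f2 ` ({P. definable M (Inl ` {..<m} \<union> Inr ` N) P} \<times> UNIV)"
      using q(2) by (auto simp: \<Sigma>2_def)
    then obtain Q where Q: "finite Q" "q \<inter> \<Sigma>2 = f2 ` Q" by (metis finite_subset_image)
    \<comment> \<open>An index is coloured by the finitely many formulas over \<open>N\<close> in
      question that hold at its tuple. Some colour occurs infinitely often, and a subsequence stays
      k-inconsistent.\<close>
    define col where "col j = {P \<in> fst ` Q. P (case_sum ((!) (b0 j)) id)}" for j
    have "range col \<subseteq> Pow (fst ` Q)" by (auto simp: col_def)
    then have "finite (range col)" using Q(1) by (meson finite_Pow_iff finite_imageI finite_subset)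
    then obtain j0 where j0: "infinite {j. col j = col j0}"
      using pigeonhole_infinite[of UNIV col] by auto
    define e where "e = enumerate {j. col j = col j0}"
    have e: "col (e i) = col j0" for i using enumerate_in_set[OF j0] unfolding e_def by blast
    have inje: "inj e" using j0 strict_mono_enumerate strict_mono_imp_inj_on unfolding e_def by blast
    define h :: "nat \<times> nat + 'm \<Rightarrow> 'm" where "h = case_sum (\<lambda>(i, v). b0 (e i) ! v) id"
    have pick: "pick i h = case_sum ((!) (b0 (e i))) id" for i
      by (auto simp: pick_def h_def split: sum.splits)
    have row: "map h (row i) = b0 (e i)" for i
      using lb0[of "e i"] map_nth[of "b0 (e i)"] by (simp add: row_def h_def o_def)
    have "P h" if "P \<in> q" for P
    proof -
      from q(1) that consider "P \<in> \<Sigma>1" | "P \<in> q \<inter> \<Sigma>2" | "P \<in> \<Sigma>3" by blast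
      then show ?thesis
      proof cases
        case 1
        then obtain S where S: "finite S" "card S = k" "P = f1 S" unfolding \<Sigma>1_def by auto
        have "\<not> satisfiable M n \<phi> b0 (e ` S)"
          using b0(2) S inje unfolding k_inconsistent_def by (metis card_image finite_imageI inj_on_subset subset_UNIV)
        then show ?thesis unfolding S(3) f1_def row by (simp add: satisfiable_def)
      next
        case 2
        then obtain P' i where P': "(P', i) \<in> Q" "P = f2 (P', i)" unfolding Q(2) by auto
        have "P' \<in> col (e i) \<longleftrightarrow> P' \<in> col (e 0)" by (simp add: e)
        moreover have "P' \<in> fst ` Q" using P'(1) by force
        ultimately show ?thesis unfolding P'(2) f2_def split pick col_def by blast
      next
        case 3
        then obtain P' i where P': "definable M (Inl ` {..<m} \<union> Inr ` A) P'" "P' (case_sum ((!) b) id)"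
          "P = (\<lambda>h. P' (pick i h))" unfolding \<Sigma>3_def by blast
        obtain \<sigma> where s: "\<sigma> \<in> Fix A" "b0 (e i) = map \<sigma> b"
          using b0(1)[of "e i"] same_tp_iff[OF A] unfolding same_tp_def by (metis same_tp_def b0(1))
        have "P' (\<lambda>v. \<sigma> (case_sum ((!) b) id v))" using Aut_definable[OF FixD(1)[OF s(1)] P'(1)] P'(2) by simp
        then have "P' (case_sum ((!) (b0 (e i))) id)"
          using FixD(2)[OF s(1)] s(2) by (subst definable_cong[OF P'(1)]) (auto simp: m_def)
        then show ?thesis unfolding P'(3) pick .
      qed
    qed
    then show "\<exists>h. (\<forall>v\<in>Inr ` N. h v = case_sum undefined id v) \<and> (\<forall>P\<in>q. P h)"
      by (intro exI[of _ h]) (auto simp: h_def)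
  qed auto
  define b1 where "b1 i = map h (row i)" for i
  have lb1: "length (b1 i) = m" for i by (simp add: b1_def row_def)
  have b1: "k_inconsistent M k n \<phi> b1"
    using h(2) unfolding \<Sigma>1_def k_inconsistent_def f1_def b1_def by auto
  obtain \<rho> where r: "\<rho> \<in> Fix A" "\<And>v. v \<in> {..<m} \<Longrightarrow> h (Inl (0, v)) = \<rho> (b ! v)"
  proof (rule aut_over_of_definable[OF small_nat A, of "{..<m}" "(!) b" "\<lambda>v. h (Inl (0, v))"])
    fix P assume P: "definable M (Inl ` {..<m} \<union> Inr ` A) P" "P (case_sum ((!) b) id)"
    then have "P (pick 0 h)" using h(2) unfolding \<Sigma>3_def by blast
    then show "P (case_sum (\<lambda>v. h (Inl (0, v))) id)"
      using h(1) N(3) by (subst definable_cong[OF P(1), of _ "pick 0 h"]) (auto simp: pick_def)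
  qed auto
  then have r': "b1 0 = map \<rho> b"
    by (auto simp: b1_def row_def m_def intro!: nth_equalityI)
  have "\<exists>\<sigma>\<in>Fix N. b1 i = map \<sigma> (b1 0)" for i
  proof -
    obtain \<sigma> where s: "\<sigma> \<in> Fix N" "\<And>v. v \<in> {..<m} \<Longrightarrow> h (Inl (i, v)) = \<sigma> (h (Inl (0, v)))"
    proof (rule aut_over_of_definable[OF small_nat N(1), of "{..<m}" "\<lambda>v. h (Inl (0, v))" "\<lambda>v. h (Inl (i, v))"])
      fix P assume P: "definable M (Inl ` {..<m} \<union> Inr ` N) P" "P (case_sum (\<lambda>v. h (Inl (0, v))) id)"
      have c: "P (case_sum (\<lambda>v. h (Inl (i, v))) id) \<longleftrightarrow> P (pick i h)" for i
        using h(1) by (intro definable_cong[OF P(1)]) (auto simp: pick_def)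
      have "f2 (P, i) h" using h(2) P(1) unfolding \<Sigma>2_def by blast
      then show "P (case_sum (\<lambda>v. h (Inl (i, v))) id)" using P(2) c unfolding f2_def by simp
    qed auto
    then show ?thesis by (intro bexI[of _ \<sigma>]) (auto simp: b1_def row_def intro!: nth_equalityI)
  qed
  then have Ls1: "Ls A (b1 0) (b1 i)" for i using Ls_strong[OF N] by metis
  \<comment> \<open>The new sequence starts at a mere conjugate of \<open>b\<close> over
    \<open>A\<close>. Moving it back makes it start at \<open>b\<close> and preserves Lascar
    equivalence over \<open>A\<close>.\<close>
  define \<tau> where "\<tau> = inv_into UNIV \<rho>"
  have t: "\<tau> \<in> Fix A" unfolding \<tau>_def by (rule Fix_inv[OF r(1)])
  have "map \<tau> (b1 0) = b" unfolding r' \<tau>_def using Aut_inv_left[OF FixD(1)[OF r(1)]] by (simp add: map_idI)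
  then have "Ls A b (map \<tau> (b1 i))" for i using Ls_Fix[OF Ls1[of i] t] by simp
  moreover have "k_inconsistent M k n \<phi> (\<lambda>i. map \<tau> (b1 i))"
    using k_inconsistent_Aut[OF FixD(1)[OF t], of n m \<phi> b1] \<phi> lb1 b1 by (simp add: m_def)
  ultimately show thesis using that by blast
qed

text \<open>
  In the notation of the literature, \<open>free X C Y\<close> says that \<open>X\<close> is independent from \<open>Y\<close> over \<open>C\<close>
  in the sense of Lascar-invariance.
\<close>

definition free :: "'m set \<Rightarrow> 'm set \<Rightarrow> 'm set \<Rightarrow> bool" where
  "free X C Y \<longleftrightarrow> (\<exists>p. global_type M X p \<and> tp M X (Y \<union> C) \<subseteq> p \<and> (\<forall>\<sigma>\<in>AutfL \<kappa> M C. type_image \<sigma> p = p))"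

lemma global_type_realised:
  assumes "global_type M X p" "q \<subseteq> p" "finite q"
  obtains h where "\<And>\<phi> xs c. (\<phi>, xs, c) \<in> q \<Longrightarrow> holds M \<phi> (map h xs @ c)"
proof -
  have "\<exists>h. \<forall>(\<phi>, xs, c)\<in>q. holds M \<phi> (map h xs @ c)"
    using assms unfolding global_type_def by simp
  then show thesis using that by blast
qed

lemma global_type_Neg:
  assumes p: "global_type M X p" and f: "set xs \<subseteq> X" "fmla M (length xs + length c) \<phi>"
  shows "(Neg \<phi>, xs, c) \<in> p \<longleftrightarrow> (\<phi>, xs, c) \<notin> p"
proof
  assume "(Neg \<phi>, xs, c) \<in> p"
  show "(\<phi>, xs, c) \<notin> p"
  proof
    assume "(\<phi>, xs, c) \<in> p"
    with \<open>(Neg \<phi>, xs, c) \<in> p\<close> have "{(\<phi>, xs, c), (Neg \<phi>, xs, c)} \<subseteq> p" by blast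
    then obtain h where h: "\<And>\<psi> ys d. (\<psi>, ys, d) \<in> {(\<phi>, xs, c), (Neg \<phi>, xs, c)} \<Longrightarrow> holds M \<psi> (map h ys @ d)"
      by (rule global_type_realised[OF p]) auto
    show False using h[of \<phi> xs c] h[of "Neg \<phi>" xs c] by simp
  qed
next
  have "(\<phi>, xs, c) \<in> insts M X UNIV" using f by (simp add: insts_def)
  moreover have "\<forall>(\<phi>, xs, c)\<in>insts M X UNIV. (\<phi>, xs, c) \<in> p \<or> (Neg \<phi>, xs, c) \<in> p"
    using p by (simp add: global_type_def)
  ultimately show "(\<phi>, xs, c) \<notin> p \<Longrightarrow> (Neg \<phi>, xs, c) \<in> p" by blast
qed

text \<open>By invariance the global extension contains both instances or neither, and on parameters
  from \<open>Y\<close> and \<open>C\<close> it agrees with the type of \<open>X\<close>.\<close>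

lemma free_Lascar:
  assumes free: "free X C Y" and xs: "set xs \<subseteq> X" and ys: "set ys \<subseteq> Y \<union> C" "set ys' \<subseteq> Y \<union> C"
    and Ls: "Ls C ys ys'" and f: "fmla M (length xs + length ys) \<phi>"
  shows "holds M \<phi> (xs @ ys) \<longleftrightarrow> holds M \<phi> (xs @ ys')"
proof -
  obtain p where p: "global_type M X p" "tp M X (Y \<union> C) \<subseteq> p" "\<forall>\<sigma>\<in>AutfL \<kappa> M C. type_image \<sigma> p = p"
    using free unfolding free_def by blast
  have *: "holds M \<phi> (xs @ ys')" if h: "holds M \<phi> (xs @ ys)" and ys: "set ys \<subseteq> Y \<union> C" "set ys' \<subseteq> Y \<union> C"
    and l: "Ls C ys ys'" and f: "fmla M (length xs + length ys) \<phi>" for ys ys'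
  proof (rule ccontr)
    assume n: "\<not> holds M \<phi> (xs @ ys')"
    obtain \<sigma> where s: "\<sigma> \<in> AutfL \<kappa> M C" "ys' = map \<sigma> ys" using l unfolding Ls_def by blast
    have "(\<phi>, xs, ys) \<in> p" using h ys f xs p(2) unfolding tp_def insts_def by blast
    then have "(\<phi>, xs, ys') \<in> type_image \<sigma> p" unfolding type_image_def s(2) by force
    then have "(\<phi>, xs, ys') \<in> p" using p(3) s(1) by blast
    moreover have "(Neg \<phi>, xs, ys') \<in> tp M X (Y \<union> C)"
      using n ys f xs s(2) unfolding tp_def insts_def by auto
    then have "(Neg \<phi>, xs, ys') \<in> p" using p(2) by blast
    ultimately show False using global_type_Neg[OF p(1) xs, of ys' \<phi>] f s(2) by simp
  qed
  show ?thesis using *[of ys ys'] *[of ys' ys] ys f Ls Ls_sym[OF Ls] Ls_length[OF Ls] by auto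
qed

text \<open>Upgrades \<open>free_Lascar\<close> from single formulas to an automorphism over
  \<open>X\<close> and \<open>C\<close> together, the form in which independence is mostly
  applied.\<close>

lemma free_Lascar_conj:
  assumes X: "small \<kappa> X" "small \<kappa> C" and free: "free X C Y" and d: "set d \<subseteq> Y" "set d' \<subseteq> Y" "Ls C d d'"
  shows "\<exists>\<sigma>\<in>Fix (X \<union> C). d' = map \<sigma> d"
proof -
  have XC: "small \<kappa> (X \<union> C)" by (rule small_Un[OF X])
  have len: "length d' = length d" using Ls_length[OF d(3)] .
  show ?thesis
    unfolding same_tp_iff[OF XC, symmetric] same_tp_def
  proof (intro conjI allI impI)
    show "length d = length d'" using len by simp
    fix \<phi> c assume c: "set c \<subseteq> X \<union> C \<and> fmla M (length d + length c) \<phi>"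
    \<comment> \<open>Parameters from \<open>X\<close> are read as instances of the variables of the
      type; the remaining ones lie in \<open>C\<close> and are fixed by Lascar
      automorphisms.\<close>
    define xs where "xs = filter (\<lambda>v. v \<in> X) c"
    define ys where "ys = filter (\<lambda>v. v \<notin> X) c"
    let ?ws = "map Inr xs @ map Inl [0..<length d] @ map Inr ys"
    have "definable M (set ?ws) (\<lambda>h. holds M \<phi> (map h (map Inl [0..<length d] @ map Inr c)))"
      using c by (intro dfnI) (auto simp: xs_def ys_def)
    then obtain \<psi> where \<psi>: "fmla M (length ?ws) \<psi>"
      "\<And>h. holds M \<phi> (map h (map Inl [0..<length d] @ map Inr c)) \<longleftrightarrow> holds M \<psi> (map h ?ws)"
      by (rule definable_list) (rule that)
    have eq: "holds M \<phi> (e @ c) \<longleftrightarrow> holds M \<psi> (xs @ e @ ys)" if "length e = length d" for e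
      using \<psi>(2)[of "case_sum ((!) e) id"] that map_nth[of e] by (simp add: o_def)
    have ys: "set ys \<subseteq> C" using c by (auto simp: ys_def)
    obtain \<sigma> where s: "\<sigma> \<in> AutfL \<kappa> M C" "d' = map \<sigma> d" using d(3) unfolding Ls_def by blast
    have "Ls C (d @ ys) (d' @ ys)"
      unfolding Ls_def using s Fix_map[OF AutfL_Fix[OF s(1)] ys] by (intro bexI[of _ \<sigma>]) auto
    then have "holds M \<psi> (xs @ d @ ys) \<longleftrightarrow> holds M \<psi> (xs @ d' @ ys)"
      using ys d \<psi>(1) by (intro free_Lascar[OF free]) (auto simp: xs_def)
    then show "holds M \<phi> (d @ c) \<longleftrightarrow> holds M \<phi> (d' @ c)" using eq len by simp
  qed
qed

end

section \<open>Forking implies quasi-dividing\<close>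

lemma elem_map_Aut: "\<sigma> \<in> Aut M \<Longrightarrow> elem_map M B \<sigma>"
  unfolding elem_map_def using Aut_holds by blast

context monster
begin

text \<open>The automorphisms over \<open>A\<close> that produce a dividing sequence from
  \<open>b\<close> also produce one from \<open>c\<close>. A common solution \<open>x\<close> of
  several instances of \<open>\<theta>\<close> must give a common solution of the instances of
  \<open>\<phi>\<close>, so \<open>f\<close> may depend on \<open>x\<close> but not on
  \<open>\<sigma>\<close>. Besides projections to subtuples, \<open>f\<close> covers the choice of
  existential witnesses.\<close>

lemma divides_transfer:
  assumes A: "small \<kappa> A" and dv: "divides M A n \<phi> b"
    and len: "\<And>x. length x = n' \<Longrightarrow> length (f x) = n"
    and imp: "\<And>\<sigma> x. \<sigma> \<in> Fix A \<Longrightarrow> length x = n' \<Longrightarrow> holds M \<theta> (x @ map \<sigma> c) \<Longrightarrow> holds M \<phi> (f x @ map \<sigma> b)"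
  shows "divides M A n' \<theta> c"
proof -
  obtain k b' where b': "\<And>i. same_tp M A (b' i) b" "k_inconsistent M k n \<phi> b'"
    using dv unfolding divides_def by blast
  have "\<exists>\<sigma>\<in>Fix A. b = map \<sigma> (b' i)" for i using b'(1) same_tp_iff[OF A] by blast
  then have "\<forall>i. \<exists>\<sigma>. \<sigma> \<in> Fix A \<and> b = map \<sigma> (b' i)" by blast
  from choice[OF this] obtain \<rho> where r: "\<And>i. \<rho> i \<in> Fix A" "\<And>i. b = map (\<rho> i) (b' i)" by blast
  define \<sigma> where "\<sigma> i = inv_into UNIV (\<rho> i)" for i
  have s: "\<sigma> i \<in> Fix A" for i unfolding \<sigma>_def by (rule Fix_inv[OF r(1)])
  have bs: "map (\<sigma> i) b = b' i" for i
    unfolding \<sigma>_def by (subst r(2)[of i]) (simp add: map_idI Aut_inv_left[OF FixD(1)[OF r(1)]])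
  have "same_tp M A (map (\<sigma> i) c) c" for i
    unfolding same_tp_iff[OF A] using r(1)[of i]
    by (intro bexI[of _ "\<rho> i"]) (simp_all add: \<sigma>_def map_idI Aut_inv_right[OF FixD(1)[OF r(1)]])
  moreover have "k_inconsistent M k n' \<theta> (\<lambda>i. map (\<sigma> i) c)"
    unfolding k_inconsistent_def
  proof (intro allI impI notI)
    fix S assume S: "finite S \<and> card S = k" and "satisfiable M n' \<theta> (\<lambda>i. map (\<sigma> i) c) S"
    then obtain x where x: "length x = n'" "\<And>i. i \<in> S \<Longrightarrow> holds M \<theta> (x @ map (\<sigma> i) c)"
      unfolding satisfiable_def by blast
    have "holds M \<phi> (f x @ b' i)" if "i \<in> S" for i
      using imp[OF s x(1) x(2)[OF that]] bs by simp
    then have "satisfiable M n \<phi> b' S" unfolding satisfiable_def using len[OF x(1)] by blast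
    then show False using b'(2) S unfolding k_inconsistent_def by blast
  qed
  ultimately show ?thesis unfolding divides_def
    by (intro exI[of _ k] exI[of _ "\<lambda>i. map (\<sigma> i) c"]) simp
qed

lemma divides_Fix:
  assumes A: "small \<kappa> A" and "divides M A n \<phi> b" and s: "\<sigma> \<in> Fix A"
  shows "divides M A n \<phi> (map \<sigma> b)"
proof -
  have "\<exists>\<rho>\<in>Fix A. map \<sigma> b = map \<rho> (b' i)" if "same_tp M A (b' i) b" for b' :: "nat \<Rightarrow> 'm list" and i
    using that s Fix_comp unfolding same_tp_iff[OF A] by (metis map_map)
  then have "same_tp M A (b' i) (map \<sigma> b)" if "same_tp M A (b' i) b" for b' :: "nat \<Rightarrow> 'm list" and i
    using that same_tp_iff[OF A] by blast
  then show ?thesis using assms(2) unfolding divides_def by meson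
qed

end

section \<open>Rules for the given relation\<close>

locale suitable_monster = monster \<kappa> M for \<kappa> :: "'k rel" and M :: "('f, 'p, 'm) struct" +
  fixes A :: "'m set" and R :: "'m ternary"
  assumes A: "small \<kappa> A" and suitable: "suitable_relation \<kappa> M A R" and NTP2: "NTP2 M"
begin

lemma R_Aut:
  assumes "small \<kappa> X" "small \<kappa> C" "small \<kappa> Y" "R X C Y" "\<sigma> \<in> Aut M"
  shows "R (\<sigma> ` X) (\<sigma> ` C) (\<sigma> ` Y)"
proof -
  have "conj_triple M (\<sigma> ` X, \<sigma> ` Y, \<sigma> ` C) (X, Y, C)"
    using elem_map_Aut[OF assms(5)] unfolding conj_triple_def by auto
  moreover have "invariance \<kappa> M R" using suitable by (simp add: suitable_relation_def)
  ultimately show ?thesis using assms unfolding invariance_def by blast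
qed

lemma R_mono:
  assumes "small \<kappa> X" "small \<kappa> C" "small \<kappa> Y" "R X C Y" "X' \<subseteq> X" "Y' \<subseteq> Y"
  shows "R X' C Y'"
proof -
  have "monotonicity \<kappa> R" using suitable by (simp add: suitable_relation_def)
  then show ?thesis using assms unfolding monotonicity_def by blast
qed

lemma R_base:
  assumes "small \<kappa> X" "small \<kappa> C" "small \<kappa> Y" "small \<kappa> D" "R X C (Y \<union> D)"
  shows "R X (C \<union> Y) D"
proof -
  have "base_monotonicity \<kappa> R" using suitable by (simp add: suitable_relation_def)
  then show ?thesis using assms unfolding base_monotonicity_def by blast
qed

lemma R_left_trans:
  assumes "small \<kappa> X1" "small \<kappa> X2" "small \<kappa> C" "small \<kappa> Y" "R X1 C Y" "R X2 (C \<union> X1) (Y \<union> X1)"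
  shows "R (X1 \<union> X2) C Y"
proof -
  have "left_transitivity \<kappa> R" using suitable by (simp add: suitable_relation_def)
  then show ?thesis using assms unfolding left_transitivity_def by blast
qed

lemma R_ext_right:
  assumes "small \<kappa> X" "small \<kappa> C" "small \<kappa> D" "R X C Y" "Y \<subseteq> D"
  obtains \<sigma> where "\<sigma> \<in> Fix (Y \<union> C)" "R X C (\<sigma> ` D)"
proof -
  have Y: "small \<kappa> Y" using small_subset assms by blast
  have "right_extension \<kappa> M R" using suitable by (simp add: suitable_relation_def)
  then obtain D' where D': "conj_over M (Y \<union> C) D' D" "R X C D'"
    using assms Y unfolding right_extension_def by blast
  then obtain f where f: "elem_map M ((Y \<union> C) \<union> D) f" "\<forall>b\<in>Y \<union> C. f b = b" "f ` D = D'"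
    unfolding conj_over_def by blast
  have "small \<kappa> ((Y \<union> C) \<union> D)" using small_Un Y assms by blast
  then obtain \<sigma> where s: "\<sigma> \<in> Aut M" "\<forall>b\<in>(Y \<union> C) \<union> D. \<sigma> b = f b"
    using homogeneous f(1) unfolding strongly_homogeneous_def by blast
  have "\<sigma> ` D = D'" using s(2) f(3) by auto
  moreover have "\<sigma> \<in> Fix (Y \<union> C)" using s f(2) by (auto simp: Fix_def)
  ultimately show thesis using that D'(2) by blast
qed

text \<open>Right extension moves \<open>D\<close>; applying the inverse automorphism to the whole
  situation moves \<open>X\<close> instead.\<close>

lemma R_ext_left:
  assumes "small \<kappa> X" "small \<kappa> C" "small \<kappa> D" "R X C Y" "Y \<subseteq> D"
  obtains \<sigma> where "\<sigma> \<in> Fix (Y \<union> C)" "R (\<sigma> ` X) C D"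
proof -
  obtain \<sigma> where s: "\<sigma> \<in> Fix (Y \<union> C)" "R X C (\<sigma> ` D)" by (rule R_ext_right[OF assms])
  let ?\<tau> = "inv_into UNIV \<sigma>"
  have t: "?\<tau> \<in> Fix (Y \<union> C)" by (rule Fix_inv[OF s(1)])
  have "R (?\<tau> ` X) (?\<tau> ` C) (?\<tau> ` \<sigma> ` D)"
    by (intro R_Aut assms small_image s FixD(1)[OF t])
  moreover have "?\<tau> ` C = C" using Fix_image[OF t] by blast
  moreover have "?\<tau> ` \<sigma> ` D = D" using Aut_inv_left[OF FixD(1)[OF s(1)]] by (auto simp: image_image)
  ultimately show thesis using that t by simp
qed

text \<open>Starts from \<open>R X A A\<close>, which the extension base property provides, and
  enlarges the right side until it contains \<open>D\<close>.\<close>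

lemma R_exists:
  assumes "small \<kappa> X" "small \<kappa> D"
  obtains \<sigma> where "\<sigma> \<in> Fix A" "R (\<sigma> ` X) A D"
proof -
  have "extension_base_for \<kappa> A R" using suitable by (simp add: suitable_relation_def)
  then have "R X A A" using assms(1) unfolding extension_base_for_def by blast
  then obtain \<sigma> where s: "\<sigma> \<in> Fix (A \<union> A)" "R (\<sigma> ` X) A (A \<union> D)"
    using R_ext_left[OF assms(1) A small_Un[OF A assms(2)]] by blast
  have "R (\<sigma> ` X) A D"
    by (rule R_mono[OF small_image[OF assms(1)] A small_Un[OF A assms(2)] s(2)]) auto
  then show thesis using that s(1) by auto
qed

lemma R_empty: "small \<kappa> D \<Longrightarrow> R {} A D"
  using R_exists[of "{}" D] small_finite[of "{}"] by auto

lemma R_free: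
  assumes "small \<kappa> X" "small \<kappa> C" "small \<kappa> Y" "R X C Y"
  shows "free X C Y"
proof -
  have "stronger_than_invariance \<kappa> M R" using suitable by (simp add: suitable_relation_def)
  then show ?thesis using assms unfolding stronger_than_invariance_def free_def by blast
qed

text \<open>
  Stack copies \<open>I\<^sub>j\<close> of a witness of dividing, each independent from the previous ones and all
  conjugate over a model.  By NTP2 some vertical path of this array is inconsistent; its elements
  are independent and Lascar equivalent.
\<close>

lemma dividing_independent:
  assumes \<phi>: "fmla M (n + length d) \<phi>" and dv: "divides M A n \<phi> d"
  obtains k ds where "0 < k" "ds 0 = d" "\<And>l. l < k \<Longrightarrow> Ls A d (ds l)"
    "\<And>l. l < k \<Longrightarrow> R (set (ds l)) A (\<Union>j<l. set (ds j))" "\<not> satisfiable M n \<phi> ds {..<k}"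
proof -
  obtain k0 b where b: "k_inconsistent M k0 n \<phi> b" "\<And>i. Ls A d (b i)"
    by (rule divides_Lascar[OF A \<phi> dv]) (rule that)
  have lb: "length (b i) = length d" for i using Ls_length[OF b(2)] .
  define X where "X = (\<Union>i. set (b i))"
  have X: "small \<kappa> X" unfolding X_def by (intro small_countable countable_UN) (auto intro: countable_finite)
  obtain N where N: "small \<kappa> N" "elem_submodel M N" "A \<subseteq> N" by (rule small_elem_submodel[OF A])
  obtain \<tau>0 where t0: "\<tau>0 \<in> Fix A" "R (\<tau>0 ` X) A N" by (rule R_exists[OF X N(1)])
  \<comment> \<open>A state consists of the automorphism placing the current copy of
    \<open>X\<close> and a small set containing \<open>N\<close> and that copy. As
    \<open>\<rho>\<close> fixes \<open>N\<close>, all copies are conjugate over the model;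
    \<open>Q\<close> makes the next copy independent from everything collected so far.\<close>
  define P where "P = (\<lambda>(\<tau>, S). (\<exists>\<rho>\<in>Fix N. \<tau> = \<rho> \<circ> \<tau>0) \<and> small \<kappa> S \<and> N \<subseteq> S \<and> \<tau> ` X \<subseteq> S)"
  define Q where "Q = (\<lambda>(\<tau> :: 'm \<Rightarrow> 'm, S) (\<tau>', S'). R (\<tau>' ` X) A S \<and> S \<subseteq> S')"
  have "\<exists>f. \<forall>j. P (f j) \<and> Q (f j) (f (Suc j))"
  proof (rule dependent_nat_choice)
    have "P (\<tau>0, N \<union> \<tau>0 ` X)"
      unfolding P_def using small_Un[OF N(1) small_image[OF X]] Fix_id[of N]
      by (auto intro!: bexI[of _ id])
    then show "\<exists>x. P x" by blast
  next
    fix x and j :: nat assume "P x"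
    then obtain \<tau> S where x: "x = (\<tau>, S)" and S: "small \<kappa> S" "N \<subseteq> S" by (auto simp: P_def)
    obtain \<sigma> where s: "\<sigma> \<in> Fix (N \<union> A)" "R (\<sigma> ` \<tau>0 ` X) A S"
      by (rule R_ext_left[OF small_image[OF X] A S(1) t0(2) S(2)])
    have "P (\<sigma> \<circ> \<tau>0, S \<union> (\<sigma> \<circ> \<tau>0) ` X)"
      unfolding P_def using S small_Un[OF S(1) small_image[OF X]] Fix_mono[OF s(1)] by auto
    moreover have "Q x (\<sigma> \<circ> \<tau>0, S \<union> (\<sigma> \<circ> \<tau>0) ` X)" unfolding Q_def x using s(2) by (simp add: image_comp)
    ultimately show "\<exists>y. P y \<and> Q x y" by blast
  qed
  then obtain f where f: "\<And>j. P (f j)" "\<And>j. Q (f j) (f (Suc j))" by blast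
  define \<tau> where "\<tau> j = fst (f j)" for j
  define S where "S j = snd (f j)" for j
  have fe: "f j = (\<tau> j, S j)" for j by (simp add: \<tau>_def S_def)
  have tau: "\<exists>\<rho>\<in>Fix N. \<tau> j = \<rho> \<circ> \<tau>0" "small \<kappa> (S j)" "N \<subseteq> S j" "\<tau> j ` X \<subseteq> S j" for j
    using f(1)[of j] unfolding P_def fe by auto
  have RS: "R (\<tau> (Suc j) ` X) A (S j)" and Smono: "S j \<subseteq> S (Suc j)" for j
    using f(2)[of j] unfolding Q_def fe by auto
  have tA: "\<tau> j \<in> Fix A" for j
  proof -
    obtain \<rho> where r: "\<rho> \<in> Fix N" "\<tau> j = \<rho> \<circ> \<tau>0" using tau(1) by blast
    show ?thesis unfolding r(2) by (rule Fix_comp[OF Fix_mono[OF r(1) N(3)] t0(1)])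
  qed
  have Smono': "S i \<subseteq> S j" if "i \<le> j" for i j using Smono that by (rule lift_Suc_mono_le)
  have Rt: "\<exists>T. small \<kappa> T \<and> R (\<tau> j ` X) A T \<and> (\<forall>i<j. \<tau> i ` X \<subseteq> T)" for j
  proof (cases j)
    \<comment> \<open>\<open>Q\<close> speaks about successors only; the first copy inherits its
      independence from \<open>N\<close> from \<open>\<tau>0\<close>.\<close>
    case 0
    obtain \<rho> where r: "\<rho> \<in> Fix N" "\<tau> 0 = \<rho> \<circ> \<tau>0" using tau(1) by blast
    have "R (\<rho> ` \<tau>0 ` X) (\<rho> ` A) (\<rho> ` N)"
      by (intro R_Aut small_image X A N t0 FixD(1)[OF r(1)])
    then have "R (\<tau> 0 ` X) A N"
      using Fix_image[OF r(1), of A] Fix_image[OF r(1), of N] N(3) by (simp add: r(2) image_comp)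
    then show ?thesis using N(1) 0 by auto
  next
    case (Suc j')
    have "\<tau> i ` X \<subseteq> S j'" if "i < j" for i
      using tau(4)[of i] Smono'[of i j'] that Suc by auto
    then show ?thesis using RS[of j'] tau(2) Suc by blast
  qed
  define a where "a j i = map (\<tau> j) (b i)" for j i
  have "k_inconsistent M k0 n \<phi> (a j)" for j
    using k_inconsistent_Aut[where b = b, OF FixD(1)[OF tA] \<phi> lb, of k0 j] b(1)
    unfolding a_def[abs_def] by simp
  moreover have "length (a j i) = length d" for j i using lb by (simp add: a_def)
  ultimately have "\<not> (\<forall>g. consistent M n \<phi> (\<lambda>j. a j (g j)))"
    using NTP2 \<phi> unfolding NTP2_def by blast
  then obtain g F where F: "finite F" "\<not> satisfiable M n \<phi> (\<lambda>j. a j (g j)) F"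
    unfolding consistent_def by blast
  define js where "js = sorted_list_of_set F"
  have js: "set js = F" "sorted_wrt (<) js" using F(1) by (simp_all add: js_def)
  define k where "k = length js"
  define e where "e l = a (js ! l) (g (js ! l))" for l
  \<comment> \<open>The empty set of formulas is satisfied by any tuple of length \<open>n\<close>,
    so the path has a first element that can be moved to \<open>d\<close>.\<close>
  have "F \<noteq> {}" using F(2) unfolding satisfiable_def by (metis empty_iff length_replicate)
  then have k: "0 < k" using js(1) by (auto simp: k_def)
  have unsat: "\<not> satisfiable M n \<phi> e {..<k}"
  proof
    assume "satisfiable M n \<phi> e {..<k}"
    then obtain x where x: "length x = n" "\<And>l. l < k \<Longrightarrow> holds M \<phi> (x @ e l)"
      unfolding satisfiable_def by auto
    have "holds M \<phi> (x @ a j (g j))" if "j \<in> F" for j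
      using that x(2) js(1) unfolding e_def k_def by (metis in_set_conv_nth)
    then show False using F(2) x(1) unfolding satisfiable_def by blast
  qed
  have e_sub: "set (e l) \<subseteq> \<tau> (js ! l) ` X" for l by (auto simp: e_def a_def X_def)
  have Re: "R (set (e l)) A (\<Union>j<l. set (e j))" if l: "l < k" for l
  proof -
    obtain T where T: "small \<kappa> T" "R (\<tau> (js ! l) ` X) A T" "\<forall>i<js ! l. \<tau> i ` X \<subseteq> T" using Rt by blast
    have "set (e j) \<subseteq> T" if "j < l" for j
    proof -
      have "js ! j < js ! l" using js(2) l that by (simp add: sorted_wrt_iff_nth_less k_def)
      then show ?thesis using T(3) e_sub by blast
    qed
    then show ?thesis by (intro R_mono[OF small_image[OF X] A T(1,2) e_sub]) auto
  qed
  \<comment> \<open>Within a row, elements are Lascar equivalent to the copy of \<open>d\<close> by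
    the choice of \<open>b\<close>; between rows, they are conjugate over the model
    \<open>N\<close>.\<close>
  have Lse: "Ls A (map \<tau>0 d) (e l)" for l
  proof -
    obtain \<rho> where r: "\<rho> \<in> Fix N" "\<tau> (js ! l) = \<rho> \<circ> \<tau>0" using tau(1) by blast
    have "e l = map \<rho> (map \<tau>0 (b (g (js ! l))))" by (simp add: e_def a_def r(2))
    then show ?thesis
      using Ls_trans[OF Ls_Fix[OF b(2) t0(1)] Ls_strong[OF N r(1)]] by metis
  qed
  obtain \<sigma> where s: "\<sigma> \<in> AutfL \<kappa> M A" "e 0 = map \<sigma> (map \<tau>0 d)" using Lse unfolding Ls_def by blast
  have st: "\<sigma> \<circ> \<tau>0 \<in> Fix A" using Fix_comp[OF AutfL_Fix[OF s(1)] t0(1)] .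
  \<comment> \<open>The first element of the path is carried back to \<open>d\<close>; the other
    properties are invariant under automorphisms over \<open>A\<close>.\<close>
  define \<theta> where "\<theta> = inv_into UNIV (\<sigma> \<circ> \<tau>0)"
  have th: "\<theta> \<in> Fix A" unfolding \<theta>_def by (rule Fix_inv[OF st])
  have thA: "\<theta> ` A = A" using Fix_image[OF th] by blast
  define ds where "ds l = map \<theta> (e l)" for l
  have ds0: "ds 0 = d"
    unfolding ds_def s(2) \<theta>_def using Aut_inv_left[OF FixD(1)[OF st]] by (simp add: map_idI)
  show thesis
  proof (rule that[of k ds, OF k ds0])
    show "Ls A d (ds l)" if "l < k" for l
      using Ls_Fix[OF Ls_trans[OF Ls_sym[OF Lse[of 0]] Lse[of l]] th] ds0 by (simp add: ds_def)
    show "R (set (ds l)) A (\<Union>j<l. set (ds j))" if "l < k" for l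
    proof -
      have "R (\<theta> ` set (e l)) (\<theta> ` A) (\<theta> ` (\<Union>j<l. set (e j)))"
        by (intro R_Aut Re A FixD(1)[OF th] small_finite that) auto
      then show ?thesis by (simp add: thA ds_def image_UN)
    qed
    show "\<not> satisfiable M n \<phi> ds {..<k}"
    proof -
      have "length (e l) = length d" for l using lb by (simp add: e_def a_def)
      then show ?thesis
        using satisfiable_Aut[OF FixD(1)[OF th] \<phi>, of "{..<k}" e] unsat unfolding ds_def[abs_def] by simp
    qed
  qed
qed

text \<open>
  The broom lemma.  The set \<open>S\<close> need not be definable, as only its conjugates are intersected.
  The first formula of the list is killed by replacing \<open>d\<close> by the sequence of
  \<open>dividing_independent\<close>, which is kept conjugate over \<open>c\<close> by Lascar-invariance.  The remaining
  formulas are then killed at one element of that sequence after the other, with the later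
  elements added to \<open>c\<close>.
\<close>

lemma broom:
  assumes "\<And>\<theta>. \<theta> \<in> set ts \<Longrightarrow> fmla M (n + length d) \<theta> \<and> divides M A n \<theta> d"
    and "small \<kappa> c" and "R c A (set d)"
    and "\<And>\<sigma> x. \<sigma> \<in> Fix (A \<union> c) \<Longrightarrow> x \<in> \<Psi> \<Longrightarrow> map \<sigma> x \<in> \<Psi>"
    and "\<And>x. x \<in> S \<Longrightarrow> x \<in> \<Psi> \<or> (\<exists>\<theta>\<in>set ts. holds M \<theta> (x @ d))"
  shows "\<exists>G. finite G \<and> G \<subseteq> Fix A \<and> (\<forall>x. length x = n \<and> (\<forall>\<sigma>\<in>G. x \<in> map \<sigma> ` S) \<longrightarrow> x \<in> \<Psi>)"
  using assms
proof (induction ts arbitrary: d c \<Psi> S)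
  case Nil
  then show ?case using Fix_id[of A] by (intro exI[of _ "{id}"]) auto
next
  case (Cons \<theta> ts)
  note prems = Cons.prems
  have th: "fmla M (n + length d) \<theta>" "divides M A n \<theta> d" using prems(1)[of \<theta>] by simp_all
  obtain k e where e: "0 < k" "e 0 = d" "\<And>l. l < k \<Longrightarrow> Ls A d (e l)"
    "\<And>l. l < k \<Longrightarrow> R (set (e l)) A (\<Union>j<l. set (e j))" "\<not> satisfiable M n \<theta> e {..<k}"
    by (rule dividing_independent[OF th]) (rule that)
  have smD: "small \<kappa> (\<Union>l<k. set (e l))" by (intro small_finite) auto
  have "set d \<subseteq> (\<Union>l<k. set (e l))" using e(1,2) by auto
  \<comment> \<open>Right extension makes \<open>c\<close> independent from the whole sequence, and
    the first element stays \<open>d\<close> because \<open>\<sigma>\<close> fixes it.\<close>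
  then obtain \<sigma> where s: "\<sigma> \<in> Fix (set d \<union> A)" "R c A (\<sigma> ` (\<Union>l<k. set (e l)))"
    using R_ext_right[OF prems(2) A smD prems(3)] by blast
  have sA: "\<sigma> \<in> Fix A" using Fix_mono[OF s(1)] by blast
  define ds where "ds l = map \<sigma> (e l)" for l
  have ds0: "ds 0 = d" unfolding ds_def e(2) using Fix_map[OF s(1)] by simp
  have Ls_ds: "Ls A d (ds l)" if "l < k" for l
    using Ls_Fix[OF e(3)[OF that] sA] ds0 unfolding ds_def e(2) by simp
  have len: "length (ds l) = length d" if "l < k" for l using Ls_length[OF Ls_ds[OF that]] .
  have R_ds: "R (set (ds l)) A (\<Union>j<l. set (ds j))" if "l < k" for l
  proof -
    have "R (\<sigma> ` set (e l)) (\<sigma> ` A) (\<sigma> ` (\<Union>j<l. set (e j)))"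
      by (intro R_Aut e(4)[OF that] A FixD(1)[OF sA] small_finite) auto
    then show ?thesis using Fix_image[OF sA, of A] by (simp add: ds_def image_UN)
  qed
  have unsat: "\<not> satisfiable M n \<theta> ds {..<k}"
    using satisfiable_Aut[OF FixD(1)[OF sA] th(1), of "{..<k}" e] e(5) Ls_length[OF e(3)]
    unfolding ds_def[abs_def] by simp
  have R_c: "R c A (\<Union>l<k. set (ds l))" using s(2) by (simp add: ds_def image_UN)
  have sm: "small \<kappa> (\<Union>l\<in>I. set (ds l))" if "finite I" for I using that by (intro small_finite) auto
  \<comment> \<open>Here the independence of \<open>c\<close> pays off: Lascar equivalent elements
    of the sequence become conjugate over \<open>c\<close>.\<close>
  have "\<exists>\<sigma>\<in>Fix (c \<union> A). ds l = map \<sigma> d" if "l < k" for l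
  proof (rule free_Lascar_conj[OF prems(2) A R_free[OF prems(2) A sm R_c]])
    show "set d \<subseteq> (\<Union>l<k. set (ds l))" using ds0 e(1) by (metis UN_upper lessThan_iff)
  qed (use Ls_ds[OF that] that in auto)
  then have "\<forall>l. \<exists>\<sigma>. l < k \<longrightarrow> \<sigma> \<in> Fix (c \<union> A) \<and> ds l = map \<sigma> d" by blast
  from choice[OF this] obtain \<rho> where r: "\<And>l. l < k \<Longrightarrow> \<rho> l \<in> Fix (c \<union> A)" "\<And>l. l < k \<Longrightarrow> ds l = map (\<rho> l) d"
    by blast
  have rA: "\<rho> l \<in> Fix A" if "l < k" for l using Fix_mono[OF r(1)[OF that]] by blast
  \<comment> \<open>Each element is independent only from the earlier ones. Base monotonicity and
    left transitivity combine this into the independence of all elements strictly between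
    \<open>r\<close> and \<open>s\<close>, taken together, from the \<open>r\<close>-th.\<close>
  have R_tail: "R (\<Union>l\<in>{r<..<s}. set (ds l)) A (set (ds r))" if "r < s" "s \<le> k" for r s
    using that
  proof (induction s)
    case (Suc s)
    show ?case
    proof (cases "r = s")
      case True
      have "{s<..<Suc s} = {}" by auto
      then show ?thesis using True R_empty[OF small_finite[of "set (ds s)"]] by simp
    next
      case False
      then have rs: "r < s" "s < k" using Suc.prems by auto
      let ?X1 = "\<Union>l\<in>{r<..<s}. set (ds l)"
      have "R (set (ds s)) A (?X1 \<union> (set (ds r) \<union> ?X1))"
        by (rule R_mono[OF _ A _ R_ds[OF rs(2)]]) (use rs in \<open>auto intro!: small_finite\<close>)
      then have "R (set (ds s)) (A \<union> ?X1) (set (ds r) \<union> ?X1)"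
        by (intro R_base) (auto intro!: small_finite A)
      then have "R (?X1 \<union> set (ds s)) A (set (ds r))"
        using Suc.IH rs by (intro R_left_trans) (auto intro!: small_finite A)
      moreover have "{r<..<Suc s} = insert s {r<..<s}" using rs by auto
      ultimately show ?thesis by (simp add: Un_commute)
    qed
  qed simp
  define c' where "c' r = (\<Union>l\<in>{r<..<k}. set (ds l)) \<union> c" for r
  have sm_c': "small \<kappa> (c' r)" for r unfolding c'_def by (intro small_Un sm prems(2)) simp
  have R_c': "R (c' r) A (set (ds r))" if "r < k" for r
  proof -
    let ?X1 = "\<Union>l\<in>{r<..<k}. set (ds l)"
    have "R c A (?X1 \<union> (set (ds r) \<union> ?X1))"
      by (rule R_mono[OF prems(2) A _ R_c]) (use that in \<open>auto intro!: small_finite\<close>)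
    then have "R c (A \<union> ?X1) (set (ds r) \<union> ?X1)"
      by (intro R_base) (auto intro!: small_finite A prems(2))
    then show ?thesis
      unfolding c'_def using R_tail[OF that] by (intro R_left_trans) (auto intro!: small_finite A prems(2))
  qed
  \<comment> \<open>The solutions still to be excluded once the elements before \<open>r\<close>
    have been treated. The inner induction on \<open>r\<close> bounds intersections of conjugates by
    \<open>\<Psi> \<union> T r\<close>, and \<open>T k\<close> is empty.\<close>
  define T where "T r = {x. length x = n \<and> (\<exists>l. r \<le> l \<and> l < k \<and> (\<exists>t\<in>set ts. holds M t (x @ ds l)))}" for r
  have "\<exists>G. finite G \<and> G \<subseteq> Fix A \<and> (\<forall>x. length x = n \<and> (\<forall>\<sigma>\<in>G. x \<in> map \<sigma> ` S) \<longrightarrow> x \<in> \<Psi> \<union> T r)"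
    if "r \<le> k" for r
    using that
  proof (induction r)
    case 0
    show ?case
    proof (intro exI[of _ "\<rho> ` {..<k}"] conjI allI impI)
      fix x assume x: "length x = n \<and> (\<forall>\<sigma>\<in>\<rho> ` {..<k}. x \<in> map \<sigma> ` S)"
      show "x \<in> \<Psi> \<union> T 0"
      proof (rule ccontr)
        assume nx: "x \<notin> \<Psi> \<union> T 0"
        \<comment> \<open>Membership in the conjugate of \<open>S\<close> by \<open>\<rho> l\<close>
          makes some formula of the list true at \<open>ds l\<close>. Outside \<open>\<Psi>\<close>
          and \<open>T 0\<close> it can only be \<open>\<theta>\<close>, which is inconsistent along
          the sequence.\<close>
        have "holds M \<theta> (x @ ds l)" if l: "l < k" for l
        proof -
          obtain y where y: "y \<in> S" "x = map (\<rho> l) y" using x l by auto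
          have "y \<notin> \<Psi>" using prems(4)[of "\<rho> l" y] r(1)[OF l] nx y(2) by (auto simp: Un_commute)
          then obtain t where t: "t \<in> set (\<theta> # ts)" "holds M t (y @ d)" using prems(5)[OF y(1)] by blast
          have "fmla M (length (y @ d)) t" using prems(1)[OF t(1)] x y(2) by simp
          then have "holds M t (x @ ds l)"
            using Aut_holds[OF FixD(1)[OF r(1)[OF l]], of "y @ d" t] t(2) by (simp add: y(2) r(2)[OF l])
          moreover have "t \<notin> set ts" using nx x l \<open>holds M t (x @ ds l)\<close> unfolding T_def by blast
          ultimately show ?thesis using t(1) by auto
        qed
        then show False using unsat x unfolding satisfiable_def by blast
      qed
    qed (use rA in auto)
  next
    case (Suc r)
    then obtain G where G: "finite G" "G \<subseteq> Fix A"
      "\<And>x. length x = n \<Longrightarrow> (\<And>\<sigma>. \<sigma> \<in> G \<Longrightarrow> x \<in> map \<sigma> ` S) \<Longrightarrow> x \<in> \<Psi> \<union> T r" by force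
    have rk: "r < k" using Suc.prems by simp
    define S' where "S' = {x. length x = n \<and> (\<forall>\<sigma>\<in>G. x \<in> map \<sigma> ` S)}"
    have "\<exists>G'. finite G' \<and> G' \<subseteq> Fix A \<and> (\<forall>x. length x = n \<and> (\<forall>\<sigma>\<in>G'. x \<in> map \<sigma> ` S') \<longrightarrow> x \<in> \<Psi> \<union> T (Suc r))"
    \<comment> \<open>The remaining formulas at \<open>ds r\<close> fall under the outer hypothesis,
      with \<open>\<Psi>\<close> enlarged by \<open>T (Suc r)\<close>. The enlarged set is invariant
      over \<open>c' r\<close> because the later elements were added there.\<close>
    proof (rule Cons.IH[of "ds r" "c' r"])
      show "fmla M (n + length (ds r)) t \<and> divides M A n t (ds r)" if "t \<in> set ts" for t
        using prems(1)[of t] that divides_Fix[OF A _ rA[OF rk]] r(2)[OF rk] len[OF rk] by auto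
      show "small \<kappa> (c' r)" by (rule sm_c')
      show "R (c' r) A (set (ds r))" by (rule R_c'[OF rk])
      show "map \<sigma> x \<in> \<Psi> \<union> T (Suc r)" if s: "\<sigma> \<in> Fix (A \<union> c' r)" and x: "x \<in> \<Psi> \<union> T (Suc r)" for \<sigma> x
      proof (cases "x \<in> \<Psi>")
        case True
        then show ?thesis using prems(4)[of \<sigma> x] Fix_mono[OF s, of "A \<union> c"] by (auto simp: c'_def)
      next
        case False
        then obtain l t where l: "length x = n" "Suc r \<le> l" "l < k" "t \<in> set ts" "holds M t (x @ ds l)"
          using x unfolding T_def by blast
        have "map \<sigma> (ds l) = ds l" using l(2,3) by (intro Fix_map[OF s]) (force simp: c'_def Suc_le_eq)
        moreover have "fmla M (length (x @ ds l)) t" using prems(1)[of t] l len by simp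
        ultimately have "holds M t (map \<sigma> x @ ds l)"
          using Aut_holds[OF FixD(1)[OF s], of "x @ ds l" t] l(5) by simp
        then show ?thesis using l unfolding T_def by auto
      qed
      show "x \<in> \<Psi> \<union> T (Suc r) \<or> (\<exists>t\<in>set ts. holds M t (x @ ds r))" if "x \<in> S'" for x
      proof -
        have "x \<in> \<Psi> \<union> T r" using G(3)[of x] that unfolding S'_def by blast
        then consider "x \<in> \<Psi>"
          | l where "length x = n" "r \<le> l" "l < k" "\<exists>t\<in>set ts. holds M t (x @ ds l)"
          unfolding T_def by blast
        then show ?thesis
        proof cases
          case 2
          show ?thesis
          proof (cases "l = r")
            case False
            then have "Suc r \<le> l" using 2(2) by simp
            then have "x \<in> T (Suc r)" unfolding T_def using 2 by blast
            then show ?thesis by blast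
          qed (use 2 in blast)
        qed simp
      qed
    qed
    then obtain G' where G': "finite G'" "G' \<subseteq> Fix A"
      "\<And>x. length x = n \<Longrightarrow> (\<And>\<sigma>. \<sigma> \<in> G' \<Longrightarrow> x \<in> map \<sigma> ` S') \<Longrightarrow> x \<in> \<Psi> \<union> T (Suc r)" by force
    show ?case
    \<comment> \<open>\<open>S'\<close> is itself an intersection of conjugates of \<open>S\<close>,
      so its conjugates are described by composed automorphisms.\<close>
    proof (intro exI[of _ "(\<lambda>(\<tau>, \<sigma>). \<tau> \<circ> \<sigma>) ` (G' \<times> G)"] conjI allI impI)
      show "finite ((\<lambda>(\<tau>, \<sigma>). \<tau> \<circ> \<sigma>) ` (G' \<times> G))" using G(1) G'(1) by simp
      show "(\<lambda>(\<tau>, \<sigma>). \<tau> \<circ> \<sigma>) ` (G' \<times> G) \<subseteq> Fix A" using G(2) G'(2) Fix_comp by fastforce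
      fix x assume x: "length x = n \<and> (\<forall>\<sigma>\<in>(\<lambda>(\<tau>, \<sigma>). \<tau> \<circ> \<sigma>) ` (G' \<times> G). x \<in> map \<sigma> ` S)"
      show "x \<in> \<Psi> \<union> T (Suc r)"
      proof (rule G'(3))
        fix \<tau> assume t: "\<tau> \<in> G'"
        then have ta: "\<tau> \<in> Aut M" using G'(2) FixD(1) by blast
        let ?y = "map (inv_into UNIV \<tau>) x"
        have "?y \<in> map \<sigma> ` S" if "\<sigma> \<in> G" for \<sigma>
        proof -
          have "x \<in> map (\<tau> \<circ> \<sigma>) ` S" using x t that by force
          then obtain z where z: "z \<in> S" "x = map (\<tau> \<circ> \<sigma>) z" by blast
          have "?y = map \<sigma> z" unfolding z(2) using Aut_inv_left[OF ta] by simp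
          then show ?thesis using z(1) by blast
        qed
        then have "?y \<in> S'" using x unfolding S'_def by simp
        moreover have "x = map \<tau> ?y" using Aut_inv_right[OF ta] by (simp add: map_idI)
        ultimately show "x \<in> map \<tau> ` S'" by blast
      qed (use x in blast)
    qed
  qed
  moreover have "T k = {}" by (auto simp: T_def)
  ultimately show ?case by (metis Un_empty_right order_refl)
qed

text \<open>With \<open>c\<close> and \<open>\<Psi>\<close> empty the broom lemma leaves an empty
  intersection.\<close>

corollary quasi_dividing:
  assumes "\<And>\<theta>. \<theta> \<in> set ts \<Longrightarrow> fmla M (n + length d) \<theta> \<and> divides M A n \<theta> d"
    and "\<And>x. x \<in> S \<Longrightarrow> \<exists>\<theta>\<in>set ts. holds M \<theta> (x @ d)"
  obtains G where "finite G" "G \<subseteq> Fix A" "\<And>x. length x = n \<Longrightarrow> \<exists>\<sigma>\<in>G. x \<notin> map \<sigma> ` S"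
proof -
  have "\<exists>G. finite G \<and> G \<subseteq> Fix A \<and> (\<forall>x. length x = n \<and> (\<forall>\<sigma>\<in>G. x \<in> map \<sigma> ` S) \<longrightarrow> x \<in> {})"
    using assms by (intro broom[of ts n d "{}"]) (auto intro: small_finite R_empty)
  then show thesis using that by auto
qed

end

section \<open>Strict realisations\<close>

text \<open>Adds dummy parameters, so that formulas with different parameters can be written over
  one tuple \<open>d\<close>.\<close>

lemma formula_select:
  assumes "set c \<subseteq> set d" "fmla M (n + length c) \<psi>"
  obtains \<theta> js where "fmla M (n + length d) \<theta>" "c = map ((!) d) js" "set js \<subseteq> {..<length d}"
    "\<And>x e. length x = n \<Longrightarrow> length e = length d \<Longrightarrow>
      holds M \<theta> (x @ e) \<longleftrightarrow> holds M \<psi> (x @ map ((!) e) js)"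
proof -
  have "(!) d ` {..<length d} = set d" by (auto simp: set_conv_nth)
  then have "set c \<subseteq> (!) d ` {..<length d}" using assms(1) by simp
  then obtain js where js: "set js \<subseteq> {..<length d}" "c = map ((!) d) js"
    using set_subset_image_list by metis
  define \<rho> where "\<rho> i = (if i < n then i else n + js ! (i - n))" for i
  have js': "js ! i < length d" if "i < length js" for i using js(1) that nth_mem by fastforce
  have f: "fmla M (n + length js) \<psi>" using assms(2) js(2) by simp
  show thesis
  proof (rule that[of "ren \<rho> \<psi>" js])
    show "fmla M (n + length d) (ren \<rho> \<psi>)"
      using js' by (intro fmla_ren[OF f]) (auto simp: \<rho>_def intro: less_le_trans)
    show "holds M (ren \<rho> \<psi>) (x @ e) \<longleftrightarrow> holds M \<psi> (x @ map ((!) e) js)"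
      if "length x = n" "length e = length d" for x e
      using that js' by (intro sat_ren[OF f]) (auto simp: \<rho>_def nth_append)
  qed (use js in auto)
qed

text \<open>The counterpart for the variables of the realisation: it adds dummy variables in
  front.\<close>

lemma formula_select_front:
  assumes "set b \<subseteq> set c" "fmla M (length b + m) \<chi>"
  obtains \<theta> js where "fmla M (length c + m) \<theta>" "b = map ((!) c) js" "set js \<subseteq> {..<length c}"
    "\<And>y e. length y = length c \<Longrightarrow> length e = m \<Longrightarrow>
      holds M \<theta> (y @ e) \<longleftrightarrow> holds M \<chi> (map ((!) y) js @ e)"
proof -
  have "(!) c ` {..<length c} = set c" by (auto simp: set_conv_nth)
  then have "set b \<subseteq> (!) c ` {..<length c}" using assms(1) by simp
  then obtain js where js: "set js \<subseteq> {..<length c}" "b = map ((!) c) js"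
    using set_subset_image_list by metis
  define \<rho> where "\<rho> i = (if i < length js then js ! i else length c + (i - length js))" for i
  have js': "js ! i < length c" if "i < length js" for i using js(1) that nth_mem by fastforce
  have f: "fmla M (length js + m) \<chi>" using assms(2) js(2) by simp
  show thesis
  proof (rule that[of "ren \<rho> \<chi>" js])
    show "fmla M (length c + m) (ren \<rho> \<chi>)"
      using js' by (intro fmla_ren[OF f]) (auto simp: \<rho>_def intro: trans_less_add1)
    show "holds M (ren \<rho> \<chi>) (y @ e) \<longleftrightarrow> holds M \<chi> (map ((!) y) js @ e)"
      if "length y = length c" "length e = m" for y e
      using that js' by (intro sat_ren[OF f]) (auto simp: \<rho>_def nth_append)
  qed (use js in auto)
qed

context suitable_monster
begin

text \<open>By compactness, arrays of every finite height with the same inconsistency bound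
  \<open>k\<close> combine into an infinite one, against NTP2. This is how a uniform bound
  \<open>K\<close> is found later.\<close>

lemma NTP2_bound:
  assumes \<phi>: "fmla M (n + m) \<phi>"
    and arrays: "\<And>K. \<exists>a. (\<forall>j i. length (a j i) = m) \<and> (\<forall>j<K. k_inconsistent M k n \<phi> (a j)) \<and>
      (\<forall>f. satisfiable M n \<phi> (\<lambda>j. a j (f j)) {..<K})"
  shows False
proof -
  define row :: "nat \<Rightarrow> nat \<Rightarrow> (nat \<times> nat \<times> nat) list" where
    "row j i = map (\<lambda>v. (j, i, v)) [0..<m]" for j i
  define f1 where "f1 = (\<lambda>(j, S) h. \<not> satisfiable M n \<phi> (\<lambda>i. map h (row j i)) S)"
  define f2 where "f2 = (\<lambda>(f, S) h. satisfiable M n \<phi> (\<lambda>j. map h (row j (f j))) S)"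
  define I1 where "I1 = (UNIV :: nat set) \<times> {S :: nat set. finite S \<and> card S = k}"
  define I2 where "I2 = (UNIV :: (nat \<Rightarrow> nat) set) \<times> {S :: nat set. finite S}"
  have row: "length (row j i) = m \<and> set (row j i) \<subseteq> UNIV" for j i by (simp add: row_def)
  have d1: "definable M UNIV (f1 x)" if "x \<in> I1" for x
  proof -
    obtain j S where x: "x = (j, S)" by (cases x)
    then show ?thesis using that \<phi> row unfolding x f1_def I1_def split
      by (intro definable_neg definable_satisfiable[where m = m]) auto
  qed
  have d2: "definable M UNIV (f2 x)" if "x \<in> I2" for x
  proof -
    obtain f S where x: "x = (f, S)" by (cases x)
    then show ?thesis using that \<phi> row unfolding x f2_def I2_def split
      by (intro definable_satisfiable[where m = m]) auto
  qed
  have sm: "small \<kappa> (UNIV :: (nat \<times> nat \<times> nat) set)" by (intro small_countable countableI_type)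
  obtain h where h: "\<And>P. P \<in> f1 ` I1 \<union> f2 ` I2 \<Longrightarrow> P h"
  proof (rule compactness[OF sm, of "f1 ` I1 \<union> f2 ` I2" "{}"])
    show "definable M UNIV P" if "P \<in> f1 ` I1 \<union> f2 ` I2" for P using that d1 d2 by blast
    fix q assume q: "q \<subseteq> f1 ` I1 \<union> f2 ` I2" "finite q"
    obtain J1 where J1: "J1 \<subseteq> I1" "finite J1" "q \<inter> f1 ` I1 = f1 ` J1"
      using finite_subset_image[of "q \<inter> f1 ` I1" f1 I1] q(2) by auto
    obtain J2 where J2: "J2 \<subseteq> I2" "finite J2" "q \<inter> f2 ` I2 = f2 ` J2"
      using finite_subset_image[of "q \<inter> f2 ` I2" f2 I2] q(2) by auto
    have "finite (fst ` J1 \<union> \<Union>(snd ` J2))" using J1 J2 by (auto simp: I2_def)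
    then obtain K where K: "\<And>j. j \<in> fst ` J1 \<union> \<Union>(snd ` J2) \<Longrightarrow> j < K"
      using finite_nat_bounded by (metis lessThan_iff subsetD)
    obtain a where a: "\<And>j i. length (a j i) = m" "\<And>j. j < K \<Longrightarrow> k_inconsistent M k n \<phi> (a j)"
      "\<And>f. satisfiable M n \<phi> (\<lambda>j. a j (f j)) {..<K}"
      using arrays[of K] by blast
    define h where "h = (\<lambda>(j, i, v). a j i ! v)"
    have row: "map h (row j i) = a j i" for j i
      using a(1)[of j i] map_nth[of "a j i"] by (simp add: row_def h_def o_def)
    have qJ: "q = f1 ` J1 \<union> f2 ` J2"
      unfolding J1(3)[symmetric] J2(3)[symmetric] Int_Un_distrib[symmetric]
      using q(1) by (rule Int_absorb2[symmetric])
    have "P h" if P: "P \<in> q" for P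
    proof -
      consider "P \<in> f1 ` J1" | "P \<in> f2 ` J2" using P unfolding qJ by (elim UnE)
      then show ?thesis
      proof cases
        case 1
        then obtain j S where jS: "(j, S) \<in> J1" "P = f1 (j, S)" by auto
        have "j < K" using K[of j] jS(1) by force
        then have "k_inconsistent M k n \<phi> (a j)" by (rule a(2))
        then show ?thesis using jS J1(1) unfolding f1_def I1_def k_inconsistent_def by (auto simp: row)
      next
        case 2
        then obtain f S where fS: "(f, S) \<in> J2" "P = f2 (f, S)" by auto
        have "S \<subseteq> {..<K}" using K fS(1) by force
        then show ?thesis using a(3)[of f] unfolding fS(2) f2_def satisfiable_def by (auto simp: row)
      qed
    qed
    then show "\<exists>h. (\<forall>v\<in>{}. h v = undefined v) \<and> (\<forall>P\<in>q. P h)" by blast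
  qed auto
  define a where "a j i = map h (row j i)" for j i
  have "k_inconsistent M k n \<phi> (a j)" for j
    unfolding k_inconsistent_def
  proof (intro allI impI)
    fix S :: "nat set" assume "finite S \<and> card S = k"
    then have "f1 (j, S) h" by (intro h[of "f1 (j, S)"]) (auto simp: I1_def)
    then show "\<not> satisfiable M n \<phi> (a j) S" by (simp add: f1_def a_def[abs_def])
  qed
  moreover have "consistent M n \<phi> (\<lambda>j. a j (f j))" for f
    unfolding consistent_def
  proof (intro allI impI)
    fix S :: "nat set" assume "finite S"
    then have "f2 (f, S) h" by (intro h[of "f2 (f, S)"]) (auto simp: I2_def)
    then show "satisfiable M n \<phi> (\<lambda>j. a j (f j)) S" by (simp add: f2_def a_def)
  qed
  moreover have "length (a j i) = m" for j i by (simp add: a_def row_def)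
  ultimately show False using NTP2 \<phi> unfolding NTP2_def by blast
qed

text \<open>
  If a finite part of the required type is inconsistent, then a disjunction of dividing formulas
  holds at all conjugates of \<open>d\<close> at once, which the broom lemma refutes.
\<close>

lemma strict_realisation:
  assumes B: "small \<kappa> B" and AB: "A \<subseteq> B"
  obtains \<sigma> where "\<sigma> \<in> Fix A"
    "\<And>ys ys' \<phi>. set ys \<subseteq> B \<Longrightarrow> set ys' \<subseteq> B \<Longrightarrow> Ls A ys ys' \<Longrightarrow> fmla M (length d + length ys) \<phi> \<Longrightarrow>
      holds M \<phi> (map \<sigma> d @ ys) \<longleftrightarrow> holds M \<phi> (map \<sigma> d @ ys')"
    "\<And>b \<chi>. set b \<subseteq> B \<Longrightarrow> fmla M (length b + length d) \<chi> \<Longrightarrow> divides M A (length b) \<chi> d \<Longrightarrow>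
      \<not> holds M \<chi> (b @ map \<sigma> d)"
proof -
  define m where "m = length d"
  define tv where "tv ys = map Inl [0..<m] @ map Inr ys" for ys :: "'m list"
  define vt where "vt b = map Inr b @ map Inl [0..<m]" for b :: "'m list"
  \<comment> \<open>The unknown is a conjugate of \<open>d\<close> over \<open>A\<close>.
    \<open>f2\<close> makes its type over \<open>B\<close> invariant under Lascar equivalence over
    \<open>A\<close>; \<open>f3\<close> forbids that a formula dividing at \<open>d\<close> holds of
    elements of \<open>B\<close> when \<open>d\<close> is replaced by it.\<close>
  define f2 where "f2 = (\<lambda>(\<phi>, ys, ys') h. holds M \<phi> (map h (tv ys)) \<longleftrightarrow> holds M \<phi> (map h (tv ys')))"
  define I2 where "I2 = {(\<phi>, ys, ys'). set ys \<subseteq> B \<and> set ys' \<subseteq> B \<and> Ls A ys ys' \<and> fmla M (m + length ys) \<phi>}"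
  define f3 where "f3 = (\<lambda>(\<chi>, b) h. \<not> holds M \<chi> (map h (vt b)))"
  define I3 where "I3 = {(\<chi>, b). set b \<subseteq> B \<and> fmla M (length b + m) \<chi> \<and> divides M A (length b) \<chi> d}"
  define \<Sigma>1 where "\<Sigma>1 = {P. definable M (Inl ` {..<m} \<union> Inr ` A) P \<and> P (case_sum ((!) d) id)}"
  define V where "V = Inl ` {..<m} \<union> Inr ` B"
  have V: "small \<kappa> V" unfolding V_def by (intro small_Plus small_nat B)
  obtain h where h: "\<And>v. v \<in> Inr ` B \<Longrightarrow> h v = case_sum ((!) d) id v"
    "\<And>P. P \<in> \<Sigma>1 \<union> f2 ` I2 \<union> f3 ` I3 \<Longrightarrow> P h"
  proof (rule compactness[OF V, of "\<Sigma>1 \<union> f2 ` I2 \<union> f3 ` I3" "Inr ` B" "case_sum ((!) d) id"])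
    show "Inr ` B \<subseteq> V" by (simp add: V_def)
    have "definable M V P" if "P \<in> \<Sigma>1" for P
      using that definable_mono[of M _ P V] AB unfolding \<Sigma>1_def V_def by blast
    moreover have "definable M V (f2 x)" if "x \<in> I2" for x
    proof -
      have tv: "definable M V (\<lambda>h. holds M \<phi> (map h (tv ys)))"
        if "fmla M (m + length ys) \<phi>" "set ys \<subseteq> B" for \<phi> ys
        using that by (intro dfnI) (auto simp: tv_def V_def)
      obtain \<phi> ys ys' where x: "x = (\<phi>, ys, ys')" by (cases x)
      then show ?thesis using that Ls_length[of A ys ys'] unfolding x f2_def I2_def split
        by (intro definable_iff tv) auto
    qed
    moreover have "definable M V (f3 x)" if "x \<in> I3" for x
    proof -
      have vt: "definable M V (\<lambda>h. holds M \<phi> (map h (vt b)))"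
        if "fmla M (length b + m) \<phi>" "set b \<subseteq> B" for \<phi> b
        using that by (intro dfnI) (auto simp: vt_def V_def)
      obtain \<chi> b where x: "x = (\<chi>, b)" by (cases x)
      then show ?thesis using that unfolding x f3_def I3_def split by (intro definable_neg vt) auto
    qed
    ultimately show "definable M V P" if "P \<in> \<Sigma>1 \<union> f2 ` I2 \<union> f3 ` I3" for P
      using that by (elim UnE imageE) simp_all
    fix q assume q: "q \<subseteq> \<Sigma>1 \<union> f2 ` I2 \<union> f3 ` I3" "finite q"
    obtain J where J: "J \<subseteq> I3" "finite J" "q \<inter> f3 ` I3 = f3 ` J"
      using finite_subset_image[of "q \<inter> f3 ` I3" f3 I3] q(2) by auto
    have "finite (\<Union>x\<in>J. set (snd x))" using J(2) by auto
    from finite_list[OF this] obtain c where c: "set c = (\<Union>x\<in>J. set (snd x))" ..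
    \<comment> \<open>The finitely many forbidden formulas are rewritten to speak about one tuple
      \<open>c\<close> from \<open>B\<close>, so that the broom lemma applies to their
      disjunction.\<close>
    have "\<exists>\<theta>. fmla M (length c + m) \<theta> \<and> divides M A (length c) \<theta> d \<and>
        (\<forall>e. length e = m \<longrightarrow> holds M (fst x) (snd x @ e) \<longrightarrow> holds M \<theta> (c @ e))" if "x \<in> J" for x
    proof -
      obtain \<chi> b where x: "x = (\<chi>, b)" by (cases x)
      then have "set b \<subseteq> set c" unfolding c using that by force
      moreover have "(\<chi>, b) \<in> I3" using that J(1) x by blast
      then have "fmla M (length b + m) \<chi>" "divides M A (length b) \<chi> d" by (simp_all add: I3_def)
      ultimately have b: "set b \<subseteq> set c" "fmla M (length b + m) \<chi>" "divides M A (length b) \<chi> d" .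
      obtain \<theta> js where \<theta>: "fmla M (length c + m) \<theta>" "b = map ((!) c) js" "set js \<subseteq> {..<length c}"
        "\<And>y e. length y = length c \<Longrightarrow> length e = m \<Longrightarrow>
          holds M \<theta> (y @ e) \<longleftrightarrow> holds M \<chi> (map ((!) y) js @ e)"
        by (rule formula_select_front[OF b(1,2)]) (rule that)
      have "divides M A (length c) \<theta> d"
        by (rule divides_transfer[OF A b(3), where f = "\<lambda>y. map ((!) y) js"])
          (use \<theta> in \<open>auto simp: m_def\<close>)
      then show ?thesis using \<theta>(1,2,4) x by (intro exI[of _ \<theta>]) auto
    qed
    then have "\<forall>x. \<exists>\<theta>. x \<in> J \<longrightarrow> fmla M (length c + m) \<theta> \<and> divides M A (length c) \<theta> d \<and>
        (\<forall>e. length e = m \<longrightarrow> holds M (fst x) (snd x @ e) \<longrightarrow> holds M \<theta> (c @ e))" by auto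
    from choice[OF this] obtain \<theta> where \<theta>: "\<And>x. x \<in> J \<Longrightarrow> fmla M (length c + m) (\<theta> x)"
      "\<And>x. x \<in> J \<Longrightarrow> divides M A (length c) (\<theta> x) d"
      "\<And>x e. x \<in> J \<Longrightarrow> length e = m \<Longrightarrow> holds M (fst x) (snd x @ e) \<Longrightarrow> holds M (\<theta> x) (c @ e)"
      by blast
    from finite_list[OF finite_imageI[OF J(2), of \<theta>]] obtain ts where ts: "set ts = \<theta> ` J" ..
    define S where "S = {y. length y = length c \<and> (\<exists>t\<in>set ts. holds M t (y @ d))}"
    obtain G where G: "finite G" "G \<subseteq> Fix A" "\<And>y. length y = length c \<Longrightarrow> \<exists>\<sigma>\<in>G. y \<notin> map \<sigma> ` S"
      by (rule quasi_dividing[of ts "length c" d S]) (use \<theta>(1,2) ts in \<open>auto simp: S_def m_def\<close>)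
    \<comment> \<open>All conjugates of \<open>d\<close> under \<open>G\<close> are made independent
      from \<open>B\<close> together, since only afterwards is it known which of them is
      suitable.\<close>
    define X where "X = (\<Union>\<sigma>\<in>G. set (map \<sigma> d))"
    have X: "small \<kappa> X" using G(1) unfolding X_def by (intro small_finite) auto
    obtain \<rho> where r: "\<rho> \<in> Fix A" "R (\<rho> ` X) A B" by (rule R_exists[OF X B])
    have ra: "\<rho> \<in> Aut M" by (rule FixD(1)[OF r(1)])
    \<comment> \<open>No tuple lies in all conjugates of \<open>S\<close>. Applied to
      \<open>c\<close> pulled back by \<open>\<rho>\<close>, this selects a conjugate
      \<open>e\<close> of \<open>d\<close> at which none of the formulas in \<open>ts\<close> holds
      of \<open>c\<close>.\<close>
    obtain \<sigma> where s: "\<sigma> \<in> G" "map (inv_into UNIV \<rho>) c \<notin> map \<sigma> ` S"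
      using G(3)[of "map (inv_into UNIV \<rho>) c"] by auto
    define \<tau> where "\<tau> = \<rho> \<circ> \<sigma>"
    have t: "\<tau> \<in> Fix A" unfolding \<tau>_def using Fix_comp[OF r(1)] s(1) G(2) by blast
    have ta: "\<tau> \<in> Aut M" by (rule FixD(1)[OF t])
    define e where "e = map \<tau> d"
    have e: "set e \<subseteq> \<rho> ` X" "length e = m" using s(1) by (auto simp: e_def \<tau>_def X_def m_def)
    have nS: "\<not> holds M (\<theta> x) (c @ e)" if x: "x \<in> J" for x
    proof
      assume hx: "holds M (\<theta> x) (c @ e)"
      define y where "y = map (inv_into UNIV \<tau>) c"
      have "c @ e = map \<tau> (y @ d)" using Aut_inv_right[OF ta] by (simp add: y_def e_def map_idI)
      then have "holds M (\<theta> x) (y @ d)"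
        using hx Aut_holds[OF ta, of "y @ d" "\<theta> x"] \<theta>(1)[OF x] by (simp add: y_def m_def)
      then have "y \<in> S" using x ts by (auto simp: S_def y_def)
      moreover have "map (inv_into UNIV \<rho>) c = map \<sigma> y"
        using Aut_inv_right[OF ta] Aut_inv_left[OF ra] unfolding y_def \<tau>_def
        by (simp add: o_def) (metis comp_apply)
      ultimately show False using s(2) by blast
    qed
    define h where "h = case_sum ((!) e) id"
    have hh: "map h (tv ys) = e @ ys" "map h (vt ys) = ys @ e" for ys
      using e(2) map_nth[of e] by (simp_all add: h_def tv_def vt_def o_def)
    have "P h" if P: "P \<in> q" for P
    proof -
      consider "P \<in> \<Sigma>1" | "P \<in> f2 ` I2" | "P \<in> f3 ` J" using P q(1) J(3) by blast
      then show ?thesis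
      proof cases
        case 1
        then have P: "definable M (Inl ` {..<m} \<union> Inr ` A) P" "P (case_sum ((!) d) id)" by (auto simp: \<Sigma>1_def)
        have "P (\<lambda>v. \<tau> (case_sum ((!) d) id v))" using Aut_definable[OF ta P(1)] P(2) by simp
        then show ?thesis using FixD(2)[OF t]
          by (subst definable_cong[OF P(1)]) (auto simp: h_def e_def m_def)
      next
        case 2
        then obtain \<phi> ys ys' where x: "P = f2 (\<phi>, ys, ys')" "set ys \<subseteq> B" "set ys' \<subseteq> B" "Ls A ys ys'"
          "fmla M (m + length ys) \<phi>" unfolding I2_def by auto
        show ?thesis unfolding x(1) f2_def split hh
          by (rule free_Lascar[OF R_free[OF small_image[OF X] A B r(2)] e(1)]) (use x e in auto)
      next
        case 3
        then obtain x where x: "x \<in> J" "P = f3 x" by blast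
        then show ?thesis using nS[OF x(1)] \<theta>(3)[OF x(1) e(2)] by (cases x) (auto simp: f3_def hh)
      qed
    qed
    then show "\<exists>h. (\<forall>v\<in>Inr ` B. h v = case_sum ((!) d) id v) \<and> (\<forall>P\<in>q. P h)"
      by (intro exI[of _ h]) (auto simp: h_def)
  qed auto
  obtain \<sigma> where s: "\<sigma> \<in> Fix A" "\<And>v. v \<in> {..<m} \<Longrightarrow> h (Inl v) = \<sigma> (d ! v)"
  proof (rule aut_over_of_definable[OF small_nat A, of "{..<m}" "(!) d" "\<lambda>v. h (Inl v)"])
    fix P assume P: "definable M (Inl ` {..<m} \<union> Inr ` A) P" "P (case_sum ((!) d) id)"
    then have "P h" using h(2) unfolding \<Sigma>1_def by blast
    then show "P (case_sum (\<lambda>v. h (Inl v)) id)"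
      using h(1) AB by (subst definable_cong[OF P(1), of _ h]) auto
  qed auto
  have hd: "map (h \<circ> Inl) [0..<m] = map \<sigma> d"
    using s(2) by (auto simp: m_def intro!: nth_equalityI)
  have hB: "map (h \<circ> Inr) ys = ys" if "set ys \<subseteq> B" for ys
    using h(1) that by (intro map_idI) auto
  show thesis
  proof (rule that[OF s(1)])
    fix ys ys' \<phi> assume ys: "set ys \<subseteq> B" "set ys' \<subseteq> B" "Ls A ys ys'" "fmla M (length d + length ys) \<phi>"
    then have "f2 (\<phi>, ys, ys') h" by (intro h(2)[of "f2 (\<phi>, ys, ys')"]) (auto simp: I2_def m_def)
    then show "holds M \<phi> (map \<sigma> d @ ys) \<longleftrightarrow> holds M \<phi> (map \<sigma> d @ ys')"
      using ys by (simp add: f2_def tv_def hd hB)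
  next
    fix b \<chi> assume b: "set b \<subseteq> B" "fmla M (length b + length d) \<chi>" "divides M A (length b) \<chi> d"
    then have "f3 (\<chi>, b) h" by (intro h(2)[of "f3 (\<chi>, b)"]) (auto simp: I3_def m_def)
    then show "\<not> holds M \<chi> (b @ map \<sigma> d)" using b by (simp add: f3_def vt_def hd hB)
  qed
qed

text \<open>A finite part of the type of \<open>d'\<close> over \<open>B\<close> is a formula
  \<open>\<chi>\<close> true of some \<open>b\<close> and \<open>d'\<close>; so it does not divide
  at \<open>d\<close>, and the witness \<open>c\<close> of dividing is not
  \<open>L\<close>-inconsistent for \<open>\<chi>\<close>, whatever \<open>L\<close> is. Hence some
  \<open>y\<close> in the place of \<open>b\<close> satisfies \<open>\<chi>\<close> with
  \<open>L\<close> of the tuples of \<open>c\<close>, which are still k-inconsistent for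
  \<open>\<theta>\<close>.\<close>

lemma dividing_row:
  assumes B: "small \<kappa> B" and \<theta>: "fmla M (n + length d) \<theta>"
    and c: "\<And>i. same_tp M A (c i) d" "k_inconsistent M k n \<theta> c"
    and nd: "\<And>b \<chi>. set b \<subseteq> B \<Longrightarrow> fmla M (length b + length d) \<chi> \<Longrightarrow> divides M A (length b) \<chi> d \<Longrightarrow>
      \<not> holds M \<chi> (b @ d')"
    and len: "length d' = length d"
  shows "\<exists>e. (\<forall>l :: nat. \<exists>\<tau>\<in>Fix B. e l = map \<tau> d') \<and> k_inconsistent M k n \<theta> e"
proof -
  define m where "m = length d"
  have lc: "length (c i) = m" for i using c(1)[of i] by (simp add: same_tp_def m_def)
  define V where "V = Inl ` B \<union> Inr ` ((UNIV :: nat set) \<times> {..<m})"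
  have V: "small \<kappa> V" unfolding V_def by (intro small_Plus B small_countable countableI_type)
  define pick :: "nat \<Rightarrow> ('m + nat \<times> nat \<Rightarrow> 'm) \<Rightarrow> nat + 'm \<Rightarrow> 'm" where
    "pick i h = (\<lambda>x. h (case x of Inl v \<Rightarrow> Inr (i, v) | Inr c \<Rightarrow> Inl c))" for i h
  define row where "row i = map (\<lambda>v. Inr (i, v) :: 'm + nat \<times> nat) [0..<m]" for i :: nat
  have dpick: "definable M V (\<lambda>h. P (pick i h))" if "definable M (Inl ` {..<m} \<union> Inr ` B) P" for P i
    unfolding pick_def using that by (rule definable_rename) (auto simp: V_def)
  define f1 where "f1 = (\<lambda>S h. \<not> satisfiable M n \<theta> (\<lambda>i. map h (row i)) S)"
  define I1 where "I1 = {S :: nat set. finite S \<and> card S = k}"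
  define f2 where "f2 = (\<lambda>(P :: (nat + 'm \<Rightarrow> 'm) \<Rightarrow> bool, i) h. P (pick i h))"
  define I2 where "I2 = {P. definable M (Inl ` {..<m} \<union> Inr ` B) P \<and> P (case_sum ((!) d') id)} \<times> (UNIV :: nat set)"
  obtain h where h: "\<And>P. P \<in> f1 ` I1 \<union> f2 ` I2 \<Longrightarrow> P h"
  \<comment> \<open>No values are prescribed on \<open>B\<close>: its elements are variables as
    well, because only a tuple \<open>y\<close> imitating \<open>b\<close> is available. An
    automorphism undoes this at the end.\<close>
  proof (rule compactness[OF V, of "f1 ` I1 \<union> f2 ` I2" "{}"])
    have "definable M V (f1 S)" if "S \<in> I1" for S
      using that \<theta> unfolding f1_def I1_def
      by (intro definable_neg definable_satisfiable[where m = m]) (auto simp: row_def V_def m_def)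
    moreover have "definable M V (f2 x)" if "x \<in> I2" for x
      using that dpick unfolding f2_def I2_def by auto
    ultimately show "definable M V P" if "P \<in> f1 ` I1 \<union> f2 ` I2" for P
      using that by (elim UnE imageE) simp_all
    fix q assume q: "q \<subseteq> f1 ` I1 \<union> f2 ` I2" "finite q"
    obtain J1 where J1: "J1 \<subseteq> I1" "finite J1" "q \<inter> f1 ` I1 = f1 ` J1"
      using finite_subset_image[of "q \<inter> f1 ` I1" f1 I1] q(2) by auto
    obtain J2 where J2: "J2 \<subseteq> I2" "finite J2" "q \<inter> f2 ` I2 = f2 ` J2"
      using finite_subset_image[of "q \<inter> f2 ` I2" f2 I2] q(2) by auto
    have "finite (\<Union>J1 \<union> snd ` J2)" using J1 J2 by (auto simp: I1_def)
    then obtain L where L: "\<And>j. j \<in> \<Union>J1 \<union> snd ` J2 \<Longrightarrow> j < L"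
      using finite_nat_bounded by (metis lessThan_iff subsetD)
    have "definable M (Inl ` {..<m} \<union> Inr ` B) (\<lambda>h. \<forall>x\<in>J2. fst x h)"
      using J2 unfolding I2_def by (intro definable_ball) auto
    then obtain \<phi> b where b: "set b \<subseteq> B" "distinct b" "fmla M (m + length b) \<phi>"
      "\<And>h. (\<forall>x\<in>J2. fst x h) \<longleftrightarrow>
        holds M \<phi> (map (\<lambda>i. h (Inl i)) [0..<m] @ map (\<lambda>v. h (Inr v)) b)"
      by (rule definable_tuple) (rule that)
    have "definable M (set (map Inr b @ map Inl [0..<m])) (\<lambda>h. holds M \<phi> (map h (map Inl [0..<m] @ map Inr b)))"
      using b(3) by (intro dfnI) auto
    then obtain \<chi> where \<chi>: "fmla M (length (map Inr b @ map Inl [0..<m])) \<chi>"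
      "\<And>h. holds M \<phi> (map h (map Inl [0..<m] @ map Inr b)) \<longleftrightarrow>
         holds M \<chi> (map h (map Inr b @ map Inl [0..<m]))"
      by (rule definable_list) (rule that)
    have \<chi>': "(\<forall>x\<in>J2. fst x h) \<longleftrightarrow> holds M \<chi> (map (\<lambda>v. h (Inr v)) b @ map (\<lambda>i. h (Inl i)) [0..<m])" for h
      using b(4)[of h] \<chi>(2)[of h] by (simp add: o_def)
    have "\<forall>x\<in>J2. fst x (case_sum ((!) d') id)" using J2(1) unfolding I2_def by auto
    then have "holds M \<chi> (b @ d')" unfolding \<chi>' using len map_nth[of d'] by (simp add: m_def)
    then have "\<not> divides M A (length b) \<chi> d" using nd[OF b(1), of \<chi>] \<chi>(1) by (auto simp: m_def)
    then have "\<not> k_inconsistent M L (length b) \<chi> c" using c(1) unfolding divides_def by blast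
    then obtain S y where S: "finite S" "card S = L" "length y = length b"
      "\<And>i. i \<in> S \<Longrightarrow> holds M \<chi> (y @ c i)" unfolding k_inconsistent_def satisfiable_def by blast
    obtain e where e: "bij_betw e {..<L} S" using ex_bij_betw_nat_finite[OF S(1)] S(2)
      by (auto simp: atLeast0LessThan)
    \<comment> \<open>The parameters \<open>b\<close> receive the values \<open>y\<close>; elements
      of \<open>B\<close> outside \<open>b\<close> receive the arbitrary value
      \<open>the None\<close>, as \<open>\<chi>\<close> does not mention them.\<close>
    define h where "h = case_sum (\<lambda>x. the (map_of (zip b y) x)) (\<lambda>(i, v). c (e i) ! v)"
    have hb: "map (\<lambda>v. h (Inl v)) b = y"
      using S(3) b(2) by (auto simp: h_def map_of_zip_nth intro!: nth_equalityI)
    have row: "map h (row i) = c (e i)" for i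
      using lc[of "e i"] map_nth[of "c (e i)"] by (simp add: row_def h_def o_def)
    have qJ: "q = f1 ` J1 \<union> f2 ` J2"
      unfolding J1(3)[symmetric] J2(3)[symmetric] Int_Un_distrib[symmetric]
      using q(1) by (rule Int_absorb2[symmetric])
    have "P h" if P: "P \<in> q" for P
    proof -
      consider "P \<in> f1 ` J1" | "P \<in> f2 ` J2" using P unfolding qJ by (elim UnE)
      then show ?thesis
      proof cases
        case 1
        then obtain T where T: "T \<in> J1" "P = f1 T" by blast
        have "T \<subseteq> {..<L}" using L T(1) by blast
        then have "card (e ` T) = card T" using e by (meson bij_betw_def card_image inj_on_subset)
        then have "\<not> satisfiable M n \<theta> c (e ` T)"
          using c(2) T(1) J1(1) unfolding k_inconsistent_def I1_def by auto
        then show ?thesis unfolding T(2) f1_def row satisfiable_def by simp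
      next
        case 2
        then obtain P' i where P': "(P', i) \<in> J2" "P = f2 (P', i)" by auto
        have "i < L" using L[of i] P'(1) by force
        then have "holds M \<chi> (y @ c (e i))" using S(4) e by (auto simp: bij_betw_def)
        moreover have "map (\<lambda>v. pick i h (Inr v)) b = y" using hb by (simp add: pick_def)
        moreover have "map (\<lambda>j. pick i h (Inl j)) [0..<m] = c (e i)"
          using row[of i] by (simp add: pick_def row_def o_def)
        ultimately have "\<forall>x\<in>J2. fst x (pick i h)" unfolding \<chi>' by simp
        then show ?thesis using P'(1) unfolding P'(2) f2_def by force
      qed
    qed
    then show "\<exists>h. (\<forall>v\<in>{}. h v = undefined v) \<and> (\<forall>P\<in>q. P h)" by blast
  qed auto
  have "\<exists>\<sigma>. \<sigma> \<in> Aut M \<and> (\<forall>v\<in>Inl ` {..<m} \<union> Inr ` B. pick i h v = \<sigma> (case_sum ((!) d') id v))" for i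
  proof -
    obtain \<sigma> where "\<sigma> \<in> Aut M"
      "\<And>v. v \<in> Inl ` {..<m} \<union> Inr ` B \<Longrightarrow> pick i h v = \<sigma> (case_sum ((!) d') id v)"
    proof (rule aut_of_definable[of "Inl ` {..<m} \<union> Inr ` B" "case_sum ((!) d') id" "pick i h"])
      show "small \<kappa> (Inl ` {..<m} \<union> Inr ` B)" by (intro small_Plus small_nat B)
      fix P assume "definable M (Inl ` {..<m} \<union> Inr ` B) P" "P (case_sum ((!) d') id)"
      then have "f2 (P, i) h" by (intro h[of "f2 (P, i)"]) (auto simp: I2_def)
      then show "P (pick i h)" by (simp add: f2_def)
    qed auto
    then show ?thesis by blast
  qed
  then have "\<forall>i. \<exists>\<sigma>. \<sigma> \<in> Aut M \<and> (\<forall>v\<in>Inl ` {..<m} \<union> Inr ` B. pick i h v = \<sigma> (case_sum ((!) d') id v))"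
    by blast
  from choice[OF this] obtain \<rho> where
    "\<forall>i. \<rho> i \<in> Aut M \<and> (\<forall>v\<in>Inl ` {..<m} \<union> Inr ` B. pick i h v = \<rho> i (case_sum ((!) d') id v))" ..
  then have r: "\<And>i. \<rho> i \<in> Aut M"
    "\<And>i v. v \<in> Inl ` {..<m} \<union> Inr ` B \<Longrightarrow> pick i h v = \<rho> i (case_sum ((!) d') id v)" by simp_all
  define x where "x i = map h (row i)" for i
  have xr: "x i = map (\<rho> i) d'" for i
  proof (rule nth_equalityI)
    fix j assume "j < length (x i)"
    then have j: "j < m" by (simp add: x_def row_def)
    then show "x i ! j = map (\<rho> i) d' ! j"
      using r(2)[of "Inl j" i] len by (simp add: x_def row_def pick_def m_def)
  qed (simp add: x_def row_def len m_def)
  have rB: "\<rho> i v = h (Inl v)" if "v \<in> B" for i v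
    using r(2)[of "Inr v" i] that by (simp add: pick_def)
  \<comment> \<open>All \<open>\<rho> i\<close> agree on \<open>B\<close>, so the inverse of one of
    them brings \<open>B\<close> back for the whole sequence.\<close>
  define \<tau> where "\<tau> = inv_into UNIV (\<rho> 0)"
  have t: "\<tau> \<in> Aut M" unfolding \<tau>_def by (rule Aut_inv[OF r(1)])
  have "\<tau> \<circ> \<rho> i \<in> Fix B" for i
  proof -
    have "\<tau> (\<rho> i v) = v" if "v \<in> B" for v
      using rB[OF that, of i] rB[OF that, of 0] Aut_inv_left[OF r(1)[of 0], of v] by (simp add: \<tau>_def)
    then show ?thesis unfolding Fix_def using Aut_comp[OF t r(1)] by simp
  qed
  then have "\<forall>l. \<exists>\<tau>'\<in>Fix B. map \<tau> (x l) = map \<tau>' d'" unfolding xr by (metis map_map)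
  moreover have "k_inconsistent M k n \<theta> x"
    unfolding k_inconsistent_def
  proof (intro allI impI)
    fix S :: "nat set" assume "finite S \<and> card S = k"
    then have "f1 S h" by (intro h[of "f1 S"]) (auto simp: I1_def)
    then show "\<not> satisfiable M n \<theta> x S" by (simp add: f1_def x_def[abs_def])
  qed
  then have "k_inconsistent M k n \<theta> (\<lambda>l. map \<tau> (x l))"
    using k_inconsistent_Aut[OF t \<theta>, of x k] len by (simp add: xr m_def)
  ultimately show ?thesis by (intro exI[of _ "\<lambda>l. map \<tau> (x l)"]) blast
qed

end

section \<open>Forking equals dividing\<close>

lemma k_inconsistent_mono:
  assumes "k_inconsistent M k n \<phi> b" "k \<le> l"
  shows "k_inconsistent M l n \<phi> b"
  unfolding k_inconsistent_def
proof (intro allI impI notI)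
  fix S assume S: "finite S \<and> card S = l" and sat: "satisfiable M n \<phi> b S"
  obtain T where T: "T \<subseteq> S" "card T = k" using obtain_subset_with_card_n[of k S] assms(2) S by auto
  then have "satisfiable M n \<phi> b T" using sat unfolding satisfiable_def by blast
  then show False using assms(1) T S finite_subset unfolding k_inconsistent_def by blast
qed

context suitable_monster
begin

text \<open>
  Kim's lemma: along a sequence of strict realisations, any witness of dividing at \<open>d\<close> can be
  copied to the rows of an array all of whose vertical paths look like the sequence itself.
\<close>

theorem simultaneous_dividing:
  assumes ts: "\<And>\<theta>. \<theta> \<in> set ts \<Longrightarrow> fmla M (n + length d) \<theta> \<and> divides M A n \<theta> d"
  obtains D K where "\<And>j. \<exists>\<sigma>\<in>Fix A. D j = map \<sigma> d" "\<And>\<theta>. \<theta> \<in> set ts \<Longrightarrow> k_inconsistent M K n \<theta> D"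
proof -
  have "\<forall>\<theta>. \<exists>k c. \<theta> \<in> set ts \<longrightarrow> (\<forall>i. same_tp M A (c i) d) \<and> k_inconsistent M k n \<theta> c"
    using ts unfolding divides_def by blast
  then obtain k c where kc: "\<And>\<theta> i. \<theta> \<in> set ts \<Longrightarrow> same_tp M A (c \<theta> i) d"
    "\<And>\<theta>. \<theta> \<in> set ts \<Longrightarrow> k_inconsistent M (k \<theta>) n \<theta> (c \<theta>)" by metis
  obtain N where N: "small \<kappa> N" "elem_submodel M N" "A \<subseteq> N" by (rule small_elem_submodel[OF A])
  \<comment> \<open>A state holds the set collected so far, the latest realisation of the type of
    \<open>d\<close> and the dividing sequences copied to it. \<open>linv\<close> is
    Lascar-invariance of the new realisation over the old set; \<open>rows\<close> says that the
    copies are conjugate to it over the old set.\<close>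
  define P where "P = (\<lambda>(S, d', e :: ('f, 'p) fm \<Rightarrow> nat \<Rightarrow> 'm list). small \<kappa> S \<and> N \<subseteq> S \<and>
    (\<exists>\<sigma>\<in>Fix A. d' = map \<sigma> d) \<and> set d' \<subseteq> S \<and> (\<forall>\<theta>\<in>set ts. \<forall>l. set (e \<theta> l) \<subseteq> S))"
  define linv where "linv S d' \<longleftrightarrow> (\<forall>ys ys' \<phi>. set ys \<subseteq> S \<and> set ys' \<subseteq> S \<and> Ls A ys ys' \<and>
    fmla M (length d + length ys) \<phi> \<longrightarrow> (holds M \<phi> (d' @ ys) \<longleftrightarrow> holds M \<phi> (d' @ ys')))" for S d'
  define rows where "rows S d' e \<longleftrightarrow> (\<forall>\<theta>\<in>set ts. (\<forall>l. \<exists>\<tau>\<in>Fix S. e \<theta> l = map \<tau> d') \<and>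
    k_inconsistent M (k \<theta>) n \<theta> (e \<theta>))" for S d' and e :: "('f, 'p) fm \<Rightarrow> nat \<Rightarrow> 'm list"
  define Q where "Q = (\<lambda>(S, d0 :: 'm list, e0 :: ('f, 'p) fm \<Rightarrow> nat \<Rightarrow> 'm list) (S', d', e).
    S \<subseteq> S' \<and> linv S d' \<and> rows S d' e)"
  have "\<exists>f. \<forall>j. P (f j) \<and> Q (f j) (f (Suc j))"
  proof (rule dependent_nat_choice)
    have "small \<kappa> (N \<union> set d)" by (intro small_Un N small_finite) simp
    then have "P (N \<union> set d, d, \<lambda>_ _. d)"
      unfolding P_def using Fix_id[of A] by (auto intro!: bexI[of _ id])
    then show "\<exists>x. P x" by blast
  next
    fix x and j :: nat assume "P x"
    moreover obtain S d0 e0 where x: "x = (S, d0, e0)" by (cases x)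
    ultimately have S: "small \<kappa> S" "N \<subseteq> S" by (auto simp: P_def)
    then have AS: "A \<subseteq> S" using N(3) by blast
    obtain \<sigma> where s: "\<sigma> \<in> Fix A"
      "\<And>ys ys' \<phi>. set ys \<subseteq> S \<Longrightarrow> set ys' \<subseteq> S \<Longrightarrow> Ls A ys ys' \<Longrightarrow> fmla M (length d + length ys) \<phi> \<Longrightarrow>
        holds M \<phi> (map \<sigma> d @ ys) \<longleftrightarrow> holds M \<phi> (map \<sigma> d @ ys')"
      "\<And>b \<chi>. set b \<subseteq> S \<Longrightarrow> fmla M (length b + length d) \<chi> \<Longrightarrow> divides M A (length b) \<chi> d \<Longrightarrow>
        \<not> holds M \<chi> (b @ map \<sigma> d)"
      by (rule strict_realisation[OF S(1) AS, of d]) (rule that)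
    have "\<exists>e. (\<forall>l :: nat. \<exists>\<tau>\<in>Fix S. e l = map \<tau> (map \<sigma> d)) \<and> k_inconsistent M (k \<theta>) n \<theta> e"
      if t: "\<theta> \<in> set ts" for \<theta>
      using ts[OF t] by (intro dividing_row[OF S(1) _ kc[OF t] s(3)]) auto
    then have "\<forall>\<theta>. \<exists>e. \<theta> \<in> set ts \<longrightarrow>
      (\<forall>l :: nat. \<exists>\<tau>\<in>Fix S. e l = map \<tau> (map \<sigma> d)) \<and> k_inconsistent M (k \<theta>) n \<theta> e" by blast
    from choice[OF this] obtain e where e: "rows S (map \<sigma> d) e" unfolding rows_def by blast
    define S' where "S' = S \<union> (set (map \<sigma> d) \<union> (\<Union>\<theta>\<in>set ts. \<Union>l. set (e \<theta> l)))"
    have "small \<kappa> S'"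
      unfolding S'_def
      by (intro small_Un S(1) small_countable countable_UN countable_Un) (auto intro: countable_finite)
    then have "P (S', map \<sigma> d, e)"
      unfolding P_def using S(2) s(1) by (auto simp: S'_def)
    moreover have "Q x (S', map \<sigma> d, e)"
      unfolding Q_def x linv_def using e s(2) by (auto simp: S'_def)
    ultimately show "\<exists>y. P y \<and> Q x y" by blast
  qed
  then obtain f where f: "\<And>j. P (f j)" "\<And>j. Q (f j) (f (Suc j))" by blast
  define T where "T j = fst (f j)" for j
  define D where "D j = fst (snd (f (Suc j)))" for j
  define E where "E j = snd (snd (f (Suc j)))" for j
  have PT: "small \<kappa> (T j)" "N \<subseteq> T j" for j
    using f(1)[of j] unfolding P_def T_def by (auto split: prod.splits)
  have PD: "\<exists>\<sigma>\<in>Fix A. D j = map \<sigma> d" "set (D j) \<subseteq> T (Suc j)"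
    "\<And>\<theta> l. \<theta> \<in> set ts \<Longrightarrow> set (E j \<theta> l) \<subseteq> T (Suc j)" for j
    using f(1)[of "Suc j"] unfolding P_def T_def D_def E_def by (auto split: prod.splits)
  have QT: "T j \<subseteq> T (Suc j)" "linv (T j) (D j)" "rows (T j) (D j) (E j)" for j
    using f(2)[of j] unfolding Q_def T_def D_def E_def by (auto split: prod.splits)
  have Tmono: "T i \<subseteq> T j" if "i \<le> j" for i j using QT(1) that by (rule lift_Suc_mono_le)
  have lD: "length (D j) = length d" for j using PD(1)[of j] by auto
  \<comment> \<open>By induction: invariance of \<open>D j\<close> yields an automorphism that
    agrees with \<open>\<sigma>\<close> on the earlier realisations and fixes \<open>D j\<close>. An
    automorphism over \<open>T j\<close> then moves \<open>D j\<close> to the chosen element of its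
    row without disturbing the earlier rows.\<close>
  have path: "\<exists>\<sigma>\<in>Fix N. \<forall>i<j. E i \<theta> (g i) = map \<sigma> (D i)" if t: "\<theta> \<in> set ts" for \<theta> g j
  proof (induction j)
    case 0
    show ?case using Fix_id by auto
  next
    case (Suc j)
    then obtain \<sigma> where s: "\<sigma> \<in> Fix N" "\<And>i. i < j \<Longrightarrow> E i \<theta> (g i) = map \<sigma> (D i)" by blast
    have "finite (\<Union>i<j. set (D i))" by simp
    from finite_list[OF this] obtain ys where ys: "set ys = (\<Union>i<j. set (D i))" ..
    have sub: "set ys \<subseteq> T j" "set (map \<sigma> ys) \<subseteq> T j"
    proof -
      show "set ys \<subseteq> T j" unfolding ys using PD(2) Tmono by (meson UN_least Suc_leI lessThan_iff order_trans)
      have "\<sigma> ` set (D i) \<subseteq> T j" if "i < j" for i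
        using PD(3)[OF t, of i "g i"] s(2)[OF that] Tmono[of "Suc i" j] that by auto
      then show "set (map \<sigma> ys) \<subseteq> T j" by (auto simp: ys)
    qed
    \<comment> \<open>\<open>\<sigma>\<close> fixes the model \<open>N\<close>, so \<open>ys\<close>
      and its image are Lascar equivalent, also when followed by parameters from
      \<open>N\<close>.\<close>
    have "same_tp M N (D j @ ys) (D j @ map \<sigma> ys)"
      unfolding same_tp_def
    proof (intro conjI allI impI)
      fix \<phi> c assume c: "set c \<subseteq> N \<and> fmla M (length (D j @ ys) + length c) \<phi>"
      have "Ls A (ys @ c) (map \<sigma> (ys @ c))" by (rule Ls_strong[OF N s(1)])
      then have "Ls A (ys @ c) (map \<sigma> ys @ c)" using Fix_map[OF s(1), of c] c by simp
      then have "holds M \<phi> (D j @ (ys @ c)) \<longleftrightarrow> holds M \<phi> (D j @ (map \<sigma> ys @ c))"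
        using QT(2)[of j, unfolded linv_def, rule_format, of "ys @ c" "map \<sigma> ys @ c" \<phi>] sub PT(2)[of j] c
        by (auto simp: lD add.assoc)
      then show "holds M \<phi> ((D j @ ys) @ c) \<longleftrightarrow> holds M \<phi> ((D j @ map \<sigma> ys) @ c)" by simp
    qed simp
    then obtain \<rho> where r: "\<rho> \<in> Fix N" "D j @ map \<sigma> ys = map \<rho> (D j @ ys)"
      using same_tp_iff[OF N(1)] by blast
    have r1: "map \<rho> (D j) = D j" and r2: "\<And>v. v \<in> set ys \<Longrightarrow> \<rho> v = \<sigma> v" using r(2) by auto
    obtain \<tau> where \<tau>: "\<tau> \<in> Fix (T j)" "E j \<theta> (g j) = map \<tau> (D j)"
      using QT(3)[of j] t unfolding rows_def by blast
    have "E i \<theta> (g i) = map (\<tau> \<circ> \<rho>) (D i)" if "i < Suc j" for i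
    proof (cases "i = j")
      case True
      then show ?thesis using \<tau>(2) r1 by (metis map_map)
    next
      case False
      then have i: "i < j" using that by simp
      have "map \<rho> (D i) = map \<sigma> (D i)" using r2 ys i by auto
      then have *: "map \<rho> (D i) = E i \<theta> (g i)" using s(2)[OF i] by simp
      have "set (E i \<theta> (g i)) \<subseteq> T j" using PD(3)[OF t] Tmono[of "Suc i" j] i by (meson Suc_leI order_trans)
      then have "map \<tau> (E i \<theta> (g i)) = E i \<theta> (g i)" by (rule Fix_map[OF \<tau>(1)])
      then show ?thesis using * by (metis map_map)
    qed
    moreover have "\<tau> \<circ> \<rho> \<in> Fix N" using Fix_comp[OF Fix_mono[OF \<tau>(1) PT(2)] r(1)] .
    ultimately show ?case by blast
  qed
  have "\<exists>K. k_inconsistent M K n \<theta> D" if t: "\<theta> \<in> set ts" for \<theta>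
  proof (rule ccontr)
    \<comment> \<open>If for every \<open>K\<close> some \<open>K\<close> instances along
      \<open>D\<close> had a common solution, the rows with these indices would form an array of
      height \<open>K\<close> whose paths are conjugate to those instances, hence
      satisfiable.\<close>
    assume no: "\<nexists>K. k_inconsistent M K n \<theta> D"
    have f: "fmla M (n + length d) \<theta>" using ts t by blast
    have lE: "length (E j \<theta> l) = length d" for j l
      using QT(3)[of j] t lD unfolding rows_def by (metis length_map)
    show False
    proof (rule NTP2_bound[OF f])
      fix K
      obtain S where S: "finite S" "card S = K" "satisfiable M n \<theta> D S"
        using no unfolding k_inconsistent_def by blast
      obtain e where e: "bij_betw e {..<K} S"
        using ex_bij_betw_nat_finite[OF S(1)] S(2) by (auto simp: atLeast0LessThan)
      obtain J where J: "\<And>i. i \<in> S \<Longrightarrow> i < J" using finite_nat_bounded[OF S(1)] by auto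
      have "satisfiable M n \<theta> (\<lambda>j. E (e j) \<theta> (g j)) {..<K}" for g
      proof -
        \<comment> \<open>The path is given by its entries at the rows in \<open>S\<close>, numbered
          by \<open>e\<close>; \<open>g'\<close> transfers it to the original numbering.\<close>
        define g' where "g' i = g (the_inv_into {..<K} e i)" for i
        obtain \<sigma> where s: "\<sigma> \<in> Fix N" "\<And>i. i < J \<Longrightarrow> E i \<theta> (g' i) = map \<sigma> (D i)"
          using path[OF t, of J g'] by blast
        have "satisfiable M n \<theta> (\<lambda>i. map \<sigma> (D i)) S"
          using satisfiable_Aut[OF FixD(1)[OF s(1)] f, of S D] S(3) lD by simp
        then obtain a where a: "length a = n" "\<And>i. i \<in> S \<Longrightarrow> holds M \<theta> (a @ map \<sigma> (D i))"
          unfolding satisfiable_def by blast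
        have "holds M \<theta> (a @ E (e j) \<theta> (g j))" if "j < K" for j
        proof -
          have "e j \<in> S" using e that by (auto simp: bij_betw_def)
          moreover have "g' (e j) = g j"
            using e that by (simp add: g'_def bij_betw_def the_inv_into_f_f)
          ultimately show ?thesis using a(2)[of "e j"] s(2)[of "e j"] J by simp
        qed
        then show ?thesis using a(1) unfolding satisfiable_def by auto
      qed
      moreover have "k_inconsistent M (k \<theta>) n \<theta> (E j \<theta>)" for j
        using QT(3)[of j] t unfolding rows_def by blast
      ultimately show "\<exists>a. (\<forall>j i. length (a j i) = length d) \<and> (\<forall>j<K. k_inconsistent M (k \<theta>) n \<theta> (a j)) \<and>
          (\<forall>f. satisfiable M n \<theta> (\<lambda>j. a j (f j)) {..<K})"
        using lE by (intro exI[of _ "\<lambda>j. E (e j) \<theta>"]) auto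
    qed
  qed
  then obtain K where K: "\<And>\<theta>. \<theta> \<in> set ts \<Longrightarrow> k_inconsistent M (K \<theta>) n \<theta> D" by metis
  have "k_inconsistent M (Max (K ` set ts)) n \<theta> D" if "\<theta> \<in> set ts" for \<theta>
    using k_inconsistent_mono[OF K[OF that]] that by simp
  then show thesis using that[of D] PD(1) by blast
qed

text \<open>The tuple \<open>d\<close> contains \<open>b\<close> and all parameters of the
  disjuncts. Conjugates of \<open>d\<close> that serve every disjunct therefore carry conjugates of
  \<open>b\<close>, and these witness that \<open>\<phi>\<close> divides.\<close>

theorem forks_imp_divides:
  assumes \<phi>: "fmla M (n + length b) \<phi>" and fk: "forks M A n \<phi> b"
  shows "divides M A n \<phi> b"
proof -
  obtain \<Psi> where "finite \<Psi>" "\<forall>(\<psi>, c)\<in>\<Psi>. fmla M (n + length c) \<psi> \<and> divides M A n \<psi> c"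
    "\<forall>a. length a = n \<and> holds M \<phi> (a @ b) \<longrightarrow> (\<exists>(\<psi>, c)\<in>\<Psi>. holds M \<psi> (a @ c))"
    using fk unfolding forks_def by auto
  then have \<Psi>: "finite \<Psi>" "\<And>\<psi> c. (\<psi>, c) \<in> \<Psi> \<Longrightarrow> fmla M (n + length c) \<psi> \<and> divides M A n \<psi> c"
    "\<And>a. length a = n \<Longrightarrow> holds M \<phi> (a @ b) \<Longrightarrow> \<exists>x\<in>\<Psi>. holds M (fst x) (a @ snd x)"
    by (auto simp: split_beta)
  have "finite (set b \<union> (\<Union>x\<in>\<Psi>. set (snd x)))" using \<Psi>(1) by simp
  from finite_list[OF this] obtain d where d: "set d = set b \<union> (\<Union>x\<in>\<Psi>. set (snd x))" ..
  have "\<exists>\<theta>. fmla M (n + length d) \<theta> \<and> divides M A n \<theta> d \<and>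
      (\<forall>a. length a = n \<longrightarrow> holds M (fst x) (a @ snd x) \<longrightarrow> holds M \<theta> (a @ d))" if "x \<in> \<Psi>" for x
  proof -
    obtain \<psi> c where x: "x = (\<psi>, c)" by (cases x)
    have c: "fmla M (n + length c) \<psi>" "divides M A n \<psi> c" using \<Psi>(2) that x by auto
    have cd: "set c \<subseteq> set d" unfolding d using that x by force
    obtain \<theta> js where \<theta>: "fmla M (n + length d) \<theta>" "c = map ((!) d) js" "set js \<subseteq> {..<length d}"
      "\<And>x e. length x = n \<Longrightarrow> length e = length d \<Longrightarrow>
        holds M \<theta> (x @ e) \<longleftrightarrow> holds M \<psi> (x @ map ((!) e) js)"
      by (rule formula_select[OF cd c(1)]) (rule that)
    have js: "map ((!) (map \<sigma> d)) js = map \<sigma> c" for \<sigma> using \<theta>(2,3) by auto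
    have "divides M A n \<theta> d"
    proof (rule divides_transfer[OF A c(2), where f = id])
      show "holds M \<psi> (id x @ map \<sigma> c)" if "length x = n" "holds M \<theta> (x @ map \<sigma> d)" for \<sigma> x
        using \<theta>(4)[of x "map \<sigma> d"] that unfolding js by simp
    qed simp
    then show ?thesis using \<theta>(1,2,4) x by (intro exI[of _ \<theta>]) auto
  qed
  then have "\<forall>x. \<exists>\<theta>. x \<in> \<Psi> \<longrightarrow> fmla M (n + length d) \<theta> \<and> divides M A n \<theta> d \<and>
      (\<forall>a. length a = n \<longrightarrow> holds M (fst x) (a @ snd x) \<longrightarrow> holds M \<theta> (a @ d))" by auto
  from choice[OF this] obtain \<theta> where \<theta>: "\<And>x. x \<in> \<Psi> \<Longrightarrow> fmla M (n + length d) (\<theta> x)"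
    "\<And>x. x \<in> \<Psi> \<Longrightarrow> divides M A n (\<theta> x) d"
    "\<And>x a. x \<in> \<Psi> \<Longrightarrow> length a = n \<Longrightarrow> holds M (fst x) (a @ snd x) \<Longrightarrow> holds M (\<theta> x) (a @ d)"
    by blast
  from finite_list[OF finite_imageI[OF \<Psi>(1), of \<theta>]] obtain ts where ts: "set ts = \<theta> ` \<Psi>" ..
  obtain D K where D: "\<And>j. \<exists>\<sigma>\<in>Fix A. D j = map \<sigma> d" "\<And>t. t \<in> set ts \<Longrightarrow> k_inconsistent M K n t D"
  proof (rule simultaneous_dividing[of ts n d])
    show "fmla M (n + length d) t \<and> divides M A n t d" if "t \<in> set ts" for t
      using that \<theta>(1,2) ts by auto
  qed (rule that)
  have "\<forall>j. \<exists>\<sigma>. \<sigma> \<in> Fix A \<and> D j = map \<sigma> d" using D(1) by blast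
  from choice[OF this] obtain \<sigma> where s: "\<And>j. \<sigma> j \<in> Fix A" "\<And>j. D j = map (\<sigma> j) d" by blast
  have "same_tp M A (map (\<sigma> j) b) b" for j
    unfolding same_tp_iff[OF A] using Fix_inv[OF s(1)[of j]] Aut_inv_left[OF FixD(1)[OF s(1)[of j]]]
    by (intro bexI[of _ "inv_into UNIV (\<sigma> j)"]) (simp_all add: map_idI)
  \<comment> \<open>A common solution satisfies some disjunct at every index; among more than
    \<open>card (set ts) * K\<close> indices one disjunct occurs more than \<open>K\<close>
    times.\<close>
  moreover have "k_inconsistent M (Suc (card (set ts) * K)) n \<phi> (\<lambda>j. map (\<sigma> j) b)"
    unfolding k_inconsistent_def
  proof (intro allI impI notI)
    fix S :: "nat set" assume S: "finite S \<and> card S = Suc (card (set ts) * K)"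
      and "satisfiable M n \<phi> (\<lambda>j. map (\<sigma> j) b) S"
    then obtain a where a: "length a = n" "\<And>j. j \<in> S \<Longrightarrow> holds M \<phi> (a @ map (\<sigma> j) b)"
      unfolding satisfiable_def by blast
    define U where "U t = {j \<in> S. holds M t (a @ D j)}" for t
    have "\<exists>t\<in>set ts. j \<in> U t" if j: "j \<in> S" for j
    proof -
      \<comment> \<open>That the disjuncts cover \<open>\<phi>\<close> is known at \<open>b\<close>
        only, so \<open>a\<close> is pulled back by \<open>\<sigma> j\<close>, treated there, and
        moved forward again.\<close>
      define a' where "a' = map (inv_into UNIV (\<sigma> j)) a"
      have sj: "\<sigma> j \<in> Aut M" by (rule FixD(1)[OF s(1)])
      have a': "a = map (\<sigma> j) a'" "length a' = n" using a(1) Aut_inv_right[OF sj] by (simp_all add: a'_def map_idI)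
      have "holds M \<phi> (map (\<sigma> j) (a' @ b))" using a(2)[OF j] a'(1) by simp
      then have "holds M \<phi> (a' @ b)" using Aut_holds[OF sj, of "a' @ b" \<phi>] \<phi> a'(2) by simp
      then obtain x where x: "x \<in> \<Psi>" "holds M (fst x) (a' @ snd x)" using \<Psi>(3)[OF a'(2)] by blast
      have "holds M (\<theta> x) (a' @ d)" by (rule \<theta>(3)[OF x(1) a'(2) x(2)])
      then have "holds M (\<theta> x) (map (\<sigma> j) (a' @ d))"
        using Aut_holds[OF sj, of "a' @ d" "\<theta> x"] \<theta>(1)[OF x(1)] a'(2) by simp
      then have "holds M (\<theta> x) (a @ D j)" using a'(1) s(2) by simp
      then show ?thesis using x(1) ts j unfolding U_def by blast
    qed
    then have "S \<subseteq> (\<Union>t\<in>set ts. U t)" by blast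
    moreover have finU: "finite (U t)" for t using S by (simp add: U_def)
    ultimately have "card S \<le> card (\<Union>t\<in>set ts. U t)" by (intro card_mono) auto
    also have "\<dots> \<le> (\<Sum>t\<in>set ts. card (U t))" by (rule card_UN_le) simp
    finally have le: "card S \<le> (\<Sum>t\<in>set ts. card (U t))" .
    have "\<exists>t\<in>set ts. K < card (U t)"
    proof (rule ccontr)
      assume "\<not> ?thesis"
      then have "(\<Sum>t\<in>set ts. card (U t)) \<le> card (set ts) * K"
        using sum_bounded_above[of "set ts" "\<lambda>t. card (U t)" K] by (auto simp: not_less)
      then show False using le S by simp
    qed
    then obtain t where t: "t \<in> set ts" "K \<le> card (U t)" by force
    obtain W where W: "W \<subseteq> U t" "card W = K" "finite W"
      using obtain_subset_with_card_n[OF t(2)] finU finite_subset by metis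
    have "satisfiable M n t D W" using W(1) a(1) unfolding satisfiable_def U_def by blast
    then show False using D(2)[OF t(1)] W unfolding k_inconsistent_def by blast
  qed
  ultimately show ?thesis unfolding divides_def
    by (intro exI[of _ "Suc (card (set ts) * K)"] exI[of _ "\<lambda>j. map (\<sigma> j) b"]) simp
qed

end

lemma divides_imp_forks:
  assumes "fmla M (n + length b) \<phi>" "divides M A n \<phi> b"
  shows "forks M A n \<phi> b"
  unfolding forks_def using assms by (intro exI[of _ "{(\<phi>, b)}"]) auto

context suitable_monster
begin

corollary forking_eq_dividing: "forking_eq_dividing M A"
  unfolding forking_eq_dividing_def using forks_imp_divides divides_imp_forks by blast

end

section \<open>Indiscernible sequences and Lascar equivalence\<close>

lemma increasing_nth:
  "increasing r is \<longleftrightarrow> set is \<subseteq> Field r \<and>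
    (\<forall>i j. i < j \<longrightarrow> j < length is \<longrightarrow> (is ! i, is ! j) \<in> r \<and> is ! i \<noteq> is ! j)"
  unfolding increasing_def sorted_wrt_iff_nth_less by blast

lemma increasing_distinct: "increasing r is \<Longrightarrow> distinct is"
  unfolding increasing_nth distinct_conv_nth by (metis nat_neq_iff)

lemma increasing_exists:
  assumes r: "Linear_order r" and "finite K" "K \<subseteq> Field r"
  shows "\<exists>ks. increasing r ks \<and> set ks = K"
  using assms(2,3)
proof (induction K rule: finite_induct)
  case empty
  then show ?case by (auto simp: increasing_def)
next
  case (insert x K)
  then obtain ks where ks: "increasing r ks" "set ks = K" by auto
  have tot: "(i, j) \<in> r \<or> (j, i) \<in> r" if "i \<in> Field r" "j \<in> Field r" "i \<noteq> j" for i j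
    using r that unfolding linear_order_on_def total_on_def by blast
  have trans: "(i, k) \<in> r \<and> i \<noteq> k" if "(i, j) \<in> r \<and> i \<noteq> j" "(j, k) \<in> r \<and> j \<noteq> k" for i j k
    using r that unfolding order_on_defs trans_def antisym_def by metis
  let ?lo = "filter (\<lambda>y. (y, x) \<in> r) ks" and ?hi = "filter (\<lambda>y. (y, x) \<notin> r) ks"
  have sw: "sorted_wrt (\<lambda>i j. (i, j) \<in> r \<and> i \<noteq> j) ks" using ks(1) by (simp add: increasing_def)
  have lo: "(y, x) \<in> r \<and> y \<noteq> x" if "y \<in> set ?lo" for y using that insert(2) ks(2) by auto
  have hi: "(x, y) \<in> r \<and> x \<noteq> y" if "y \<in> set ?hi" for y
    using that insert(2,4) ks(2) tot[of x y] by auto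
  have "sorted_wrt (\<lambda>i j. (i, j) \<in> r \<and> i \<noteq> j) (?lo @ x # ?hi)"
    unfolding sorted_wrt_append sorted_wrt.simps
  proof (intro conjI ballI)
    show "sorted_wrt (\<lambda>i j. (i, j) \<in> r \<and> i \<noteq> j) ?lo" "sorted_wrt (\<lambda>i j. (i, j) \<in> r \<and> i \<noteq> j) ?hi"
      using sw by (simp_all add: sorted_wrt_filter)
    show "(y, z) \<in> r" "y \<noteq> z" if y: "y \<in> set ?lo" and z: "z \<in> set (x # ?hi)" for y z
    proof -
      have "(y, z) \<in> r \<and> y \<noteq> z"
      proof (cases "z = x")
        case True
        then show ?thesis using lo[OF y] by simp
      next
        case False
        then have "z \<in> set ?hi" using z by auto
        from trans[OF lo[OF y] hi[OF this]] show ?thesis .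
      qed
      then show "(y, z) \<in> r" "y \<noteq> z" by auto
    qed
  qed (use hi in auto)
  moreover have "set (?lo @ x # ?hi) = insert x K" using ks(2) by auto
  ultimately show ?case using insert(4) unfolding increasing_def
    by (intro exI[of _ "?lo @ x # ?hi"]) simp
qed

lemma increasing_unique:
  assumes r: "Linear_order r" and "increasing r ks" "increasing r ks'" "set ks = set ks'"
  shows "ks = ks'"
  using assms(2-)
proof (induction ks arbitrary: ks')
  case Nil
  then show ?case by simp
next
  case (Cons x xs)
  then obtain y ys where ks': "ks' = y # ys" by (cases ks') auto
  have antisym: "i = j" if "(i, j) \<in> r" "(j, i) \<in> r" for i j
    using r that unfolding order_on_defs antisym_def by blast
  have "x = y"
  proof (rule ccontr)
    assume ne: "x \<noteq> y"
    then have "x \<in> set ys" "y \<in> set xs" using Cons.prems(3) ks' by auto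
    then have "(y, x) \<in> r" "(x, y) \<in> r" using Cons.prems(1,2) ks' by (auto simp: increasing_def)
    then show False using ne antisym by blast
  qed
  moreover have "set xs = set ys"
    using Cons.prems increasing_distinct[OF Cons.prems(1)] increasing_distinct[OF Cons.prems(2)] \<open>x = y\<close>
    unfolding ks' by (auto simp: insert_ident)
  ultimately show ?case
    using Cons.IH[of ys] Cons.prems(1,2) unfolding ks' by (simp add: increasing_def)
qed

lemma increasing_sub:
  assumes "increasing r ks" "sorted_wrt (<) p" "set p \<subseteq> {..<length ks}"
  shows "increasing r (map ((!) ks) p)"
proof -
  have p: "p ! j < length ks" if "j < length p" for j using assms(3) that nth_mem by fastforce
  show ?thesis
    unfolding increasing_nth
  proof (intro conjI allI impI)
    show "set (map ((!) ks) p) \<subseteq> Field r"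
      using assms(1,3) unfolding increasing_nth by (auto intro: nth_mem)
    fix i j assume ij: "i < j" "j < length (map ((!) ks) p)"
    then have "p ! i < p ! j" using assms(2) by (simp add: sorted_wrt_iff_nth_less)
    then show "(map ((!) ks) p ! i, map ((!) ks) p ! j) \<in> r" "map ((!) ks) p ! i \<noteq> map ((!) ks) p ! j"
      using assms(1) p[of j] ij unfolding increasing_nth by auto
  qed
qed

text \<open>Two increasing lists can be compared inside a common one, where only their positions
  matter.\<close>

lemma increasing_positions:
  assumes r: "Linear_order r" and ks: "increasing r ks" and "is": "increasing r is" "set is \<subseteq> set ks"
  obtains p where "sorted_wrt (<) p" "set p \<subseteq> {..<length ks}" "is = map ((!) ks) p"
proof -
  have antisym: "i = j" if "(i, j) \<in> r" "(j, i) \<in> r" for i j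
    using r that unfolding order_on_defs antisym_def by blast
  have "(!) ks ` {..<length ks} = set ks" by (auto simp: set_conv_nth)
  then have "set is \<subseteq> (!) ks ` {..<length ks}" using "is"(2) by simp
  then obtain p where p: "set p \<subseteq> {..<length ks}" "is = map ((!) ks) p"
    using set_subset_image_list by metis
  have "p ! i < p ! j" if ij: "i < j" "j < length p" for i j
  proof (rule ccontr)
    assume "\<not> p ! i < p ! j"
    then have le: "p ! j \<le> p ! i" by simp
    have "p ! i \<in> set p" "p ! j \<in> set p" using ij by simp_all
    then have l: "p ! i < length ks" "p ! j < length ks" using p(1) by auto
    have lt: "(ks ! (p ! i), ks ! (p ! j)) \<in> r" "ks ! (p ! i) \<noteq> ks ! (p ! j)"
      using "is"(1) ij unfolding increasing_nth p(2) by auto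
    then have "p ! j < p ! i" using le by (metis nat_less_le)
    then have "(ks ! (p ! j), ks ! (p ! i)) \<in> r" using ks l unfolding increasing_nth by blast
    then show False using lt antisym by blast
  qed
  then show thesis using p by (intro that[of p]) (simp_all add: sorted_wrt_iff_nth_less)
qed

text \<open>\<open>Ramsey\<close> colours by numbers; here sets of formulas serve as colours and are
  numbered first.\<close>

lemma Ramsey_finite_colours:
  assumes Z: "infinite (Z :: 'a set)" and fin: "finite (range f)"
  obtains Y where "Y \<subseteq> Z" "infinite Y"
    "\<And>X X'. X \<subseteq> Y \<Longrightarrow> finite X \<Longrightarrow> card X = n \<Longrightarrow> X' \<subseteq> Y \<Longrightarrow> finite X' \<Longrightarrow> card X' = n \<Longrightarrow> f X = f X'"
proof -
  obtain g :: "_ \<Rightarrow> nat" where g: "bij_betw g (range f) {0..<card (range f)}"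
    using ex_bij_betw_finite_nat[OF fin] by blast
  have "\<forall>X. X \<subseteq> Z \<and> finite X \<and> card X = n \<longrightarrow> g (f X) < card (range f)"
    using g by (auto simp: bij_betw_def)
  from Ramsey[OF Z this] obtain Y t where Y: "Y \<subseteq> Z" "infinite Y"
    "\<forall>X. X \<subseteq> Y \<and> finite X \<and> card X = n \<longrightarrow> g (f X) = t" by blast
  have "f X = f X'" if "g (f X) = g (f X')" for X X'
    using that g by (auto simp: bij_betw_def inj_on_def)
  then show thesis using that[OF Y(1,2)] Y(3) by metis
qed

lemma definable_split:
  assumes "definable M (Inl ` U \<union> Inr ` C) P"
  obtains \<phi> us c where "set us \<subseteq> U" "set c \<subseteq> C" "fmla M (length us + length c) \<phi>"
    "\<And>h. P h \<longleftrightarrow> holds M \<phi> (map (\<lambda>v. h (Inl v)) us @ map (\<lambda>v. h (Inr v)) c)"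
proof -
  obtain F where F: "finite F" "F \<subseteq> Inl ` U \<union> Inr ` C" "definable M F P"
    by (rule definable_finite_support[OF assms])
  have "finite (Inl -` F)" "finite (Inr -` F)" using F(1) by (auto intro!: finite_vimageI)
  then obtain us c where us: "set us = Inl -` F" and c: "set c = Inr -` F" using finite_list by metis
  have "F \<subseteq> set (map Inl us @ map Inr c)" using F(2) us c by auto
  from definable_mono[OF F(3) this] obtain \<phi> where
    "fmla M (length (map Inl us @ map Inr c)) \<phi>"
    "\<And>h. P h \<longleftrightarrow> holds M \<phi> (map h (map Inl us @ map Inr c))"
    by (rule definable_list) (rule that)
  moreover have "set us \<subseteq> U" "set c \<subseteq> C" using us c F(2) by auto
  ultimately show thesis using that[of us c \<phi>] by (simp add: o_def)
qed

text \<open>The Tarski-Vaught property for tuples, one component at a time, from the agreement of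
  \<open>sat M N\<close> with \<open>holds\<close>.\<close>

lemma elem_submodel_witness:
  assumes N: "elem_submodel M N"
  shows "fmla M (m + length n) \<phi> \<Longrightarrow> set n \<subseteq> N \<Longrightarrow> length d = m \<Longrightarrow> holds M \<phi> (d @ n) \<Longrightarrow>
    \<exists>d'. length d' = m \<and> set d' \<subseteq> N \<and> holds M \<phi> (d' @ n)"
proof (induction m arbitrary: \<phi> d)
  case 0
  then show ?case by simp
next
  case (Suc m)
  then obtain x d1 where d: "d = x # d1" "length d1 = m" by (cases d) auto
  have "fmla M (m + length n) (Ex \<phi>)" using Suc.prems(1) by simp
  moreover have "holds M (Ex \<phi>) (d1 @ n)" using Suc.prems(4) d by auto
  ultimately obtain d' where d': "length d' = m" "set d' \<subseteq> N" "holds M (Ex \<phi>) (d' @ n)"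
    using Suc.IH[of "Ex \<phi>" d1] Suc.prems(2) d(2) by blast
  have eq: "sat M N xs \<psi> \<longleftrightarrow> holds M \<psi> xs" if "fmla M (length xs) \<psi>" "set xs \<subseteq> N" for \<psi> xs
    using N that unfolding elem_submodel_def by blast
  have "sat M N (d' @ n) (Ex \<phi>)" using eq[of "d' @ n" "Ex \<phi>"] d' Suc.prems(1,2) by simp
  then obtain y where y: "y \<in> N" "sat M N (y # d' @ n) \<phi>" by auto
  then have "holds M \<phi> ((y # d') @ n)" using eq[of "y # d' @ n" \<phi>] d' Suc.prems(1,2) by simp
  then show ?case using y(1) d' by (intro exI[of _ "y # d'"]) auto
qed

context monster
begin

text \<open>
  Ramsey and compactness yield a conjugate of the sequence in which the two given subtuples have
  the same type over a model.
\<close>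

theorem indiscernible_Ls:
  fixes r :: "'i rel"
  assumes C: "small \<kappa> C" and r: "Linear_order r" "infinite (Field r)"
    and ind: "indiscernible M C r V s"
    and incr: "increasing r is" "increasing r js" "length is = length js"
    and vs: "set vs \<subseteq> {..<length is} \<times> V"
  shows "Ls C (map (\<lambda>(l, v). s (is ! l) v) vs) (map (\<lambda>(l, v). s (js ! l) v) vs)"
proof -
  obtain N where N: "small \<kappa> N" "elem_submodel M N" "C \<subseteq> N" by (rule small_elem_submodel[OF C])
  define m where "m = length is"
  have "finite (set is \<union> set js)" "set is \<union> set js \<subseteq> Field r" using incr by (auto simp: increasing_def)
  \<comment> \<open>Both index lists are merged into one increasing list \<open>ks\<close> and
    become lists \<open>p\<close> and \<open>q\<close> of positions in it.\<close>
  from increasing_exists[OF r(1) this] obtain ks where ks: "increasing r ks" "set ks = set is \<union> set js" by blast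
  define L where "L = length ks"
  obtain p where p: "sorted_wrt (<) p" "set p \<subseteq> {..<L}" "is = map ((!) ks) p"
    using increasing_positions[OF r(1) ks(1) incr(1)] ks(2) unfolding L_def by blast
  obtain q where q: "sorted_wrt (<) q" "set q \<subseteq> {..<L}" "js = map ((!) ks) q"
    using increasing_positions[OF r(1) ks(1) incr(2)] ks(2) unfolding L_def by blast
  have lp: "length p = m" "length q = m" using p(3) q(3) incr(3) by (simp_all add: m_def)
  have pL: "p ! l < L" "q ! l < L" if "l < m" for l
  proof -
    have "p ! l \<in> set p" "q ! l \<in> set q" using that lp by simp_all
    then show "p ! l < L" "q ! l < L" using p(2) q(2) by auto
  qed
  define V0 where "V0 = snd ` set vs"
  have V0: "finite V0" "V0 \<subseteq> V" using vs by (auto simp: V0_def)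
  define w where "w ks = (\<lambda>(l, v). s (ks ! l) v)" for ks
  define pick :: "nat list \<Rightarrow> ((nat \<times> 'i) + 'm \<Rightarrow> 'm) \<Rightarrow> (nat \<times> 'i) + 'm \<Rightarrow> 'm" where
    "pick p h = (\<lambda>x. h (case x of Inl (l, v) \<Rightarrow> Inl (p ! l, v) | Inr c \<Rightarrow> Inr c))" for p h
  define U where "U = Inl ` ({..<L} \<times> V0) \<union> Inr ` N"
  define U' where "U' = Inl ` ({..<m} \<times> V0) \<union> Inr ` N"
  have smU: "small \<kappa> U" unfolding U_def by (intro small_Plus N small_finite) (simp add: V0)
  have dpick: "definable M U (\<lambda>h. P (pick p h))" "definable M U (\<lambda>h. P (pick q h))" if "definable M U' P" for P
    unfolding pick_def by (rule definable_rename[OF that], auto simp: U_def U'_def pL)+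
  \<comment> \<open>Required for all \<open>P\<close> over \<open>N\<close>, this says that the
    tuples at the positions \<open>p\<close> and \<open>q\<close> have the same type over
    \<open>N\<close>.\<close>
  define f where "f P h \<longleftrightarrow> (P (pick p h) \<longleftrightarrow> P (pick q h))" for P h
  define \<Sigma>1 where "\<Sigma>1 = {P. definable M (Inl ` ({..<L} \<times> V0) \<union> Inr ` C) P \<and> P (case_sum (w ks) id)}"
  obtain h where h: "\<And>v. v \<in> Inr ` N \<Longrightarrow> h v = case_sum (w ks) id v"
    "\<And>P. P \<in> \<Sigma>1 \<union> f ` {P. definable M U' P} \<Longrightarrow> P h"
  proof (rule compactness[OF smU, of "\<Sigma>1 \<union> f ` {P. definable M U' P}" "Inr ` N" "case_sum (w ks) id"])
    show "Inr ` N \<subseteq> U" by (simp add: U_def)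
    have "definable M U P" if "P \<in> \<Sigma>1" for P
    proof -
      have "definable M (Inl ` ({..<L} \<times> V0) \<union> Inr ` C) P" using that by (simp add: \<Sigma>1_def)
      then show ?thesis by (rule definable_mono) (use N(3) in \<open>auto simp: U_def\<close>)
    qed
    moreover have "definable M U (f P)" if "definable M U' P" for P
      unfolding f_def[abs_def] by (intro definable_iff dpick that)
    ultimately show "definable M U P" if "P \<in> \<Sigma>1 \<union> f ` {P. definable M U' P}" for P
      using that by (elim UnE imageE) simp_all
    fix q0 assume q0: "q0 \<subseteq> \<Sigma>1 \<union> f ` {P. definable M U' P}" "finite q0"
    obtain Q where Q: "Q \<subseteq> {P. definable M U' P}" "finite Q" "q0 \<inter> f ` {P. definable M U' P} = f ` Q"
      using finite_subset_image[of "q0 \<inter> f ` {P. definable M U' P}" f "{P. definable M U' P}"] q0(2) by auto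
    \<comment> \<open>The increasing enumeration of a finite set of indices, unique by
      \<open>increasing_unique\<close>. It lets colours be attached to sets, as Ramsey's theorem
      demands.\<close>
    define lst where "lst X = (SOME ks. increasing r ks \<and> set ks = X)" for X
    have lst: "lst (set ks) = ks" if "increasing r ks" for ks
      unfolding lst_def using that increasing_unique[OF r(1)] by (intro some_equality) auto
    define col where "col X = {P \<in> Q. P (case_sum (w (lst X)) id)}" for X
    have "range col \<subseteq> Pow Q" by (auto simp: col_def)
    then have "finite (range col)" using Q(2) by (meson finite_Pow_iff finite_subset)
    from Ramsey_finite_colours[OF r(2) this, of m] obtain Y where Y: "Y \<subseteq> Field r" "infinite Y"
      "\<And>X X'. X \<subseteq> Y \<Longrightarrow> finite X \<Longrightarrow> card X = m \<Longrightarrow> X' \<subseteq> Y \<Longrightarrow> finite X' \<Longrightarrow> card X' = m \<Longrightarrow> col X = col X'"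
      by metis
    \<comment> \<open>Any \<open>L\<close> indices from the homogeneous set will do:
      \<open>p\<close> and \<open>q\<close> pick out \<open>m\<close>-element subsets of one colour,
      while indiscernibility makes the new list look like \<open>ks\<close> over
      \<open>C\<close>.\<close>
    obtain K where K: "finite K" "card K = L" "K \<subseteq> Y" using infinite_arbitrarily_large[OF Y(2)] by blast
    have "K \<subseteq> Field r" using K(3) Y(1) by blast
    from increasing_exists[OF r(1) K(1) this] obtain ks' where ks': "increasing r ks'" "set ks' = K" by blast
    have lks': "length ks' = L" using K(2) ks' increasing_distinct distinct_card by metis
    define h where "h = case_sum (w ks') id"
    have pk: "pick p0 h v = case_sum (w (map ((!) ks') p0)) id v" if "v \<in> U'" "length p0 = m" for p0 v
      using that by (auto simp: pick_def h_def w_def U'_def)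
    have colp: "col (set (map ((!) ks') p0)) = {P \<in> Q. P (case_sum (w (map ((!) ks') p0)) id)}"
      and subp: "set (map ((!) ks') p0) \<subseteq> Y" and cardp: "card (set (map ((!) ks') p0)) = m"
      if "sorted_wrt (<) p0" "set p0 \<subseteq> {..<L}" "length p0 = m" for p0
    proof -
      have inc: "increasing r (map ((!) ks') p0)" using increasing_sub[OF ks'(1) that(1)] that(2) lks' by simp
      show "col (set (map ((!) ks') p0)) = {P \<in> Q. P (case_sum (w (map ((!) ks') p0)) id)}"
        unfolding col_def lst[OF inc] ..
      have "ks' ! j \<in> K" if "j < L" for j using that lks' ks'(2) nth_mem by metis
      then show "set (map ((!) ks') p0) \<subseteq> Y" using that(2) K(3) by auto
      show "card (set (map ((!) ks') p0)) = m"
        using distinct_card[OF increasing_distinct[OF inc]] that(3) by simp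
    qed
    have coleq: "col (set (map ((!) ks') p)) = col (set (map ((!) ks') q))"
      by (intro Y(3) subp cardp p q lp) auto
    have "P h" if P: "P \<in> q0" for P
    proof -
      have "q0 = q0 \<inter> \<Sigma>1 \<union> f ` Q"
        unfolding Q(3)[symmetric] Int_Un_distrib[symmetric] using q0(1) by (rule Int_absorb2[symmetric])
      with P have "P \<in> q0 \<inter> \<Sigma>1 \<union> f ` Q" by simp
      then have "P \<in> \<Sigma>1 \<or> P \<in> f ` Q" by (elim UnE IntE) simp_all
      then show ?thesis
      proof
        assume "P \<in> \<Sigma>1"
        then have P: "definable M (Inl ` ({..<L} \<times> V0) \<union> Inr ` C) P" "P (case_sum (w ks) id)"
          by (simp_all add: \<Sigma>1_def)
        obtain \<phi> us c where u: "set us \<subseteq> {..<L} \<times> V0" "set c \<subseteq> C" "fmla M (length us + length c) \<phi>"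
          "\<And>h. P h \<longleftrightarrow> holds M \<phi> (map (\<lambda>v. h (Inl v)) us @ map (\<lambda>v. h (Inr v)) c)"
          by (rule definable_split[OF P(1)]) (rule that)
        have "holds M \<phi> (map (w ks) us @ c)" using P(2) unfolding u(4) by simp
        then have "holds M \<phi> (map (w ks') us @ c)"
          using ind[unfolded indiscernible_def, rule_format, of ks ks' us c \<phi>] ks ks' lks' u(1-3) V0(2)
          by (auto simp: L_def w_def)
        then show "P h" unfolding u(4) h_def by simp
      next
        assume "P \<in> f ` Q"
        then obtain P' where P': "P' \<in> Q" "P = f P'" by blast
        have d: "definable M U' P'" using P'(1) Q(1) by blast
        have "P' (pick p h) \<longleftrightarrow> P' (case_sum (w (map ((!) ks') p)) id)"
          "P' (pick q h) \<longleftrightarrow> P' (case_sum (w (map ((!) ks') q)) id)"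
          using pk lp by (auto intro!: definable_cong[OF d])
        moreover have "P' \<in> col (set (map ((!) ks') p)) \<longleftrightarrow> P' (case_sum (w (map ((!) ks') p)) id)"
          "P' \<in> col (set (map ((!) ks') q)) \<longleftrightarrow> P' (case_sum (w (map ((!) ks') q)) id)"
          using colp[OF p(1,2) lp(1)] colp[OF q(1,2) lp(2)] P'(1) by simp_all
        ultimately show "P h" unfolding P'(2) f_def using coleq by simp
      qed
    qed
    then show "\<exists>h. (\<forall>v\<in>Inr ` N. h v = case_sum (w ks) id v) \<and> (\<forall>P\<in>q0. P h)"
      by (intro exI[of _ h]) (auto simp: h_def)
  qed auto
  \<comment> \<open>The new sequence is conjugate to the old one over \<open>C\<close>, so Lascar
    equivalence over \<open>C\<close> can be moved back.\<close>
  obtain \<tau> where t: "\<tau> \<in> Fix C" "\<And>x. x \<in> {..<L} \<times> V0 \<Longrightarrow> h (Inl x) = \<tau> (w ks x)"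
  proof (rule aut_over_of_definable[of "{..<L} \<times> V0" C "w ks" "\<lambda>x. h (Inl x)"])
    show "small \<kappa> ({..<L} \<times> V0)" by (intro small_finite) (simp add: V0)
    fix P assume P: "definable M (Inl ` ({..<L} \<times> V0) \<union> Inr ` C) P" "P (case_sum (w ks) id)"
    then have "P h" by (intro h(2)[of P]) (simp add: \<Sigma>1_def)
    then show "P (case_sum (\<lambda>x. h (Inl x)) id)"
      using h(1) N(3) by (subst definable_cong[OF P(1), of _ h]) auto
  qed (use C in auto)
  define y where "y p = map (\<lambda>(l, v). h (Inl (p ! l, v))) vs" for p
  obtain \<sigma> where s: "\<sigma> \<in> Fix N" "\<And>l v. (l, v) \<in> {..<m} \<times> V0 \<Longrightarrow> h (Inl (q ! l, v)) = \<sigma> (h (Inl (p ! l, v)))"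
  proof (rule aut_over_of_definable[of "{..<m} \<times> V0" N "\<lambda>(l, v). h (Inl (p ! l, v))" "\<lambda>(l, v). h (Inl (q ! l, v))"])
    show "small \<kappa> ({..<m} \<times> V0)" by (intro small_finite) (simp add: V0)
    fix P assume P: "definable M (Inl ` ({..<m} \<times> V0) \<union> Inr ` N) P"
      "P (case_sum (\<lambda>(l, v). h (Inl (p ! l, v))) id)"
    have c: "P (case_sum (\<lambda>(l, v). h (Inl (p ! l, v))) id) \<longleftrightarrow> P (pick p h)" for p
      using h(1) by (intro definable_cong[OF P(1)]) (auto simp: pick_def)
    have "f P h" using P(1) by (intro h(2)[of "f P"]) (simp add: U'_def)
    then show "P (case_sum (\<lambda>(l, v). h (Inl (q ! l, v))) id)" using P(2) c unfolding f_def by simp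
  next
    fix \<sigma> assume "\<sigma> \<in> Fix N" and "\<And>x. x \<in> {..<m} \<times> V0 \<Longrightarrow>
      (case x of (l, v) \<Rightarrow> h (Inl (q ! l, v))) = \<sigma> (case x of (l, v) \<Rightarrow> h (Inl (p ! l, v)))"
    then show thesis by (intro that[of \<sigma>]) force+
  qed (rule N)
  have vs': "l < m \<and> v \<in> V0" if "(l, v) \<in> set vs" for l v
    using that vs by (force simp: V0_def m_def)
  have "y q = map \<sigma> (y p)" unfolding y_def using s(2) vs' by auto
  then have "Ls C (y p) (y q)" using Ls_strong[OF N s(1)] by simp
  moreover have "y p = map \<tau> (map (\<lambda>(l, v). s (is ! l) v) vs)"
    unfolding y_def using t(2) vs' pL lp by (auto simp: p(3) w_def)
  moreover have "y q = map \<tau> (map (\<lambda>(l, v). s (js ! l) v) vs)"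
    unfolding y_def using t(2) vs' pL lp by (auto simp: q(3) w_def)
  ultimately have "Ls C (map \<tau> (map (\<lambda>(l, v). s (is ! l) v) vs)) (map \<tau> (map (\<lambda>(l, v). s (js ! l) v) vs))"
    by (simp only:)
  note Ls = Ls_Fix[OF this Fix_inv[OF t(1)]]
  have inv: "map (inv_into UNIV \<tau>) (map \<tau> xs) = xs" for xs
    using Aut_inv_left[OF FixD(1)[OF t(1)]] by (simp add: map_idI)
  show ?thesis using Ls unfolding inv .
qed

text \<open>Listing all coordinates from \<open>V0\<close> at all positions produces a single
  automorphism for all of them.\<close>

lemma indiscernible_aut:
  fixes r :: "'i rel"
  assumes "small \<kappa> C" "Linear_order r" "infinite (Field r)" "indiscernible M C r V s"
    and "increasing r is" "increasing r js" "length is = length js" and V0: "finite V0" "V0 \<subseteq> V"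
  obtains \<sigma> where "\<sigma> \<in> AutfL \<kappa> M C" "\<And>l v. l < length is \<Longrightarrow> v \<in> V0 \<Longrightarrow> s (js ! l) v = \<sigma> (s (is ! l) v)"
proof -
  have "finite ({..<length is} \<times> V0)" using V0 by simp
  from finite_list[OF this] obtain vs where vs: "set vs = {..<length is} \<times> V0" ..
  have "Ls C (map (\<lambda>(l, v). s (is ! l) v) vs) (map (\<lambda>(l, v). s (js ! l) v) vs)"
    using vs V0(2) by (intro indiscernible_Ls[OF assms(1-7)]) auto
  then obtain \<sigma> where s: "\<sigma> \<in> AutfL \<kappa> M C"
    "map (\<lambda>(l, v). s (js ! l) v) vs = map \<sigma> (map (\<lambda>(l, v). s (is ! l) v) vs)" unfolding Ls_def by blast
  have "s (js ! l) v = \<sigma> (s (is ! l) v)" if "l < length is" "v \<in> V0" for l v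
  proof -
    have "(l, v) \<in> set vs" using that vs by simp
    then show ?thesis using s(2) by auto
  qed
  then show thesis using that s(1) by blast
qed

end

section \<open>Connecting sequences\<close>

text \<open>
  Sequences indexed by \<open>rge\<close> are listed backwards: the last element of \<open>case_nat c e\<close> is \<open>c\<close>.
\<close>

definition rge :: "nat rel" where
  "rge = {(i, j). j \<le> i}"

lemma Field_rge: "Field rge = UNIV"
  by (auto simp: rge_def Field_def)

lemma Linear_order_rge: "Linear_order rge"
  unfolding order_on_defs Field_rge by (auto simp: rge_def refl_on_def trans_def antisym_def total_on_def)

lemma increasing_rge: "increasing rge is \<longleftrightarrow> sorted_wrt (>) is"
proof -
  have "(\<lambda>i j. (i, j) \<in> rge \<and> i \<noteq> j) = (>)" by (auto simp: rge_def fun_eq_iff)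
  then show ?thesis by (simp add: increasing_def Field_rge)
qed

text \<open>As in \<open>indiscernible\<close>, a pair \<open>(l, v)\<close> selects coordinate
  \<open>v\<close> of the \<open>l\<close>-th tuple, and \<open>n\<close> supplies the
  parameters.\<close>

definition evl :: "('f, 'p, 'm) struct \<Rightarrow> ('f, 'p) fm \<times> (nat \<times> nat) list \<times> 'm list \<Rightarrow> 'm list list \<Rightarrow> bool" where
  "evl M = (\<lambda>(\<phi>, vs, n) t. holds M \<phi> (map (\<lambda>(l, v). t ! l ! v) vs @ n))"

context monster
begin

lemma elem_submodel_definable:
  assumes N: "elem_submodel M N" and P: "definable M (Inl ` {..<length c} \<union> Inr ` N) P" "P (case_sum ((!) c) id)"
  obtains d where "length d = length c" "set d \<subseteq> N" "P (case_sum ((!) d) id)"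
proof -
  obtain \<phi> n where n: "set n \<subseteq> N" "distinct n" "fmla M (length c + length n) \<phi>"
    "\<And>h. P h \<longleftrightarrow> holds M \<phi> (map (\<lambda>i. h (Inl i)) [0..<length c] @ map (\<lambda>v. h (Inr v)) n)"
    by (rule definable_tuple[OF P(1)]) (rule that)
  have "holds M \<phi> (c @ n)" using P(2) unfolding n(4) by (simp add: map_nth)
  from elem_submodel_witness[OF N n(3,1) refl this] obtain d where
    d: "length d = length c" "set d \<subseteq> N" "holds M \<phi> (d @ n)" by blast
  have "map ((!) d) [0..<length c] = d" using d(1) map_nth by metis
  then have "P (case_sum ((!) d) id)" unfolding n(4) using d(3) by simp
  then show thesis using that d by blast
qed

text \<open>
  The elements \<open>ms j\<close> of the model imitate \<open>c\<close>, hence also any conjugate of \<open>c\<close> over the model;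
  this is what makes one sequence work for both tuples in \<open>connecting_sequence\<close>.
\<close>

lemma approximating_sequence:
  assumes N: "elem_submodel M N" and fin: "finite \<Delta>"
    and \<Delta>: "\<And>k \<phi> vs n. (k, \<phi>, vs, n) \<in> \<Delta> \<Longrightarrow> set vs \<subseteq> {..<k} \<times> {..<length c} \<and> set n \<subseteq> N \<and>
      fmla M (length vs + length n) \<phi>"
  obtains ms :: "nat \<Rightarrow> 'm list" where "\<And>j. length (ms j) = length c" "\<And>j. set (ms j) \<subseteq> N"
    "\<And>j k \<delta> u. (k, \<delta>) \<in> \<Delta> \<Longrightarrow> set u \<subseteq> ms ` {..<j} \<Longrightarrow> Suc (length u) = k \<Longrightarrow>
      evl M \<delta> (u @ [ms j]) \<longleftrightarrow> evl M \<delta> (u @ [c])"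
proof -
  define m where "m = length c"
  define ok where "ok ms j d \<longleftrightarrow> length d = m \<and> set d \<subseteq> N \<and> (\<forall>(k, \<delta>)\<in>\<Delta>. \<forall>u. set u \<subseteq> ms ` {..<j} \<longrightarrow>
    Suc (length u) = k \<longrightarrow> (evl M \<delta> (u @ [d]) \<longleftrightarrow> evl M \<delta> (u @ [c])))" for ms :: "nat \<Rightarrow> 'm list" and j :: nat and d
  have "\<exists>ms. \<forall>j. ok ms j (ms j)"
  proof (rule dependent_wellorder_choice)
    show "ok f x r \<longleftrightarrow> ok g x r" if "\<And>y. y < x \<Longrightarrow> f y = g y" for r f g and x :: nat
    proof -
      have "f ` {..<x} = g ` {..<x}" using that by (intro image_cong) auto
      then show ?thesis unfolding ok_def by simp
    qed
  next
    fix j and ms :: "nat \<Rightarrow> 'm list" assume prev: "\<And>i. i < j \<Longrightarrow> ok ms i (ms i)"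
    have msN: "length u = m \<and> set u \<subseteq> N" if "u \<in> ms ` {..<j}" for u
      using prev that unfolding ok_def by auto
    define I where "I = (SIGMA x:\<Delta>. {u. set u \<subseteq> ms ` {..<j} \<and> Suc (length u) = fst x})"
    have "finite {u. set u \<subseteq> ms ` {..<j} \<and> Suc (length u) = k}" for k
      by (rule finite_subset[OF _ finite_lists_length_eq[of "ms ` {..<j}" "k - 1"]]) auto
    then have finI: "finite I" unfolding I_def using fin by (intro finite_SigmaI) auto
    \<comment> \<open>The tuples in \<open>u\<close> lie in the model and become parameters; only
      the last tuple stays variable.\<close>
    define vars :: "'m list list \<Rightarrow> (nat \<times> nat) list \<Rightarrow> 'm list \<Rightarrow> (nat + 'm) list" where
      "vars u vs n = map (\<lambda>(l, v). if l < length u then Inr (u ! l ! v) else Inl v) vs @ map Inr n" for u vs n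
    \<comment> \<open>The truth value at \<open>c\<close> is a constant here, so the finitely many
      requirements amount to one formula over \<open>N\<close> that \<open>c\<close> satisfies, and
      a solution exists in \<open>N\<close>.\<close>
    define F where "F = (\<lambda>((k :: nat, \<phi>, vs, n), u) h.
      holds M \<phi> (map h (vars u vs n)) \<longleftrightarrow> evl M (\<phi>, vs, n) (u @ [c]))"
    have val: "holds M \<phi> (map (case_sum ((!) d) id) (vars u vs n)) \<longleftrightarrow> evl M (\<phi>, vs, n) (u @ [d])"
      if "((k, \<phi>, vs, n), u) \<in> I" for k \<phi> vs n u d
    proof -
      have vs: "set vs \<subseteq> {..<Suc (length u)} \<times> {..<m}"
        using that \<Delta>[of k \<phi> vs n] unfolding I_def m_def by auto
      have "(u @ [d]) ! l ! v = case_sum ((!) d) id (if l < length u then Inr (u ! l ! v) else Inl v)"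
        if "(l, v) \<in> set vs" for l v
        using that vs by (auto simp: nth_append less_Suc_eq)
      then have "map (case_sum ((!) d) id) (vars u vs n) = map (\<lambda>(l, v). (u @ [d]) ! l ! v) vs @ n"
        by (auto simp: vars_def intro!: map_idI)
      then show ?thesis unfolding evl_def split by (simp only:)
    qed
    have "definable M (Inl ` {..<m} \<union> Inr ` N) (F x)" if "x \<in> I" for x
    proof -
      obtain k \<phi> vs n u where x: "x = ((k, \<phi>, vs, n), u)" by (metis prod_cases3 surj_pair)
      have a: "set vs \<subseteq> {..<k} \<times> {..<m}" "set n \<subseteq> N" "fmla M (length vs + length n) \<phi>" "Suc (length u) = k"
        "set u \<subseteq> ms ` {..<j}"
        using \<Delta>[of k \<phi> vs n] that unfolding x I_def m_def by auto
      have uN: "u ! l ! v \<in> N" if "l < length u" "v < m" for l v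
        using msN[of "u ! l"] that a(5) nth_mem by (metis subsetD)
      have "v < m" if "(l, v) \<in> set vs" for l v using a(1) that by auto
      then have "set (vars u vs n) \<subseteq> Inl ` {..<m} \<union> Inr ` N"
        using a(2) uN unfolding vars_def by auto
      then show ?thesis unfolding x F_def split
        using a(3) by (intro definable_iff definable_const dfnI) (auto simp: vars_def)
    qed
    then have "definable M (Inl ` {..<length c} \<union> Inr ` N) (\<lambda>h. \<forall>x\<in>I. F x h)"
      unfolding m_def by (intro definable_ball finI) auto
    moreover have "\<forall>x\<in>I. F x (case_sum ((!) c) id)"
    proof
      fix x assume x: "x \<in> I"
      obtain k \<phi> vs n u where xe: "x = ((k, \<phi>, vs, n), u)" by (metis prod_cases3 surj_pair)
      show "F x (case_sum ((!) c) id)" using val[of k \<phi> vs n u c] x unfolding xe F_def split by blast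
    qed
    ultimately obtain d where d: "length d = length c" "set d \<subseteq> N" "\<forall>x\<in>I. F x (case_sum ((!) d) id)"
      by (rule elem_submodel_definable[OF N])
    have "evl M \<delta> (u @ [d]) \<longleftrightarrow> evl M \<delta> (u @ [c])"
      if k: "(k, \<delta>) \<in> \<Delta>" "set u \<subseteq> ms ` {..<j}" "Suc (length u) = k" for k \<delta> u
    proof -
      obtain \<phi> vs n where de: "\<delta> = (\<phi>, vs, n)" by (cases \<delta>)
      have I: "((k, \<phi>, vs, n), u) \<in> I" using k unfolding I_def de by simp
      then show ?thesis using d(3) val[OF I, of d] unfolding F_def de by auto
    qed
    then show "\<exists>d. ok ms j d" using d(1,2) unfolding ok_def m_def by (intro exI[of _ d]) auto
  qed
  then obtain ms where "\<And>j. ok ms j (ms j)" by blast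
  then show thesis using that[of ms] unfolding ok_def m_def by blast
qed

text \<open>Ramsey's theorem makes a subsequence of the approximating sequence homogeneous for the
  finitely many formulas. A window of it is listed backwards with \<open>c\<close> at the end; there
  \<open>c\<close> can be replaced by a later approximating element.\<close>

lemma connecting_sequence_finite:
  assumes N: "elem_submodel M N" and fin: "finite \<Delta>"
    and \<Delta>: "\<And>k \<phi> vs n. (k, \<phi>, vs, n) \<in> \<Delta> \<Longrightarrow> set vs \<subseteq> {..<k} \<times> {..<length c} \<and> set n \<subseteq> N \<and>
      fmla M (length vs + length n) \<phi>"
  obtains e :: "nat \<Rightarrow> 'm list" where "\<And>j. length (e j) = length c" "\<And>j. set (e j) \<subseteq> N"
    "\<And>k \<delta> is js. (k, \<delta>) \<in> \<Delta> \<Longrightarrow> increasing rge is \<Longrightarrow> increasing rge js \<Longrightarrow> length is = k \<Longrightarrow> length js = k \<Longrightarrow>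
      set is \<union> set js \<subseteq> {..Z} \<Longrightarrow>
      evl M \<delta> (map (case_nat c e) is) \<longleftrightarrow> evl M \<delta> (map (case_nat c e) js)"
proof -
  obtain ms :: "nat \<Rightarrow> 'm list" where ms: "\<And>j. length (ms j) = length c" "\<And>j. set (ms j) \<subseteq> N"
    "\<And>j k \<delta> u. (k, \<delta>) \<in> \<Delta> \<Longrightarrow> set u \<subseteq> ms ` {..<j} \<Longrightarrow> Suc (length u) = k \<Longrightarrow>
      evl M \<delta> (u @ [ms j]) \<longleftrightarrow> evl M \<delta> (u @ [c])"
    by (rule approximating_sequence[OF N fin \<Delta>]) (assumption | rule that)+
  obtain L where L: "\<And>k \<delta>. (k, \<delta>) \<in> \<Delta> \<Longrightarrow> k \<le> L"
  proof -
    have "finite (fst ` \<Delta>)" using fin by simp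
    then obtain L where L: "\<And>k. k \<in> fst ` \<Delta> \<Longrightarrow> k \<le> L" using finite_nat_set_iff_bounded_le by meson
    show thesis
    proof (rule that)
      fix k \<delta> assume "(k, \<delta>) \<in> \<Delta>"
      then show "k \<le> L" by (intro L) force
    qed
  qed
  \<comment> \<open>A formula of arity \<open>k\<close> is evaluated at the first \<open>k\<close>
    elements of a set of size \<open>L\<close>, so one use of Ramsey's theorem covers all
    arities.\<close>
  define col where "col X = {x \<in> \<Delta>. evl M (snd x) (map ms (take (fst x) (sorted_list_of_set X)))}" for X
  have "range col \<subseteq> Pow \<Delta>" by (auto simp: col_def)
  then have "finite (range col)" using fin by (meson finite_Pow_iff finite_subset)
  from Ramsey_finite_colours[OF infinite_UNIV_nat this, of L] obtain Y where Y: "infinite Y"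
    "\<And>X X'. X \<subseteq> Y \<Longrightarrow> finite X \<Longrightarrow> card X = L \<Longrightarrow> X' \<subseteq> Y \<Longrightarrow> finite X' \<Longrightarrow> card X' = L \<Longrightarrow> col X = col X'"
    by metis
  define h where "h = enumerate Y"
  have h: "strict_mono h" "\<And>i. h i \<in> Y"
    using Y(1) by (simp_all add: h_def strict_mono_enumerate enumerate_in_set)
  have colour: "evl M \<delta> (map (ms \<circ> h) p) \<longleftrightarrow> (k, \<delta>) \<in> col (h ` {..<L})"
    if k: "(k, \<delta>) \<in> \<Delta>" "length p = k" and p: "sorted_wrt (<) p" for k \<delta> p
  proof -
    \<comment> \<open>\<open>p\<close> is padded to length \<open>L\<close> by numbers beyond its
      maximum, which leaves the first \<open>k\<close> entries unchanged.\<close>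
    define B where "B = Suc (Max (insert 0 (set p)))"
    have B: "i < B" if "i \<in> set p" for i unfolding B_def using that by (simp add: less_Suc_eq_le)
    define p' where "p' = p @ [B..<B + (L - k)]"
    have p': "sorted_wrt (<) p'" unfolding p'_def sorted_wrt_append using p by (auto intro: less_le_trans[OF B])
    have lp': "length p' = L" using k(2) L[OF k(1)] by (simp add: p'_def)
    have sh: "sorted_wrt (<) (map h p')"
      using p' h(1) by (simp add: sorted_wrt_map strict_mono_less)
    then have "sorted_list_of_set (set (map h p')) = map h p'"
      by (meson sorted_list_of_set.idem_if_sorted_distinct strict_sorted_iff)
    then have "(k, \<delta>) \<in> col (set (map h p')) \<longleftrightarrow> evl M \<delta> (map (ms \<circ> h) p)"
      using k by (simp add: col_def p'_def take_map)
    moreover have "col (set (map h p')) = col (h ` {..<L})"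
    proof (rule Y(2))
      show "card (set (map h p')) = L" using sh lp' by (metis distinct_card length_map strict_sorted_iff)
      show "card (h ` {..<L}) = L" using h(1) by (simp add: card_image strict_mono_imp_inj_on)
    qed (use h(2) in auto)
    ultimately show ?thesis by simp
  qed
  \<comment> \<open>The window is reversed: position \<open>i\<close> of \<open>case_nat c e\<close>
    corresponds to \<open>Suc Z - i\<close>, and the position 0 of \<open>c\<close> to
    \<open>Suc Z\<close>, above all the others.\<close>
  define e where "e i = ms (h (Z - i))" for i
  have main: "evl M \<delta> (map (case_nat c e) is) \<longleftrightarrow> (k, \<delta>) \<in> col (h ` {..<L})"
    if k: "(k, \<delta>) \<in> \<Delta>" and "is": "increasing rge is" "length is = k" "set is \<subseteq> {..Z}" for k \<delta> "is"
  proof -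
    define p where "p = map (\<lambda>i. Suc Z - i) is"
    have p: "sorted_wrt (<) p" "length p = k"
      using "is" unfolding p_def increasing_rge sorted_wrt_map
      by (auto elim!: sorted_wrt_mono_rel[rotated])
    have e: "case_nat c e i = (ms \<circ> h) (Suc Z - i)" if "i \<in> set is" "i \<noteq> 0" for i
    proof -
      obtain j where "i = Suc j" using \<open>i \<noteq> 0\<close> not0_implies_Suc by blast
      then show ?thesis by (simp add: e_def)
    qed
    have "evl M \<delta> (map (case_nat c e) is) \<longleftrightarrow> evl M \<delta> (map (ms \<circ> h) p)"
    proof (cases "0 \<in> set is")
      case False
      then have "map (case_nat c e) is = map (ms \<circ> h) p"
        using e by (auto simp: p_def)
      then show ?thesis by (simp only:)
    next
      case True
      then obtain a b where ab: "is = a @ 0 # b" by (metis split_list)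
      \<comment> \<open>In the order \<open>rge\<close> the index 0 is the largest, so
        \<open>c\<close> can only occur at the end.\<close>
      have "b = []" using "is"(1) unfolding ab increasing_rge by (cases b) (auto simp: sorted_wrt_append)
      then have a: "is = a @ [0]" using ab by simp
      have a0: "0 \<notin> set a" using "is"(1) unfolding a increasing_rge by (auto simp: sorted_wrt_append)
      define u where "u = map (ms \<circ> h) (map (\<lambda>i. Suc Z - i) a)"
      have u: "map (case_nat c e) is = u @ [c]" "map (ms \<circ> h) p = u @ [ms (h (Suc Z))]"
        using e a0 a by (auto simp: u_def p_def)
      have "set u \<subseteq> ms ` {..<h (Suc Z)}"
      proof
        fix x assume "x \<in> set u"
        then obtain i where i: "i \<in> set a" "x = ms (h (Suc Z - i))" by (auto simp: u_def)
        have "i \<noteq> 0" using i(1) a0 by metis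
        then have "h (Suc Z - i) < h (Suc Z)" using strict_mono_less[OF h(1)] by simp
        then show "x \<in> ms ` {..<h (Suc Z)}" using i(2) by blast
      qed
      then show ?thesis unfolding u using ms(3)[OF k, of u "h (Suc Z)"] "is"(2) a by (simp add: u_def)
    qed
    then show ?thesis using colour[OF k p(2,1)] by simp
  qed
  show thesis
  proof (rule that[of e])
    show "evl M \<delta> (map (case_nat c e) is) \<longleftrightarrow> evl M \<delta> (map (case_nat c e) js)"
      if "(k, \<delta>) \<in> \<Delta>" "increasing rge is" "increasing rge js" "length is = k" "length js = k"
        "set is \<union> set js \<subseteq> {..Z}" for k \<delta> "is" js
      using main[of k \<delta> "is"] main[of k \<delta> js] that by simp
  qed (use ms in \<open>auto simp: e_def\<close>)
qed

text \<open>In a finite approximation \<open>e\<close> lies in \<open>N\<close> and is fixed by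
  \<open>\<sigma>\<close>. So \<open>\<sigma>\<close> carries the indiscernibility of the sequence
  through \<open>c\<close> to the sequence through its image, and compactness can demand both for
  one \<open>e\<close>.\<close>

theorem connecting_sequence:
  assumes N: "small \<kappa> N" "elem_submodel M N" and s: "\<sigma> \<in> Fix N"
  obtains e :: "nat \<Rightarrow> 'm list" where "\<And>i. length (e i) = length c"
    "indiscernible M N rge {..<length c} (\<lambda>i v. case_nat c e i ! v)"
    "indiscernible M N rge {..<length c} (\<lambda>i v. case_nat (map \<sigma> c) e i ! v)"
proof -
  define m where "m = length c"
  define c' where "c' b = (if b then map \<sigma> c else c)" for b
  have lc': "length (c' b) = m" for b by (simp add: c'_def m_def)
  define Par where "Par = N \<union> (set (c' False) \<union> set (c' True))"
  define U where "U = Inl ` ((UNIV :: nat set) \<times> {..<m}) \<union> Inr ` Par"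
  have U: "small \<kappa> U" unfolding U_def Par_def
    by (intro small_Plus small_Un N small_countable countableI_type countable_finite) auto
  \<comment> \<open>The flag \<open>b\<close> selects whether the sequence ends in \<open>c\<close>
    or in its image.\<close>
  define I where "I = {((k, \<phi>, vs, n), is, js, b :: bool). set vs \<subseteq> {..<k} \<times> {..<m} \<and> set n \<subseteq> N \<and>
    fmla M (length vs + length n) \<phi> \<and> increasing rge is \<and> increasing rge js \<and> length is = k \<and> length js = k}"
  define vars where "vars b is vs n = map (\<lambda>(l, v). case is ! l of 0 \<Rightarrow> Inr (c' b ! v) | Suc j \<Rightarrow> Inl (j, v)) vs
    @ map Inr n" for b "is" vs and n :: "'m list"
  define F where "F = (\<lambda>((k :: nat, \<phi>, vs, n), is, js, b) h.
    holds M \<phi> (map h (vars b is vs n)) \<longleftrightarrow> holds M \<phi> (map h (vars b js vs n)))"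
  define h0 where "h0 = case_sum (\<lambda>_ :: nat \<times> nat. undefined :: 'm) id"
  have val: "holds M \<phi> (map h (vars b is vs n)) \<longleftrightarrow> evl M (\<phi>, vs, n) (map (case_nat (c' b) e) is)"
    if h: "\<And>v. v \<in> Par \<Longrightarrow> h (Inr v) = v" "\<And>j v. v < m \<Longrightarrow> h (Inl (j, v)) = e j ! v"
      and vs: "set vs \<subseteq> {..<length is} \<times> {..<m}" "set n \<subseteq> N" for h e \<phi> b "is" vs n
  proof -
    have "h (case is ! l of 0 \<Rightarrow> Inr (c' b ! v) | Suc j \<Rightarrow> Inl (j, v)) = map (case_nat (c' b) e) is ! l ! v"
      if "(l, v) \<in> set vs" for l v
    proof -
      have l: "l < length is" "v < m" using that vs by auto
      have "c' b ! v \<in> Par" using l(2) lc'[of b] by (cases b) (auto simp: Par_def)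
      then show ?thesis using l h by (auto split: nat.splits)
    qed
    then have "map h (vars b is vs n) = map (\<lambda>(l, v). map (case_nat (c' b) e) is ! l ! v) vs @ n"
      using h(1) vs(2) by (auto simp: vars_def Par_def intro!: map_idI)
    then show ?thesis unfolding evl_def split by (simp only:)
  qed
  obtain h where h: "\<And>v. v \<in> Inr ` Par \<Longrightarrow> h v = h0 v" "\<And>P. P \<in> F ` I \<Longrightarrow> P h"
  proof (rule compactness[OF U, of "F ` I" "Inr ` Par" h0])
    show "Inr ` Par \<subseteq> U" by (simp add: U_def)
    have "definable M U (F x)" if "x \<in> I" for x
    proof -
      obtain k \<phi> vs n "is" js b where x: "x = ((k, \<phi>, vs, n), is, js, b)" by (metis prod_cases4 surj_pair)
      have "definable M U (\<lambda>h. holds M \<phi> (map h (vars b is vs n)))" if "length is = k" for "is"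
      proof (rule dfnI)
        show "fmla M (length (vars b is vs n)) \<phi>" using \<open>x \<in> I\<close> unfolding x I_def by (simp add: vars_def)
        have "c' b ! v \<in> Par" if "v < m" for v using that lc'[of b] by (cases b) (auto simp: Par_def)
        then show "set (vars b is vs n) \<subseteq> U"
          using \<open>x \<in> I\<close> unfolding x I_def vars_def U_def Par_def by (auto split: nat.splits)
      qed
      then show ?thesis using that unfolding x F_def split I_def by (intro definable_iff) auto
    qed
    then show "definable M U P" if "P \<in> F ` I" for P using that by (elim imageE) simp
    fix q assume q: "q \<subseteq> F ` I" "finite q"
    then obtain J where J: "J \<subseteq> I" "finite J" "q = F ` J" by (metis finite_subset_image)
    have "finite (\<Union>x\<in>J. set (fst (snd x)) \<union> set (fst (snd (snd x))))" using J(2) by auto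
    then obtain Z where Z: "\<And>i. i \<in> (\<Union>x\<in>J. set (fst (snd x)) \<union> set (fst (snd (snd x)))) \<Longrightarrow> i \<le> Z"
      using finite_nat_set_iff_bounded_le by meson
    have fJ: "finite (fst ` J)" using J(2) by simp
    have vJ: "set vs \<subseteq> {..<k} \<times> {..<length c} \<and> set n \<subseteq> N \<and> fmla M (length vs + length n) \<phi>"
      if "(k, \<phi>, vs, n) \<in> fst ` J" for k \<phi> vs n
      using that J(1) unfolding I_def m_def by auto
    obtain e :: "nat \<Rightarrow> 'm list" where e: "\<And>j. length (e j) = length c" "\<And>j. set (e j) \<subseteq> N"
      "\<And>k \<delta> is js. (k, \<delta>) \<in> fst ` J \<Longrightarrow> increasing rge is \<Longrightarrow> increasing rge js \<Longrightarrow> length is = k \<Longrightarrow> length js = k \<Longrightarrow>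
        set is \<union> set js \<subseteq> {..Z} \<Longrightarrow>
        evl M \<delta> (map (case_nat c e) is) \<longleftrightarrow> evl M \<delta> (map (case_nat c e) js)"
      by (rule connecting_sequence_finite[OF N(2) fJ vJ, where Z = Z]) (assumption | rule that)+
    have sig: "evl M (\<phi>, vs, n) (map (case_nat (c' b) e) is) \<longleftrightarrow> evl M (\<phi>, vs, n) (map (case_nat c e) is)"
      if "set vs \<subseteq> {..<length is} \<times> {..<m}" "set n \<subseteq> N" "fmla M (length vs + length n) \<phi>" for \<phi> vs n "is" b
    proof (cases b)
      case True
      have "map (case_nat (c' b) e) is ! l ! v = \<sigma> (map (case_nat c e) is ! l ! v)" if "(l, v) \<in> set vs" for l v
      proof -
        have l: "l < length is" "v < m" using that \<open>set vs \<subseteq> _\<close> by auto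
        have "\<sigma> (e j ! v) = e j ! v" for j
          using FixD(2)[OF s] e(1,2)[of j] l(2) nth_mem by (metis m_def subsetD)
        then show ?thesis using l True by (auto simp: c'_def m_def split: nat.splits)
      qed
      then have "map (\<lambda>(l, v). map (case_nat (c' b) e) is ! l ! v) vs @ n =
          map \<sigma> (map (\<lambda>(l, v). map (case_nat c e) is ! l ! v) vs @ n)"
        using Fix_map[OF s that(2)] by auto
      then show ?thesis unfolding evl_def split
        using Aut_holds[OF FixD(1)[OF s], of "map (\<lambda>(l, v). map (case_nat c e) is ! l ! v) vs @ n" \<phi>] that(3)
        by (simp del: map_append)
    qed (simp add: c'_def)
    define h where "h = case_sum (\<lambda>(j, v). e j ! v) id"
    have "F x h" if x: "x \<in> J" for x
    proof -
      obtain k \<phi> vs n "is" js b where xe: "x = ((k, \<phi>, vs, n), is, js, b)" by (metis prod_cases4 surj_pair)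
      have I: "set vs \<subseteq> {..<k} \<times> {..<m}" "set n \<subseteq> N" "fmla M (length vs + length n) \<phi>"
        "increasing rge is" "increasing rge js" "length is = k" "length js = k"
        using x J(1) unfolding xe I_def by auto
      have "(k, \<phi>, vs, n) \<in> fst ` J" using x unfolding xe by force
      moreover have "set is \<union> set js \<subseteq> {..Z}" using Z x unfolding xe by force
      ultimately have "evl M (\<phi>, vs, n) (map (case_nat c e) is) \<longleftrightarrow> evl M (\<phi>, vs, n) (map (case_nat c e) js)"
        using e(3) I(4-7) by blast
      then have "evl M (\<phi>, vs, n) (map (case_nat (c' b) e) is) \<longleftrightarrow> evl M (\<phi>, vs, n) (map (case_nat (c' b) e) js)"
        using sig I by simp
      then show ?thesis unfolding xe F_def split using I
        by (subst (1 2) val[where e = e]) (auto simp: h_def)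
    qed
    then show "\<exists>h. (\<forall>v\<in>Inr ` Par. h v = h0 v) \<and> (\<forall>P\<in>q. P h)"
      unfolding J(3) by (intro exI[of _ h]) (auto simp: h_def h0_def)
  qed auto
  define e where "e j = map (\<lambda>v. h (Inl (j, v))) [0..<m]" for j
  have ind: "indiscernible M N rge {..<m} (\<lambda>i v. case_nat (c' b) e i ! v)" for b
    unfolding indiscernible_def
  proof (intro allI impI)
    fix "is" js vs \<phi> n assume a: "increasing rge is \<and> increasing rge js \<and> length is = length js \<and>
      set vs \<subseteq> {..<length is} \<times> {..<m} \<and> set n \<subseteq> N \<and> fmla M (length vs + length n) \<phi>"
    define k where "k = length is"
    have "((k, \<phi>, vs, n), is, js, b) \<in> I" using a unfolding I_def k_def by auto
    then have "F ((k, \<phi>, vs, n), is, js, b) h" by (intro h(2)[of "F ((k, \<phi>, vs, n), is, js, b)"]) simp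
    moreover have v: "holds M \<phi> (map h (vars b is vs n)) \<longleftrightarrow> evl M (\<phi>, vs, n) (map (case_nat (c' b) e) is)"
      if "length is = k" for "is"
      using a that h(1) by (intro val) (auto simp: e_def h0_def k_def)
    ultimately have "evl M (\<phi>, vs, n) (map (case_nat (c' b) e) is) \<longleftrightarrow> evl M (\<phi>, vs, n) (map (case_nat (c' b) e) js)"
      unfolding F_def using a by (simp add: k_def)
    moreover have "evl M (\<phi>, vs, n) (map (case_nat (c' b) e) is) \<longleftrightarrow>
        holds M \<phi> (map (\<lambda>(l, v). case_nat (c' b) e (is ! l) ! v) vs @ n)" if "length is = k" for "is"
    proof -
      have "map (\<lambda>(l, v). map (case_nat (c' b) e) is ! l ! v) vs = map (\<lambda>(l, v). case_nat (c' b) e (is ! l) ! v) vs"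
        using a that by (auto simp: k_def)
      then show ?thesis unfolding evl_def split by (simp only:)
    qed
    ultimately show "holds M \<phi> (map (\<lambda>(l, v). case_nat (c' b) e (is ! l) ! v) vs @ n) \<longleftrightarrow>
        holds M \<phi> (map (\<lambda>(l, v). case_nat (c' b) e (js ! l) ! v) vs @ n)" using a by (simp add: k_def)
  qed
  show thesis
  proof (rule that[of e])
    show "length (e i) = length c" for i by (simp add: e_def m_def)
    show "indiscernible M N rge {..<length c} (\<lambda>i v. case_nat c e i ! v)"
      using ind[of False] unfolding c'_def m_def by (simp only: if_False if_True)
    show "indiscernible M N rge {..<length c} (\<lambda>i v. case_nat (map \<sigma> c) e i ! v)"
      using ind[of True] unfolding c'_def m_def by (simp only: if_False if_True)
  qed
qed

end

section \<open>Lascar-invariant independence\<close>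

lemma type_image_comp: "type_image (\<sigma> \<circ> \<tau>) p = type_image \<sigma> (type_image \<tau> p)"
  unfolding type_image_def image_image by (intro image_cong) (auto split: prod.splits)

lemma type_image_id: "type_image id p = p"
  by (auto simp: type_image_def image_iff split_beta)

lemma type_image_mono: "p \<subseteq> q \<Longrightarrow> type_image \<sigma> p \<subseteq> type_image \<sigma> q"
  unfolding type_image_def by (rule image_mono)

lemma formula_of_definable:
  assumes "definable M {..<k} P"
  obtains \<chi> where "fmla M k \<chi>" "\<And>e. length e = k \<Longrightarrow> holds M \<chi> e \<longleftrightarrow> P ((!) e)"
proof -
  have "definable M (set [0..<k]) P" using assms by (simp add: atLeast0LessThan)
  then obtain \<chi> where \<chi>: "fmla M (length [0..<k]) \<chi>" "\<And>h. P h \<longleftrightarrow> holds M \<chi> (map h [0..<k])"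
    by (rule definable_list) (rule that)
  have "holds M \<chi> e \<longleftrightarrow> P ((!) e)" if "length e = k" for e
    using \<chi>(2)[of "(!) e"] map_nth[of e] that by simp
  then show thesis using that \<chi>(1) by simp
qed

lemma map_nth_left: "map ((!) (xs @ ys)) [0..<length xs] = xs"
  by (rule nth_equalityI) (auto simp: nth_append)

lemma map_nth_right: "map ((!) (xs @ ys)) [length xs..<length xs + length ys] = ys"
  by (rule nth_equalityI) (auto simp: nth_append)

lemma map_nth_middle: "map ((!) (xs @ ys @ zs)) [length xs..<length xs + length ys] = ys"
  by (rule nth_equalityI) (auto simp: nth_append)

text \<open>Used with the biconditional, which expresses invariance between two parameters, and with
  conjunction and negation, which express alternation.\<close>

lemma formula_pair:
  assumes \<phi>: "fmla M (n + m) \<phi>"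
    and f: "\<And>V P Q. definable M (V :: nat set) P \<Longrightarrow> definable M V Q \<Longrightarrow> definable M V (\<lambda>h. f (P h) (Q h))"
  obtains \<chi> where "fmla M (n + (m + m)) \<chi>"
    "\<And>a d d'. length a = n \<Longrightarrow> length d = m \<Longrightarrow> length d' = m \<Longrightarrow>
      holds M \<chi> (a @ d @ d') \<longleftrightarrow> f (holds M \<phi> (a @ d)) (holds M \<phi> (a @ d'))"
proof -
  have "definable M {..<n + (m + m)} (\<lambda>h. f (holds M \<phi> (map h ([0..<n] @ [n..<n + m])))
      (holds M \<phi> (map h ([0..<n] @ [n + m..<n + m + m]))))"
    using \<phi> by (intro f dfnI) auto
  then obtain \<chi> where \<chi>: "fmla M (n + (m + m)) \<chi>"
    "\<And>e. length e = n + (m + m) \<Longrightarrow> holds M \<chi> e \<longleftrightarrow> f (holds M \<phi> (map ((!) e) ([0..<n] @ [n..<n + m])))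
      (holds M \<phi> (map ((!) e) ([0..<n] @ [n + m..<n + m + m])))"
    by (rule formula_of_definable) (rule that)
  show thesis
  proof (rule that[OF \<chi>(1)])
    fix a d d' :: "'c list" assume l: "length a = n" "length d = m" "length d' = m"
    have "map ((!) (a @ d @ d')) [0..<n] = a" using map_nth_left[of a "d @ d'"] l by simp
    moreover have "map ((!) (a @ d @ d')) [n..<n + m] = d" using map_nth_middle[of a d d'] l by simp
    moreover have "map ((!) (a @ d @ d')) [n + m..<n + m + m] = d'" using map_nth_right[of "a @ d" d'] l by simp
    ultimately show "holds M \<chi> (a @ d @ d') \<longleftrightarrow> f (holds M \<phi> (a @ d)) (holds M \<phi> (a @ d'))"
      using \<chi>(2)[of "a @ d @ d'"] l by (simp only: map_append length_append)
  qed
qed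

text \<open>Parameters range over the whole universe, which need not be small, so saturation does
  not apply. A maximal finitely satisfiable set containing \<open>\<Sigma>\<close> exists by Zorn's
  lemma and is complete.\<close>

lemma global_type_extend:
  fixes M :: "('f, 'p, 'm) struct"
  assumes "\<Sigma> \<subseteq> insts M X UNIV"
    and "\<And>q. q \<subseteq> \<Sigma> \<Longrightarrow> finite q \<Longrightarrow> \<exists>h. \<forall>(\<phi>, xs, c)\<in>q. holds M \<phi> (map h xs @ c)"
  obtains p where "global_type M X p" "\<Sigma> \<subseteq> p"
proof -
  define sat where "sat q h \<longleftrightarrow> (\<forall>(\<phi>, xs, c)\<in>q. holds M \<phi> (map h xs @ c))"
    for q :: "('f, 'p, 'm) inst set" and h
  define \<T> where "\<T> = {p. \<Sigma> \<subseteq> p \<and> p \<subseteq> insts M X UNIV \<and> (\<forall>q\<subseteq>p. finite q \<longrightarrow> (\<exists>h. sat q h))}"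
  have "\<Sigma> \<in> \<T>" using assms by (simp add: \<T>_def sat_def)
  then have ne: "\<T> \<noteq> {}" by blast
  have ch: "\<Union>\<C> \<in> \<T>" if "\<C> \<noteq> {}" and C: "subset.chain \<T> \<C>" for \<C>
  proof -
    have CT: "\<C> \<subseteq> \<T>" using C by (simp add: subset.chain_def)
    have "\<exists>h. sat q h" if q: "q \<subseteq> \<Union>\<C>" "finite q" for q
    proof -
      obtain p where "p \<in> \<C>" "q \<subseteq> p" using finite_subset_Union_chain[OF q(2,1) \<open>\<C> \<noteq> {}\<close> C] by metis
      then show ?thesis using CT q(2) by (auto simp: \<T>_def)
    qed
    moreover have "\<Sigma> \<subseteq> \<Union>\<C>"
    proof -
      obtain p where "p \<in> \<C>" using \<open>\<C> \<noteq> {}\<close> by blast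
      moreover from this have "\<Sigma> \<subseteq> p" using CT unfolding \<T>_def by blast
      ultimately show ?thesis by blast
    qed
    moreover have "\<Union>\<C> \<subseteq> insts M X UNIV" using CT by (auto simp: \<T>_def)
    ultimately show ?thesis by (simp add: \<T>_def)
  qed
  obtain p where p: "p \<in> \<T>" and max: "\<And>p'. p' \<in> \<T> \<Longrightarrow> p \<subseteq> p' \<Longrightarrow> p' = p"
    using subset_Zorn_nonempty[OF ne ch] by blast
  have pfin: "\<exists>h. sat q h" if "q \<subseteq> p" "finite q" for q using p that by (simp add: \<T>_def)
  have bad: "\<exists>q. q \<subseteq> p \<and> finite q \<and> (\<forall>h. \<not> sat (insert x q) h)" if x: "x \<in> insts M X UNIV" "x \<notin> p" for x
  proof (rule ccontr)
    assume no: "\<not> ?thesis"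
    have "\<exists>h. sat q h" if q: "q \<subseteq> insert x p" "finite q" for q
    proof -
      have "q - {x} \<subseteq> p" "finite (q - {x})" using q by auto
      then obtain h where "sat (insert x (q - {x})) h" using no by blast
      then have "sat q h" by (auto simp: sat_def)
      then show ?thesis by blast
    qed
    then have "insert x p \<in> \<T>" using p x(1) by (auto simp: \<T>_def)
    then show False using max x(2) by blast
  qed
  have "(\<phi>, xs, c) \<in> p \<or> (Neg \<phi>, xs, c) \<in> p" if i: "(\<phi>, xs, c) \<in> insts M X UNIV" for \<phi> xs c
  proof (rule ccontr)
    assume n: "\<not> ?thesis"
    have i': "(Neg \<phi>, xs, c) \<in> insts M X UNIV" using i by (simp add: insts_def)
    obtain q where q: "q \<subseteq> p" "finite q" "\<And>h. \<not> sat (insert (\<phi>, xs, c) q) h" using bad[OF i] n by blast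
    obtain q' where q': "q' \<subseteq> p" "finite q'" "\<And>h. \<not> sat (insert (Neg \<phi>, xs, c) q') h" using bad[OF i'] n by blast
    obtain h where h: "sat (q \<union> q') h" using pfin[of "q \<union> q'"] q q' by auto
    then have "sat q h" "sat q' h" unfolding sat_def by blast+
    then show False using q(3)[of h] q'(3)[of h] by (auto simp: sat_def)
  qed
  then have "\<forall>(\<phi>, xs, c)\<in>insts M X UNIV. (\<phi>, xs, c) \<in> p \<or> (Neg \<phi>, xs, c) \<in> p" by auto
  then have "global_type M X p" using p by (simp add: global_type_def \<T>_def sat_def)
  moreover have "\<Sigma> \<subseteq> p" using p by (simp add: \<T>_def)
  ultimately show thesis using that by blast
qed

context monster
begin

text \<open>Composition extends the inclusion from the generators to the group, and inverses turn it
  into equality.\<close>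

lemma type_image_AutfL:
  assumes "\<And>\<sigma> \<phi> xs c. \<sigma> \<in> strong C \<Longrightarrow> (\<phi>, xs, c) \<in> p \<Longrightarrow> (\<phi>, xs, map \<sigma> c) \<in> p"
    and s: "\<sigma> \<in> AutfL \<kappa> M C"
  shows "type_image \<sigma> p = p"
proof -
  have sub: "type_image \<sigma> p \<subseteq> p" if "\<sigma> \<in> AutfL \<kappa> M C" for \<sigma>
    using that
  proof (induction rule: AutfL_induct)
    case id
    show ?case by (simp only: type_image_id order_refl)
  next
    case (strong \<sigma>)
    then show ?case using assms(1) by (auto simp: type_image_def)
  next
    case (comp \<sigma> \<tau>)
    then show ?case unfolding type_image_comp by (meson order_trans type_image_mono)
  qed
  have "\<sigma> \<circ> inv_into UNIV \<sigma> = id" using Aut_inv_right[OF AutfL_Aut[OF s]] by (simp add: fun_eq_iff)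
  then have "p = type_image \<sigma> (type_image (inv_into UNIV \<sigma>) p)"
    by (simp only: type_image_comp[symmetric] type_image_id)
  also have "\<dots> \<subseteq> type_image \<sigma> p" using sub[OF AutfL_inv[OF s]] by (rule type_image_mono)
  finally show ?thesis using sub[OF s] by blast
qed

lemma global_type_complete:
  assumes "global_type M X p" and "(\<phi>, xs, c) \<in> insts M X UNIV"
  shows "(\<phi>, xs, c) \<in> p \<or> (Neg \<phi>, xs, c) \<in> p"
proof -
  have "\<forall>(\<phi>, xs, c)\<in>insts M X UNIV. (\<phi>, xs, c) \<in> p \<or> (Neg \<phi>, xs, c) \<in> p"
    using assms(1) by (simp add: global_type_def)
  then show ?thesis using assms(2) by blast
qed

lemma freeE:
  assumes "free X C Y"
  obtains p where "global_type M X p" "tp M X (Y \<union> C) \<subseteq> p" "\<And>\<sigma>. \<sigma> \<in> AutfL \<kappa> M C \<Longrightarrow> type_image \<sigma> p = p"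
  using assms unfolding free_def by blast

text \<open>Variables are renamed by \<open>\<alpha>\<close> and parameters moved by
  \<open>\<rho>\<close> independently: \<open>free_Aut\<close> takes one automorphism for both,
  \<open>free_ext_right\<close> the identity for \<open>\<alpha>\<close>.\<close>

lemma global_type_transport:
  assumes p: "global_type M X p" and r: "\<rho> \<in> Aut M" and inj: "inj_on \<alpha> X"
    and inv: "\<And>\<sigma>. \<sigma> \<in> AutfL \<kappa> M C \<Longrightarrow> type_image \<sigma> p = p"
  defines "p' \<equiv> (\<lambda>(\<phi>, xs, c). (\<phi>, map \<alpha> xs, map \<rho> c)) ` p"
  shows "global_type M (\<alpha> ` X) p'" "\<And>\<sigma>. \<sigma> \<in> AutfL \<kappa> M (\<rho> ` C) \<Longrightarrow> type_image \<sigma> p' = p'"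
proof -
  have pi: "p \<subseteq> insts M X UNIV" using p by (simp add: global_type_def)
  show "global_type M (\<alpha> ` X) p'"
    unfolding global_type_def
  proof (intro conjI allI impI ballI)
    show "p' \<subseteq> insts M (\<alpha> ` X) UNIV"
    proof
      fix x assume "x \<in> p'"
      then obtain \<phi> xs c where x: "(\<phi>, xs, c) \<in> p" "x = (\<phi>, map \<alpha> xs, map \<rho> c)" by (auto simp: p'_def)
      have "(\<phi>, xs, c) \<in> insts M X UNIV" using x(1) pi by blast
      then show "x \<in> insts M (\<alpha> ` X) UNIV" unfolding x(2) by (auto simp: insts_def)
    qed
  next
    fix q assume q: "q \<subseteq> p'" "finite q"
    obtain q0 where q0: "q0 \<subseteq> p" "finite q0" "q = (\<lambda>(\<phi>, xs, c). (\<phi>, map \<alpha> xs, map \<rho> c)) ` q0"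
      using finite_subset_image[OF q(2) q(1)[unfolded p'_def]] by blast
    obtain h where h: "\<And>\<phi> xs c. (\<phi>, xs, c) \<in> q0 \<Longrightarrow> holds M \<phi> (map h xs @ c)"
      by (rule global_type_realised[OF p q0(1,2)]) (rule that)
    have "holds M \<phi> (map (\<rho> \<circ> h \<circ> inv_into X \<alpha>) (map \<alpha> xs) @ map \<rho> c)" if x: "(\<phi>, xs, c) \<in> q0" for \<phi> xs c
    proof -
      have i: "set xs \<subseteq> X" "fmla M (length xs + length c) \<phi>" using x q0(1) pi by (auto simp: insts_def)
      have "map (\<rho> \<circ> h \<circ> inv_into X \<alpha>) (map \<alpha> xs) @ map \<rho> c = map \<rho> (map h xs @ c)"
        using i(1) inj by (auto simp: inv_into_f_f subset_iff)
      then show ?thesis using Aut_holds[OF r, of "map h xs @ c" \<phi>] h[OF x] i(2) by (simp only: length_append length_map)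
    qed
    then show "\<exists>h. \<forall>(\<phi>, xs, c)\<in>q. holds M \<phi> (map h xs @ c)"
      unfolding q0(3) by (intro exI[of _ "\<rho> \<circ> h \<circ> inv_into X \<alpha>"]) fast
  next
    fix x assume "x \<in> insts M (\<alpha> ` X) UNIV"
    moreover obtain \<phi> ys d where x: "x = (\<phi>, ys, d)" by (cases x)
    ultimately have i: "set ys \<subseteq> \<alpha> ` X" "fmla M (length ys + length d) \<phi>" by (auto simp: insts_def)
    obtain xs where xs: "set xs \<subseteq> X" "ys = map \<alpha> xs" using set_subset_image_list[OF i(1)] by blast
    define c where "c = map (inv_into UNIV \<rho>) d"
    have d: "d = map \<rho> c" unfolding c_def using Aut_inv_right[OF r] by (simp add: map_idI)
    have "(\<phi>, xs, c) \<in> insts M X UNIV" using i xs d by (simp add: insts_def)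
    then have "(\<phi>, xs, c) \<in> p \<or> (Neg \<phi>, xs, c) \<in> p" by (rule global_type_complete[OF p])
    then show "case x of (\<phi>, xs, c) \<Rightarrow> (\<phi>, xs, c) \<in> p' \<or> (Neg \<phi>, xs, c) \<in> p'"
      unfolding x xs(2) d p'_def by force
  qed
  fix \<sigma> assume s: "\<sigma> \<in> AutfL \<kappa> M (\<rho> ` C)"
  \<comment> \<open>Invariance of the moved type under \<open>\<sigma>\<close> amounts to invariance
    of \<open>p\<close> under this conjugate of \<open>\<sigma>\<close>.\<close>
  define \<tau> where "\<tau> = inv_into UNIV \<rho> \<circ> \<sigma> \<circ> \<rho>"
  have "inv_into UNIV (inv_into UNIV \<rho>) = \<rho>" using Aut_bij[OF r] by (rule inv_inv_eq)
  moreover have "inv_into UNIV \<rho> ` \<rho> ` C = C" using Aut_inv_left[OF r] by (simp add: image_image)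
  ultimately have "\<tau> \<in> AutfL \<kappa> M C" using AutfL_conj[OF s Aut_inv[OF r]] by (simp only: \<tau>_def)
  then have ti: "type_image \<tau> p = p" by (rule inv)
  have \<tau>: "\<rho> (\<tau> v) = \<sigma> (\<rho> v)" for v using Aut_inv_right[OF r] by (simp add: \<tau>_def)
  have "type_image \<sigma> p' = (\<lambda>(\<phi>, xs, c). (\<phi>, map \<alpha> xs, map \<rho> c)) ` type_image \<tau> p"
    unfolding p'_def type_image_def image_image by (intro image_cong) (auto simp: \<tau>)
  then show "type_image \<sigma> p' = p'" by (simp add: ti p'_def)
qed

section \<open>Closure properties of Lascar-invariant independence\<close>

lemma free_Aut:
  assumes "free X C Y" and s: "\<sigma> \<in> Aut M"
  shows "free (\<sigma> ` X) (\<sigma> ` C) (\<sigma> ` Y)"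
proof -
  obtain p where p: "global_type M X p" "tp M X (Y \<union> C) \<subseteq> p" "\<And>\<sigma>. \<sigma> \<in> AutfL \<kappa> M C \<Longrightarrow> type_image \<sigma> p = p"
    by (rule freeE[OF assms(1)]) (rule that)
  have inj: "inj_on \<sigma> X" using Aut_bij[OF s] by (meson bij_is_inj inj_on_subset subset_UNIV)
  have "tp M (\<sigma> ` X) (\<sigma> ` Y \<union> \<sigma> ` C) \<subseteq> (\<lambda>(\<phi>, xs, c). (\<phi>, map \<sigma> xs, map \<sigma> c)) ` p"
  proof
    fix x assume x: "x \<in> tp M (\<sigma> ` X) (\<sigma> ` Y \<union> \<sigma> ` C)"
    obtain \<phi> ys d where xe: "x = (\<phi>, ys, d)" by (cases x)
    have i: "set ys \<subseteq> \<sigma> ` X" "set d \<subseteq> \<sigma> ` (Y \<union> C)" "fmla M (length ys + length d) \<phi>" "holds M \<phi> (ys @ d)"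
      using x unfolding xe by (auto simp: tp_def insts_def)
    obtain xs where xs: "set xs \<subseteq> X" "ys = map \<sigma> xs" using set_subset_image_list[OF i(1)] by blast
    obtain c where c: "set c \<subseteq> Y \<union> C" "d = map \<sigma> c" using set_subset_image_list[OF i(2)] by blast
    have "holds M \<phi> (xs @ c)" using Aut_holds[OF s, of "xs @ c" \<phi>] i(3,4) xs(2) c(2) by simp
    then have "(\<phi>, xs, c) \<in> p" using p(2) xs c i(3) by (auto simp: tp_def insts_def)
    then show "x \<in> (\<lambda>(\<phi>, xs, c). (\<phi>, map \<sigma> xs, map \<sigma> c)) ` p" unfolding xe xs(2) c(2) by force
  qed
  then show ?thesis unfolding free_def using global_type_transport[OF p(1) s inj p(3)] by blast
qed

lemma free_mono:
  assumes "free X C Y" "X' \<subseteq> X" "Y' \<subseteq> Y"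
  shows "free X' C Y'"
proof -
  obtain p where p: "global_type M X p" "tp M X (Y \<union> C) \<subseteq> p" "\<And>\<sigma>. \<sigma> \<in> AutfL \<kappa> M C \<Longrightarrow> type_image \<sigma> p = p"
    by (rule freeE[OF assms(1)]) (rule that)
  define p' where "p' = p \<inter> insts M X' UNIV"
  have "global_type M X' p'"
    unfolding global_type_def
  proof (intro conjI allI impI ballI)
    fix q assume q: "q \<subseteq> p'" "finite q"
    have "q \<subseteq> p" using q(1) by (auto simp: p'_def)
    then obtain h where "\<And>\<phi> xs c. (\<phi>, xs, c) \<in> q \<Longrightarrow> holds M \<phi> (map h xs @ c)"
      by (rule global_type_realised[OF p(1) _ q(2)]) (rule that)
    then show "\<exists>h. \<forall>(\<phi>, xs, c)\<in>q. holds M \<phi> (map h xs @ c)" by blast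
  next
    fix x assume "x \<in> insts M X' UNIV"
    moreover obtain \<phi> xs c where x: "x = (\<phi>, xs, c)" by (cases x)
    ultimately have i: "set xs \<subseteq> X'" "fmla M (length xs + length c) \<phi>" by (auto simp: insts_def)
    then have "(\<phi>, xs, c) \<in> p \<or> (Neg \<phi>, xs, c) \<in> p"
      using assms(2) by (intro global_type_complete[OF p(1)]) (auto simp: insts_def)
    then show "case x of (\<phi>, xs, c) \<Rightarrow> (\<phi>, xs, c) \<in> p' \<or> (Neg \<phi>, xs, c) \<in> p'"
      using i unfolding x p'_def by (auto simp: insts_def)
  qed (simp add: p'_def)
  moreover have "tp M X' (Y' \<union> C) \<subseteq> p'"
  proof
    fix x assume "x \<in> tp M X' (Y' \<union> C)"
    moreover obtain \<phi> xs c where x: "x = (\<phi>, xs, c)" by (cases x)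
    ultimately have i: "set xs \<subseteq> X'" "set c \<subseteq> Y' \<union> C" "fmla M (length xs + length c) \<phi>" "holds M \<phi> (xs @ c)"
      by (auto simp: tp_def insts_def)
    then have "(\<phi>, xs, c) \<in> tp M X (Y \<union> C)" using assms(2,3) by (auto simp: tp_def insts_def)
    then show "x \<in> p'" using p(2) i(1,3) unfolding x p'_def by (auto simp: insts_def)
  qed
  moreover have "type_image \<sigma> p' = p'" if s: "\<sigma> \<in> AutfL \<kappa> M C" for \<sigma>
  proof (rule type_image_AutfL[OF _ s])
    fix \<sigma> \<phi> xs c assume "\<sigma> \<in> strong C" and x: "(\<phi>, xs, c) \<in> p'"
    then have "type_image \<sigma> p = p" using AutfL_strong p(3) by blast
    then have "(\<phi>, xs, map \<sigma> c) \<in> p" using x unfolding p'_def type_image_def by force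
    then show "(\<phi>, xs, map \<sigma> c) \<in> p'" using x by (simp add: p'_def insts_def)
  qed
  ultimately show ?thesis unfolding free_def by blast
qed

lemma free_base_mono:
  assumes "free X C (Y \<union> D)"
  shows "free X (C \<union> Y) D"
proof -
  obtain p where p: "global_type M X p" "tp M X ((Y \<union> D) \<union> C) \<subseteq> p" "\<And>\<sigma>. \<sigma> \<in> AutfL \<kappa> M C \<Longrightarrow> type_image \<sigma> p = p"
    by (rule freeE[OF assms]) (rule that)
  have "D \<union> (C \<union> Y) = (Y \<union> D) \<union> C" by auto
  then have "tp M X (D \<union> (C \<union> Y)) \<subseteq> p" using p(2) by (simp only:)
  then show ?thesis unfolding free_def using p(1,3) AutfL_mono[of _ "C \<union> Y" C] by blast
qed

text \<open>The restriction of the global type to \<open>D\<close> and \<open>C\<close> is realised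
  by a conjugate of \<open>X\<close> over \<open>Y\<close> and \<open>C\<close>. Moving this
  realisation back to \<open>X\<close> moves \<open>D\<close> instead, and takes the global type to
  one that is again invariant over \<open>C\<close>.\<close>

lemma free_ext_right:
  assumes X: "small \<kappa> X" and C: "small \<kappa> C" and D: "small \<kappa> D" and free: "free X C Y" and YD: "Y \<subseteq> D"
  obtains \<rho> where "\<rho> \<in> Fix (Y \<union> C)" "free X C (\<rho> ` D)"
proof -
  obtain p where p: "global_type M X p" "tp M X (Y \<union> C) \<subseteq> p" "\<And>\<sigma>. \<sigma> \<in> AutfL \<kappa> M C \<Longrightarrow> type_image \<sigma> p = p"
    by (rule freeE[OF free]) (rule that)
  have pi: "p \<subseteq> insts M X UNIV" using p(1) by (simp add: global_type_def)
  define V :: "('m + 'm) set" where "V = Inl ` X \<union> Inr ` (D \<union> C)"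
  have V: "small \<kappa> V" unfolding V_def by (intro small_Plus small_Un X C D)
  define I where "I = {(\<phi>, xs, c). (\<phi>, xs, c) \<in> p \<and> set c \<subseteq> D \<union> C}"
  define F :: "('f, 'p, 'm) inst \<Rightarrow> ('m + 'm \<Rightarrow> 'm) \<Rightarrow> bool" where
    "F = (\<lambda>(\<phi>, xs, c) h. holds M \<phi> (map h (map Inl xs @ map Inr c)))"
  define h0 :: "'m + 'm \<Rightarrow> 'm" where "h0 = case_sum id id"
  obtain h where h: "\<And>v. v \<in> Inr ` (D \<union> C) \<Longrightarrow> h v = h0 v" "\<And>P. P \<in> F ` I \<Longrightarrow> P h"
  proof (rule compactness[OF V, of "F ` I" "Inr ` (D \<union> C)" h0])
    have "definable M V (F x)" if "x \<in> I" for x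
    proof -
      obtain \<phi> xs c where x: "x = (\<phi>, xs, c)" by (cases x)
      have "set xs \<subseteq> X" "set c \<subseteq> D \<union> C" "fmla M (length xs + length c) \<phi>"
        using that pi unfolding x I_def by (auto simp: insts_def)
      then show ?thesis unfolding x F_def split V_def by (intro dfnI) auto
    qed
    then show "definable M V P" if "P \<in> F ` I" for P using that by (elim imageE) simp
    fix q assume q: "q \<subseteq> F ` I" "finite q"
    obtain J where J: "J \<subseteq> I" "finite J" "q = F ` J" using finite_subset_image[OF q(2,1)] by blast
    have "J \<subseteq> p" using J(1) by (auto simp: I_def)
    then obtain h where h: "\<And>\<phi> xs c. (\<phi>, xs, c) \<in> J \<Longrightarrow> holds M \<phi> (map h xs @ c)"
      by (rule global_type_realised[OF p(1) _ J(2)]) (rule that)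
    have "F x (case_sum h id)" if "x \<in> J" for x
      using h that by (cases x) (simp add: F_def o_def)
    then show "\<exists>h. (\<forall>v\<in>Inr ` (D \<union> C). h v = h0 v) \<and> (\<forall>P\<in>q. P h)"
      unfolding J(3) by (intro exI[of _ "case_sum h id"]) (auto simp: h0_def)
  qed (auto simp: V_def)
  have hc: "map (h \<circ> Inr) c = c" if "set c \<subseteq> D \<union> C" for c
    using h(1) that by (intro map_idI) (auto simp: h0_def)
  have realise: "holds M \<phi> (map (h \<circ> Inl) xs @ c)" if "(\<phi>, xs, c) \<in> p" "set c \<subseteq> D \<union> C" for \<phi> xs c
  proof -
    have "F (\<phi>, xs, c) h" using that by (intro h(2)[of "F (\<phi>, xs, c)"]) (auto simp: I_def)
    then show ?thesis using hc[OF that(2)] by (simp add: F_def)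
  qed
  have YC: "small \<kappa> (Y \<union> C)" using small_subset[OF D YD] small_Un C by blast
  obtain \<tau> where t: "\<tau> \<in> Fix (Y \<union> C)" "\<And>x. x \<in> X \<Longrightarrow> (h \<circ> Inl) x = \<tau> (id x)"
  proof (rule aut_over_of_definable[OF X YC, of id "h \<circ> Inl"])
    fix P assume P: "definable M (Inl ` X \<union> Inr ` (Y \<union> C)) P" "P (case_sum id id)"
    obtain \<phi> us c where u: "set us \<subseteq> X" "set c \<subseteq> Y \<union> C" "fmla M (length us + length c) \<phi>"
      "\<And>h. P h \<longleftrightarrow> holds M \<phi> (map (\<lambda>v. h (Inl v)) us @ map (\<lambda>v. h (Inr v)) c)"
      by (rule definable_split[OF P(1)]) (rule that)
    have "holds M \<phi> (us @ c)" using P(2) unfolding u(4) by simp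
    then have "(\<phi>, us, c) \<in> tp M X (Y \<union> C)" using u by (simp add: tp_def insts_def)
    then have "holds M \<phi> (map (h \<circ> Inl) us @ c)" using realise p(2) u(2) YD by blast
    then show "P (case_sum (h \<circ> Inl) id)" unfolding u(4) by (simp add: o_def)
  qed auto
  have ta: "\<tau> \<in> Aut M" by (rule FixD(1)[OF t(1)])
  define \<rho> where "\<rho> = inv_into UNIV \<tau>"
  have r: "\<rho> \<in> Fix (Y \<union> C)" unfolding \<rho>_def by (rule Fix_inv[OF t(1)])
  have ra: "\<rho> \<in> Aut M" by (rule FixD(1)[OF r])
  have rC: "\<rho> ` C = C" using Fix_image[OF r] by blast
  define p' where "p' = (\<lambda>(\<phi>, xs, c). (\<phi>, map id xs, map \<rho> c)) ` p"
  have "global_type M (id ` X) p'" "\<And>\<sigma>. \<sigma> \<in> AutfL \<kappa> M (\<rho> ` C) \<Longrightarrow> type_image \<sigma> p' = p'"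
    unfolding p'_def by (rule global_type_transport[OF p(1) ra inj_on_id p(3)], assumption)+
  then have p': "global_type M X p'" "\<And>\<sigma>. \<sigma> \<in> AutfL \<kappa> M C \<Longrightarrow> type_image \<sigma> p' = p'"
    by (simp_all only: image_id id_apply rC)
  have "tp M X (\<rho> ` D \<union> C) \<subseteq> p'"
  proof
    fix x assume x: "x \<in> tp M X (\<rho> ` D \<union> C)"
    obtain \<phi> xs c where xe: "x = (\<phi>, xs, c)" by (cases x)
    have i: "set xs \<subseteq> X" "set c \<subseteq> \<rho> ` D \<union> C" "fmla M (length xs + length c) \<phi>" "holds M \<phi> (xs @ c)"
      using x unfolding xe by (auto simp: tp_def insts_def)
    have tr: "\<tau> (\<rho> v) = v" "\<rho> (\<tau> v) = v" for v using Aut_inv_right[OF ta] Aut_inv_left[OF ta] by (simp_all add: \<rho>_def)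
    have tc: "set (map \<tau> c) \<subseteq> D \<union> C" using i(2) FixD(2)[OF t(1)] tr by auto
    have "map \<tau> xs = map (h \<circ> Inl) xs" using t(2) i(1) by auto
    then have "holds M \<phi> (map (h \<circ> Inl) xs @ map \<tau> c)"
      using Aut_holds[OF ta, of "xs @ c" \<phi>] i(3,4) by (simp only: map_append length_append)
    then have "(Neg \<phi>, xs, map \<tau> c) \<notin> p" using realise[OF _ tc, of "Neg \<phi>" xs] by auto
    then have "(\<phi>, xs, map \<tau> c) \<in> p" using global_type_Neg[OF p(1) i(1), of "map \<tau> c" \<phi>] i(3) by simp
    moreover have "map \<rho> (map \<tau> c) = c" using tr by (simp add: map_idI)
    ultimately show "x \<in> p'" unfolding xe p'_def by (intro image_eqI[of _ _ "(\<phi>, xs, map \<tau> c)"]) simp_all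
  qed
  then have "free X C (\<rho> ` D)" unfolding free_def using p' by blast
  then show thesis using that r by blast
qed

lemma free_ext_left:
  assumes "small \<kappa> X" "small \<kappa> C" "small \<kappa> D" "free X C Y" "Y \<subseteq> D"
  obtains \<sigma> where "\<sigma> \<in> Fix (Y \<union> C)" "free (\<sigma> ` X) C D"
proof -
  obtain \<rho> where r: "\<rho> \<in> Fix (Y \<union> C)" "free X C (\<rho> ` D)" by (rule free_ext_right[OF assms])
  let ?\<tau> = "inv_into UNIV \<rho>"
  have t: "?\<tau> \<in> Fix (Y \<union> C)" by (rule Fix_inv[OF r(1)])
  have "free (?\<tau> ` X) (?\<tau> ` C) (?\<tau> ` \<rho> ` D)" by (rule free_Aut[OF r(2) FixD(1)[OF t]])
  moreover have "?\<tau> ` C = C" using Fix_image[OF t] by blast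
  moreover have "?\<tau> ` \<rho> ` D = D" using Aut_inv_left[OF FixD(1)[OF r(1)]] by (auto simp: image_image)
  ultimately show thesis using that t by simp
qed

text \<open>Subtuples at different increasing indices are Lascar equivalent over \<open>C\<close>,
  hence conjugate over \<open>X\<close> and \<open>C\<close> together by independence.\<close>

lemma free_indiscernible:
  fixes r :: "'i rel"
  assumes "small \<kappa> X" "small \<kappa> C" "Linear_order r" "infinite (Field r)"
    and ind: "indiscernible M C r V s" and free: "free X C Y" and Y: "(\<Union>i\<in>Field r. s i ` V) \<subseteq> Y"
  shows "indiscernible M (X \<union> C) r V s"
  unfolding indiscernible_def
proof (intro allI impI)
  fix "is" js vs \<phi> c
  assume a: "increasing r is \<and> increasing r js \<and> length is = length js \<and>
    set vs \<subseteq> {..<length is} \<times> V \<and> set c \<subseteq> X \<union> C \<and> fmla M (length vs + length c) \<phi>"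
  let ?t = "\<lambda>is. map (\<lambda>(l, v). s (is ! l) v) vs"
  have sub: "set (?t is) \<subseteq> Y" if "increasing r is" "set vs \<subseteq> {..<length is} \<times> V" for "is"
  proof -
    have "s (is ! l) v \<in> Y" if lv: "(l, v) \<in> set vs" for l v
    proof -
      have "l < length is" "v \<in> V" using lv \<open>set vs \<subseteq> _\<close> by auto
      moreover have "is ! l \<in> Field r" using that(1) \<open>increasing r is\<close> calculation by (auto simp: increasing_def)
      ultimately show ?thesis using Y by blast
    qed
    then show ?thesis by auto
  qed
  have "Ls C (?t is) (?t js)" using a by (intro indiscernible_Ls[OF assms(2-4) ind]) auto
  then obtain \<sigma> where s: "\<sigma> \<in> Fix (X \<union> C)" "?t js = map \<sigma> (?t is)"
    using free_Lascar_conj[OF assms(1,2) free sub sub, of "is" js] a by auto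
  have "?t js @ c = map \<sigma> (?t is @ c)" using s(2) Fix_map[OF s(1), of c] a by simp
  then show "holds M \<phi> (?t is @ c) \<longleftrightarrow> holds M \<phi> (?t js @ c)"
    using Aut_holds[OF FixD(1)[OF s(1)], of "?t is @ c" \<phi>] a by (simp only: length_append length_map)
qed

text \<open>Invariance under the generators is a set of biconditionals between instances at
  \<open>d\<close> and at its image under \<open>\<sigma>\<close>. It suffices to satisfy finitely
  many of them by a conjugate of \<open>X\<close> over \<open>Y\<close> and \<open>C\<close>; for
  each pair \<open>(d, \<sigma>)\<close> all formulas and all tuples from \<open>X\<close> are
  treated at once.\<close>

lemma free_of_finite:
  assumes fin: "\<And>E. finite E \<Longrightarrow> E \<subseteq> UNIV \<times> strong C \<Longrightarrow>
    \<exists>\<rho>\<in>Fix (Y \<union> C). \<forall>(d, \<sigma>)\<in>E. \<forall>xs \<phi>. set xs \<subseteq> X \<and> fmla M (length xs + length d) \<phi> \<longrightarrow>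
      (holds M \<phi> (map \<rho> xs @ d) \<longleftrightarrow> holds M \<phi> (map \<rho> xs @ map \<sigma> d))"
  shows "free X C Y"
proof -
  have "\<exists>\<chi>. fmla M (n + (m + m)) \<chi> \<and> (\<forall>a d d' :: 'm list. length a = n \<longrightarrow> length d = m \<longrightarrow> length d' = m \<longrightarrow>
      (holds M \<chi> (a @ d @ d') \<longleftrightarrow> (holds M \<phi> (a @ d) \<longleftrightarrow> holds M \<phi> (a @ d'))))"
    if f: "fmla M (n + m) \<phi>" for n m \<phi>
  proof -
    obtain \<chi> where "fmla M (n + (m + m)) \<chi>"
      "\<And>a d d' :: 'm list. length a = n \<Longrightarrow> length d = m \<Longrightarrow> length d' = m \<Longrightarrow>
        holds M \<chi> (a @ d @ d') \<longleftrightarrow> (holds M \<phi> (a @ d) \<longleftrightarrow> holds M \<phi> (a @ d'))"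
      by (rule formula_pair[OF f, of "(=)"]) (assumption | rule definable_iff that)+
    then show ?thesis by blast
  qed
  then have "\<forall>n m \<phi>. \<exists>\<chi>. fmla M (n + m) \<phi> \<longrightarrow> fmla M (n + (m + m)) \<chi> \<and>
      (\<forall>a d d' :: 'm list. length a = n \<longrightarrow> length d = m \<longrightarrow> length d' = m \<longrightarrow>
      (holds M \<chi> (a @ d @ d') \<longleftrightarrow> (holds M \<phi> (a @ d) \<longleftrightarrow> holds M \<phi> (a @ d'))))" by blast
  then obtain iff where iff: "\<And>n m \<phi>. fmla M (n + m) \<phi> \<Longrightarrow> fmla M (n + (m + m)) (iff n m \<phi>)"
    "\<And>n m \<phi> (a :: 'm list) d d'. fmla M (n + m) \<phi> \<Longrightarrow> length a = n \<Longrightarrow> length d = m \<Longrightarrow> length d' = m \<Longrightarrow>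
      holds M (iff n m \<phi>) (a @ d @ d') \<longleftrightarrow> (holds M \<phi> (a @ d) \<longleftrightarrow> holds M \<phi> (a @ d'))"
    by metis
  define I where "I = {(\<phi>, xs, d :: 'm list, \<sigma>). set xs \<subseteq> X \<and> fmla M (length xs + length d) \<phi> \<and> \<sigma> \<in> strong C}"
  \<comment> \<open>A biconditional becomes one formula whose parameters are \<open>d\<close>
    followed by its image.\<close>
  define g where "g = (\<lambda>(\<phi>, xs, d :: 'm list, \<sigma>). (iff (length xs) (length d) \<phi>, xs :: 'm list, d @ map \<sigma> d))"
  obtain p where p: "global_type M X p" "tp M X (Y \<union> C) \<union> g ` I \<subseteq> p"
  proof (rule global_type_extend)
    show "tp M X (Y \<union> C) \<union> g ` I \<subseteq> insts M X UNIV"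
      using iff(1) by (auto simp: tp_def insts_def g_def I_def)
    fix q assume q: "q \<subseteq> tp M X (Y \<union> C) \<union> g ` I" "finite q"
    obtain J where J: "J \<subseteq> I" "finite J" "q \<inter> g ` I = g ` J"
      using finite_subset_image[of "q \<inter> g ` I" g I] q(2) by auto
    define E where "E = (\<lambda>(\<phi>, xs, d, \<sigma>). (d, \<sigma>)) ` J"
    have "finite E" "E \<subseteq> UNIV \<times> strong C" using J by (auto simp: E_def I_def)
    from fin[OF this] obtain \<rho> where r: "\<rho> \<in> Fix (Y \<union> C)"
      "\<forall>(d, \<sigma>)\<in>E. \<forall>xs \<phi>. set xs \<subseteq> X \<and> fmla M (length xs + length d) \<phi> \<longrightarrow>
        (holds M \<phi> (map \<rho> xs @ d) \<longleftrightarrow> holds M \<phi> (map \<rho> xs @ map \<sigma> d))" by blast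
    have "holds M \<phi> (map \<rho> xs @ c)" if x: "(\<phi>, xs, c) \<in> q" for \<phi> xs c
    proof -
      from x q(1) J(3) have "(\<phi>, xs, c) \<in> tp M X (Y \<union> C) \<or> (\<phi>, xs, c) \<in> g ` J" by blast
      then show ?thesis
      proof
        assume "(\<phi>, xs, c) \<in> tp M X (Y \<union> C)"
        then have i: "set c \<subseteq> Y \<union> C" "fmla M (length xs + length c) \<phi>" "holds M \<phi> (xs @ c)"
          by (auto simp: tp_def insts_def)
        then show ?thesis
          using Aut_holds[OF FixD(1)[OF r(1)], of "xs @ c" \<phi>] Fix_map[OF r(1) i(1)] by simp
      next
        assume "(\<phi>, xs, c) \<in> g ` J"
        then obtain \<psi> d \<sigma> where d: "(\<psi>, xs, d, \<sigma>) \<in> J" "\<phi> = iff (length xs) (length d) \<psi>" "c = d @ map \<sigma> d"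
          by (auto simp: g_def)
        have "(d, \<sigma>) \<in> E" using d(1) by (force simp: E_def)
        moreover have "set xs \<subseteq> X" "fmla M (length xs + length d) \<psi>" using d(1) J(1) by (auto simp: I_def)
        ultimately show ?thesis using r(2) iff(2)[of "length xs" "length d" \<psi> "map \<rho> xs" d "map \<sigma> d"]
          unfolding d(2,3) by auto
      qed
    qed
    then show "\<exists>h. \<forall>(\<phi>, xs, c)\<in>q. holds M \<phi> (map h xs @ c)" by blast
  qed
  have pi: "p \<subseteq> insts M X UNIV" using p(1) by (simp add: global_type_def)
  have "(\<phi>, xs, map \<sigma> c) \<in> p" if s: "\<sigma> \<in> strong C" and x: "(\<phi>, xs, c) \<in> p" for \<sigma> \<phi> xs c
  proof (rule ccontr)
    assume n: "(\<phi>, xs, map \<sigma> c) \<notin> p"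
    have i: "set xs \<subseteq> X" "fmla M (length xs + length c) \<phi>" using x pi by (auto simp: insts_def)
    have "(Neg \<phi>, xs, map \<sigma> c) \<in> p" using global_type_Neg[OF p(1) i(1), of "map \<sigma> c" \<phi>] i(2) n by simp
    moreover have "(\<phi>, xs, c, \<sigma>) \<in> I" using i s by (simp add: I_def)
    then have "g (\<phi>, xs, c, \<sigma>) \<in> p" using p(2) by blast
    ultimately have "{(\<phi>, xs, c), (Neg \<phi>, xs, map \<sigma> c), (iff (length xs) (length c) \<phi>, xs, c @ map \<sigma> c)} \<subseteq> p"
      (is "?q \<subseteq> p") using x by (simp add: g_def)
    then obtain h where h: "\<And>\<psi> ys d. (\<psi>, ys, d) \<in> ?q \<Longrightarrow> holds M \<psi> (map h ys @ d)"
      by (rule global_type_realised[OF p(1)]) auto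
    show False
      using h[of \<phi> xs c] h[of "Neg \<phi>" xs "map \<sigma> c"] h[of "iff (length xs) (length c) \<phi>" xs "c @ map \<sigma> c"]
        iff(2)[OF i(2), of "map h xs" c "map \<sigma> c"] by simp
  qed
  then have "type_image \<sigma> p = p" if "\<sigma> \<in> AutfL \<kappa> M C" for \<sigma> using type_image_AutfL[OF _ that] by blast
  then show ?thesis unfolding free_def using p by blast
qed

text \<open>A generator of the group over \<open>C\<close> need not fix \<open>X1\<close>, so the
  invariance of \<open>X2\<close> cannot be applied directly to \<open>d\<close> and its image. Both
  are compared with a third tuple: after \<open>X1\<close> is moved to be independent from the
  connecting sequences, neighbours in them are Lascar equivalent over \<open>C\<close> and
  \<open>X1\<close> together.\<close>

lemma free_left_trans:
  assumes X: "small \<kappa> X1" "small \<kappa> X2" and C: "small \<kappa> C" and Y: "small \<kappa> Y"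
    and free: "free X1 C Y" "free X2 (C \<union> X1) (Y \<union> X1)"
  shows "free (X1 \<union> X2) C Y"
proof (rule free_of_finite)
  fix E :: "('m list \<times> ('m \<Rightarrow> 'm)) set" assume E: "finite E" "E \<subseteq> UNIV \<times> strong C"
  have "\<exists>e :: nat \<Rightarrow> 'm list. (\<forall>i. length (e i) = length (fst x)) \<and>
      indiscernible M C rge {..<length (fst x)} (\<lambda>i v. case_nat (fst x) e i ! v) \<and>
      indiscernible M C rge {..<length (fst x)} (\<lambda>i v. case_nat (map (snd x) (fst x)) e i ! v)"
    if x: "x \<in> E" for x
  proof -
    have "snd x \<in> strong C" using x E(2) by auto
    then obtain N where N: "small \<kappa> N" "elem_submodel M N" "C \<subseteq> N" "snd x \<in> Fix N" by (rule strongE)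
    have mono: "indiscernible M C r V s" if "indiscernible M N r V s" for r V and s :: "nat \<Rightarrow> nat \<Rightarrow> 'm"
      using that N(3) unfolding indiscernible_def by (meson order_trans)
    obtain e :: "nat \<Rightarrow> 'm list" where "\<And>i. length (e i) = length (fst x)"
      "indiscernible M N rge {..<length (fst x)} (\<lambda>i v. case_nat (fst x) e i ! v)"
      "indiscernible M N rge {..<length (fst x)} (\<lambda>i v. case_nat (map (snd x) (fst x)) e i ! v)"
      by (rule connecting_sequence[OF N(1,2,4), of "fst x"]) (rule that)
    then show ?thesis using mono by blast
  qed
  then have "\<forall>x. \<exists>e :: nat \<Rightarrow> 'm list. x \<in> E \<longrightarrow> (\<forall>i. length (e i) = length (fst x)) \<and>
      indiscernible M C rge {..<length (fst x)} (\<lambda>i v. case_nat (fst x) e i ! v) \<and>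
      indiscernible M C rge {..<length (fst x)} (\<lambda>i v. case_nat (map (snd x) (fst x)) e i ! v)" by blast
  from choice[OF this] obtain e :: "_ \<Rightarrow> nat \<Rightarrow> 'm list" where
    e: "\<forall>x. x \<in> E \<longrightarrow> (\<forall>i. length (e x i) = length (fst x)) \<and>
      indiscernible M C rge {..<length (fst x)} (\<lambda>i v. case_nat (fst x) (e x) i ! v) \<and>
      indiscernible M C rge {..<length (fst x)} (\<lambda>i v. case_nat (map (snd x) (fst x)) (e x) i ! v)" ..
  define D0 where "D0 = (\<Union>x\<in>E. set (fst x) \<union> set (map (snd x) (fst x)) \<union> (\<Union>i. set (e x i)))"
  have "countable D0"
    unfolding D0_def using E(1)
    by (intro countable_UN countable_Un) (auto intro: countable_finite)
  then have D0: "small \<kappa> D0" by (rule small_countable)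
  define D where "D = Y \<union> D0"
  have D: "small \<kappa> D" "Y \<subseteq> D" unfolding D_def using small_Un[OF Y D0] by auto
  obtain \<rho>1 where r1: "\<rho>1 \<in> Fix (Y \<union> C)" "free (\<rho>1 ` X1) C D" by (rule free_ext_left[OF X(1) C D(1) free(1) D(2)])
  have r1a: "\<rho>1 \<in> Aut M" by (rule FixD(1)[OF r1(1)])
  define Z where "Z = \<rho>1 ` X1"
  have Z: "small \<kappa> Z" unfolding Z_def by (rule small_image[OF X(1)])
  have "\<rho>1 ` (C \<union> X1) = C \<union> Z" "\<rho>1 ` (Y \<union> X1) = Y \<union> Z"
    using Fix_image[OF r1(1), of C] Fix_image[OF r1(1), of Y] by (auto simp: image_Un Z_def)
  then have f2: "free (\<rho>1 ` X2) (C \<union> Z) (Y \<union> Z)" using free_Aut[OF free(2) r1a] by simp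
  \<comment> \<open>The copy \<open>Z\<close> of \<open>X1\<close> stays in place while
    \<open>X2\<close> is made independent from the connecting sequences as well.\<close>
  obtain \<rho>2 where r2: "\<rho>2 \<in> Fix ((Y \<union> Z) \<union> (C \<union> Z))" "free (\<rho>2 ` \<rho>1 ` X2) (C \<union> Z) (D \<union> Z)"
    by (rule free_ext_left[OF small_image[OF X(2)] small_Un[OF C Z] small_Un[OF D(1) Z] f2]) (use D(2) in auto)
  define \<rho> where "\<rho> = \<rho>2 \<circ> \<rho>1"
  have "\<rho> \<in> Fix (Y \<union> C)" unfolding \<rho>_def by (rule Fix_comp[OF Fix_mono[OF r2(1)] r1(1)]) auto
  moreover have "holds M \<phi> (map \<rho> xs @ d) \<longleftrightarrow> holds M \<phi> (map \<rho> xs @ map \<sigma> d)"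
    if E: "(d, \<sigma>) \<in> E" and xs: "set xs \<subseteq> X1 \<union> X2" and \<phi>: "fmla M (length xs + length d) \<phi>" for d \<sigma> xs \<phi>
  proof -
    define m where "m = length d"
    define e0 where "e0 = e (d, \<sigma>)"
    have e0: "\<And>i. length (e0 i) = m" "indiscernible M C rge {..<m} (\<lambda>i v. case_nat d e0 i ! v)"
      "indiscernible M C rge {..<m} (\<lambda>i v. case_nat (map \<sigma> d) e0 i ! v)"
      using e[THEN spec, THEN mp, OF E, unfolded fst_conv snd_conv] unfolding e0_def m_def by blast+
    have sub: "set d \<subseteq> D" "set (map \<sigma> d) \<subseteq> D" "\<And>i. set (e0 i) \<subseteq> D"
      using E unfolding D_def D0_def e0_def by force+
    have xsZ: "set (map \<rho> xs) \<subseteq> \<rho>2 ` \<rho>1 ` X2 \<union> (C \<union> Z)"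
      using xs FixD(2)[OF r2(1)] by (auto simp: \<rho>_def Z_def)
    \<comment> \<open>\<open>c\<close> stands for \<open>d\<close> or for its image; both agree with
      the common element \<open>e0 0\<close>.\<close>
    have step: "holds M \<phi> (map \<rho> xs @ c) \<longleftrightarrow> holds M \<phi> (map \<rho> xs @ e0 0)"
      if c: "length c = m" "set c \<subseteq> D" and ind: "indiscernible M C rge {..<m} (\<lambda>i v. case_nat c e0 i ! v)" for c
    proof -
      have "case_nat c e0 i ! v \<in> D" if "v < m" for i v
      proof (cases i)
        case 0
        then show ?thesis using c that nth_mem[of v c] by auto
      next
        case (Suc j)
        then show ?thesis using sub(3)[of j] e0(1)[of j] that nth_mem[of v "e0 j"] by auto
      qed
      then have sD: "(\<Union>i\<in>Field rge. (\<lambda>v. case_nat c e0 i ! v) ` {..<m}) \<subseteq> D" by blast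
      have inf: "infinite (Field rge)" by (simp add: Field_rge)
      have "indiscernible M (Z \<union> C) rge {..<m} (\<lambda>i v. case_nat c e0 i ! v)"
        by (rule free_indiscernible[OF Z C Linear_order_rge inf ind r1(2)[folded Z_def] sD])
      then have ind': "indiscernible M (C \<union> Z) rge {..<m} (\<lambda>i v. case_nat c e0 i ! v)" by (simp add: Un_commute)
      have "Ls (C \<union> Z) (map (\<lambda>(l, v). case_nat c e0 ([0] ! l) ! v) (map (Pair 0) [0..<m]))
          (map (\<lambda>(l, v). case_nat c e0 ([1] ! l) ! v) (map (Pair 0) [0..<m]))"
        by (rule indiscernible_Ls[OF small_Un[OF C Z] Linear_order_rge inf ind'])
          (auto simp: increasing_rge)
      moreover have "map ((!) c) [0..<m] = c" "map ((!) (e0 0)) [0..<m] = e0 0"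
        using c(1) e0(1)[of 0] map_nth by metis+
      ultimately have "Ls (C \<union> Z) c (e0 0)" by (simp add: o_def)
      then obtain \<tau> where t: "\<tau> \<in> Fix (\<rho>2 ` \<rho>1 ` X2 \<union> (C \<union> Z))" "e0 0 = map \<tau> c"
        using free_Lascar_conj[OF small_image[OF small_image[OF X(2)]] small_Un[OF C Z] r2(2), of c "e0 0"]
          c(2) sub(3)[of 0] by blast
      have "map \<rho> xs @ e0 0 = map \<tau> (map \<rho> xs @ c)" using t(2) Fix_map[OF t(1) xsZ] by simp
      then show ?thesis
        using Aut_holds[OF FixD(1)[OF t(1)], of "map \<rho> xs @ c" \<phi>] \<phi> c(1)
        by (simp only: length_append length_map m_def)
    qed
    show ?thesis using step[of d] step[of "map \<sigma> d"] sub e0 by (simp add: m_def)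
  qed
  ultimately show "\<exists>\<rho>\<in>Fix (Y \<union> C). \<forall>(d, \<sigma>)\<in>E. \<forall>xs \<phi>. set xs \<subseteq> X1 \<union> X2 \<and> fmla M (length xs + length d) \<phi> \<longrightarrow>
      (holds M \<phi> (map \<rho> xs @ d) \<longleftrightarrow> holds M \<phi> (map \<rho> xs @ map \<sigma> d))" by blast
qed

end

section \<open>Dependent theories\<close>

lemma map_of_zip_map:
  assumes "distinct us" "length a = length us"
  shows "map (\<lambda>v. the (map_of (zip us a) v)) us = a"
  using assms by (auto simp: map_of_zip_nth intro!: nth_equalityI)

context monster
begin

lemma sequence_aut:
  assumes A: "small \<kappa> A" and len: "\<And>i. length (t i) = m"
    and ind: "indiscernible M A rge {..<m} (\<lambda>i v. t i ! v)"
    and incr: "increasing rge is" "increasing rge js" "length is = length js"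
  obtains \<sigma> where "\<sigma> \<in> Fix A" "\<And>l. l < length is \<Longrightarrow> t (js ! l) = map \<sigma> (t (is ! l))"
proof -
  have inf: "infinite (Field rge)" by (simp add: Field_rge)
  obtain \<sigma> where s: "\<sigma> \<in> AutfL \<kappa> M A"
    "\<And>l v. l < length is \<Longrightarrow> v \<in> {..<m} \<Longrightarrow> t (js ! l) ! v = \<sigma> (t (is ! l) ! v)"
    by (rule indiscernible_aut[OF A Linear_order_rge inf ind incr finite_lessThan subset_refl]) (rule that)
  have "t (js ! l) = map \<sigma> (t (is ! l))" if "l < length is" for l
    using s(2)[OF that] len by (intro nth_equalityI) auto
  then show thesis using that AutfL_Fix[OF s(1)] by blast
qed

text \<open>Disjoint consecutive pairs of the sequence are conjugate over \<open>A\<close>. If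
  arbitrarily many of them satisfied the alternation formula together, picking one member of each
  pair would realise every pattern of truth values on a subsequence; indiscernibility moves it to an
  initial segment, and compactness gives the independence property.\<close>

lemma alternation_divides:
  assumes dep: "dependent M" and A: "small \<kappa> A" and \<phi>: "fmla M (n + m) \<phi>"
    and len: "\<And>i. length (t i) = m" and ind: "indiscernible M A rge {..<m} (\<lambda>i v. t i ! v)"
    and \<chi>: "\<And>a d d' :: 'm list. length a = n \<Longrightarrow> length d = m \<Longrightarrow> length d' = m \<Longrightarrow>
      holds M \<chi> (a @ d @ d') \<longleftrightarrow> holds M \<phi> (a @ d) \<and> \<not> holds M \<phi> (a @ d')"
  shows "divides M A n \<chi> (t 0 @ t 1)"
proof -
  define b where "b i = t (2 * i) @ t (2 * i + 1)" for i
  have "same_tp M A (b i) (t 0 @ t 1)" for i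
  proof -
    obtain \<sigma> where s: "\<sigma> \<in> Fix A"
      "\<And>l. l < length [2 * i + 1, 2 * i] \<Longrightarrow> t ([1, 0] ! l) = map \<sigma> (t ([2 * i + 1, 2 * i] ! l))"
      by (rule sequence_aut[OF A len ind, of "[2 * i + 1, 2 * i]" "[1, 0]"]) (auto simp: increasing_rge)
    have "t 0 @ t 1 = map \<sigma> (b i)" using s(2)[of 0] s(2)[of 1] by (simp add: b_def)
    then show ?thesis using s(1) same_tp_iff[OF A] by blast
  qed
  moreover have "\<exists>k. k_inconsistent M k n \<chi> b"
  proof (rule ccontr)
    assume no: "\<nexists>k. k_inconsistent M k n \<chi> b"
    \<comment> \<open>In \<open>dependent\<close> the tuples indexed by numbers come first, so the
      two groups of variables of \<open>\<phi>\<close> are exchanged.\<close>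
    have "definable M {..<m + n} (\<lambda>h. holds M \<phi> (map h ([m..<m + n] @ [0..<m])))"
      using \<phi> by (intro dfnI) auto
    then obtain \<psi> where \<psi>: "fmla M (m + n) \<psi>"
      "\<And>e. length e = m + n \<Longrightarrow> holds M \<psi> e \<longleftrightarrow> holds M \<phi> (map ((!) e) ([m..<m + n] @ [0..<m]))"
      by (rule formula_of_definable) (rule that)
    have \<psi>': "holds M \<psi> (d @ a) \<longleftrightarrow> holds M \<phi> (a @ d)" if "length d = m" "length a = n" for d a
      using \<psi>(2)[of "d @ a"] map_nth_left[of d a] map_nth_right[of d a] that by (simp only: map_append length_append)
    have "\<exists>y. length y = n \<and> (\<forall>i. holds M \<phi> (y @ t i) \<longleftrightarrow> i \<in> T)" for T
    proof -
      define W where "W = (\<Union>i. set (t i))"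
      define V where "V = Inl ` {..<n} \<union> Inr ` W"
      have V: "small \<kappa> V"
        unfolding V_def W_def by (intro small_Plus small_nat small_countable countable_UN) (auto intro: countable_finite)
      define F where "F i h \<longleftrightarrow> (holds M \<phi> (map h (map Inl [0..<n] @ map Inr (t i))) \<longleftrightarrow> i \<in> T)" for i h
      define h0 :: "nat + 'm \<Rightarrow> 'm" where "h0 = case_sum undefined id"
      obtain h where h: "\<And>v. v \<in> Inr ` W \<Longrightarrow> h v = h0 v" "\<And>P. P \<in> F ` UNIV \<Longrightarrow> P h"
      proof (rule compactness[OF V, of "F ` UNIV" "Inr ` W" h0])
        have "definable M V (F i)" for i
          unfolding F_def[abs_def] using \<phi> len[of i] by (intro definable_iff definable_const dfnI) (auto simp: V_def W_def)
        then show "definable M V P" if "P \<in> F ` UNIV" for P using that by (elim imageE) simp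
        fix q assume q: "q \<subseteq> F ` UNIV" "finite q"
        obtain J where J: "finite J" "q = F ` J" using finite_subset_image[OF q(2,1)] by blast
        obtain K where K: "\<And>i. i \<in> J \<Longrightarrow> i < K" using finite_nat_bounded[OF J(1)] by auto
        obtain S where S: "finite S" "card S = K" "satisfiable M n \<chi> b S"
          using no unfolding k_inconsistent_def by blast
        obtain y where y: "length y = n" "\<And>j. j \<in> S \<Longrightarrow> holds M \<chi> (y @ b j)"
          using S(3) unfolding satisfiable_def by blast
        have alt: "holds M \<phi> (y @ t (2 * j))" "\<not> holds M \<phi> (y @ t (2 * j + 1))" if "j \<in> S" for j
          using y(2)[OF that] \<chi>[OF y(1) len len] unfolding b_def by auto
        define js where "js = sorted_list_of_set S"
        have js: "set js = S" "sorted_wrt (<) js" "length js = K" using S(1,2) by (simp_all add: js_def)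
        \<comment> \<open>From the \<open>i\<close>-th available pair the even index is taken where
          \<open>\<phi>\<close> shall hold, the odd one where it shall fail.\<close>
        define g where "g i = 2 * (js ! i) + (if i \<in> T then 0 else 1)" for i
        have gmono: "g i < g j" if "i < j" "j < K" for i j
        proof -
          have "js ! i < js ! j" using js that by (simp add: sorted_wrt_iff_nth_less)
          then show ?thesis by (simp add: g_def)
        qed
        have gval: "holds M \<phi> (y @ t (g i)) \<longleftrightarrow> i \<in> T" if "i < K" for i
        proof -
          have "js ! i \<in> S" using that js(1,3) nth_mem by metis
          then show ?thesis using alt[of "js ! i"] by (simp add: g_def)
        qed
        \<comment> \<open>The lists are reversed because \<open>rge\<close> is the reversed order of
          the numbers.\<close>
        have i1: "increasing rge (rev (map g [0..<K]))"
          unfolding increasing_rge sorted_wrt_rev sorted_wrt_map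
          by (simp add: sorted_wrt_iff_nth_less gmono)
        have i2: "increasing rge (rev [0..<K])"
          unfolding increasing_rge sorted_wrt_rev by (simp add: sorted_wrt_iff_nth_less)
        obtain \<sigma> where s: "\<sigma> \<in> Fix A"
          "\<And>l. l < length (rev (map g [0..<K])) \<Longrightarrow> t (rev [0..<K] ! l) = map \<sigma> (t (rev (map g [0..<K]) ! l))"
          by (rule sequence_aut[OF A len ind i1 i2]) (simp, rule that)
        have ti: "t i = map \<sigma> (t (g i))" if "i < K" for i
          using s(2)[of "K - Suc i"] that by (simp add: rev_nth)
        define y' where "y' = map \<sigma> y"
        have "holds M \<phi> (y' @ t i) \<longleftrightarrow> i \<in> T" if "i < K" for i
        proof -
          have "y' @ t i = map \<sigma> (y @ t (g i))" using ti[OF that] by (simp add: y'_def)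
          then show ?thesis
            using Aut_holds[OF FixD(1)[OF s(1)], of "y @ t (g i)" \<phi>] gval[OF that] \<phi> y(1) len[of "g i"]
            by (simp only: length_append)
        qed
        moreover have "map ((!) y') [0..<n] = y'" using y(1) map_nth[of y'] by (simp add: y'_def)
        ultimately have "F i (case_sum ((!) y') id)" if "i \<in> J" for i
          using K[OF that] by (simp add: F_def o_def)
        then show "\<exists>h. (\<forall>v\<in>Inr ` W. h v = h0 v) \<and> (\<forall>P\<in>q. P h)"
          unfolding J(2) by (intro exI[of _ "case_sum ((!) y') id"]) (auto simp: h0_def)
      qed (auto simp: V_def)
      define y where "y = map (h \<circ> Inl) [0..<n]"
      have "holds M \<phi> (y @ t i) \<longleftrightarrow> i \<in> T" for i
      proof -
        have "F i h" by (rule h(2)[of "F i"]) simp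
        moreover have "set (t i) \<subseteq> W" by (auto simp: W_def)
        then have "map (h \<circ> Inr) (t i) = t i"
          using h(1) by (intro map_idI) (auto simp: h0_def)
        ultimately show ?thesis by (simp add: F_def y_def)
      qed
      then show ?thesis by (intro exI[of _ y]) (simp add: y_def)
    qed
    then have "\<forall>T. \<exists>y. length y = n \<and> (\<forall>i. holds M \<phi> (y @ t i) \<longleftrightarrow> i \<in> T)" by blast
    from choice[OF this] obtain y where "\<forall>T. length (y T) = n \<and> (\<forall>i. holds M \<phi> (y T @ t i) \<longleftrightarrow> i \<in> T)" ..
    then have y: "\<And>T. length (y T) = n" "\<And>T i. holds M \<phi> (y T @ t i) \<longleftrightarrow> i \<in> T" by simp_all
    have "holds M \<psi> (t i @ y T) \<longleftrightarrow> i \<in> T" for i T using \<psi>' len y by simp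
    then have "fmla M (m + n) \<psi> \<and> (\<forall>i. length (t i) = m) \<and> (\<forall>T. length (y T) = n) \<and>
        (\<forall>i T. holds M \<psi> (t i @ y T) \<longleftrightarrow> i \<in> T)" using \<psi>(1) len y(1) by simp
    then have "\<exists>n m \<phi> a b. fmla M (n + m) \<phi> \<and> (\<forall>i :: nat. length (a i) = n) \<and>
        (\<forall>s :: nat set. length (b s) = m) \<and> (\<forall>i s. holds M \<phi> (a i @ b s) \<longleftrightarrow> i \<in> s)"
      by (rule_tac exI[of _ m], rule_tac exI[of _ n], rule_tac exI[of _ \<psi>], rule_tac exI[of _ t], rule_tac exI[of _ y])
    with dep show False unfolding dependent_def by (rule notE)
  qed
  ultimately show ?thesis unfolding divides_def by blast
qed

text \<open>The negations of all dividing formulas can be added to the type: a formula of the type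
  that implied a disjunction of dividing formulas would fork, hence divide. If the resulting global
  type distinguished \<open>c\<close> from its image, it would contain an alternation formula along
  one of the two connecting sequences.\<close>

theorem free_of_nondividing:
  assumes dep: "dependent M" and fd: "forking_eq_dividing M A" and A: "small \<kappa> A"
    and nd: "\<And>\<phi> xs c. (\<phi>, xs, c) \<in> tp M X (Y \<union> A) \<Longrightarrow> \<not> divides M A (length xs) \<phi> c"
  shows "free X A Y"
proof -
  define Dv where "Dv = {(Neg \<psi>, xs, c) | \<psi> xs c. set xs \<subseteq> X \<and> fmla M (length xs + length c) \<psi> \<and>
    divides M A (length xs) \<psi> c}"
  obtain p where p: "global_type M X p" "tp M X (Y \<union> A) \<union> Dv \<subseteq> p"
  proof (rule global_type_extend)
    show "tp M X (Y \<union> A) \<union> Dv \<subseteq> insts M X UNIV" by (auto simp: tp_def insts_def Dv_def)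
    fix q assume q: "q \<subseteq> tp M X (Y \<union> A) \<union> Dv" "finite q"
    have qX: "set xs \<subseteq> X" if "(\<phi>, xs, c) \<in> q" for \<phi> xs c
      using that q(1) by (auto simp: tp_def insts_def Dv_def)
    define q1 where "q1 = q \<inter> tp M X (Y \<union> A)"
    have q1: "finite q1" "set c \<subseteq> Y \<union> A" "fmla M (length xs + length c) \<phi>" "holds M \<phi> (xs @ c)"
      if "(\<phi>, xs, c) \<in> q1" for \<phi> xs c
      using that q(2) by (auto simp: q1_def tp_def insts_def)
    have "finite (\<Union>x\<in>q. set (fst (snd x)))" using q(2) by simp
    \<comment> \<open>The variables occurring in \<open>q\<close> are listed without repetition, so
      that any tuple of that length defines an assignment by
      \<open>map_of (zip us a)\<close>.\<close>
    from finite_distinct_list[OF this] obtain us where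
      us: "set us = (\<Union>x\<in>q. set (fst (snd x)))" "distinct us" by blast
    have "finite (\<Union>x\<in>q1. set (snd (snd x)))" using q(2) by (simp add: q1_def)
    from finite_list[OF this] obtain b where b: "set b = (\<Union>x\<in>q1. set (snd (snd x)))" ..
    have usX: "set us \<subseteq> X" using qX unfolding us(1) by fastforce
    have bYA: "set b \<subseteq> Y \<union> A" using q1(2) unfolding b by fastforce
    define ws where "ws = map Inl us @ map Inr b"
    have "definable M (set ws) (\<lambda>h. \<forall>x\<in>q1. holds M (fst x) (map h (map Inl (fst (snd x)) @ map Inr (snd (snd x)))))"
    proof (intro definable_ball dfnI)
      show "finite q1" using q(2) by (simp add: q1_def)
      fix x assume x: "x \<in> q1"
      obtain \<phi> xs c where xe: "x = (\<phi>, xs, c)" by (cases x)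
      show "fmla M (length (map Inl (fst (snd x)) @ map Inr (snd (snd x)))) (fst x)"
        using q1(3) x unfolding xe by simp
      have "x \<in> q" using x by (simp add: q1_def)
      then have "set (fst (snd x)) \<subseteq> set us" "set (snd (snd x)) \<subseteq> set b" using x unfolding us(1) b by blast+
      then show "set (map Inl (fst (snd x)) @ map Inr (snd (snd x))) \<subseteq> set ws" by (auto simp: ws_def)
    qed
    then obtain \<Phi> where \<Phi>: "fmla M (length ws) \<Phi>"
      "\<And>h. (\<forall>x\<in>q1. holds M (fst x) (map h (map Inl (fst (snd x)) @ map Inr (snd (snd x))))) \<longleftrightarrow>
        holds M \<Phi> (map h ws)"
      by (rule definable_list) (rule that)
    have \<Phi>': "fmla M (length us + length b) \<Phi>" using \<Phi>(1) by (simp add: ws_def)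
    have "holds M \<Phi> (map (case_sum id id) ws)"
      unfolding \<Phi>(2)[symmetric] using q1(4) by (auto simp: o_def)
    then have "(\<Phi>, us, b) \<in> tp M X (Y \<union> A)"
      using usX bYA \<Phi>' by (simp add: tp_def insts_def ws_def o_def)
    then have "\<not> divides M A (length us) \<Phi> b" by (rule nd)
    then have nf: "\<not> forks M A (length us) \<Phi> b" using fd \<Phi>' unfolding forking_eq_dividing_def by blast
    define q2 where "q2 = q \<inter> Dv"
    have "\<exists>\<theta>. fmla M (length us + length (snd (snd x))) \<theta> \<and> divides M A (length us) \<theta> (snd (snd x)) \<and>
        (\<forall>a. length a = length us \<longrightarrow> \<not> holds M \<theta> (a @ snd (snd x)) \<longrightarrow>
          holds M (fst x) (map (\<lambda>v. the (map_of (zip us a) v)) (fst (snd x)) @ snd (snd x)))"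
      if x: "x \<in> q2" for x
    proof -
      obtain \<psi> xs c where xe: "x = (Neg \<psi>, xs, c)" and xs: "fmla M (length xs + length c) \<psi>"
        "divides M A (length xs) \<psi> c" using x by (auto simp: q2_def Dv_def)
      have "x \<in> q" using x by (simp add: q2_def)
      then have sub: "set xs \<subseteq> set us" unfolding us(1) xe by force
      obtain \<theta> js where \<theta>: "fmla M (length us + length c) \<theta>" "xs = map ((!) us) js" "set js \<subseteq> {..<length us}"
        "\<And>y e. length y = length us \<Longrightarrow> length e = length c \<Longrightarrow>
          holds M \<theta> (y @ e) \<longleftrightarrow> holds M \<psi> (map ((!) y) js @ e)"
        by (rule formula_select_front[OF sub xs(1)]) (rule that)
      have "divides M A (length us) \<theta> c"
        by (rule divides_transfer[OF A xs(2), where f = "\<lambda>y. map ((!) y) js"]) (use \<theta> in auto)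
      moreover have "map (\<lambda>v. the (map_of (zip us a) v)) xs = map ((!) a) js" if "length a = length us" for a :: "'m list"
        using \<theta>(3) that us(2) unfolding \<theta>(2) by (auto simp: map_of_zip_nth)
      ultimately show ?thesis using \<theta>(1,4) unfolding xe by (intro exI[of _ \<theta>]) auto
    qed
    then have "\<forall>x. \<exists>\<theta>. x \<in> q2 \<longrightarrow> fmla M (length us + length (snd (snd x))) \<theta> \<and> divides M A (length us) \<theta> (snd (snd x)) \<and>
        (\<forall>a. length a = length us \<longrightarrow> \<not> holds M \<theta> (a @ snd (snd x)) \<longrightarrow>
          holds M (fst x) (map (\<lambda>v. the (map_of (zip us a) v)) (fst (snd x)) @ snd (snd x)))" by blast
    from choice[OF this] obtain \<theta> where \<theta>:
      "\<And>x. x \<in> q2 \<Longrightarrow> fmla M (length us + length (snd (snd x))) (\<theta> x)"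
      "\<And>x. x \<in> q2 \<Longrightarrow> divides M A (length us) (\<theta> x) (snd (snd x))"
      "\<And>x a. x \<in> q2 \<Longrightarrow> length a = length us \<Longrightarrow> \<not> holds M (\<theta> x) (a @ snd (snd x)) \<Longrightarrow>
          holds M (fst x) (map (\<lambda>v. the (map_of (zip us a) v)) (fst (snd x)) @ snd (snd x))"
      by blast
    define \<Psi> where "\<Psi> = (\<lambda>x. (\<theta> x, snd (snd x))) ` q2"
    have "finite \<Psi>" using q(2) by (simp add: \<Psi>_def q2_def)
    moreover have "\<forall>(\<psi>, c)\<in>\<Psi>. fmla M (length us + length c) \<psi> \<and> divides M A (length us) \<psi> c"
      using \<theta>(1,2) unfolding \<Psi>_def by blast
    ultimately have "\<not> (\<forall>a. length a = length us \<and> holds M \<Phi> (a @ b) \<longrightarrow> (\<exists>(\<psi>, c)\<in>\<Psi>. holds M \<psi> (a @ c)))"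
      using nf unfolding forks_def by blast
    then obtain a where a: "length a = length us" "holds M \<Phi> (a @ b)"
      and na: "\<And>\<psi> c. (\<psi>, c) \<in> \<Psi> \<Longrightarrow> \<not> holds M \<psi> (a @ c)" by blast
    define h where "h v = the (map_of (zip us a) v)" for v
    have "map (case_sum h id) ws = a @ b"
      using map_of_zip_map[OF us(2) a(1)] by (simp add: ws_def h_def o_def)
    then have "\<forall>x\<in>q1. holds M (fst x) (map (case_sum h id) (map Inl (fst (snd x)) @ map Inr (snd (snd x))))"
      unfolding \<Phi>(2) using a(2) by simp
    then have h1: "holds M (fst x) (map h (fst (snd x)) @ snd (snd x))" if "x \<in> q1" for x
      using that by (auto simp: o_def)
    have h2: "holds M (fst x) (map h (fst (snd x)) @ snd (snd x))" if "x \<in> q2" for x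
      unfolding h_def using \<theta>(3)[OF that a(1)] na[of "\<theta> x" "snd (snd x)"] that by (auto simp: \<Psi>_def)
    have "x \<in> q1 \<or> x \<in> q2" if "x \<in> q" for x using that q(1) by (auto simp: q1_def q2_def)
    then have "holds M (fst x) (map h (fst (snd x)) @ snd (snd x))" if "x \<in> q" for x
      using h1 h2 that by blast
    then show "\<exists>h. \<forall>(\<phi>, xs, c)\<in>q. holds M \<phi> (map h xs @ c)"
      by (intro exI[of _ h]) fastforce
  qed
  have pi: "p \<subseteq> insts M X UNIV" using p(1) by (simp add: global_type_def)
  have no_alternation: "(Neg \<phi>, xs, t 1) \<notin> p"
    if x: "(\<phi>, xs, t 0) \<in> p" and len: "\<And>i. length (t i) = m"
      and ind: "indiscernible M A rge {..<m} (\<lambda>i v. t i ! v)" for \<phi> xs m and t :: "nat \<Rightarrow> 'm list"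
  proof
    assume n: "(Neg \<phi>, xs, t 1) \<in> p"
    have i: "set xs \<subseteq> X" "fmla M (length xs + m) \<phi>" using x pi len by (auto simp: insts_def)
    obtain \<chi> where \<chi>: "fmla M (length xs + (m + m)) \<chi>"
      "\<And>a d d' :: 'm list. length a = length xs \<Longrightarrow> length d = m \<Longrightarrow> length d' = m \<Longrightarrow>
        holds M \<chi> (a @ d @ d') \<longleftrightarrow> holds M \<phi> (a @ d) \<and> \<not> holds M \<phi> (a @ d')"
      by (rule formula_pair[OF i(2), of "\<lambda>P Q. P \<and> \<not> Q"]) (assumption | rule definable_conj definable_neg that)+
    have "divides M A (length xs) \<chi> (t 0 @ t 1)"
      by (rule alternation_divides[OF dep A i(2) len ind \<chi>(2)])
    then have "(Neg \<chi>, xs, t 0 @ t 1) \<in> Dv" using i(1) \<chi>(1) len unfolding Dv_def by auto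
    then have "{(\<phi>, xs, t 0), (Neg \<phi>, xs, t 1), (Neg \<chi>, xs, t 0 @ t 1)} \<subseteq> p" (is "?q \<subseteq> p")
      using x n p(2) by blast
    then obtain h where h: "\<And>\<psi> ys d. (\<psi>, ys, d) \<in> ?q \<Longrightarrow> holds M \<psi> (map h ys @ d)"
      by (rule global_type_realised[OF p(1)]) auto
    show False
      using h[of \<phi> xs "t 0"] h[of "Neg \<phi>" xs "t 1"] h[of "Neg \<chi>" xs "t 0 @ t 1"] \<chi>(2)[of "map h xs" "t 0" "t 1"] len
      by simp
  qed
  have "(\<phi>, xs, map \<sigma> c) \<in> p" if s: "\<sigma> \<in> strong A" and x: "(\<phi>, xs, c) \<in> p" for \<sigma> \<phi> xs c
  proof (rule ccontr)
    assume n: "(\<phi>, xs, map \<sigma> c) \<notin> p"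
    define m where "m = length c"
    have i: "set xs \<subseteq> X" "fmla M (length xs + m) \<phi>" using x pi by (auto simp: insts_def m_def)
    note neg = global_type_Neg[OF p(1) i(1)]
    obtain N where N: "small \<kappa> N" "elem_submodel M N" "A \<subseteq> N" "\<sigma> \<in> Fix N" using s by (rule strongE)
    have mono: "indiscernible M A r V s" if "indiscernible M N r V s" for r V and s :: "nat \<Rightarrow> nat \<Rightarrow> 'm"
      using that N(3) unfolding indiscernible_def by (meson order_trans)
    obtain e :: "nat \<Rightarrow> 'm list" where e: "\<And>i. length (e i) = length c"
      "indiscernible M N rge {..<length c} (\<lambda>i v. case_nat c e i ! v)"
      "indiscernible M N rge {..<length c} (\<lambda>i v. case_nat (map \<sigma> c) e i ! v)"
      by (rule connecting_sequence[OF N(1,2,4), of c]) (rule that)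
    have l1: "length (case_nat c e i) = m" and l2: "length (case_nat (map \<sigma> c) e i) = m" for i
      using e(1) by (simp_all add: m_def split: nat.splits)
    \<comment> \<open>Following the sequence through \<open>c\<close>, the type must contain
      \<open>\<phi>\<close> at \<open>e 0\<close>; following the one through the image of
      \<open>c\<close>, it must not.\<close>
    have "(Neg \<phi>, xs, e 0) \<notin> p"
      using no_alternation[of \<phi> xs "case_nat c e" m] x l1 mono[OF e(2)] by (simp add: m_def)
    moreover have "(Neg \<phi>, xs, map \<sigma> c) \<in> p" using neg[of "map \<sigma> c" \<phi>] n i(2) by (simp add: m_def)
    then have "(Neg (Neg \<phi>), xs, e 0) \<notin> p"
      using no_alternation[of "Neg \<phi>" xs "case_nat (map \<sigma> c) e" m] l2 mono[OF e(3)] by (simp add: m_def)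
    ultimately show False using neg[of "e 0" "Neg \<phi>"] i(2) e(1)[of 0] by (simp add: m_def)
  qed
  then have "type_image \<sigma> p = p" if "\<sigma> \<in> AutfL \<kappa> M A" for \<sigma> using type_image_AutfL[OF _ that] by blast
  then show ?thesis unfolding free_def using p by blast
qed

text \<open>A tuple from \<open>A\<close> is its only conjugate over \<open>A\<close>, so a dividing
  sequence would be constant and \<open>xs\<close> a common solution.\<close>

lemma not_divides_over_base:
  assumes A: "small \<kappa> A" and "set c \<subseteq> A" "holds M \<phi> (xs @ c)"
  shows "\<not> divides M A (length xs) \<phi> c"
proof
  assume "divides M A (length xs) \<phi> c"
  then obtain k b where b: "\<And>i. same_tp M A (b i) c" "k_inconsistent M k (length xs) \<phi> b"
    unfolding divides_def by blast
  have "b i = c" for i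
  proof -
    obtain \<sigma> where s: "\<sigma> \<in> Fix A" "c = map \<sigma> (b i)" using b(1)[of i] same_tp_iff[OF A] by blast
    have "map (inv_into UNIV \<sigma>) c = b i"
      unfolding s(2) using Aut_inv_left[OF FixD(1)[OF s(1)]] by (simp add: map_idI)
    then show ?thesis using Fix_map[OF Fix_inv[OF s(1)] assms(2)] by simp
  qed
  then have "satisfiable M (length xs) \<phi> b {..<k}"
    unfolding satisfiable_def using assms(3) by (intro exI[of _ xs]) simp
  then show False using b(2) unfolding k_inconsistent_def by (metis card_lessThan finite_lessThan)
qed

text \<open>A Lascar-invariant extension contains every instance along a sequence of Lascar
  equivalent tuples, so any \<open>k\<close> of these instances have a common solution.\<close>

lemma free_not_divides:
  assumes A: "small \<kappa> A" and free: "free X A Y"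
    and i: "set xs \<subseteq> X" "set c \<subseteq> Y \<union> A" "fmla M (length xs + length c) \<phi>" "holds M \<phi> (xs @ c)"
  shows "\<not> divides M A (length xs) \<phi> c"
proof
  assume "divides M A (length xs) \<phi> c"
  then obtain k b where b: "k_inconsistent M k (length xs) \<phi> b" "\<And>i. Ls A c (b i)"
    by (rule divides_Lascar[OF A i(3)]) (rule that)
  obtain p where p: "global_type M X p" "tp M X (Y \<union> A) \<subseteq> p" "\<And>\<sigma>. \<sigma> \<in> AutfL \<kappa> M A \<Longrightarrow> type_image \<sigma> p = p"
    by (rule freeE[OF free]) (rule that)
  have "(\<phi>, xs, c) \<in> p" using p(2) i by (auto simp: tp_def insts_def)
  then have "(\<phi>, xs, b j) \<in> p" for j
    using b(2)[of j] p(3) unfolding Ls_def type_image_def by force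
  then have "(\<lambda>j. (\<phi>, xs, b j)) ` {..<k} \<subseteq> p" by blast
  then obtain h where h: "\<And>\<psi> ys d. (\<psi>, ys, d) \<in> (\<lambda>j. (\<phi>, xs, b j)) ` {..<k} \<Longrightarrow> holds M \<psi> (map h ys @ d)"
    by (rule global_type_realised[OF p(1)]) auto
  have "satisfiable M (length xs) \<phi> b {..<k}"
    unfolding satisfiable_def using h by (intro exI[of _ "map h xs"]) auto
  then show False using b(1) unfolding k_inconsistent_def by (metis card_lessThan finite_lessThan)
qed

text \<open>If no conjugate of \<open>D\<close> works, a formula \<open>\<Phi>\<close> of its type
  over \<open>X\<close> and \<open>A\<close> implies a disjunction \<open>\<Theta>\<close> of
  dividing formulas, which divides as well. Then the statement about \<open>X\<close> that
  \<open>\<Phi>\<close> has a solution and all its solutions satisfy \<open>\<Theta>\<close> divides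
  too, although it belongs to the type of \<open>X\<close>.\<close>

theorem free_left_extension:
  assumes dep: "dependent M" and fd: "forking_eq_dividing M A" and A: "small \<kappa> A"
    and sm: "small \<kappa> X" "small \<kappa> Y" "small \<kappa> D" and free: "free X A Y" and XD: "X \<subseteq> D"
  obtains \<rho> where "\<rho> \<in> Fix (X \<union> A)" "free (\<rho> ` D) A Y"
proof -
  define V where "V = Inl ` D \<union> Inr ` (X \<union> A \<union> Y)"
  have V: "small \<kappa> V" unfolding V_def by (intro small_Plus small_Un sm A)
  define \<Sigma>1 where "\<Sigma>1 = {P. definable M (Inl ` D \<union> Inr ` (X \<union> A)) P \<and> P (case_sum id id)}"
  define I where "I = {(\<psi>, xs, c). set xs \<subseteq> D \<and> set c \<subseteq> Y \<union> A \<and> fmla M (length xs + length c) \<psi> \<and>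
    divides M A (length xs) \<psi> c}"
  define F :: "('f, 'p, 'm) inst \<Rightarrow> ('m + 'm \<Rightarrow> 'm) \<Rightarrow> bool" where
    "F = (\<lambda>(\<psi>, xs, c) h. \<not> holds M \<psi> (map h (map Inl xs @ map Inr c)))"
  define h0 :: "'m + 'm \<Rightarrow> 'm" where "h0 = case_sum id id"
  obtain h where h: "\<And>v. v \<in> Inr ` (X \<union> A \<union> Y) \<Longrightarrow> h v = h0 v" "\<And>P. P \<in> \<Sigma>1 \<union> F ` I \<Longrightarrow> P h"
  proof (rule compactness[OF V, of "\<Sigma>1 \<union> F ` I" "Inr ` (X \<union> A \<union> Y)" h0])
    have "definable M V P" if "P \<in> \<Sigma>1" for P
    proof -
      have "definable M (Inl ` D \<union> Inr ` (X \<union> A)) P" using that by (simp add: \<Sigma>1_def)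
      then show ?thesis by (rule definable_mono) (auto simp: V_def)
    qed
    moreover have "definable M V (F x)" if "x \<in> I" for x
    proof -
      obtain \<psi> xs c where x: "x = (\<psi>, xs, c)" by (cases x)
      have "set xs \<subseteq> D" "set c \<subseteq> Y \<union> A" "fmla M (length xs + length c) \<psi>" using that unfolding x I_def by auto
      then show ?thesis unfolding x F_def split V_def by (intro definable_neg dfnI) auto
    qed
    ultimately show "definable M V P" if "P \<in> \<Sigma>1 \<union> F ` I" for P using that by (elim UnE imageE) simp_all
    fix q assume q: "q \<subseteq> \<Sigma>1 \<union> F ` I" "finite q"
    obtain J where J: "J \<subseteq> I" "finite J" "q \<inter> F ` I = F ` J"
      using finite_subset_image[of "q \<inter> F ` I" F I] q(2) by auto
    define Q where "Q = q \<inter> \<Sigma>1"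
    have Q: "finite Q" using q(2) by (simp add: Q_def)
    have qQ: "q = Q \<union> F ` J"
      unfolding Q_def J(3)[symmetric] Int_Un_distrib[symmetric] using q(1) by (rule Int_absorb2[symmetric])
    have Q1: "definable M (Inl ` D \<union> Inr ` (X \<union> A)) P" "P (case_sum id id)" if "P \<in> Q" for P
      using that by (simp_all add: Q_def \<Sigma>1_def)
    have "definable M (Inl ` D \<union> Inr ` (X \<union> A)) (\<lambda>h. \<forall>P\<in>Q. P h)" by (rule definable_ball[OF Q Q1(1)])
    then obtain G where G: "finite G" "G \<subseteq> Inl ` D \<union> Inr ` (X \<union> A)" "definable M G (\<lambda>h. \<forall>P\<in>Q. P h)"
      by (rule definable_finite_support)
    have "finite (Inl -` G \<union> (\<Union>x\<in>J. set (fst (snd x))))"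
      using G(1) J(2) by (auto intro!: finite_vimageI)
    from finite_distinct_list[OF this] obtain w where
      w: "set w = Inl -` G \<union> (\<Union>x\<in>J. set (fst (snd x)))" "distinct w" by blast
    have fG: "finite (Inr -` G)" using G(1) by (auto intro!: finite_vimageI)
    have "finite (Inr -` G \<inter> X)" "finite (Inr -` G - X)" using fG by simp_all
    \<comment> \<open>Parameters from \<open>X\<close> are split off as \<open>u\<close>, since they
      are to become variables; those in \<open>\<alpha>\<close> lie in \<open>A\<close> and stay
      fixed.\<close>
    then obtain u \<alpha> where u: "set u = Inr -` G \<inter> X" and \<alpha>: "set \<alpha> = Inr -` G - X"
      using finite_list by metis
    have uX: "set u \<subseteq> X" and \<alpha>A: "set \<alpha> \<subseteq> A" using u \<alpha> G(2) by auto
    have wD: "set w \<subseteq> D"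
    proof -
      have "set (fst (snd x)) \<subseteq> D" if "x \<in> J" for x
        using subsetD[OF J(1) that] by (cases x) (simp add: I_def)
      then show ?thesis using G(2) unfolding w(1) by auto
    qed
    have "G \<subseteq> set (map Inl w @ map Inr u @ map Inr \<alpha>)"
    proof
      fix v assume v: "v \<in> G"
      show "v \<in> set (map Inl w @ map Inr u @ map Inr \<alpha>)"
        using v w(1) u \<alpha> by (cases v) auto
    qed
    from definable_mono[OF G(3) this] obtain \<Phi> where \<Phi>: "fmla M (length (map Inl w @ map Inr u @ map Inr \<alpha>)) \<Phi>"
      "\<And>h. (\<forall>P\<in>Q. P h) \<longleftrightarrow> holds M \<Phi> (map h (map Inl w @ map Inr u @ map Inr \<alpha>))"
      by (rule definable_list) (rule that)
    have \<Phi>0: "holds M \<Phi> (w @ u @ \<alpha>)"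
    proof -
      have "\<forall>P\<in>Q. P (case_sum id id)" using Q1(2) by (intro ballI)
      then show ?thesis unfolding \<Phi>(2) by (simp add: o_def)
    qed
    have "finite (\<Union>x\<in>J. set (snd (snd x)))" using J(2) by simp
    from finite_list[OF this] obtain c where c: "set c = (\<Union>x\<in>J. set (snd (snd x)))" ..
    have cYA: "set c \<subseteq> Y \<union> A"
    proof -
      have "set (snd (snd x)) \<subseteq> Y \<union> A" if "x \<in> J" for x
        using subsetD[OF J(1) that] by (cases x) (simp add: I_def)
      then show ?thesis unfolding c by blast
    qed
    define hw where "hw w' v = the (map_of (zip w w') v)" for w' :: "'m list" and v
    define bad where "bad w' \<longleftrightarrow> (\<exists>x\<in>J. holds M (fst x) (map (hw w') (fst (snd x)) @ snd (snd x)))" for w'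
    have "\<exists>w'. length w' = length w \<and> holds M \<Phi> (w' @ u @ \<alpha>) \<and> \<not> bad w'"
    proof (rule ccontr)
      assume no: "\<nexists>w'. length w' = length w \<and> holds M \<Phi> (w' @ u @ \<alpha>) \<and> \<not> bad w'"
      have "\<exists>\<theta>. fmla M (length w + length (snd (snd x))) \<theta> \<and> divides M A (length w) \<theta> (snd (snd x)) \<and>
          (\<forall>w'. length w' = length w \<longrightarrow> (holds M (fst x) (map (hw w') (fst (snd x)) @ snd (snd x)) \<longleftrightarrow>
            holds M \<theta> (w' @ snd (snd x))))" if x: "x \<in> J" for x
      proof -
        obtain \<psi> xs d where xe: "x = (\<psi>, xs, d)" by (cases x)
        have i: "fmla M (length xs + length d) \<psi>" "divides M A (length xs) \<psi> d" using x J(1) unfolding xe I_def by auto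
        have sub: "set xs \<subseteq> set w" unfolding w(1) using x unfolding xe by force
        obtain \<theta> js where \<theta>: "fmla M (length w + length d) \<theta>" "xs = map ((!) w) js" "set js \<subseteq> {..<length w}"
          "\<And>y e. length y = length w \<Longrightarrow> length e = length d \<Longrightarrow>
            holds M \<theta> (y @ e) \<longleftrightarrow> holds M \<psi> (map ((!) y) js @ e)"
          by (rule formula_select_front[OF sub i(1)]) (rule that)
        have "divides M A (length w) \<theta> d"
          by (rule divides_transfer[OF A i(2), where f = "\<lambda>y. map ((!) y) js"]) (use \<theta> in auto)
        moreover have "map (hw w') xs = map ((!) w') js" if "length w' = length w" for w'
          using \<theta>(3) that w(2) unfolding \<theta>(2) hw_def by (auto simp: map_of_zip_nth)
        ultimately show ?thesis using \<theta>(1,4) unfolding xe by (intro exI[of _ \<theta>]) auto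
      qed
      then have "\<forall>x. \<exists>\<theta>. x \<in> J \<longrightarrow> fmla M (length w + length (snd (snd x))) \<theta> \<and>
          divides M A (length w) \<theta> (snd (snd x)) \<and>
          (\<forall>w'. length w' = length w \<longrightarrow> (holds M (fst x) (map (hw w') (fst (snd x)) @ snd (snd x)) \<longleftrightarrow>
            holds M \<theta> (w' @ snd (snd x))))" by blast
      from choice[OF this] obtain \<theta> where \<theta>:
        "\<And>x. x \<in> J \<Longrightarrow> fmla M (length w + length (snd (snd x))) (\<theta> x)"
        "\<And>x. x \<in> J \<Longrightarrow> divides M A (length w) (\<theta> x) (snd (snd x))"
        "\<And>x w'. x \<in> J \<Longrightarrow> length w' = length w \<Longrightarrow>
          holds M (fst x) (map (hw w') (fst (snd x)) @ snd (snd x)) \<longleftrightarrow> holds M (\<theta> x) (w' @ snd (snd x))"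
        by blast
      have "definable M (set (map Inl [0..<length w] @ map Inr c))
          (\<lambda>h. \<exists>x\<in>J. holds M (\<theta> x) (map h (map Inl [0..<length w] @ map Inr (snd (snd x)))))"
      proof (intro definable_bex J(2) dfnI)
        fix x assume x: "x \<in> J"
        show "fmla M (length (map Inl [0..<length w] @ map Inr (snd (snd x)))) (\<theta> x)" using \<theta>(1)[OF x] by simp
        have "set (snd (snd x)) \<subseteq> set c" using x unfolding c by blast
        then show "set (map Inl [0..<length w] @ map Inr (snd (snd x))) \<subseteq> set (map Inl [0..<length w] @ map Inr c)"
          by auto
      qed
      then obtain \<Theta> where \<Theta>: "fmla M (length (map Inl [0..<length w] @ map Inr c)) \<Theta>"
        "\<And>h. (\<exists>x\<in>J. holds M (\<theta> x) (map h (map Inl [0..<length w] @ map Inr (snd (snd x))))) \<longleftrightarrow>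
          holds M \<Theta> (map h (map Inl [0..<length w] @ map Inr c))"
        by (rule definable_list) (rule that)
      have \<Theta>1: "fmla M (length w + length c) \<Theta>" using \<Theta>(1) by simp
      have \<Theta>2: "bad w' \<longleftrightarrow> holds M \<Theta> (w' @ c)" if "length w' = length w" for w'
      proof -
        have "map ((!) w') [0..<length w] = w'" using that map_nth[of w'] by simp
        then show ?thesis using \<Theta>(2)[of "case_sum ((!) w') id"] \<theta>(3)[OF _ that] unfolding bad_def by (simp add: o_def)
      qed
      define \<Psi> where "\<Psi> = (\<lambda>x. (\<theta> x, snd (snd x))) ` J"
      have "finite \<Psi>" using J(2) by (simp add: \<Psi>_def)
      moreover have "\<forall>(\<psi>, d)\<in>\<Psi>. fmla M (length w + length d) \<psi> \<and> divides M A (length w) \<psi> d"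
        using \<theta>(1,2) unfolding \<Psi>_def by blast
      moreover have "\<exists>(\<psi>, d)\<in>\<Psi>. holds M \<psi> (w' @ d)" if l: "length w' = length w" "holds M \<Theta> (w' @ c)" for w'
      proof -
        have "bad w'" using \<Theta>2 l by simp
        then obtain x where x: "x \<in> J" "holds M (\<theta> x) (w' @ snd (snd x))"
          unfolding bad_def using \<theta>(3)[OF _ l(1)] by blast
        then show ?thesis unfolding \<Psi>_def by (intro bexI[of _ "(\<theta> x, snd (snd x))"]) auto
      qed
      ultimately have "forks M A (length w) \<Theta> c" unfolding forks_def by blast
      \<comment> \<open>The disjunction forks by construction; that it divides is where forking
        equals dividing enters.\<close>
      then have dv: "divides M A (length w) \<Theta> c" using fd \<Theta>1 unfolding forking_eq_dividing_def by blast
      define n where "n = length u + (length c + length \<alpha>)"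
      let ?ua = "[0..<length u] @ [length u + length c..<n]"
      let ?c = "[length u..<length u + length c]"
      \<comment> \<open>The formula about \<open>u\<close> and \<open>c\<close>:
        \<open>\<Phi>\<close> has a solution, and no solution of \<open>\<Phi>\<close> violates
        \<open>\<Theta>\<close>.\<close>
      have "definable M {..<n} (\<lambda>h. (\<exists>w'. length w' = length w \<and> holds M \<Phi> (w' @ map h ?ua)) \<and>
          \<not> (\<exists>w'. length w' = length w \<and> (holds M \<Phi> (w' @ map h ?ua) \<and> \<not> holds M \<Theta> (w' @ map h ?c))))"
      proof -
        have e: "map (\<lambda>i. h (Inl i)) [0..<length w] @ map (\<lambda>v. h (Inr v)) l =
            map h (map Inl [0..<length w] @ map Inr l)" for h :: "nat + nat \<Rightarrow> 'm" and l
          by simp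
        have d1: "definable M (Inl ` {..<length w} \<union> Inr ` {..<n})
            (\<lambda>h. holds M \<Phi> (map (\<lambda>i. h (Inl i)) [0..<length w] @ map (\<lambda>v. h (Inr v)) ?ua))"
          unfolding e by (rule dfnI) (use \<Phi>(1) in \<open>auto simp: n_def\<close>)
        have d2: "definable M (Inl ` {..<length w} \<union> Inr ` {..<n})
            (\<lambda>h. holds M \<Theta> (map (\<lambda>i. h (Inl i)) [0..<length w] @ map (\<lambda>v. h (Inr v)) ?c))"
          unfolding e by (rule dfnI) (use \<Theta>1 in \<open>auto simp: n_def\<close>)
        show ?thesis
          by (intro definable_conj definable_neg definable_ex_list d1 d2)
      qed
      then obtain \<Xi> where \<Xi>: "fmla M n \<Xi>"
        "\<And>e. length e = n \<Longrightarrow> holds M \<Xi> e \<longleftrightarrow>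
          (\<exists>w'. length w' = length w \<and> holds M \<Phi> (w' @ map ((!) e) ?ua)) \<and>
          \<not> (\<exists>w'. length w' = length w \<and> (holds M \<Phi> (w' @ map ((!) e) ?ua) \<and> \<not> holds M \<Theta> (w' @ map ((!) e) ?c)))"
        by (rule formula_of_definable) (rule that)
      have \<Xi>': "holds M \<Xi> (u' @ c' @ \<alpha>) \<longleftrightarrow>
          (\<exists>w'. length w' = length w \<and> holds M \<Phi> (w' @ u' @ \<alpha>)) \<and>
          (\<forall>w'. length w' = length w \<longrightarrow> holds M \<Phi> (w' @ u' @ \<alpha>) \<longrightarrow> holds M \<Theta> (w' @ c'))"
        if "length u' = length u" "length c' = length c" for u' c'
      proof -
        have "map ((!) (u' @ c' @ \<alpha>)) [0..<length u] = u'" using map_nth_left[of u' "c' @ \<alpha>"] that by simp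
        moreover have "map ((!) (u' @ c' @ \<alpha>)) ?c = c'" using map_nth_middle[of u' c' \<alpha>] that by simp
        moreover have "map ((!) (u' @ c' @ \<alpha>)) [length u + length c..<n] = \<alpha>"
          using map_nth_right[of "u' @ c'" \<alpha>] that by (simp add: n_def add.assoc)
        ultimately show ?thesis
          using \<Xi>(2)[of "u' @ c' @ \<alpha>"] that by (simp add: n_def) blast
      qed
      have "divides M A (length u) \<Xi> (c @ \<alpha>)"
      \<comment> \<open>A tuple \<open>u'\<close> is sent to a solution of \<open>\<Phi>\<close>,
        which exists when \<open>\<Xi>\<close> holds. It depends only on \<open>u'\<close> and the
        fixed \<open>\<alpha>\<close>, so it satisfies all instances of \<open>\<Theta>\<close> at
        once.\<close>
      proof (rule divides_transfer[OF A dv, where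
            f = "\<lambda>u'. SOME w'. length w' = length w \<and> ((\<exists>w'. length w' = length w \<and> holds M \<Phi> (w' @ u' @ \<alpha>)) \<longrightarrow>
              holds M \<Phi> (w' @ u' @ \<alpha>))"])
        define f where "f u' = (SOME w'. length w' = length w \<and> ((\<exists>w'. length w' = length w \<and> holds M \<Phi> (w' @ u' @ \<alpha>)) \<longrightarrow>
              holds M \<Phi> (w' @ u' @ \<alpha>)))" for u' :: "'m list"
        have f: "length (f u') = length w \<and> ((\<exists>w'. length w' = length w \<and> holds M \<Phi> (w' @ u' @ \<alpha>)) \<longrightarrow>
              holds M \<Phi> (f u' @ u' @ \<alpha>))" for u'
        proof -
          have "\<exists>w'. length w' = length w \<and> ((\<exists>w'. length w' = length w \<and> holds M \<Phi> (w' @ u' @ \<alpha>)) \<longrightarrow>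
              holds M \<Phi> (w' @ u' @ \<alpha>))" by blast
          from someI_ex[OF this] show ?thesis unfolding f_def .
        qed
        show "length (SOME w'. length w' = length w \<and> ((\<exists>w'. length w' = length w \<and> holds M \<Phi> (w' @ x @ \<alpha>)) \<longrightarrow>
              holds M \<Phi> (w' @ x @ \<alpha>))) = length w" for x
          using f[of x] unfolding f_def by blast
        show "holds M \<Theta> ((SOME w'. length w' = length w \<and> ((\<exists>w'. length w' = length w \<and> holds M \<Phi> (w' @ x @ \<alpha>)) \<longrightarrow>
              holds M \<Phi> (w' @ x @ \<alpha>))) @ map \<sigma> c)"
          if s: "\<sigma> \<in> Fix A" and x: "length x = length u" and hx: "holds M \<Xi> (x @ map \<sigma> (c @ \<alpha>))" for \<sigma> x
        proof -
          have "holds M \<Xi> (x @ map \<sigma> c @ \<alpha>)" using hx Fix_map[OF s \<alpha>A] by simp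
          then have "holds M \<Theta> (f x @ map \<sigma> c)" using \<Xi>'[of x "map \<sigma> c"] x f[of x] by auto
          then show ?thesis unfolding f_def .
        qed
      qed
      moreover have "holds M \<Xi> (u @ c @ \<alpha>)"
        using \<Xi>'[of u c] \<Phi>0 no \<Theta>2 by blast
      ultimately show False
        using free_not_divides[OF A free uX, of "c @ \<alpha>" \<Xi>] cYA \<alpha>A \<Xi>(1) by (auto simp: n_def)
    qed
    then obtain w' where w': "length w' = length w" "holds M \<Phi> (w' @ u @ \<alpha>)" "\<not> bad w'" by blast
    define h where "h = case_sum (hw w') id"
    have "map h (map Inl w @ map Inr u @ map Inr \<alpha>) = w' @ u @ \<alpha>"
      using map_of_zip_map[OF w(2) w'(1)] by (simp add: h_def hw_def o_def)
    then have "\<forall>P\<in>Q. P h" unfolding \<Phi>(2) using w'(2) by simp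
    moreover have "F x h" if "x \<in> J" for x
      using w'(3) that unfolding bad_def by (cases x) (force simp: F_def h_def o_def)
    ultimately have "\<forall>P\<in>q. P h" unfolding qQ by blast
    then show "\<exists>h. (\<forall>v\<in>Inr ` (X \<union> A \<union> Y). h v = h0 v) \<and> (\<forall>P\<in>q. P h)"
      by (intro exI[of _ h]) (auto simp: h_def h0_def)
  qed (auto simp: V_def)
  obtain \<rho> where r: "\<rho> \<in> Fix (X \<union> A)" "\<And>v. v \<in> D \<Longrightarrow> h (Inl v) = \<rho> (id v)"
  proof (rule aut_over_of_definable[OF sm(3) small_Un[OF sm(1) A], of id "\<lambda>v. h (Inl v)"])
    fix P assume P: "definable M (Inl ` D \<union> Inr ` (X \<union> A)) P" "P (case_sum id id)"
    then have "P h" by (intro h(2)[of P]) (simp add: \<Sigma>1_def)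
    then show "P (case_sum (\<lambda>v. h (Inl v)) id)"
      using h(1) by (subst definable_cong[OF P(1), of _ h]) (auto simp: h0_def)
  qed auto
  have "free (\<rho> ` D) A Y"
  proof (rule free_of_nondividing[OF dep fd A])
    fix \<phi> ys c assume "(\<phi>, ys, c) \<in> tp M (\<rho> ` D) (Y \<union> A)"
    then have i: "set ys \<subseteq> \<rho> ` D" "set c \<subseteq> Y \<union> A" "fmla M (length ys + length c) \<phi>" "holds M \<phi> (ys @ c)"
      by (auto simp: tp_def insts_def)
    obtain xs where xs: "set xs \<subseteq> D" "ys = map \<rho> xs" using set_subset_image_list[OF i(1)] by blast
    show "\<not> divides M A (length ys) \<phi> c"
    proof
      assume "divides M A (length ys) \<phi> c"
      then have "(\<phi>, xs, c) \<in> I" using i xs by (simp add: I_def)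
      then have "F (\<phi>, xs, c) h" by (intro h(2)[of "F (\<phi>, xs, c)"]) simp
      moreover have "map (h \<circ> Inl) xs = ys" using r(2) xs by auto
      moreover have "map (h \<circ> Inr) c = c" using h(1) i(2) by (intro map_idI) (auto simp: h0_def)
      ultimately show False using i(4) by (simp add: F_def)
    qed
  qed
  then show thesis using that r(1) by blast
qed

lemma conj_over_Fix: "\<rho> \<in> Fix B \<Longrightarrow> conj_over M B (\<rho> ` D) D"
  unfolding conj_over_def using elem_map_Aut FixD by blast

theorem suitable_free:
  assumes dep: "dependent M" and fd: "forking_eq_dividing M A" and A: "small \<kappa> A"
  shows "suitable_relation \<kappa> M A free"
  unfolding suitable_relation_def
proof (intro conjI)
  show "invariance \<kappa> M free"
    unfolding invariance_def
  proof (intro allI impI)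
    fix X C Y X' C' Y'
    assume a: "small \<kappa> X \<and> small \<kappa> C \<and> small \<kappa> Y \<and> free X C Y \<and> conj_triple M (X', Y', C') (X, Y, C)"
    then obtain f where f: "elem_map M (X \<union> Y \<union> C) f" "f ` X = X'" "f ` Y = Y'" "f ` C = C'"
      unfolding conj_triple_def by auto
    have "small \<kappa> (X \<union> Y \<union> C)" using a by (intro small_Un) auto
    then obtain \<sigma> where s: "\<sigma> \<in> Aut M" "\<forall>b\<in>X \<union> Y \<union> C. \<sigma> b = f b"
      using homogeneous f(1) unfolding strongly_homogeneous_def by blast
    have "\<sigma> ` X = X'" "\<sigma> ` Y = Y'" "\<sigma> ` C = C'" using s(2) f(2-4) by auto
    then show "free X' C' Y'" using free_Aut[of X C Y \<sigma>] a s(1) by blast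
  qed
  show "monotonicity \<kappa> free" unfolding monotonicity_def using free_mono by blast
  show "base_monotonicity \<kappa> free" unfolding base_monotonicity_def using free_base_mono by blast
  show "right_extension \<kappa> M free"
    unfolding right_extension_def using free_ext_right conj_over_Fix by metis
  show "left_transitivity \<kappa> free" unfolding left_transitivity_def using free_left_trans by blast
  show "stronger_than_invariance \<kappa> M free" unfolding stronger_than_invariance_def free_def by blast
  show "preserves_indiscernibles \<kappa> M free"
    unfolding preserves_indiscernibles_def seq_index_def seq_set_def
    using free_indiscernible by (metis order_refl)
  show "left_extension_over \<kappa> M A free"
    unfolding left_extension_over_def
  proof (intro allI impI)
    fix X Y D assume a: "small \<kappa> X \<and> small \<kappa> Y \<and> small \<kappa> D \<and> free X A Y \<and> X \<subseteq> D"
    then obtain \<rho> where "\<rho> \<in> Fix (X \<union> A)" "free (\<rho> ` D) A Y"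
      using free_left_extension[OF dep fd A, of X Y D] by blast
    then show "\<exists>D'. conj_over M (X \<union> A) D' D \<and> free D' A Y" using conj_over_Fix by blast
  qed
  show "extension_base_for \<kappa> A free"
    unfolding extension_base_for_def
  proof (intro allI impI)
    fix X show "free X A A"
    proof (rule free_of_nondividing[OF dep fd A])
      fix \<phi> xs c assume "(\<phi>, xs, c) \<in> tp M X (A \<union> A)"
      then show "\<not> divides M A (length xs) \<phi> c"
        by (intro not_divides_over_base[OF A]) (auto simp: tp_def insts_def)
    qed
  qed
qed

end

theorem theorem3p9:
  fixes \<kappa> :: "'k rel" and M :: "('f, 'p, 'm) struct" and A :: "'m set"
  assumes "monster_model \<kappa> M" and "NTP2 M" and "small \<kappa> A"
  shows "((\<exists>R. suitable_relation \<kappa> M A R) \<longrightarrow> forking_eq_dividing M A) \<and>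
    (dependent M \<longrightarrow> ((\<exists>R. suitable_relation \<kappa> M A R) \<longleftrightarrow> forking_eq_dividing M A))"
proof -
  have "forking_eq_dividing M A" if "suitable_relation \<kappa> M A R" for R
  proof -
    interpret suitable_monster \<kappa> M A R
      by unfold_locales (use assms that in auto)
    show ?thesis by (rule forking_eq_dividing)
  qed
  moreover have "\<exists>R. suitable_relation \<kappa> M A R" if "dependent M" "forking_eq_dividing M A"
  proof -
    interpret monster \<kappa> M by unfold_locales (rule assms(1))
    show ?thesis using suitable_free[OF that assms(3)] by blast
  qed
  ultimately show ?thesis by blast
qed

end
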